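(* Let $P$ be the set of all prime numbers and $G=\bigoplus_{p\in P}\mathbb{F}_p$. There exist a solenoid $U$ with an ergodic $G$-action such that the $G$-system $(U,G)$ is of order $<2$, and a cocycle $\rho:G\times U\to S^1$ of type $<2$ that is not $(G,U,S^1)$-cohomologous to a phase polynomial of any degree. The extension $U\times_\rho S^1$ is an ergodic $G$-system of order $<3$ that is not Abramov of any order.
   Context: **Solenoid.** A compact abelian group $H$ is finite dimensional if for some $n\ge 0$ there is a compact totally disconnected subgroup $\Delta\le H$ with $H/\Delta\cong\mathbb T^n$. A solenoid is a finite-dimensional compact abelian group that is not a Lie group. **Systems.** A $G$-system is a probability space $(X,\mathcal{B},\mu)$ ($X$ compact, $\mathcal B$ Borel, separable modulo null sets) with an action of the discrete group $G$ by measure-preserving maps $T_g$. It is ergodic if only constants in $L^2(X)$ are $G$-invariant. A compact group $U$ is considered as a probability space with Haar measure. **Order.** For $\phi\in L^\infty(X)$ put $\|\phi\|_{U^1}=\lim_N\big\|\frac1{|\Phi_N|}\sum_{g\in\Phi_N}\phi\circ T_g\big\|_{L^2}$ and $\|\phi\|_{U^{k}}=\lim_N\big(\frac{1}{|\Phi_N|}\sum_{g\in\Phi_N}\|(\phi\circ T_g)\overline{\phi}\|_{U^{k-1}}^{2^{k-1}}\big)^{1/2^k}$ for $k\ge2$ (any Følner sequences). $Z_{<k}(X)$ is the (unique up to isomorphism) factor of $X$ with $\|f\|_{U^k}=0\iff E(f|Z_{<k}(X))=0$ for all $f\in L^\infty(X)$. $X$ is of order $<k$ if $X=Z_{<k}(X)$.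 **Cocycles.** A cocycle is a measurable $\rho:G\times X\to S^1$ with $\rho(g+g',x)=\rho(g,x)\rho(g',T_gx)$ for a.e. $x$, all $g,g'$. For measurable $F:X\to S^1$ put $\Delta_gF=(F\circ T_g)/F$ and $\Delta F(g,x)=\Delta_gF(x)$; functions $\Delta F$ are the $(G,X,S^1)$-coboundaries, and two functions $G\times X\to S^1$ are $(G,X,S^1)$-cohomologous if their quotient is a coboundary. $X\times_\rho S^1$ is $X\times S^1$ with the product of $\mu$ and Haar measure and action $(x,u)\mapsto(T_gx,\rho(g,x)u)$. **Type.** Define measures $\mu^{[k]}$ on $X^{[k]}=X^{2^k}$ by $\mu^{[0]}=\mu$ and $\int f_1(x)f_2(y)\,d\mu^{[k+1]}(x,y)=\int E(f_1|\mathcal I_k)E(f_2|\mathcal I_k)\,d\mu^{[k]}$, where $X^{[k+1]}=X^{[k]}\times X^{[k]}$ and $\mathcal I_k$ is the $\sigma$-algebra of sets of $X^{[k]}$ invariant under the diagonal $G$-action. For $\rho:G\times X\to S^1$ measurable let $d^{[k]}\rho(g,(x_w)_{w\in\{-1,1\}^k})=\prod_w\rho(g,x_w)^{w_1\cdots w_k}$. $\rho$ is of type $<k$ if $d^{[k]}\rho$ is a $(G,X^{[k]},S^1)$-coboundary (diagonal action). **Phase polynomials, Abramov.** A measurable $\phi:X\to S^1$ is a phase polynomial of degree $<k$ if $\Delta_{h_1}\cdots\Delta_{h_k}\phi=1$ a.e. for all $h_1,\dots,h_k\in G$; $f:G\times X\to S^1$ is a phase polynomial of degree $<k$ if $f(g,\cdot)$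 is, for every $g$. $X$ is Abramov of order $<k$ if the phase polynomials $X\to S^1$ of degree $<k$ span a dense subspace of $L^2(X)$. *)

theory Defs
  imports
    "HOL-Probability.Probability"
    "HOL-Algebra.Group_Action"
    "HOL-Algebra.Product_Groups"
begin

section \<open>The acting group and the circle\<close>

text \<open>The discrete group of finitely supported families with entry in Z/p at each prime p.
  Groups are written multiplicatively, as everywhere in HOL-Algebra.\<close>

definition prime_sum_group :: "(nat \<Rightarrow> int) monoid" where
  "prime_sum_group = sum_group {p. prime p} integer_mod_group"

definition circle_group :: "complex monoid" where
  "circle_group = \<lparr>carrier = sphere 0 1, monoid.mult = (*), one = 1\<rparr>"

definition circle_topology :: "complex topology" where
  "circle_topology = top_of_set (sphere 0 1)"

text \<open>Haar probability measure of the circle, as normalised arc length.\<close>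

definition circle_measure :: "complex measure" where
  "circle_measure =
     distr (uniform_measure lborel {0..<1}) (restrict_space borel (sphere 0 1))
       (\<lambda>t::real. cis (2 * pi * t))"

definition circle_valued :: "'x measure \<Rightarrow> ('x \<Rightarrow> complex) \<Rightarrow> bool" where
  "circle_valued M F \<longleftrightarrow> F \<in> measurable M (restrict_space borel (sphere 0 1))"


section \<open>Compact abelian groups, Lie groups and solenoids\<close>

definition topological_group :: "('a, 'b) monoid_scheme \<Rightarrow> 'a topology \<Rightarrow> bool" where
  "topological_group H T \<longleftrightarrow>
     group H \<and> topspace T = carrier H \<and>
     continuous_map (prod_topology T T) T (\<lambda>(x, y). x \<otimes>\<^bsub>H\<^esub> y) \<and>
     continuous_map T T (\<lambda>x. inv\<^bsub>H\<^esub> x)"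

definition compact_abelian_group :: "('a, 'b) monoid_scheme \<Rightarrow> 'a topology \<Rightarrow> bool" where
  "compact_abelian_group H T \<longleftrightarrow>
     comm_group H \<and> topological_group H T \<and> compact_space T \<and> Hausdorff_space T"

text \<open>The quotient topology on the set of cosets of \<open>D\<close>: a set of cosets is open iff its preimage
  under the projection, i.e. its union, is open.\<close>

definition coset_topology ::
  "('a, 'b) monoid_scheme \<Rightarrow> 'a topology \<Rightarrow> 'a set \<Rightarrow> 'a set topology" where
  "coset_topology H T D = topology (\<lambda>\<U>. \<U> \<subseteq> rcosets\<^bsub>H\<^esub> D \<and> openin T (\<Union>\<U>))"

lemma openin_coset_topology:
  assumes "group H" "subgroup D H"
  shows "openin (coset_topology H T D) \<U> \<longleftrightarrow> \<U> \<subseteq> rcosets\<^bsub>H\<^esub> D \<and> openin T (\<Union>\<U>)"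
proof -
  interpret group H by fact
  have dj: "A \<inter> B = {}" if "A \<in> rcosets\<^bsub>H\<^esub> D" "B \<in> rcosets\<^bsub>H\<^esub> D" "A \<noteq> B" for A B
    using rcos_disjoint[OF assms(2)] that by (auto simp: pairwise_def disjnt_def)
  have "istopology (\<lambda>\<U>. \<U> \<subseteq> rcosets\<^bsub>H\<^esub> D \<and> openin T (\<Union>\<U>))"
    unfolding istopology_def
  proof (intro conjI allI impI; (elim conjE)?)
    fix S R assume S: "S \<subseteq> rcosets\<^bsub>H\<^esub> D" "openin T (\<Union>S)"
      and R: "R \<subseteq> rcosets\<^bsub>H\<^esub> D" "openin T (\<Union>R)"
    show "S \<inter> R \<subseteq> rcosets\<^bsub>H\<^esub> D" using S by blast
    have "\<Union>(S \<inter> R) = \<Union>S \<inter> \<Union>R"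
    proof
      show "\<Union>S \<inter> \<Union>R \<subseteq> \<Union>(S \<inter> R)"
      proof
        fix x assume "x \<in> \<Union>S \<inter> \<Union>R"
        then obtain A B where AB: "A \<in> S" "B \<in> R" "x \<in> A" "x \<in> B" by blast
        moreover from this have "A = B" using dj[of A B] S R by blast
        ultimately show "x \<in> \<Union>(S \<inter> R)" by blast
      qed
    qed blast
    then show "openin T (\<Union>(S \<inter> R))" using S R by (metis openin_Int)
  next
    fix \<K> assume K: "\<forall>K\<in>\<K>. K \<subseteq> rcosets\<^bsub>H\<^esub> D \<and> openin T (\<Union>K)"
    show "\<Union>\<K> \<subseteq> rcosets\<^bsub>H\<^esub> D" using K by blast
    have "\<Union>(\<Union>\<K>) = \<Union>((\<lambda>K. \<Union>K) ` \<K>)" by blast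
    then show "openin T (\<Union>(\<Union>\<K>))" using K by auto
  qed
  then show ?thesis by (simp add: coset_topology_def topology_inverse')
qed

definition topological_group_isomorphic ::
  "('a, 'c) monoid_scheme \<Rightarrow> 'a topology \<Rightarrow> ('b, 'd) monoid_scheme \<Rightarrow> 'b topology \<Rightarrow> bool" where
  "topological_group_isomorphic H T K S \<longleftrightarrow> (\<exists>f \<in> iso H K. homeomorphic_map T S f)"

definition totally_disconnected_in :: "'a topology \<Rightarrow> 'a set \<Rightarrow> bool" where
  "totally_disconnected_in T D \<longleftrightarrow>
     (\<forall>C. C \<subseteq> D \<longrightarrow> connectedin T C \<longrightarrow> (\<forall>x\<in>C. \<forall>y\<in>C. x = y))"

definition finite_dimensional :: "('a, 'b) monoid_scheme \<Rightarrow> 'a topology \<Rightarrow> bool" where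
  "finite_dimensional H T \<longleftrightarrow>
     (\<exists>(n::nat) D. subgroup D H \<and> compactin T D \<and> totally_disconnected_in T D \<and>
        topological_group_isomorphic (H Mod D) (coset_topology H T D)
          (product_group {..<n} (\<lambda>_. circle_group))
          (product_topology (\<lambda>_. circle_topology) {..<n}))"

text \<open>Smoothness on open subsets of \<open>\<real>\<^sup>n\<close>, where \<open>\<real>\<^sup>n\<close> is the library space \<open>Euclidean_space n\<close> of
  sequences vanishing from index \<open>n\<close> on (the dimension has to be a number, not a type, since it is
  quantified in the definition of a Lie group).\<close>

primrec Ck_on :: "nat \<Rightarrow> nat \<Rightarrow> (nat \<Rightarrow> real) set \<Rightarrow> ((nat \<Rightarrow> real) \<Rightarrow> real) \<Rightarrow> bool" where
  "Ck_on 0 n W f \<longleftrightarrow> continuous_map (subtopology (Euclidean_space n) W) euclideanreal f"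
| "Ck_on (Suc r) n W f \<longleftrightarrow>
     continuous_map (subtopology (Euclidean_space n) W) euclideanreal f \<and>
     (\<forall>i<n. \<exists>f'. Ck_on r n W f' \<and>
        (\<forall>x\<in>W. ((\<lambda>t. f (x(i := t))) has_real_derivative f' x) (at (x i))))"

definition smooth_map_on ::
  "nat \<Rightarrow> nat \<Rightarrow> (nat \<Rightarrow> real) set \<Rightarrow> ((nat \<Rightarrow> real) \<Rightarrow> (nat \<Rightarrow> real)) \<Rightarrow> bool" where
  "smooth_map_on n m W F \<longleftrightarrow> (\<forall>r. \<forall>j<m. Ck_on r n W (\<lambda>x. F x j))"

definition chart :: "nat \<Rightarrow> 'a topology \<Rightarrow> 'a set \<times> ('a \<Rightarrow> nat \<Rightarrow> real) \<Rightarrow> bool" where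
  "chart n T = (\<lambda>(D, \<phi>). openin T D \<and> openin (Euclidean_space n) (\<phi> ` D) \<and>
     homeomorphic_map (subtopology T D) (subtopology (Euclidean_space n) (\<phi> ` D)) \<phi>)"

definition smooth_atlas :: "nat \<Rightarrow> 'a topology \<Rightarrow> ('a set \<times> ('a \<Rightarrow> nat \<Rightarrow> real)) set \<Rightarrow> bool" where
  "smooth_atlas n T \<A> \<longleftrightarrow>
     (\<forall>c\<in>\<A>. chart n T c) \<and> \<Union>(fst ` \<A>) = topspace T \<and>
     (\<forall>(D, \<phi>)\<in>\<A>. \<forall>(E, \<psi>)\<in>\<A>.
        smooth_map_on n n (\<phi> ` (D \<inter> E)) (\<lambda>u. \<psi> (inv_into D \<phi> u)))"

definition join_coords :: "nat \<Rightarrow> (nat \<Rightarrow> real) \<Rightarrow> (nat \<Rightarrow> real) \<Rightarrow> (nat \<Rightarrow> real)" where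
  "join_coords n u v = (\<lambda>i. if i < n then u i else v (i - n))"

definition fst_coords :: "nat \<Rightarrow> (nat \<Rightarrow> real) \<Rightarrow> (nat \<Rightarrow> real)" where
  "fst_coords n z = (\<lambda>i. if i < n then z i else 0)"

definition snd_coords :: "nat \<Rightarrow> (nat \<Rightarrow> real) \<Rightarrow> (nat \<Rightarrow> real)" where
  "snd_coords n z = (\<lambda>i. z (n + i))"

definition lie_group :: "('a, 'b) monoid_scheme \<Rightarrow> 'a topology \<Rightarrow> bool" where
  "lie_group H T \<longleftrightarrow>
     topological_group H T \<and> Hausdorff_space T \<and> second_countable T \<and>
     (\<exists>n \<A>. smooth_atlas n T \<A> \<and>
        (\<forall>(D, \<phi>)\<in>\<A>. \<forall>(E, \<psi>)\<in>\<A>. \<forall>(C, \<theta>)\<in>\<A>.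
           smooth_map_on (n + n) n
             {join_coords n (\<phi> x) (\<psi> y) | x y. x \<in> D \<and> y \<in> E \<and> x \<otimes>\<^bsub>H\<^esub> y \<in> C}
             (\<lambda>z. \<theta> (inv_into D \<phi> (fst_coords n z) \<otimes>\<^bsub>H\<^esub> inv_into E \<psi> (snd_coords n z)))) \<and>
        (\<forall>(D, \<phi>)\<in>\<A>. \<forall>(E, \<psi>)\<in>\<A>.
           smooth_map_on n n (\<phi> ` {x \<in> D. inv\<^bsub>H\<^esub> x \<in> E})
             (\<lambda>u. \<psi> (inv\<^bsub>H\<^esub> (inv_into D \<phi> u)))))"

definition solenoid :: "('a, 'b) monoid_scheme \<Rightarrow> 'a topology \<Rightarrow> bool" where
  "solenoid H T \<longleftrightarrow>
     compact_abelian_group H T \<and> finite_dimensional H T \<and> \<not> lie_group H T"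

definition borel_of :: "'a topology \<Rightarrow> 'a measure" where
  "borel_of T = sigma (topspace T) {A. openin T A}"

text \<open>The regularity clause is the usual one for Haar measure; it is automatic for metrizable
  groups.\<close>

definition haar_probability ::
  "('a, 'b) monoid_scheme \<Rightarrow> 'a topology \<Rightarrow> 'a measure \<Rightarrow> bool" where
  "haar_probability H T M \<longleftrightarrow>
     space M = topspace T \<and> sets M = sets (borel_of T) \<and> prob_space M \<and>
     (\<forall>h\<in>carrier H. \<forall>A\<in>sets M. emeasure M (h <#\<^bsub>H\<^esub> A) = emeasure M A) \<and>
     (\<forall>A\<in>sets M. \<forall>e>0. \<exists>K. compactin T K \<and> K \<subseteq> A \<and> measure M A < measure M K + e)"


section \<open>Measure-preserving systems\<close>

definition separable_mod_null :: "'x measure \<Rightarrow> bool" where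
  "separable_mod_null M \<longleftrightarrow>
     (\<exists>\<C>. countable \<C> \<and> \<C> \<subseteq> sets M \<and>
        (\<forall>A\<in>sets M. \<forall>e>0. \<exists>C\<in>\<C>. measure M (sym_diff A C) < e))"

text \<open>The transformations satisfy the action law everywhere (not just almost everywhere);
  \<open>group_action\<close> also makes them extensional on the underlying space.\<close>

definition g_system ::
  "('g, 'c) monoid_scheme \<Rightarrow> 'x topology \<Rightarrow> 'x measure \<Rightarrow> ('g \<Rightarrow> 'x \<Rightarrow> 'x) \<Rightarrow> bool" where
  "g_system G T M \<alpha> \<longleftrightarrow>
     compact_space T \<and> Hausdorff_space T \<and>
     space M = topspace T \<and> sets M = sets (borel_of T) \<and> prob_space M \<and> separable_mod_null M \<and>
     group_action G (space M) \<alpha> \<and>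
     (\<forall>g\<in>carrier G. \<alpha> g \<in> measurable M M \<and> distr M M (\<alpha> g) = M)"

definition square_integrable :: "'x measure \<Rightarrow> ('x \<Rightarrow> complex) \<Rightarrow> bool" where
  "square_integrable M f \<longleftrightarrow> f \<in> borel_measurable M \<and> integrable M (\<lambda>x. (cmod (f x))\<^sup>2)"

definition l2_norm :: "'x measure \<Rightarrow> ('x \<Rightarrow> complex) \<Rightarrow> real" where
  "l2_norm M f = sqrt (\<integral>x. (cmod (f x))\<^sup>2 \<partial>M)"

definition ess_bounded :: "'x measure \<Rightarrow> ('x \<Rightarrow> complex) \<Rightarrow> bool" where
  "ess_bounded M f \<longleftrightarrow> f \<in> borel_measurable M \<and> (\<exists>C. AE x in M. cmod (f x) \<le> C)"

definition g_ergodic ::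
  "('g, 'c) monoid_scheme \<Rightarrow> 'x measure \<Rightarrow> ('g \<Rightarrow> 'x \<Rightarrow> 'x) \<Rightarrow> bool" where
  "g_ergodic G M \<alpha> \<longleftrightarrow>
     (\<forall>f. square_integrable M f \<and> (\<forall>g\<in>carrier G. AE x in M. f (\<alpha> g x) = f x) \<longrightarrow>
        (\<exists>c. AE x in M. f x = c))"

definition complex_cond_exp ::
  "'x measure \<Rightarrow> 'x measure \<Rightarrow> ('x \<Rightarrow> complex) \<Rightarrow> 'x \<Rightarrow> complex" where
  "complex_cond_exp M F f =
     (\<lambda>x. Complex (real_cond_exp M F (\<lambda>y. Re (f y)) x) (real_cond_exp M F (\<lambda>y. Im (f y)) x))"


section \<open>Order of a system\<close>

definition folner_sequence :: "('g, 'c) monoid_scheme \<Rightarrow> (nat \<Rightarrow> 'g set) \<Rightarrow> bool" where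
  "folner_sequence G \<Phi> \<longleftrightarrow>
     (\<forall>N. finite (\<Phi> N) \<and> \<Phi> N \<noteq> {} \<and> \<Phi> N \<subseteq> carrier G) \<and>
     (\<forall>g\<in>carrier G.
        (\<lambda>N. real (card (sym_diff (g <#\<^bsub>G\<^esub> \<Phi> N) (\<Phi> N))) / real (card (\<Phi> N))) \<longlonglongrightarrow> 0)"

text \<open>The common limit of a set function along all Foelner sequences.\<close>

definition folner_lim :: "('g, 'c) monoid_scheme \<Rightarrow> ('g set \<Rightarrow> real) \<Rightarrow> real" where
  "folner_lim G a = (THE L. \<forall>\<Phi>. folner_sequence G \<Phi> \<longrightarrow> (\<lambda>N. a (\<Phi> N)) \<longlonglongrightarrow> L)"

text \<open>The Gowers-Host-Kra seminorms \<open>U\<^sup>k\<close> for \<open>k \<ge> 1\<close>; the value at \<open>k = 0\<close> is a dummy.\<close>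

fun gowers_norm ::
  "('g, 'c) monoid_scheme \<Rightarrow> 'x measure \<Rightarrow> ('g \<Rightarrow> 'x \<Rightarrow> 'x) \<Rightarrow> nat \<Rightarrow> ('x \<Rightarrow> complex) \<Rightarrow> real" where
  "gowers_norm G M \<alpha> 0 f = 0"
| "gowers_norm G M \<alpha> (Suc 0) f =
     folner_lim G (\<lambda>A. l2_norm M (\<lambda>x. (\<Sum>g\<in>A. f (\<alpha> g x)) / of_nat (card A)))"
| "gowers_norm G M \<alpha> (Suc (Suc k)) f =
     folner_lim G (\<lambda>A. root (2 ^ Suc (Suc k))
       ((\<Sum>g\<in>A. gowers_norm G M \<alpha> (Suc k) (\<lambda>x. f (\<alpha> g x) * cnj (f x)) ^ (2 ^ Suc k))
         / real (card A)))"

text \<open>Factors are given by invariant sub-sigma-algebras \<open>F\<close>.\<close>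

definition is_factor ::
  "('g, 'c) monoid_scheme \<Rightarrow> 'x measure \<Rightarrow> ('g \<Rightarrow> 'x \<Rightarrow> 'x) \<Rightarrow> 'x measure \<Rightarrow> bool" where
  "is_factor G M \<alpha> F \<longleftrightarrow>
     subalgebra M F \<and> (\<forall>g\<in>carrier G. \<forall>A\<in>sets F. \<alpha> g -` A \<inter> space M \<in> sets F)"

definition is_Z_factor ::
  "('g, 'c) monoid_scheme \<Rightarrow> 'x measure \<Rightarrow> ('g \<Rightarrow> 'x \<Rightarrow> 'x) \<Rightarrow> nat \<Rightarrow> 'x measure \<Rightarrow> bool" where
  "is_Z_factor G M \<alpha> k F \<longleftrightarrow>
     is_factor G M \<alpha> F \<and>
     (\<forall>f. ess_bounded M f \<longrightarrow>
        (gowers_norm G M \<alpha> k f = 0 \<longleftrightarrow> (AE x in M. complex_cond_exp M F f x = 0)))"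

text \<open>The Z-factor is determined up to null sets, so equality with the whole system means that
  every measurable set agrees with a set of the factor modulo a null set. Used for \<open>k \<ge> 1\<close>.\<close>

definition order_less ::
  "('g, 'c) monoid_scheme \<Rightarrow> 'x measure \<Rightarrow> ('g \<Rightarrow> 'x \<Rightarrow> 'x) \<Rightarrow> nat \<Rightarrow> bool" where
  "order_less G M \<alpha> k \<longleftrightarrow>
     (\<exists>F. is_Z_factor G M \<alpha> k F \<and>
        (\<forall>A\<in>sets M. \<exists>B\<in>sets F. emeasure M (sym_diff A B) = 0))"


section \<open>Cocycles and extensions\<close>

definition circle_family ::
  "('g, 'c) monoid_scheme \<Rightarrow> 'x measure \<Rightarrow> ('g \<Rightarrow> 'x \<Rightarrow> complex) \<Rightarrow> bool" where
  "circle_family G M \<rho> \<longleftrightarrow> (\<forall>g\<in>carrier G. circle_valued M (\<rho> g))"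

definition cocycle ::
  "('g, 'c) monoid_scheme \<Rightarrow> 'x measure \<Rightarrow> ('g \<Rightarrow> 'x \<Rightarrow> 'x) \<Rightarrow> ('g \<Rightarrow> 'x \<Rightarrow> complex) \<Rightarrow> bool" where
  "cocycle G M \<alpha> \<rho> \<longleftrightarrow>
     circle_family G M \<rho> \<and>
     (\<forall>g\<in>carrier G. \<forall>h\<in>carrier G. AE x in M. \<rho> (g \<otimes>\<^bsub>G\<^esub> h) x = \<rho> g x * \<rho> h (\<alpha> g x))"

definition mult_deriv :: "('g \<Rightarrow> 'x \<Rightarrow> 'x) \<Rightarrow> 'g \<Rightarrow> ('x \<Rightarrow> complex) \<Rightarrow> 'x \<Rightarrow> complex" where
  "mult_deriv \<alpha> g F = (\<lambda>x. F (\<alpha> g x) / F x)"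

definition coboundary ::
  "('g, 'c) monoid_scheme \<Rightarrow> 'x measure \<Rightarrow> ('g \<Rightarrow> 'x \<Rightarrow> 'x) \<Rightarrow> ('g \<Rightarrow> 'x \<Rightarrow> complex) \<Rightarrow> bool" where
  "coboundary G M \<alpha> \<rho> \<longleftrightarrow>
     (\<exists>F. circle_valued M F \<and> (\<forall>g\<in>carrier G. AE x in M. \<rho> g x = mult_deriv \<alpha> g F x))"

definition cohomologous ::
  "('g, 'c) monoid_scheme \<Rightarrow> 'x measure \<Rightarrow> ('g \<Rightarrow> 'x \<Rightarrow> 'x) \<Rightarrow>
     ('g \<Rightarrow> 'x \<Rightarrow> complex) \<Rightarrow> ('g \<Rightarrow> 'x \<Rightarrow> complex) \<Rightarrow> bool" where
  "cohomologous G M \<alpha> \<rho> \<sigma> \<longleftrightarrow> coboundary G M \<alpha> (\<lambda>g x. \<rho> g x / \<sigma> g x)"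

definition extension_measure :: "'x measure \<Rightarrow> ('x \<times> complex) measure" where
  "extension_measure M = M \<Otimes>\<^sub>M circle_measure"

definition extension_topology :: "'x topology \<Rightarrow> ('x \<times> complex) topology" where
  "extension_topology T = prod_topology T circle_topology"

definition extension_action ::
  "'x measure \<Rightarrow> ('g \<Rightarrow> 'x \<Rightarrow> 'x) \<Rightarrow> ('g \<Rightarrow> 'x \<Rightarrow> complex) \<Rightarrow>
     'g \<Rightarrow> 'x \<times> complex \<Rightarrow> 'x \<times> complex" where
  "extension_action M \<alpha> \<rho> g =
     (\<lambda>z \<in> space M \<times> sphere 0 1. (\<alpha> g (fst z), \<rho> g (fst z) * snd z))"


section \<open>Cube measures and type\<close>

text \<open>Points of \<open>X\<^sup>[\<^sup>k\<^sup>]\<close> are functions on \<open>cube_vertices k\<close>, the words of length \<open>k\<close> over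
  \<open>{-1, 1}\<close>. The identification of \<open>X\<^sup>[\<^sup>k\<^sup>+\<^sup>1\<^sup>]\<close> with \<open>X\<^sup>[\<^sup>k\<^sup>] \<times> X\<^sup>[\<^sup>k\<^sup>]\<close> splits off the first
  letter.\<close>

definition cube_vertices :: "nat \<Rightarrow> int list set" where
  "cube_vertices k = {w. length w = k \<and> set w \<subseteq> {-1, 1}}"

definition cube_algebra :: "'x measure \<Rightarrow> nat \<Rightarrow> (int list \<Rightarrow> 'x) measure" where
  "cube_algebra M k = PiM (cube_vertices k) (\<lambda>_. M)"

definition cube_action ::
  "nat \<Rightarrow> ('g \<Rightarrow> 'x \<Rightarrow> 'x) \<Rightarrow> 'g \<Rightarrow> (int list \<Rightarrow> 'x) \<Rightarrow> (int list \<Rightarrow> 'x)" where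
  "cube_action k \<alpha> g x = (\<lambda>w \<in> cube_vertices k. \<alpha> g (x w))"

definition cube_face :: "nat \<Rightarrow> int \<Rightarrow> (int list \<Rightarrow> 'x) \<Rightarrow> (int list \<Rightarrow> 'x)" where
  "cube_face k e z = (\<lambda>w \<in> cube_vertices k. z (e # w))"

definition invariant_algebra ::
  "('g, 'c) monoid_scheme \<Rightarrow> 'x measure \<Rightarrow> ('g \<Rightarrow> 'x \<Rightarrow> 'x) \<Rightarrow> 'x measure" where
  "invariant_algebra G M \<alpha> =
     sigma (space M) {A \<in> sets M. \<forall>g\<in>carrier G. \<alpha> g -` A \<inter> space M = A}"

text \<open>\<open>is_cube_measure G M \<alpha> k N\<close> says that \<open>N\<close> is the measure \<open>\<mu>\<^sup>[\<^sup>k\<^sup>]\<close> of the system; the integral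
  identity determines \<open>N\<close> uniquely, by its values on products of measurable sets.\<close>

primrec is_cube_measure ::
  "('g, 'c) monoid_scheme \<Rightarrow> 'x measure \<Rightarrow> ('g \<Rightarrow> 'x \<Rightarrow> 'x) \<Rightarrow> nat \<Rightarrow>
     (int list \<Rightarrow> 'x) measure \<Rightarrow> bool" where
  "is_cube_measure G M \<alpha> 0 N \<longleftrightarrow>
     N = distr M (cube_algebra M 0) (\<lambda>x. \<lambda>w \<in> cube_vertices 0. x)"
| "is_cube_measure G M \<alpha> (Suc k) N \<longleftrightarrow>
     space N = space (cube_algebra M (Suc k)) \<and> sets N = sets (cube_algebra M (Suc k)) \<and>
     (\<exists>N'. is_cube_measure G M \<alpha> k N' \<and>
        (\<forall>f1 f2. ess_bounded N' f1 \<and> ess_bounded N' f2 \<longrightarrow>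
           (\<integral>z. f1 (cube_face k (-1) z) * f2 (cube_face k 1 z) \<partial>N) =
           (\<integral>x. complex_cond_exp N' (invariant_algebra G N' (cube_action k \<alpha>)) f1 x *
                 complex_cond_exp N' (invariant_algebra G N' (cube_action k \<alpha>)) f2 x \<partial>N')))"

definition cube_derivative ::
  "nat \<Rightarrow> ('g \<Rightarrow> 'x \<Rightarrow> complex) \<Rightarrow> 'g \<Rightarrow> (int list \<Rightarrow> 'x) \<Rightarrow> complex" where
  "cube_derivative k \<rho> g x = (\<Prod>w\<in>cube_vertices k. \<rho> g (x w) powi prod_list w)"

definition type_less ::
  "('g, 'c) monoid_scheme \<Rightarrow> 'x measure \<Rightarrow> ('g \<Rightarrow> 'x \<Rightarrow> 'x) \<Rightarrow> ('g \<Rightarrow> 'x \<Rightarrow> complex) \<Rightarrow> nat \<Rightarrow> bool"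
  where
  "type_less G M \<alpha> \<rho> k \<longleftrightarrow>
     circle_family G M \<rho> \<and>
     (\<exists>N. is_cube_measure G M \<alpha> k N \<and>
        coboundary G N (cube_action k \<alpha>) (cube_derivative k \<rho>))"


section \<open>Phase polynomials and Abramov systems\<close>

definition phase_polynomial ::
  "('g, 'c) monoid_scheme \<Rightarrow> 'x measure \<Rightarrow> ('g \<Rightarrow> 'x \<Rightarrow> 'x) \<Rightarrow> nat \<Rightarrow> ('x \<Rightarrow> complex) \<Rightarrow> bool" where
  "phase_polynomial G M \<alpha> k \<phi> \<longleftrightarrow>
     circle_valued M \<phi> \<and>
     (\<forall>hs. length hs = k \<and> set hs \<subseteq> carrier G \<longrightarrow>
        (AE x in M. foldr (mult_deriv \<alpha>) hs \<phi> x = 1))"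

definition phase_polynomial_family ::
  "('g, 'c) monoid_scheme \<Rightarrow> 'x measure \<Rightarrow> ('g \<Rightarrow> 'x \<Rightarrow> 'x) \<Rightarrow> nat \<Rightarrow>
     ('g \<Rightarrow> 'x \<Rightarrow> complex) \<Rightarrow> bool" where
  "phase_polynomial_family G M \<alpha> k q \<longleftrightarrow> (\<forall>g\<in>carrier G. phase_polynomial G M \<alpha> k (q g))"

definition abramov_less ::
  "('g, 'c) monoid_scheme \<Rightarrow> 'x measure \<Rightarrow> ('g \<Rightarrow> 'x \<Rightarrow> 'x) \<Rightarrow> nat \<Rightarrow> bool" where
  "abramov_less G M \<alpha> k \<longleftrightarrow>
     (\<forall>f. square_integrable M f \<longrightarrow>
        (\<forall>e>0. \<exists>S c. finite S \<and> (\<forall>\<phi>\<in>S. phase_polynomial G M \<alpha> k \<phi>) \<and>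
           l2_norm M (\<lambda>x. f x - (\<Sum>\<phi>\<in>S. c \<phi> * \<phi> x)) < e))"

end

theory Submission
  imports Defs "HOL-Library.Function_Algebras" "HOL-Number_Theory.Number_Theory"
begin

text \<open>
The solenoid is the group of families \<open>u\<close> of unit complex numbers with two free coordinates \<open>u 0\<close>, \<open>u 1\<close>
such that, for every prime \<open>p\<close>, \<open>u p\<close> is a \<open>p\<close>-th root of \<open>u 0\<close> or of \<open>u 1\<close>; both classes of primes are
infinite. \<open>G\<close> acts by translation through a dense homomorphism \<open>iota\<close> into it. The cocycle \<open>rho\<close>
lifts this rotation to a Heisenberg-type nilrotation on a circle bundle; cutting the bundle open along a
discontinuous angle function makes it a skew product.

Along parallelograms \<open>u, v u, b u, v b u\<close> the alternating product of \<open>rho\<close> is an explicit coboundary, so \<open>rho\<close>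
has type less than 2. The third Gowers norm of \<open>f\<close> is a mean ergodic limit on a fourfold
fibre product; if it vanishes, testing against an invariant function built from this coboundary and
concentrated near \<open>v = b = 1\<close> kills all vertical Fourier coefficients of \<open>f\<close>, whence the order is less than 3.

Every element of \<open>G\<close> has finite order while the dual of the solenoid is torsion free. By induction
on the degree, each phase polynomial of the skew product is therefore a constant times a character of the base. These
are orthogonal to the fibre coordinate, which excludes the Abramov property; a phase polynomial cohomologous to \<open>rho\<close>
would turn the fibre coordinate, up to a function on the base, into a phase polynomial.
\<close>

text \<open>A generator \<open>single p\<close> rotates a single free coordinate by
  \<open>1 / p\<close>: \<open>u 0\<close> if \<open>base p\<close> is 1, \<open>u 1\<close> if
  \<open>base p\<close> is 0. Its evident lift to the Heisenberg bundle does not have order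
  \<open>p\<close>: the \<open>p\<close>-th power multiplies the fibre by the other free coordinate
  or its inverse. A \<open>p\<close>-th root of that coordinate repairs this, so one root per prime
  has to be adjoined, and infinitely many roots turn the torus into a solenoid. The lifts for primes
  \<open>p\<close> and \<open>q\<close> of different classes moreover commute only up to a primitive
  root of unity of order \<open>p q\<close>. The adjoined roots are moved by the action as well, the
  root at \<open>p\<close> through an inverse of \<open>p\<close> modulo \<open>q\<close> and
  conversely; these phases cancel the commutator because p'/q + q'/p - 1/(pq) is an integer for such
  inverses p' and q'. Both repairs together form the factor \<open>twist\<close> of
  \<open>rho\<close>. Both classes of primes must be infinite: a free coordinate moved by finitely
  many generators only would have a nonconstant invariant power, and ergodicity would fail.\<close>

type_synonym sol = "nat => complex"
type_synonym dpt = "(sol \<times> sol) \<times> sol"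
type_synonym ypt = "(((dpt \<times> complex) \<times> complex) \<times> complex) \<times> complex"

lemmas LINT_cong = Bochner_Integration.integral_cong
lemmas m_comp = measurable_compose
abbreviation "CM \<equiv> circle_measure"
abbreviation "sqi \<equiv> square_integrable"
abbreviation seq_limit (infix "---->" 60) where "X ----> L \<equiv> X \<longlonglongrightarrow> L"

section \<open>Square-integrable functions\<close>

lemma measurable_cnj [measurable]: "cnj \<in> borel_measurable borel" by (intro borel_measurable_continuous_onI continuous_intros)

lemma norm_add_sq_le: "(cmod (a + b))\<^sup>2 \<le> 2 * (cmod a)\<^sup>2 + 2 * (cmod b)\<^sup>2"
proof -
 have "(cmod (a + b))\<^sup>2 \<le> (cmod a + cmod b)\<^sup>2" by (intro power_mono norm_triangle_ineq norm_ge_zero)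
 also have "... \<le> 2 * (cmod a)\<^sup>2 + 2 * (cmod b)\<^sup>2" using sum_squares_bound[of "cmod a" "cmod b"] by (simp add: power2_sum)
 finally show ?thesis .
qed

lemma square_integrableD:
 assumes "sqi M f"
 shows "f \<in> borel_measurable M" "integrable M (\<lambda>x. (cmod (f x))\<^sup>2)" using assms by (auto simp: square_integrable_def)

lemma sqi_add:
 assumes f: "sqi M f" and g: "sqi M g"
 shows "sqi M (\<lambda>x. f x + g x)"
proof -
 note [measurable] = square_integrableD(1)[OF f] square_integrableD(1)[OF g]
 have "integrable M (\<lambda>x. 2 * (cmod (f x))\<^sup>2 + 2 * (cmod (g x))\<^sup>2)"
  using square_integrableD(2)[OF f] square_integrableD(2)[OF g] by auto
 hence "integrable M (\<lambda>x. (cmod (f x + g x))\<^sup>2)" by (rule Bochner_Integration.integrable_bound) (use norm_add_sq_le in auto)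
 thus ?thesis by (simp add: square_integrable_def)
qed

lemma sqi_cmult:
 assumes f: "sqi M f"
 shows "sqi M (\<lambda>x. c * f x)" using assms by (auto simp: square_integrable_def norm_mult power_mult_distrib)

lemma sqi_diff:
 assumes f: "sqi M f" and g: "sqi M g"
 shows "sqi M (\<lambda>x. f x - g x)" using sqi_add[OF f sqi_cmult[OF g, of "-1"]] by simp

lemma sqi_divide:
 assumes f: "sqi M f"
 shows "sqi M (\<lambda>x. f x / c)" using sqi_cmult[OF f, of "1 / c"] by simp

lemma sqi_cnj:
 assumes f: "sqi M f"
 shows "sqi M (\<lambda>x. cnj (f x))" using assms by (auto simp: square_integrable_def intro: m_comp[OF _ measurable_cnj])

lemma sqi_sum:
 assumes "\<And>i. i \<in> A ==> sqi M (f i)"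
 shows "sqi M (\<lambda>x. \<Sum>i\<in>A. f i x)"
proof (cases "finite A")
 case True
 thus ?thesis using assms
 proof (induction A)
  case empty
  thus ?case by (auto simp: square_integrable_def)
 next
  case (insert x F)
  thus ?case using sqi_add[of M "f x" "\<lambda>y. \<Sum>i\<in>F. f i y"] by auto
 qed
qed (auto simp: square_integrable_def)

lemma (in finite_measure) sqi_bounded:
 assumes "f \<in> borel_measurable M" "AE x in M. cmod (f x) \<le> B"
 shows "sqi M f"
proof -
 note [measurable] = assms(1)
 have "integrable M (\<lambda>x. (cmod (f x))\<^sup>2)"
 proof (rule integrable_const_bound[of _ "B\<^sup>2"])
  show "AE x in M. norm ((cmod (f x))\<^sup>2) \<le> B\<^sup>2" using assms(2) by eventually_elim (auto intro!: power_mono)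
 qed auto
 thus ?thesis by (simp add: square_integrable_def)
qed

lemma integrable_mult_cmod:
 assumes f: "sqi M f" and g: "sqi M g"
 shows "integrable M (\<lambda>x. cmod (f x) * cmod (g x))"
proof -
 note [measurable] = square_integrableD(1)[OF f] square_integrableD(1)[OF g]
 have "integrable M (\<lambda>x. (cmod (f x))\<^sup>2 + (cmod (g x))\<^sup>2)" using square_integrableD(2)[OF f] square_integrableD(2)[OF g] by auto
 thus ?thesis
 proof (rule Bochner_Integration.integrable_bound)
  have *: "a * b \<le> a\<^sup>2 + b\<^sup>2" if "a \<ge> 0" "b \<ge> 0" for a b :: real
   using sum_squares_bound[of a b] mult_nonneg_nonneg[OF that] by linarith
  show "AE x in M. norm (cmod (f x) * cmod (g x)) \<le> norm ((cmod (f x))\<^sup>2 + (cmod (g x))\<^sup>2)" using * by (auto intro!: AE_I2)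
 qed auto
qed

lemma integrable_mult_square:
 assumes f: "sqi M f" and g: "sqi M g"
 shows "integrable M (\<lambda>x. f x * g x)"
proof -
 note [measurable] = square_integrableD(1)[OF f] square_integrableD(1)[OF g]
 show ?thesis by (rule Bochner_Integration.integrable_bound[OF integrable_mult_cmod[OF f g]]) (auto simp: norm_mult)
qed

lemma l2_norm_nonneg: "l2_norm M f \<ge> 0" by (simp add: l2_norm_def)

lemma l2_norm_power2: "(l2_norm M f)\<^sup>2 = (LINT x|M. (cmod (f x))\<^sup>2)" by (simp add: l2_norm_def)

lemma l2_norm_cmult: "l2_norm M (\<lambda>x. c * f x) = cmod c * l2_norm M f" by (simp add: l2_norm_def norm_mult power_mult_distrib real_sqrt_mult)

lemma l2_norm_divide: "l2_norm M (\<lambda>x. f x / c) = l2_norm M f / cmod c" using l2_norm_cmult[of M "1 / c" f] by (simp add: norm_divide)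

lemma l2_norm_cong_AE:
 assumes "f \<in> borel_measurable M" "g \<in> borel_measurable M" "AE x in M. f x = g x"
 shows "l2_norm M f = l2_norm M g"
proof -
 note [measurable] = assms(1,2)
 have "(LINT x|M. (cmod (f x))\<^sup>2) = (LINT x|M. (cmod (g x))\<^sup>2)" by (rule integral_cong_AE) (use assms(3) in auto)
 thus ?thesis by (simp add: l2_norm_def)
qed

text \<open>The integral of the square of \<open>t * cmod (f x) - cmod (g x)\<close> is a
  nonnegative quadratic in \<open>t\<close>; its value at the minimum \<open>B / A\<close> gives the
  inequality.\<close>

lemma Cauchy_Schwarz_cmod:
 assumes f: "sqi M f" and g: "sqi M g"
 shows "(LINT x|M. cmod (f x) * cmod (g x)) \<le> l2_norm M f * l2_norm M g"
proof -
 define A where "A = (LINT x|M. (cmod (f x))\<^sup>2)"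
 define B where "B = (LINT x|M. cmod (f x) * cmod (g x))"
 define C where "C = (LINT x|M. (cmod (g x))\<^sup>2)"
 note int = square_integrableD(2)[OF f] square_integrableD(2)[OF g] integrable_mult_cmod[OF f g]
 have nn: "A \<ge> 0" "B \<ge> 0" "C \<ge> 0" by (auto simp: A_def B_def C_def)
 have q: "0 \<le> t\<^sup>2 * A - 2 * t * B + C" for t
 proof -
  have "0 \<le> (LINT x|M. (t * cmod (f x) - cmod (g x))\<^sup>2)" by simp
  also have "... = (LINT x|M. t\<^sup>2 * (cmod (f x))\<^sup>2 - 2 * t * (cmod (f x) * cmod (g x)) + (cmod (g x))\<^sup>2)"
   by (rule LINT_cong) (auto simp: power2_eq_square algebra_simps)
  also have "... = t\<^sup>2 * A - 2 * t * B + C" unfolding A_def B_def C_def using int by simp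
  finally show ?thesis .
 qed
 have "B\<^sup>2 \<le> A * C"
 proof (cases "A = 0")
  case True
  \<comment> \<open>Without a quadratic term the nonnegative polynomial is linear in
    \<open>t\<close>, so its slope has to vanish.\<close>
  have "B = 0"
  proof (rule ccontr)
   assume "B \<noteq> 0"
   hence "B > 0" using nn by simp
   moreover have "2 * ((C + 1) / (2 * B)) * B \<le> C" using q[of "(C + 1) / (2 * B)"] True by simp
   moreover have "2 * ((C + 1) / (2 * B)) * B = C + 1" using \<open>B > 0\<close> by (simp add: field_simps)
   ultimately show False by simp
  qed
  thus ?thesis using True by simp
 next
  case False
  hence "A > 0" using nn by simp
  thus ?thesis using q[of "B / A"] by (simp add: field_simps power2_eq_square)
 qed
 hence "B \<le> sqrt (A * C)" using nn by (simp add: real_le_rsqrt)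
 thus ?thesis by (simp add: l2_norm_def A_def B_def C_def real_sqrt_mult)
qed

lemma Cauchy_Schwarz_l2:
 assumes f: "sqi M f" and g: "sqi M g"
 shows "cmod (LINT x|M. f x * cnj (g x)) \<le> l2_norm M f * l2_norm M g"
proof -
 have "cmod (LINT x|M. f x * cnj (g x)) \<le> (LINT x|M. cmod (f x) * cmod (g x))"
  using integral_norm_bound[of M "\<lambda>x. f x * cnj (g x)"] by (simp add: norm_mult)
 thus ?thesis using Cauchy_Schwarz_cmod[OF f g] by simp
qed

lemma l2_norm_triangle:
 assumes f: "sqi M f" and g: "sqi M g"
 shows "l2_norm M (\<lambda>x. f x + g x) \<le> l2_norm M f + l2_norm M g"
proof (rule power2_le_imp_le)
 note int = square_integrableD(2)[OF f] square_integrableD(2)[OF g] integrable_mult_cmod[OF f g]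
 have "(l2_norm M (\<lambda>x. f x + g x))\<^sup>2 = (LINT x|M. (cmod (f x + g x))\<^sup>2)" by (rule l2_norm_power2)
 also have "... \<le> (LINT x|M. (cmod (f x))\<^sup>2 + (cmod (g x))\<^sup>2 + 2 * (cmod (f x) * cmod (g x)))"
 proof (rule integral_mono)
  show "integrable M (\<lambda>x. (cmod (f x + g x))\<^sup>2)" using square_integrableD(2)[OF sqi_add[OF f g]] .
  show "(cmod (f x + g x))\<^sup>2 \<le> (cmod (f x))\<^sup>2 + (cmod (g x))\<^sup>2 + 2 * (cmod (f x) * cmod (g x))" for x
  proof -
   have "(cmod (f x + g x))\<^sup>2 \<le> (cmod (f x) + cmod (g x))\<^sup>2" by (intro power_mono norm_triangle_ineq norm_ge_zero)
   thus ?thesis by (simp add: power2_sum)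
  qed
 qed (use int in auto)
 also have "... = (l2_norm M f)\<^sup>2 + (l2_norm M g)\<^sup>2 + 2 * (LINT x|M. cmod (f x) * cmod (g x))" using int by (simp add: l2_norm_power2)
 also have "... \<le> (l2_norm M f + l2_norm M g)\<^sup>2" using Cauchy_Schwarz_cmod[OF f g] by (simp add: power2_sum)
 finally show "(l2_norm M (\<lambda>x. f x + g x))\<^sup>2 \<le> (l2_norm M f + l2_norm M g)\<^sup>2" .
qed (simp add: l2_norm_nonneg)

lemma l2_norm_minus_commute: "l2_norm M (\<lambda>x. f x - g x) = l2_norm M (\<lambda>x. g x - f x)" by (simp add: l2_norm_def norm_minus_commute)

lemma l2_norm_triangle_diff:
 assumes "sqi M f" "sqi M g"
 shows "l2_norm M f \<le> l2_norm M (\<lambda>x. f x - g x) + l2_norm M g" using l2_norm_triangle[OF sqi_diff[OF assms] assms(2)] by simp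

lemma l2_norm_triangle3:
 assumes "sqi M f" "sqi M g" "sqi M h"
 shows "l2_norm M (\<lambda>x. f x - h x) \<le> l2_norm M (\<lambda>x. f x - g x) + l2_norm M (\<lambda>x. g x - h x)"
 using l2_norm_triangle[OF sqi_diff[OF assms(1,2)] sqi_diff[OF assms(2,3)]] by simp

lemma l2_norm_sum_le:
 assumes "\<And>i. i \<in> A ==> sqi M (f i)"
 shows "l2_norm M (\<lambda>x. \<Sum>i\<in>A. f i x) \<le> (\<Sum>i\<in>A. l2_norm M (f i))"
proof (cases "finite A")
 case True
 thus ?thesis using assms
 proof (induction A)
  case empty
  thus ?case by (simp add: l2_norm_def)
 next
  case (insert x F)
  have "l2_norm M (\<lambda>y. f x y + (\<Sum>i\<in>F. f i y)) \<le> l2_norm M (f x) + l2_norm M (\<lambda>y. \<Sum>i\<in>F. f i y)"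
   by (intro l2_norm_triangle sqi_sum) (simp_all add: insert.prems)
  moreover have "l2_norm M (\<lambda>y. \<Sum>i\<in>F. f i y) \<le> (\<Sum>i\<in>F. l2_norm M (f i))" by (rule insert.IH) (simp add: insert.prems)
  ultimately show ?case using insert.hyps by simp
 qed
qed (simp add: l2_norm_def)

text \<open>Written so that a lower bound for the norm of a sum becomes an upper bound for a
  distance, as the convergence of ergodic averages requires.\<close>

lemma l2_norm_parallelogram:
 assumes f: "sqi M f" and g: "sqi M g"
 shows "(l2_norm M (\<lambda>x. f x - g x))\<^sup>2 = 2 * (l2_norm M f)\<^sup>2 + 2 * (l2_norm M g)\<^sup>2
  - (l2_norm M (\<lambda>x. f x + g x))\<^sup>2"
proof -
 note int = square_integrableD(2)[OF f] square_integrableD(2)[OF g]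
  square_integrableD(2)[OF sqi_add[OF f g]]
  square_integrableD(2)[OF sqi_diff[OF f g]]
 have pw: "(cmod (a - b))\<^sup>2 = 2 * (cmod a)\<^sup>2 + 2 * (cmod b)\<^sup>2 - (cmod (a + b))\<^sup>2" for a b
  by (simp only: cmod_power2 minus_complex.sel plus_complex.sel power2_diff power2_sum) simp
 have "(LINT x|M. (cmod (f x - g x))\<^sup>2) = (LINT x|M. 2 * (cmod (f x))\<^sup>2 + 2 * (cmod (g x))\<^sup>2 - (cmod (f x + g x))\<^sup>2)"
  by (simp only: pw)
 also have "... = 2 * (LINT x|M. (cmod (f x))\<^sup>2) + 2 * (LINT x|M. (cmod (g x))\<^sup>2) - (LINT x|M. (cmod (f x + g x))\<^sup>2)" using int by simp
 finally show ?thesis by (simp add: l2_norm_power2)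
qed

lemma integral_self_cnj: "(LINT x|M. f x * cnj (f x)) = of_real ((l2_norm M f)\<^sup>2)"
proof -
 have "(LINT x|M. f x * cnj (f x)) = (LINT x|M. complex_of_real ((cmod (f x))\<^sup>2))" by (simp only: complex_norm_square)
 also have "... = of_real (LINT x|M. (cmod (f x))\<^sup>2)" by (rule integral_complex_of_real)
 finally show ?thesis by (simp only: l2_norm_power2)
qed

lemma l2_norm_eq_0_AE:
 assumes f: "sqi M f" and "l2_norm M f = 0"
 shows "AE x in M. f x = 0"
proof -
 have "(LINT x|M. (cmod (f x))\<^sup>2) = 0" using assms(2) by (simp add: l2_norm_power2[symmetric])
 hence "AE x in M. (cmod (f x))\<^sup>2 = 0" using integral_nonneg_eq_0_iff_AE[OF square_integrableD(2)[OF f]] by simp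
 thus ?thesis by simp
qed

section \<open>Averages along Foelner sequences\<close>

lemma folner_sequenceD:
 assumes "folner_sequence G Ph"
 shows "finite (Ph N)" "Ph N \<noteq> {}" "Ph N \<subseteq> carrier G" "card (Ph N) > 0"
  "g \<in> carrier G ==> (\<lambda>N. real (card (sym_diff (g <#\<^bsub>G\<^esub> Ph N) (Ph N))) / real (card (Ph N))) ----> 0"
 using assms by (auto simp: folner_sequence_def card_gt_0_iff)

text \<open>\<open>folner_lim\<close> is a definite description over all Foelner sequences. The
  sequence \<open>Ph0\<close> is what makes the described number unique.\<close>

lemma folner_limI:
 assumes "folner_sequence G Ph0"
  and "\<And>Ph. folner_sequence G Ph ==> (\<lambda>N. a (Ph N)) ----> L"
 shows "folner_lim G a = L" unfolding folner_lim_def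
proof (rule the_equality)
 show "\<forall>Ph. folner_sequence G Ph \<longrightarrow> (\<lambda>N. a (Ph N)) ----> L" using assms(2) by blast
 fix L' assume "\<forall>Ph. folner_sequence G Ph \<longrightarrow> (\<lambda>N. a (Ph N)) ----> L'"
 thus "L' = L" using assms LIMSEQ_unique by blast
qed

lemma sum_sym_diff:
 fixes f :: "'a => 'b :: ab_group_add"
 assumes "finite A" "finite B"
 shows "sum f A - sum f B = sum f (A - B) - sum f (B - A)"
proof -
 have "sum f A = sum f (A - B) + sum f (A \<inter> B)" "sum f B = sum f (B - A) + sum f (A \<inter> B)"
  using sum.Int_Diff[OF assms(1), of f B] sum.Int_Diff[OF assms(2), of f A] by (simp_all add: Int_commute add.commute)
 thus ?thesis by simp
qed

context comm_group
begin

lemma l_coset_eq_image: "g <#\<^bsub>G\<^esub> A = (\<lambda>a. g \<otimes> a) ` A" by (auto simp: l_coset_def)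

lemma inj_on_mult_left: "g \<in> carrier G ==> A \<subseteq> carrier G ==> inj_on (\<lambda>a. g \<otimes> a) A" by (intro inj_onI) (simp add: subset_iff)

lemma sum_translate:
 assumes "g \<in> carrier G" "A \<subseteq> carrier G"
 shows "(\<Sum>a\<in>A. f (g \<otimes> a)) = sum f (g <#\<^bsub>G\<^esub> A)" using assms by (simp add: l_coset_eq_image sum.reindex inj_on_mult_left)

lemma card_sym_diff: "finite A ==> finite B ==> card (sym_diff A B) = card (A - B) + card (B - A)" by (subst card_Un_disjoint) auto

lemma norm_sum_translate_diff:
 fixes c :: "'a => complex" and B :: real
 assumes A: "finite A" "A \<subseteq> carrier G" and h: "h \<in> carrier G"
  and bd: "\<And>g. g \<in> carrier G ==> cmod (c g) \<le> B"
 shows "cmod ((\<Sum>g\<in>A. c (h \<otimes> g)) - (\<Sum>g\<in>A. c g)) \<le> card (sym_diff (h <#\<^bsub>G\<^esub> A) A) * B"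
proof -
 define hA where "hA = h <#\<^bsub>G\<^esub> A"
 have fin: "finite hA" using A(1) by (simp add: hA_def l_coset_eq_image)
 have sub: "hA \<subseteq> carrier G" using A(2) h by (auto simp: hA_def l_coset_eq_image)
 have s: "(\<Sum>g\<in>A. c (h \<otimes> g)) - (\<Sum>g\<in>A. c g) = sum c (hA - A) - sum c (A - hA)"
  using sum_sym_diff[OF fin A(1), of c] sum_translate[OF h A(2), of c] by (simp only: hA_def)
 have "cmod ((\<Sum>g\<in>A. c (h \<otimes> g)) - (\<Sum>g\<in>A. c g)) \<le> cmod (sum c (hA - A)) + cmod (sum c (A - hA))"
  unfolding s by (rule norm_triangle_ineq4)
 moreover have "cmod (sum c (hA - A)) \<le> card (hA - A) * B" by (rule sum_norm_bound) (use bd sub in blast)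
 moreover have "cmod (sum c (A - hA)) \<le> card (A - hA) * B" by (rule sum_norm_bound) (use bd A(2) in blast)
 moreover have "real (card (sym_diff hA A)) * B = card (hA - A) * B + card (A - hA) * B"
  by (simp only: card_sym_diff[OF fin A(1)] of_nat_add distrib_right)
 ultimately show ?thesis unfolding hA_def by linarith
qed

lemma folner_average_shift:
 fixes c :: "'a => complex" and B :: real
 assumes Ph: "folner_sequence G Ph" and h: "h \<in> carrier G"
  and bd: "\<And>g. g \<in> carrier G ==> cmod (c g) \<le> B"
 shows "(\<lambda>N. (\<Sum>g\<in>Ph N. c (h \<otimes> g)) / of_nat (card (Ph N)) - (\<Sum>g\<in>Ph N. c g) / of_nat (card (Ph N))) ----> 0"
proof (rule Lim_null_comparison)
 note F = folner_sequenceD[OF Ph]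
 show "(\<lambda>N. real (card (sym_diff (h <#\<^bsub>G\<^esub> Ph N) (Ph N))) / real (card (Ph N)) * B) ----> 0"
  by (rule tendsto_mult_left_zero[OF F(5)[OF h]])
 show "\<forall>\<^sub>F N in sequentially. norm ((\<Sum>g\<in>Ph N. c (h \<otimes> g)) / of_nat (card (Ph N)) - (\<Sum>g\<in>Ph N. c g) / of_nat (card (Ph N)))
   \<le> real (card (sym_diff (h <#\<^bsub>G\<^esub> Ph N) (Ph N))) / real (card (Ph N)) * B"
 proof (intro always_eventually allI)
  fix N
  have "cmod ((\<Sum>g\<in>Ph N. c (h \<otimes> g)) - (\<Sum>g\<in>Ph N. c g)) / real (card (Ph N))
   \<le> real (card (sym_diff (h <#\<^bsub>G\<^esub> Ph N) (Ph N))) * B / real (card (Ph N))"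
   by (intro divide_right_mono norm_sum_translate_diff F(1) F(3) h bd of_nat_0_le_iff)
  thus "norm ((\<Sum>g\<in>Ph N. c (h \<otimes> g)) / of_nat (card (Ph N)) - (\<Sum>g\<in>Ph N. c g) / of_nat (card (Ph N)))
   \<le> real (card (sym_diff (h <#\<^bsub>G\<^esub> Ph N) (Ph N))) / real (card (Ph N)) * B"
   by (simp only: diff_divide_distrib[symmetric] norm_divide norm_of_nat times_divide_eq_left of_nat_mult)
 qed
qed

text \<open>A set of fewer than \<open>C\<close> elements that is moved by less than a fraction
  \<open>1 / (C + 1)\<close> is not moved at all. If this holds for \<open>C + 1\<close> group
  elements, the set contains \<open>C + 1\<close> translates of one point.\<close>

lemma folner_card_at_top:
 assumes Ph: "folner_sequence G Ph" and inf: "infinite (carrier G)"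
 shows "filterlim (\<lambda>N. card (Ph N)) at_top sequentially" unfolding filterlim_at_top
proof
 fix C :: nat
 note F = folner_sequenceD[OF Ph]
 obtain A where A: "finite A" "card A = Suc C" "A \<subseteq> carrier G" using infinite_arbitrarily_large[OF inf, of "Suc C"] by metis
 have "\<forall>\<^sub>F N in sequentially. \<forall>g\<in>A. real (card (sym_diff (g <#\<^bsub>G\<^esub> Ph N) (Ph N))) / real (card (Ph N)) < 1 / real (C + 1)"
 proof (intro eventually_ball_finite ballI)
  fix g assume "g \<in> A"
  hence "g \<in> carrier G" using A by blast
  from F(5)[OF this]
  show "\<forall>\<^sub>F N in sequentially. real (card (sym_diff (g <#\<^bsub>G\<^esub> Ph N) (Ph N))) / real (card (Ph N)) < 1 / real (C + 1)"
   by (rule order_tendstoD(2)) simp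
 qed (rule A(1))
 thus "\<forall>\<^sub>F N in sequentially. C \<le> card (Ph N)"
 proof eventually_elim
  case (elim N)
  note fin = F(1)[of N] and ne = F(2)[of N] and sub = F(3)[of N] and pos = F(4)[of N]
  show ?case
  proof (rule ccontr)
   assume "\<not> C \<le> card (Ph N)"
   hence small: "card (Ph N) < C" by simp
   \<comment> \<open>The symmetric difference has fewer than \<open>card (Ph N) / (C + 1)\<close>
     elements, hence fewer than one.\<close>
   have st: "g <#\<^bsub>G\<^esub> Ph N = Ph N" if "g \<in> A" for g
   proof -
    define D where "D = sym_diff (g <#\<^bsub>G\<^esub> Ph N) (Ph N)"
    have finD: "finite D" using fin by (simp add: D_def l_coset_eq_image)
    have "real (card D) / real (card (Ph N)) < 1 / real (C + 1)" using elim that by (simp only: D_def)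
    hence "real (card D) < real (card (Ph N)) / real (C + 1)" using pos by (simp add: divide_less_eq mult.commute)
    also have "... < 1" using small by simp
    finally have "card D = 0" by simp
    hence "D = {}" using finD by simp
    thus ?thesis unfolding D_def by blast
   qed
   obtain a where a: "a \<in> Ph N" using ne by blast
   have im: "(\<lambda>g. g \<otimes> a) ` A \<subseteq> Ph N"
   proof safe
    fix g assume "g \<in> A"
    have "g \<otimes> a \<in> g <#\<^bsub>G\<^esub> Ph N" using a by (simp add: l_coset_eq_image)
    thus "g \<otimes> a \<in> Ph N" by (simp only: st[OF \<open>g \<in> A\<close>])
   qed
   have aG: "a \<in> carrier G" using a sub by blast
   have "inj_on (\<lambda>g. g \<otimes> a) A"
   proof (rule inj_onI)
    fix x y assume "x \<in> A" "y \<in> A" and eq: "x \<otimes> a = y \<otimes> a"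
    hence "x \<in> carrier G" "y \<in> carrier G" using A(3) by blast+
    thus "x = y" using eq right_cancel[OF aG] by blast
   qed
   hence "card A \<le> card (Ph N)" using im fin by (rule card_inj_on_le)
   thus False using A(2) small by simp
  qed
 qed
qed

text \<open>The elements with a large value form a finite set, whose share in \<open>Ph N\<close>
  tends to 0 because the sets of the sequence grow.\<close>

lemma folner_average_vanishing:
 fixes c :: "'a => complex" and B :: real
 assumes Ph: "folner_sequence G Ph" and inf: "infinite (carrier G)"
  and bd: "\<And>g. g \<in> carrier G ==> cmod (c g) \<le> B"
  and van: "\<And>e. e > 0 ==> finite {g \<in> carrier G. cmod (c g) \<ge> e}"
 shows "(\<lambda>N. (\<Sum>g\<in>Ph N. c g) / of_nat (card (Ph N))) ----> 0"
proof (rule tendstoI)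
 fix e :: real assume e: "e > 0"
 note F = folner_sequenceD[OF Ph]
 define E where "E = {g \<in> carrier G. cmod (c g) \<ge> e / 2}"
 have finE: "finite E" unfolding E_def using van[of "e / 2"] e by simp
 have B: "B \<ge> 0" using bd[of \<one>] norm_ge_zero order_trans by blast
 obtain K :: nat where K: "real K > 2 * (card E * B) / e" using reals_Archimedean2 by blast
 have "\<forall>\<^sub>F N in sequentially. card (Ph N) \<ge> Suc K" using folner_card_at_top[OF Ph inf] by (simp add: filterlim_at_top)
 thus "\<forall>\<^sub>F N in sequentially. dist ((\<Sum>g\<in>Ph N. c g) / of_nat (card (Ph N))) 0 < e"
 proof eventually_elim
  case (elim N)
  let ?A = "Ph N"
  have s: "(\<Sum>g\<in>?A. c g) = (\<Sum>g\<in>?A \<inter> E. c g) + (\<Sum>g\<in>?A - E. c g)" by (rule sum.Int_Diff[OF F(1)])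
  have "cmod (\<Sum>g\<in>?A. c g) \<le> cmod (\<Sum>g\<in>?A \<inter> E. c g) + cmod (\<Sum>g\<in>?A - E. c g)" unfolding s by (rule norm_triangle_ineq)
  moreover have "cmod (\<Sum>g\<in>?A \<inter> E. c g) \<le> card (?A \<inter> E) * B" by (rule sum_norm_bound) (use bd F(3)[of N] in blast)
  moreover have "card (?A \<inter> E) * B \<le> card E * B" using finE B by (intro mult_right_mono) (auto intro: card_mono)
  moreover have "cmod (\<Sum>g\<in>?A - E. c g) \<le> card (?A - E) * (e / 2)"
  proof (rule sum_norm_bound)
   fix g assume "g \<in> ?A - E"
   thus "cmod (c g) \<le> e / 2" using F(3)[of N] unfolding E_def by force
  qed
  moreover have "card (?A - E) * (e / 2) \<le> card ?A * (e / 2)" using e F(1)[of N] by (intro mult_right_mono) (auto intro: card_mono)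
  ultimately have "cmod (\<Sum>g\<in>?A. c g) \<le> card E * B + card ?A * (e / 2)" by linarith
  moreover have "card E * B < card ?A * (e / 2)"
  proof -
   have "2 * (card E * B) / e < real (card ?A)" using K elim by simp
   thus ?thesis using e by (simp add: field_simps)
  qed
  ultimately have "cmod (\<Sum>g\<in>?A. c g) < card ?A * e" by simp
  thus ?case using F(4)[of N] by (simp add: norm_divide field_simps)
 qed
qed

text \<open>Translation by \<open>g0\<close> multiplies the average by \<open>c g0\<close> but
  changes it only by a null sequence.\<close>

lemma folner_average_character:
 fixes c :: "'a => complex" and B :: real
 assumes Ph: "folner_sequence G Ph"
  and mult: "\<And>g h. g \<in> carrier G ==> h \<in> carrier G ==> c (g \<otimes> h) = c g * c h"
  and bd: "\<And>g. g \<in> carrier G ==> cmod (c g) \<le> 1"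
  and nt: "g0 \<in> carrier G" "c g0 \<noteq> 1"
 shows "(\<lambda>N. (\<Sum>g\<in>Ph N. c g) / of_nat (card (Ph N))) ----> 0"
proof -
 note F = folner_sequenceD[OF Ph]
 have "(\<lambda>N. (\<Sum>g\<in>Ph N. c (g0 \<otimes> g)) / of_nat (card (Ph N)) - (\<Sum>g\<in>Ph N. c g) / of_nat (card (Ph N))) ----> 0"
  using folner_average_shift[OF Ph nt(1) bd] .
 moreover have "(\<Sum>g\<in>Ph N. c (g0 \<otimes> g)) = c g0 * (\<Sum>g\<in>Ph N. c g)" for N
 proof -
  have "(\<Sum>g\<in>Ph N. c (g0 \<otimes> g)) = (\<Sum>g\<in>Ph N. c g0 * c g)" using F(3)[of N] nt(1) mult by (intro sum.cong) auto
  thus ?thesis by (simp add: sum_distrib_left)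
 qed
 ultimately have "(\<lambda>N. (c g0 - 1) * ((\<Sum>g\<in>Ph N. c g) / of_nat (card (Ph N)))) ----> 0"
  by (simp add: left_diff_distrib diff_divide_distrib)
 hence "(\<lambda>N. (c g0 - 1) * ((\<Sum>g\<in>Ph N. c g) / of_nat (card (Ph N))) / (c g0 - 1)) ----> 0 / (c g0 - 1)"
  by (intro tendsto_intros) (use nt in auto)
 thus ?thesis using nt by simp
qed

end

section \<open>The mean ergodic theorem for abelian actions\<close>

locale mp_action = comm_group G + prob_space M for G :: "('g, 'c) monoid_scheme" and M :: "'x measure" +
 fixes T :: "'g => 'x => 'x"
 assumes T_measurable: "g \<in> carrier G ==> T g \<in> measurable M M"
  and T_distr: "g \<in> carrier G ==> distr M M (T g) = M"
  and T_mult: "g \<in> carrier G ==> h \<in> carrier G ==> x \<in> space M ==> T (g \<otimes>\<^bsub>G\<^esub> h) x = T g (T h x)"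
begin

definition avg :: "'g set => ('x => complex) => 'x => complex" where
 "avg A f x = (\<Sum>g\<in>A. f (T g x)) / of_nat (card A)"

lemma T_space: "g \<in> carrier G ==> x \<in> space M ==> T g x \<in> space M" by (rule measurable_space[OF T_measurable])

lemma integral_T:
 fixes f :: "'x => 'b :: {banach, second_countable_topology}"
 assumes "g \<in> carrier G" "f \<in> borel_measurable M"
 shows "(LINT x|M. f (T g x)) = (LINT x|M. f x)" using integral_distr[OF T_measurable[OF assms(1)] assms(2)] T_distr[OF assms(1)] by simp

lemma integrable_T:
 fixes f :: "'x => 'b :: {banach, second_countable_topology}"
 assumes "g \<in> carrier G" "integrable M f"
 shows "integrable M (\<lambda>x. f (T g x))" using integrable_distr[OF T_measurable[OF assms(1)], of f] T_distr[OF assms(1)] assms(2) by simp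

lemma sqi_T:
 assumes "g \<in> carrier G" "sqi M f"
 shows "sqi M (\<lambda>x. f (T g x))" using integrable_T[OF assms(1) square_integrableD(2)[OF assms(2)]]
  m_comp[OF T_measurable[OF assms(1)] square_integrableD(1)[OF assms(2)]] by (simp add: square_integrable_def)

lemma l2_norm_T:
 assumes "g \<in> carrier G" "f \<in> borel_measurable M"
 shows "l2_norm M (\<lambda>x. f (T g x)) = l2_norm M f"
proof -
 have "(\<lambda>x. (cmod (f x))\<^sup>2) \<in> borel_measurable M" using assms(2) by measurable
 from integral_T[OF assms(1) this] show ?thesis by (simp only: l2_norm_def)
qed

lemma sqi_avg:
 assumes "A \<subseteq> carrier G" "sqi M f"
 shows "sqi M (avg A f)" unfolding avg_def[abs_def] using assms by (intro sqi_divide sqi_sum sqi_T) auto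

lemma l2_norm_avg_le:
 assumes A: "A \<subseteq> carrier G" and f: "sqi M f"
 shows "l2_norm M (avg A f) \<le> l2_norm M f"
proof -
 have "l2_norm M (\<lambda>x. \<Sum>g\<in>A. f (T g x)) \<le> (\<Sum>g\<in>A. l2_norm M (\<lambda>x. f (T g x)))"
  using A f by (intro l2_norm_sum_le sqi_T) auto
 also have "... = (\<Sum>g\<in>A. l2_norm M f)" using A by (intro sum.cong l2_norm_T square_integrableD(1)[OF f]) auto
 finally have *: "l2_norm M (\<lambda>x. \<Sum>g\<in>A. f (T g x)) \<le> card A * l2_norm M f" by simp
 have "l2_norm M (avg A f) = l2_norm M (\<lambda>x. \<Sum>g\<in>A. f (T g x)) / card A" unfolding avg_def[abs_def] l2_norm_divide by simp
 also have "... \<le> card A * l2_norm M f / card A" by (rule divide_right_mono[OF *]) simp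
 also have "... \<le> l2_norm M f" using l2_norm_nonneg[of M f] by (cases "card A = 0") auto
 finally show ?thesis .
qed

text \<open>After reindexing by \<open>h\<close>, the terms common to the set and its translate
  cancel; only the symmetric difference is left.\<close>

lemma l2_norm_avg_translate:
 assumes A: "finite A" "A \<subseteq> carrier G" and h: "h \<in> carrier G" and f: "sqi M f"
 shows "l2_norm M (\<lambda>x. avg A (\<lambda>x. f (T h x)) x - avg A f x) \<le> card (sym_diff (h <#\<^bsub>G\<^esub> A) A) / card A * l2_norm M f"
proof -
 define hA where "hA = h <#\<^bsub>G\<^esub> A"
 have fin: "finite hA" using A(1) by (simp add: hA_def l_coset_eq_image)
 have sub: "hA \<subseteq> carrier G" using A(2) h by (auto simp: hA_def l_coset_eq_image)
 define D where "D x = (\<Sum>g\<in>hA - A. f (T g x)) - (\<Sum>g\<in>A - hA. f (T g x))" for x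
 have sq: "sqi M (\<lambda>x. \<Sum>g\<in>B. f (T g x))" if "B \<subseteq> carrier G" for B using that f by (intro sqi_sum sqi_T) auto
 have l2: "l2_norm M (\<lambda>x. \<Sum>g\<in>B. f (T g x)) \<le> card B * l2_norm M f" if "B \<subseteq> carrier G" for B
 proof -
  have "l2_norm M (\<lambda>x. \<Sum>g\<in>B. f (T g x)) \<le> (\<Sum>g\<in>B. l2_norm M (\<lambda>x. f (T g x)))"
   using that f by (intro l2_norm_sum_le sqi_T) auto
  also have "... = (\<Sum>g\<in>B. l2_norm M f)" using that by (intro sum.cong l2_norm_T square_integrableD(1)[OF f]) auto
  finally show ?thesis by simp
 qed
 have eq: "avg A (\<lambda>x. f (T h x)) x - avg A f x = D x / of_nat (card A)" if "x \<in> space M" for x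
 proof -
  have "(\<Sum>g\<in>A. f (T h (T g x))) = (\<Sum>g\<in>A. f (T (h \<otimes>\<^bsub>G\<^esub> g) x))"
   using A(2) h that by (intro sum.cong) (auto simp: T_mult subset_iff)
  also have "... = (\<Sum>g\<in>hA. f (T g x))" unfolding hA_def by (rule sum_translate[OF h A(2)])
  finally show ?thesis unfolding avg_def D_def using sum_sym_diff[OF fin A(1), of "\<lambda>g. f (T g x)"] by (simp add: diff_divide_distrib[symmetric])
 qed
 have "l2_norm M (\<lambda>x. avg A (\<lambda>x. f (T h x)) x - avg A f x) = l2_norm M (\<lambda>x. D x / of_nat (card A))"
  unfolding l2_norm_def by (intro arg_cong[where f=sqrt] LINT_cong refl) (simp add: eq)
 also have "... = l2_norm M D / card A" by (simp add: l2_norm_divide)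
 also have "l2_norm M D \<le> card (hA - A) * l2_norm M f + card (A - hA) * l2_norm M f"
 proof -
  have s: "hA - A \<subseteq> carrier G" "A - hA \<subseteq> carrier G" using sub A(2) by auto
  have "l2_norm M D \<le> l2_norm M (\<lambda>x. \<Sum>g\<in>hA - A. f (T g x)) + l2_norm M (\<lambda>x. (-1) * (\<Sum>g\<in>A - hA. f (T g x)))"
   using l2_norm_triangle[OF sq[OF s(1)] sqi_cmult[OF sq[OF s(2)], of "-1"]] unfolding D_def[abs_def] by simp
  also have "l2_norm M (\<lambda>x. (-1) * (\<Sum>g\<in>A - hA. f (T g x))) = l2_norm M (\<lambda>x. \<Sum>g\<in>A - hA. f (T g x))"
   unfolding l2_norm_cmult by simp
  finally show ?thesis using l2[OF s(1)] l2[OF s(2)] by linarith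
 qed
 also have "card (hA - A) * l2_norm M f + card (A - hA) * l2_norm M f = card (sym_diff hA A) * l2_norm M f"
  by (simp only: card_sym_diff[OF fin A(1)] of_nat_add distrib_right)
 finally show ?thesis by (simp add: hA_def divide_right_mono)
qed

text \<open>Functions with asymptotically the same averages as \<open>F\<close>. This class contains
  the translates of \<open>F\<close> and their finite means, and stands in for the closed convex
  hull of the orbit.\<close>

definition sim :: "('x => complex) => (nat => 'g set) => ('x => complex) => bool" where
 "sim F Ph f \<longleftrightarrow> sqi M f \<and> (\<lambda>N. l2_norm M (\<lambda>x. avg (Ph N) f x - avg (Ph N) F x)) ----> 0"

lemma sim_T:
 assumes Ph: "folner_sequence G Ph" and h: "h \<in> carrier G" and F: "sqi M F"
 shows "sim F Ph (\<lambda>x. F (T h x))" unfolding sim_def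
proof
 note FS = folner_sequenceD[OF Ph]
 show "sqi M (\<lambda>x. F (T h x))" by (rule sqi_T[OF h F])
 show "(\<lambda>N. l2_norm M (\<lambda>x. avg (Ph N) (\<lambda>x. F (T h x)) x - avg (Ph N) F x)) ----> 0"
 proof (rule tendsto_sandwich[OF _ _ tendsto_const tendsto_mult_left_zero[OF FS(5)[OF h], of "l2_norm M F"]])
  show "\<forall>\<^sub>F N in sequentially. l2_norm M (\<lambda>x. avg (Ph N) (\<lambda>x. F (T h x)) x - avg (Ph N) F x)
   \<le> real (card (sym_diff (h <#\<^bsub>G\<^esub> Ph N) (Ph N))) / real (card (Ph N)) * l2_norm M F"
   by (intro always_eventually allI l2_norm_avg_translate FS(1) FS(3) h F)
 qed (simp add: l2_norm_nonneg)
qed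

lemma sim_mean:
 assumes B: "finite B" "B \<noteq> {}" and Ph: "folner_sequence G Ph" and F: "sqi M F"
  and sim: "\<And>i. i \<in> B ==> sim F Ph (f i)"
 shows "sim F Ph (\<lambda>x. (\<Sum>i\<in>B. f i x) / of_nat (card B))" unfolding sim_def
proof
 note FS = folner_sequenceD[OF Ph]
 have sq: "sqi M (f i)" if "i \<in> B" for i using sim[OF that] by (simp add: sim_def)
 show "sqi M (\<lambda>x. (\<Sum>i\<in>B. f i x) / of_nat (card B))" using sq by (intro sqi_divide sqi_sum) auto
 have cB: "of_nat (card B) \<noteq> (0::complex)" using B by simp
 have eq: "avg A (\<lambda>x. (\<Sum>i\<in>B. f i x) / of_nat (card B)) x - avg A F x
   = (\<Sum>i\<in>B. (avg A (f i) x - avg A F x)) / of_nat (card B)" for A x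
 proof -
  have "avg A (\<lambda>x. (\<Sum>i\<in>B. f i x) / of_nat (card B)) x = (\<Sum>i\<in>B. avg A (f i) x) / of_nat (card B)"
   unfolding avg_def sum_divide_distrib by (subst sum.swap) (simp add: mult.commute)
  moreover have "avg A F x = (\<Sum>i\<in>B. avg A F x) / of_nat (card B)" using cB by simp
  ultimately show ?thesis by (simp only: sum_subtractf diff_divide_distrib)
 qed
 have lim: "(\<lambda>N. (\<Sum>i\<in>B. l2_norm M (\<lambda>x. avg (Ph N) (f i) x - avg (Ph N) F x)) / card B) ----> (\<Sum>i\<in>B. 0) / card B"
  using B sim by (intro tendsto_intros) (auto simp: sim_def)
 show "(\<lambda>N. l2_norm M (\<lambda>x. avg (Ph N) (\<lambda>x. (\<Sum>i\<in>B. f i x) / of_nat (card B)) x - avg (Ph N) F x)) ----> 0"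
 proof (rule tendsto_sandwich[OF _ _ tendsto_const])
  show "(\<lambda>N. (\<Sum>i\<in>B. l2_norm M (\<lambda>x. avg (Ph N) (f i) x - avg (Ph N) F x)) / card B) ----> 0" using lim by simp
  show "\<forall>\<^sub>F N in sequentially. l2_norm M (\<lambda>x. avg (Ph N) (\<lambda>x. (\<Sum>i\<in>B. f i x) / of_nat (card B)) x - avg (Ph N) F x)
    \<le> (\<Sum>i\<in>B. l2_norm M (\<lambda>x. avg (Ph N) (f i) x - avg (Ph N) F x)) / card B"
  proof (intro always_eventually allI)
   fix N
   have "l2_norm M (\<lambda>x. \<Sum>i\<in>B. (avg (Ph N) (f i) x - avg (Ph N) F x))
     \<le> (\<Sum>i\<in>B. l2_norm M (\<lambda>x. avg (Ph N) (f i) x - avg (Ph N) F x))" by (intro l2_norm_sum_le sqi_diff sqi_avg sq FS(3) F)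
   thus "l2_norm M (\<lambda>x. avg (Ph N) (\<lambda>x. (\<Sum>i\<in>B. f i x) / of_nat (card B)) x - avg (Ph N) F x)
     \<le> (\<Sum>i\<in>B. l2_norm M (\<lambda>x. avg (Ph N) (f i) x - avg (Ph N) F x)) / card B"
    unfolding eq l2_norm_divide by (simp add: divide_right_mono)
  qed
 qed (simp add: l2_norm_nonneg)
qed

lemma sim_avg:
 assumes "finite B" "B \<noteq> {}" "B \<subseteq> carrier G" "folner_sequence G Ph" "sqi M F"
 shows "sim F Ph (avg B F)" unfolding avg_def[abs_def] using assms by (intro sim_mean sim_T) auto

text \<open>The length of the projection of \<open>F\<close> to the invariant functions, in the form
  of von Neumann's argument; no limit function has to be constructed.\<close>

definition hull_norm :: "('x => complex) => real" where
 "hull_norm F = Inf ((\<lambda>A. l2_norm M (avg A F)) ` {A. finite A \<and> A \<noteq> {} \<and> A \<subseteq> carrier G})"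

lemma hull_norm_le:
 assumes "finite A" "A \<noteq> {}" "A \<subseteq> carrier G"
 shows "hull_norm F \<le> l2_norm M (avg A F)" unfolding hull_norm_def
proof (rule cInf_lower)
 show "l2_norm M (avg A F) \<in> (\<lambda>A. l2_norm M (avg A F)) ` {A. finite A \<and> A \<noteq> {} \<and> A \<subseteq> carrier G}"
  using assms by blast
 show "bdd_below ((\<lambda>A. l2_norm M (avg A F)) ` {A. finite A \<and> A \<noteq> {} \<and> A \<subseteq> carrier G})"
  by (rule bdd_belowI[of _ 0]) (auto simp: l2_norm_nonneg)
qed

lemma hull_norm_less:
 assumes "e > 0"
 obtains A where "finite A" "A \<noteq> {}" "A \<subseteq> carrier G" "l2_norm M (avg A F) < hull_norm F + e"
proof -
 have "{\<one>\<^bsub>G\<^esub>} \<in> {A. finite A \<and> A \<noteq> {} \<and> A \<subseteq> carrier G}" by simp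
 hence "(\<lambda>A. l2_norm M (avg A F)) ` {A. finite A \<and> A \<noteq> {} \<and> A \<subseteq> carrier G} \<noteq> {}" by blast
 from cInf_lessD[OF this, of "hull_norm F + e"] assms that show thesis unfolding hull_norm_def[symmetric] by auto
qed

lemma hull_norm_nonneg: "hull_norm F \<ge> 0"
proof (rule ccontr)
 assume "\<not> hull_norm F \<ge> 0"
 then obtain A where "l2_norm M (avg A F) < hull_norm F + (- hull_norm F)" using hull_norm_less[of "- hull_norm F" F] by auto
 thus False using l2_norm_nonneg[of M "avg A F"] by simp
qed

lemma avg_le_sim:
 assumes Ph: "folner_sequence G Ph" and F: "sqi M F" and f: "sim F Ph f"
 shows "l2_norm M (avg (Ph N) F) \<le> l2_norm M f + l2_norm M (\<lambda>x. avg (Ph N) f x - avg (Ph N) F x)"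
proof -
 note FS = folner_sequenceD[OF Ph]
 have f': "sqi M f" using f by (simp add: sim_def)
 have "l2_norm M (avg (Ph N) F) \<le> l2_norm M (\<lambda>x. avg (Ph N) F x - avg (Ph N) f x) + l2_norm M (avg (Ph N) f)"
  by (intro l2_norm_triangle_diff sqi_avg FS(3) F f')
 thus ?thesis using l2_norm_avg_le[OF FS(3)[of N] f'] l2_norm_minus_commute[of M "avg (Ph N) F" "avg (Ph N) f"] by linarith
qed

text \<open>Extends the lower bound from averages of \<open>F\<close> to all functions similar to
  \<open>F\<close>, in particular to midpoints of two averages.\<close>

lemma hull_norm_le_sim:
 assumes Ph: "folner_sequence G Ph" and F: "sqi M F" and f: "sim F Ph f"
 shows "hull_norm F \<le> l2_norm M f"
proof -
 note FS = folner_sequenceD[OF Ph]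
 have "(\<lambda>N. l2_norm M f + l2_norm M (\<lambda>x. avg (Ph N) f x - avg (Ph N) F x)) ----> l2_norm M f + 0"
  using f by (intro tendsto_intros) (simp add: sim_def)
 moreover have "hull_norm F \<le> l2_norm M f + l2_norm M (\<lambda>x. avg (Ph N) f x - avg (Ph N) F x)" for N
  using hull_norm_le[OF FS(1,2,3)[of N], of F] avg_le_sim[OF assms, of N] by linarith
 ultimately show ?thesis using LIMSEQ_le_const[of "\<lambda>N. l2_norm M f + l2_norm M (\<lambda>x. avg (Ph N) f x - avg (Ph N) F x)" "l2_norm M f + 0"]
  by simp
qed

text \<open>A finite average \<open>avg B F\<close> of nearly minimal norm is similar to
  \<open>F\<close>, so the averages of \<open>F\<close> along \<open>Ph\<close> finally have a norm
  no larger than that, up to a small error.\<close>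

lemma avg_norm_tendsto:
 assumes Ph: "folner_sequence G Ph" and F: "sqi M F"
 shows "(\<lambda>N. l2_norm M (avg (Ph N) F)) ----> hull_norm F"
proof (rule tendstoI)
 fix e :: real assume e: "e > 0"
 note FS = folner_sequenceD[OF Ph]
 obtain B where B: "finite B" "B \<noteq> {}" "B \<subseteq> carrier G" "l2_norm M (avg B F) < hull_norm F + e / 2"
  using hull_norm_less[of "e / 2" F] e by auto
 have s: "sim F Ph (avg B F)" by (rule sim_avg[OF B(1-3) Ph F])
 hence "\<forall>\<^sub>F N in sequentially. l2_norm M (\<lambda>x. avg (Ph N) (avg B F) x - avg (Ph N) F x) < e / 2"
  unfolding sim_def using order_tendstoD(2)[of _ 0 sequentially "e / 2"] e by simp
 thus "\<forall>\<^sub>F N in sequentially. dist (l2_norm M (avg (Ph N) F)) (hull_norm F) < e"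
 proof eventually_elim
  case (elim N)
  have "hull_norm F \<le> l2_norm M (avg (Ph N) F)" by (rule hull_norm_le[OF FS(1,2,3)])
  thus ?case using elim B(4) avg_le_sim[OF Ph F s, of N] by (simp add: dist_real_def)
 qed
qed

definition corr :: "('x => complex) => 'g => complex" where
 "corr F g = (LINT x|M. F (T g x) * cnj (F x))"

lemma corr_bound:
 assumes "sqi M F" "g \<in> carrier G"
 shows "cmod (corr F g) \<le> (l2_norm M F)\<^sup>2" using Cauchy_Schwarz_l2[OF sqi_T[OF assms(2,1)] assms(1)]
  l2_norm_T[OF assms(2) square_integrableD(1)[OF assms(1)]] by (simp add: corr_def power2_eq_square)

lemma corr_shift:
 assumes F: "sqi M F" and g: "g \<in> carrier G" and k: "k \<in> carrier G"
 shows "(LINT x|M. F (T g x) * cnj (F (T k x))) = corr F (inv\<^bsub>G\<^esub> k \<otimes>\<^bsub>G\<^esub> g)"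
proof -
 let ?h = "inv\<^bsub>G\<^esub> k \<otimes>\<^bsub>G\<^esub> g"
 have h: "?h \<in> carrier G" using g k by simp
 have hk: "?h \<otimes>\<^bsub>G\<^esub> k = g" using g k by (simp add: m_ac)
 have [measurable]: "F \<in> borel_measurable M" "T ?h \<in> measurable M M" using square_integrableD(1)[OF F] T_measurable[OF h] by auto
 have "corr F ?h = (LINT x|M. F (T ?h (T k x)) * cnj (F (T k x)))" unfolding corr_def by (rule integral_T[OF k, symmetric]) measurable
 also have "... = (LINT x|M. F (T g x) * cnj (F (T k x)))" by (intro LINT_cong refl) (simp add: T_mult[OF h k, symmetric] hk)
 finally show ?thesis ..
qed

lemma corr_average:
 assumes A: "A \<subseteq> carrier G" and F: "sqi M F" and f: "sqi M f"
 shows "(LINT x|M. avg A F x * cnj (f x)) = (\<Sum>g\<in>A. (LINT x|M. F (T g x) * cnj (f x))) / of_nat (card A)"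
proof -
 have int: "integrable M (\<lambda>x. F (T g x) * cnj (f x))" if "g \<in> A" for g using that A by (intro integrable_mult_square sqi_T F sqi_cnj f) auto
 have "(LINT x|M. avg A F x * cnj (f x)) = (LINT x|M. (\<Sum>g\<in>A. F (T g x) * cnj (f x)) / of_nat (card A))" by (simp add: avg_def sum_distrib_right)
 also have "... = (LINT x|M. (\<Sum>g\<in>A. F (T g x) * cnj (f x))) / of_nat (card A)" by simp
 also have "(LINT x|M. (\<Sum>g\<in>A. F (T g x) * cnj (f x))) = (\<Sum>g\<in>A. (LINT x|M. F (T g x) * cnj (f x)))"
  by (rule Bochner_Integration.integral_sum[OF int])
 finally show ?thesis .
qed

lemma corr_average2:
 assumes A: "A \<subseteq> carrier G" and B: "B \<subseteq> carrier G" and F: "sqi M F"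
 shows "(LINT x|M. avg A F x * cnj (avg B F x)) =
  (\<Sum>k\<in>B. (\<Sum>g\<in>A. corr F (inv\<^bsub>G\<^esub> k \<otimes>\<^bsub>G\<^esub> g)) / of_nat (card A)) / of_nat (card B)"
proof -
 have sA: "sqi M (avg A F)" by (rule sqi_avg[OF A F])
 have sk: "sqi M (\<lambda>x. F (T k x))" if "k \<in> B" for k using sqi_T[OF _ F] B that by blast
 have int: "integrable M (\<lambda>x. avg A F x * cnj (F (T k x)))" if "k \<in> B" for k by (rule integrable_mult_square[OF sA sqi_cnj[OF sk[OF that]]])
 have "(LINT x|M. avg A F x * cnj (avg B F x)) = (LINT x|M. (\<Sum>k\<in>B. avg A F x * cnj (F (T k x))) / of_nat (card B))"
  by (simp add: avg_def[of B] sum_distrib_left)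
 also have "... = (LINT x|M. (\<Sum>k\<in>B. avg A F x * cnj (F (T k x)))) / of_nat (card B)" by simp
 also have "(LINT x|M. (\<Sum>k\<in>B. avg A F x * cnj (F (T k x)))) = (\<Sum>k\<in>B. (LINT x|M. avg A F x * cnj (F (T k x))))"
  by (rule Bochner_Integration.integral_sum[OF int])
 also have "... = (\<Sum>k\<in>B. (\<Sum>g\<in>A. corr F (inv\<^bsub>G\<^esub> k \<otimes>\<^bsub>G\<^esub> g)) / of_nat (card A))"
 proof (rule sum.cong[OF refl])
  fix k assume k: "k \<in> B"
  hence kG: "k \<in> carrier G" using B by blast
  have "(\<Sum>g\<in>A. LINT x|M. F (T g x) * cnj (F (T k x))) = (\<Sum>g\<in>A. corr F (inv\<^bsub>G\<^esub> k \<otimes>\<^bsub>G\<^esub> g))"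
   by (rule sum.cong[OF refl], rule corr_shift[OF F _ kG]) (use A in blast)
  thus "(LINT x|M. avg A F x * cnj (F (T k x))) = (\<Sum>g\<in>A. corr F (inv\<^bsub>G\<^esub> k \<otimes>\<^bsub>G\<^esub> g)) / of_nat (card A)"
   by (simp only: corr_average[OF A F sk[OF k]])
 qed
 finally show ?thesis .
qed

text \<open>Uniform convexity: the midpoint of two averages has norm at least
  \<open>hull_norm F\<close>, so by the parallelogram law two nearly minimal averages are close to
  each other.\<close>

lemma l2_norm_avg_diff_bound:
 assumes Ph: "folner_sequence G Ph" and F: "sqi M F"
 shows "l2_norm M (\<lambda>x. avg (Ph N) F x - avg (Ph K) F x) \<le> sqrt (2 * ((l2_norm M (avg (Ph N) F))\<^sup>2 - (hull_norm F)\<^sup>2))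
   + sqrt (2 * ((l2_norm M (avg (Ph K) F))\<^sup>2 - (hull_norm F)\<^sup>2))"
proof -
 note FS = folner_sequenceD[OF Ph]
 let ?a = "\<lambda>N. avg (Ph N) F" and ?d = "hull_norm F"
 have sq: "sqi M (?a N)" for N by (rule sqi_avg[OF FS(3) F])
 \<comment> \<open>The two averages are indexed by truth values, so that the mean has two terms even
   when they coincide.\<close>
 have "sim F Ph (\<lambda>x. (\<Sum>i\<in>{True, False}. (if i then ?a N else ?a K) x) / of_nat (card {True, False}))"
  by (rule sim_mean[OF _ _ Ph F]) (auto intro: sim_avg[OF FS(1,2,3) Ph F])
 hence "?d \<le> l2_norm M (\<lambda>x. (?a N x + ?a K x) / 2)" using hull_norm_le_sim[OF Ph F] by simp
 hence "2 * ?d \<le> l2_norm M (\<lambda>x. ?a N x + ?a K x)" by (simp add: l2_norm_divide)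
 hence "(2 * ?d)\<^sup>2 \<le> (l2_norm M (\<lambda>x. ?a N x + ?a K x))\<^sup>2" by (rule power_mono) (simp add: hull_norm_nonneg)
 hence *: "(l2_norm M (\<lambda>x. ?a N x - ?a K x))\<^sup>2 \<le> 2 * ((l2_norm M (?a N))\<^sup>2 - ?d\<^sup>2) + 2 * ((l2_norm M (?a K))\<^sup>2 - ?d\<^sup>2)"
  unfolding l2_norm_parallelogram[OF sq sq] by (simp add: power_mult_distrib)
 have nn: "0 \<le> 2 * ((l2_norm M (?a N))\<^sup>2 - ?d\<^sup>2)" for N
  using power_mono[OF hull_norm_le[OF FS(1,2,3)[of N], of F] hull_norm_nonneg, of 2] by simp
 have "l2_norm M (\<lambda>x. ?a N x - ?a K x) \<le> sqrt (2 * ((l2_norm M (?a N))\<^sup>2 - ?d\<^sup>2) + 2 * ((l2_norm M (?a K))\<^sup>2 - ?d\<^sup>2))"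
  by (rule real_le_rsqrt[OF *])
 also have "... \<le> sqrt (2 * ((l2_norm M (?a N))\<^sup>2 - ?d\<^sup>2)) + sqrt (2 * ((l2_norm M (?a K))\<^sup>2 - ?d\<^sup>2))"
  by (rule sqrt_add_le_add_sqrt[OF nn nn])
 finally show ?thesis .
qed

text \<open>The inner product of the averages over \<open>Ph N\<close> and over a fixed good
  \<open>Ph K\<close> is computed in two ways: for large \<open>N\<close> it is close to the mean
  correlation, and it is close to the squared norm of the average over \<open>Ph K\<close>.\<close>

lemma avg_corr_tendsto:
 assumes Ph: "folner_sequence G Ph" and F: "sqi M F"
 shows "(\<lambda>N. (\<Sum>g\<in>Ph N. corr F g) / of_nat (card (Ph N))) ----> of_real ((hull_norm F)\<^sup>2)"
proof (rule tendstoI)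
 fix e :: real assume e: "e > 0"
 note FS = folner_sequenceD[OF Ph]
 let ?a = "\<lambda>N. avg (Ph N) F" and ?d = "hull_norm F"
 define L where "L = l2_norm M F"
 define s where "s N = l2_norm M (?a N)" for N
 define v where "v N = sqrt (2 * ((s N)\<^sup>2 - ?d\<^sup>2))" for N
 have slim: "s ----> ?d" unfolding s_def[abs_def] by (rule avg_norm_tendsto[OF Ph F])
 have sL: "s N \<le> L" for N unfolding s_def L_def by (rule l2_norm_avg_le[OF FS(3) F])
 have snn: "0 \<le> s N" for N by (simp add: s_def l2_norm_nonneg)
 have vlim: "v ----> sqrt (2 * (?d\<^sup>2 - ?d\<^sup>2))" unfolding v_def[abs_def] by (intro tendsto_intros slim)
 have vL: "(\<lambda>N. v N * L) ----> sqrt (2 * (?d\<^sup>2 - ?d\<^sup>2)) * L" by (intro tendsto_intros vlim)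
 have wlim: "(\<lambda>N. v N * L + \<bar>(s N)\<^sup>2 - ?d\<^sup>2\<bar>) ----> sqrt (2 * (?d\<^sup>2 - ?d\<^sup>2)) * L + \<bar>?d\<^sup>2 - ?d\<^sup>2\<bar>"
  by (intro tendsto_intros vlim slim)
 have "\<forall>\<^sub>F K in sequentially. v K * L + \<bar>(s K)\<^sup>2 - ?d\<^sup>2\<bar> < e / 3"
  using order_tendstoD(2)[OF wlim, of "e / 3"] e by simp
 then obtain K where K: "v K * L + \<bar>(s K)\<^sup>2 - ?d\<^sup>2\<bar> < e / 3" unfolding eventually_sequentially by blast
 define X where "X N = (\<Sum>g\<in>Ph N. corr F g) / of_nat (card (Ph N))" for N
 define Y where "Y N = (LINT x|M. ?a N x * cnj (?a K x))" for N
 have sq: "sqi M (?a N)" for N by (rule sqi_avg[OF FS(3) F])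
 \<comment> \<open>Expanding the average over \<open>Ph K\<close> gives means of translated
   correlations, and a fixed translation does not change a Foelner mean in the limit.\<close>
 have YX: "(\<lambda>N. Y N - X N) ----> 0"
 proof -
  have "Y N - X N = (\<Sum>k\<in>Ph K. (\<Sum>g\<in>Ph N. corr F (inv\<^bsub>G\<^esub> k \<otimes>\<^bsub>G\<^esub> g)) / of_nat (card (Ph N)) - X N) / of_nat (card (Ph K))" for N
  proof -
   have "X N = (\<Sum>k\<in>Ph K. X N) / of_nat (card (Ph K))" using FS(4)[of K] by simp
   thus ?thesis unfolding Y_def corr_average2[OF FS(3) FS(3) F] sum_subtractf diff_divide_distrib by simp
  qed
  moreover have "(\<lambda>N. (\<Sum>k\<in>Ph K. (\<Sum>g\<in>Ph N. corr F (inv\<^bsub>G\<^esub> k \<otimes>\<^bsub>G\<^esub> g)) / of_nat (card (Ph N)) - X N) / of_nat (card (Ph K)))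
    ----> (\<Sum>k\<in>Ph K. 0) / of_nat (card (Ph K))"
  proof (intro tendsto_divide tendsto_sum tendsto_const)
   fix k assume "k \<in> Ph K"
   hence "inv\<^bsub>G\<^esub> k \<in> carrier G" using FS(3)[of K] by auto
   thus "(\<lambda>N. (\<Sum>g\<in>Ph N. corr F (inv\<^bsub>G\<^esub> k \<otimes>\<^bsub>G\<^esub> g)) / of_nat (card (Ph N)) - X N) ----> 0"
    unfolding X_def by (rule folner_average_shift[OF Ph _ corr_bound[OF F]])
  qed (use FS(4)[of K] in simp)
  ultimately show ?thesis by simp
 qed
 \<comment> \<open>Replaces the average over \<open>Ph N\<close> by the one over
   \<open>Ph K\<close>; the error is controlled by how far both norms are from their
   infimum.\<close>
 have Ys: "cmod (Y N - of_real ((s K)\<^sup>2)) \<le> (v N + v K) * L" for N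
 proof -
  have "Y N - of_real ((s K)\<^sup>2) = (LINT x|M. (?a N x - ?a K x) * cnj (?a K x))"
   unfolding Y_def s_def integral_self_cnj[symmetric] left_diff_distrib by (rule Bochner_Integration.integral_diff[symmetric])
    (intro integrable_mult_square sqi_cnj sq)+
  hence "cmod (Y N - of_real ((s K)\<^sup>2)) \<le> l2_norm M (\<lambda>x. ?a N x - ?a K x) * s K"
   using Cauchy_Schwarz_l2[OF sqi_diff[OF sq sq] sq, of N K K] by (simp add: s_def)
  also have "... \<le> (v N + v K) * s K" using l2_norm_avg_diff_bound[OF Ph F, of N K] snn by (intro mult_right_mono) (auto simp: v_def s_def)
  also have "... \<le> (v N + v K) * L"
  proof (rule mult_left_mono[OF sL])
   have "0 \<le> l2_norm M (\<lambda>x. ?a N x - ?a K x)" by (rule l2_norm_nonneg)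
   thus "0 \<le> v N + v K" using l2_norm_avg_diff_bound[OF Ph F, of N K] by (simp add: v_def s_def)
  qed
  finally show ?thesis .
 qed
 have "\<forall>\<^sub>F N in sequentially. v N * L < e / 3" using order_tendstoD(2)[OF vL, of "e / 3"] e by simp
 moreover have "\<forall>\<^sub>F N in sequentially. dist (Y N - X N) 0 < e / 3" by (rule tendstoD[OF YX]) (use e in simp)
 ultimately show "\<forall>\<^sub>F N in sequentially. dist ((\<Sum>g\<in>Ph N. corr F g) / of_nat (card (Ph N))) (of_real ((hull_norm F)\<^sup>2)) < e"
 proof eventually_elim
  case (elim N)
  have "X N - of_real (?d\<^sup>2) = - (Y N - X N) + (Y N - of_real ((s K)\<^sup>2)) + of_real ((s K)\<^sup>2 - ?d\<^sup>2)" by simp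
  hence "cmod (X N - of_real (?d\<^sup>2)) \<le> cmod (Y N - X N) + cmod (Y N - of_real ((s K)\<^sup>2)) + \<bar>(s K)\<^sup>2 - ?d\<^sup>2\<bar>"
   by (metis norm_minus_cancel norm_of_real norm_triangle_ineq norm_triangle_le add_right_mono)
  also have "... < e" using Ys[of N] K elim by (simp add: dist_norm distrib_right)
  finally show ?case by (simp add: dist_norm X_def)
 qed
qed

text \<open>Because \<open>J\<close> is invariant, \<open>F\<close> may be replaced by any of its
  averages in the inner product, and these have arbitrarily small norm.\<close>

lemma hull_norm_0_orthogonal:
 assumes F: "sqi M F" and J: "sqi M J"
  and inv: "\<And>g. g \<in> carrier G ==> AE x in M. J (T g x) = J x" and d: "hull_norm F = 0"
 shows "(LINT x|M. F x * cnj (J x)) = 0"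
proof -
 let ?I = "LINT x|M. F x * cnj (J x)"
 have [measurable]: "F \<in> borel_measurable M" "J \<in> borel_measurable M" using square_integrableD(1)[OF F] square_integrableD(1)[OF J] by auto
 have inv_int: "(LINT x|M. F (T g x) * cnj (J x)) = ?I" if g: "g \<in> carrier G" for g
 proof -
  have [measurable]: "T g \<in> measurable M M" by (rule T_measurable[OF g])
  have "?I = (LINT x|M. F (T g x) * cnj (J (T g x)))" by (rule integral_T[OF g, symmetric]) measurable
  also have "... = (LINT x|M. F (T g x) * cnj (J x))" by (rule integral_cong_AE) (use inv[OF g] in auto)
  finally show ?thesis ..
 qed
 have le: "cmod ?I \<le> e * l2_norm M J" if e: "e > 0" for e
 proof -
  obtain A where A: "finite A" "A \<noteq> {}" "A \<subseteq> carrier G" "l2_norm M (avg A F) < hull_norm F + e"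
   using hull_norm_less[OF e, of F] by blast
  have "(LINT x|M. avg A F x * cnj (J x)) = (\<Sum>g\<in>A. (LINT x|M. F (T g x) * cnj (J x))) / of_nat (card A)" by (rule corr_average[OF A(3) F J])
  also have "(\<Sum>g\<in>A. (LINT x|M. F (T g x) * cnj (J x))) = (\<Sum>g\<in>A. ?I)" by (rule sum.cong[OF refl], rule inv_int) (use A in blast)
  also have "(\<Sum>g\<in>A. ?I) / of_nat (card A) = ?I" using A by simp
  finally have "cmod ?I \<le> l2_norm M (avg A F) * l2_norm M J" using Cauchy_Schwarz_l2[OF sqi_avg[OF A(3) F] J] by simp
  also have "... \<le> e * l2_norm M J" using A(4) d by (intro mult_right_mono l2_norm_nonneg) simp
  finally show ?thesis .
 qed
 have "cmod ?I \<le> 0"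
 proof (rule field_le_epsilon)
  fix e :: real assume e: "e > 0"
  have "cmod ?I \<le> e / (l2_norm M J + 1) * l2_norm M J" by (rule le) (use e l2_norm_nonneg[of M J] in auto)
  also have "... \<le> e" using e l2_norm_nonneg[of M J] by (simp add: field_simps)
  finally show "cmod ?I \<le> 0 + e" by simp
 qed
 thus ?thesis by simp
qed

end

section \<open>Density in the space of square-integrable functions\<close>

definition l2_closure :: "'x measure => ('x => complex) set => ('x => complex) set" where
 "l2_closure M \<T> = {f. sqi M f \<and> (\<forall>e>0. \<exists>P\<in>\<T>. l2_norm M (\<lambda>x. f x - P x) < e)}"

text \<open>Passes from uniform approximation of continuous functions to approximation in the square
  mean. It is instantiated for trigonometric polynomials on the solenoid and on the skew
  product.\<close>

locale l2_dense_setup = finite_measure M for M :: "'x :: metric_space measure" +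
 fixes S :: "'x set" and \<T> :: "('x => complex) set"
 assumes sets_M: "sets M = sets (restrict_space borel S)" and compact_S: "compact S"
  and T_add: "f \<in> \<T> ==> g \<in> \<T> ==> (\<lambda>x. f x + g x) \<in> \<T>"
  and T_cmult: "f \<in> \<T> ==> (\<lambda>x. c * f x) \<in> \<T>"
  and T_square: "f \<in> \<T> ==> sqi M f"
  and T_const: "(\<lambda>_. c) \<in> \<T>"
  and T_uniform: "continuous_on S (r :: 'x => real) ==> e > 0 ==> \<exists>P\<in>\<T>. \<forall>x\<in>S. cmod (of_real (r x) - P x) < e"
begin

lemma space_M: "space M = S" using sets_eq_imp_space_eq[OF sets_M] by (simp add: space_restrict_space)

lemma cl_square: "f \<in> l2_closure M \<T> ==> sqi M f" by (simp add: l2_closure_def)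

lemma cl_approx: "f \<in> l2_closure M \<T> ==> e > 0 ==> \<exists>P\<in>\<T>. l2_norm M (\<lambda>x. f x - P x) < e" by (simp add: l2_closure_def)

lemma cl_basic:
 assumes "f \<in> \<T>"
 shows "f \<in> l2_closure M \<T>" unfolding l2_closure_def
proof (intro CollectI conjI allI impI)
 show "sqi M f" by (rule T_square[OF assms])
 fix e :: real assume "e > 0"
 hence "l2_norm M (\<lambda>x. f x - f x) < e" by (simp add: l2_norm_def)
 thus "\<exists>P\<in>\<T>. l2_norm M (\<lambda>x. f x - P x) < e" using assms by (rule bexI)
qed

lemma cl_add:
 assumes f: "f \<in> l2_closure M \<T>" and g: "g \<in> l2_closure M \<T>"
 shows "(\<lambda>x. f x + g x) \<in> l2_closure M \<T>" unfolding l2_closure_def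
proof (intro CollectI conjI allI impI)
 show "sqi M (\<lambda>x. f x + g x)" by (intro sqi_add cl_square f g)
 fix e :: real assume e: "e > 0"
 hence e2: "e / 2 > 0" by simp
 obtain P where P: "P \<in> \<T>" "l2_norm M (\<lambda>x. f x - P x) < e / 2" using cl_approx[OF f e2] by blast
 obtain Q where Q: "Q \<in> \<T>" "l2_norm M (\<lambda>x. g x - Q x) < e / 2" using cl_approx[OF g e2] by blast
 have "l2_norm M (\<lambda>x. (f x - P x) + (g x - Q x)) \<le> l2_norm M (\<lambda>x. f x - P x) + l2_norm M (\<lambda>x. g x - Q x)"
  by (intro l2_norm_triangle sqi_diff cl_square f g T_square P Q)
 also have "(\<lambda>x. (f x - P x) + (g x - Q x)) = (\<lambda>x. f x + g x - (P x + Q x))" by (simp add: fun_eq_iff)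
 finally show "\<exists>R\<in>\<T>. l2_norm M (\<lambda>x. f x + g x - R x) < e" using P(2) Q(2) by (intro bexI[OF _ T_add[OF P(1) Q(1)]]) simp
qed

lemma cl_cmult:
 assumes f: "f \<in> l2_closure M \<T>"
 shows "(\<lambda>x. c * f x) \<in> l2_closure M \<T>" unfolding l2_closure_def
proof (intro CollectI conjI allI impI)
 show "sqi M (\<lambda>x. c * f x)" by (intro sqi_cmult cl_square f)
 fix e :: real assume e: "e > 0"
 have e': "e / (cmod c + 1) > 0" using e by (simp add: add_nonneg_pos)
 obtain P where P: "P \<in> \<T>" "l2_norm M (\<lambda>x. f x - P x) < e / (cmod c + 1)" using cl_approx[OF f e'] by blast
 have "l2_norm M (\<lambda>x. c * f x - c * P x) = cmod c * l2_norm M (\<lambda>x. f x - P x)" by (simp only: right_diff_distrib[symmetric] l2_norm_cmult)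
 also have "... \<le> cmod c * (e / (cmod c + 1))" using P(2) by (intro mult_left_mono) auto
 also have "... < e"
 proof -
  have "cmod c + 1 > 0" by (simp add: add_nonneg_pos)
  thus ?thesis using e by (simp add: field_simps)
 qed
 finally show "\<exists>R\<in>\<T>. l2_norm M (\<lambda>x. c * f x - R x) < e" by (intro bexI[OF _ T_cmult[OF P(1), of c]])
qed

lemma cl_sum:
 assumes "finite A" "\<And>i. i \<in> A ==> f i \<in> l2_closure M \<T>"
 shows "(\<lambda>x. \<Sum>i\<in>A. f i x) \<in> l2_closure M \<T>" using assms
proof (induction A)
 case empty
 show ?case using cl_basic[OF T_const[of 0]] by simp
next
 case (insert a A)
 have "(\<lambda>x. f a x + (\<Sum>i\<in>A. f i x)) \<in> l2_closure M \<T>" by (rule cl_add) (simp_all add: insert.prems insert.IH)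
 thus ?case using insert.hyps by simp
qed

text \<open>Dominated convergence for the squares. Every enlargement of the class below goes through
  it: continuous functions, closed sets, Borel sets, and finally all square-integrable
  functions.\<close>

lemma cl_limit:
 assumes fs: "\<And>n. F n \<in> l2_closure M \<T>" and f: "f \<in> borel_measurable M"
  and lim: "\<And>x. x \<in> space M ==> (\<lambda>n. F n x) ----> f x"
  and w: "integrable M w" and bd: "\<And>n x. x \<in> space M ==> (cmod (F n x))\<^sup>2 \<le> w x"
 shows "f \<in> l2_closure M \<T>"
proof -
 have Fm [measurable]: "F n \<in> borel_measurable M" for n using square_integrableD(1)[OF cl_square[OF fs]] .
 note [measurable] = f
 have bf: "(cmod (f x))\<^sup>2 \<le> w x" if "x \<in> space M" for x
 proof (rule LIMSEQ_le_const2)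
  show "(\<lambda>n. (cmod (F n x))\<^sup>2) ----> (cmod (f x))\<^sup>2" by (intro tendsto_intros lim that)
 qed (use bd that in blast)
 have wnn: "0 \<le> w x" if "x \<in> space M" for x using bf[OF that] zero_le_power2 order_trans by blast
 have sqf: "sqi M f" unfolding square_integrable_def
 proof
  show "integrable M (\<lambda>x. (cmod (f x))\<^sup>2)" by (rule Bochner_Integration.integrable_bound[OF w]) (use bf wnn in "auto intro!: AE_I2")
 qed (rule f)
 have "(\<lambda>n. LINT x|M. (cmod (f x - F n x))\<^sup>2) ----> (LINT x|M. 0)"
 proof (rule integral_dominated_convergence[where w="\<lambda>x. 4 * w x"])
  show "AE x in M. (\<lambda>n. (cmod (f x - F n x))\<^sup>2) ----> 0"
  proof (rule AE_I2)
   fix x assume "x \<in> space M"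
   hence "(\<lambda>n. (cmod (f x - F n x))\<^sup>2) ----> (cmod (f x - f x))\<^sup>2" by (intro tendsto_intros lim)
   thus "(\<lambda>n. (cmod (f x - F n x))\<^sup>2) ----> 0" by simp
  qed
  show "AE x in M. norm ((cmod (f x - F n x))\<^sup>2) \<le> 4 * w x" for n
  proof (rule AE_I2)
   fix x assume x: "x \<in> space M"
   have "(cmod (f x + (- F n x)))\<^sup>2 \<le> 2 * (cmod (f x))\<^sup>2 + 2 * (cmod (- F n x))\<^sup>2" by (rule norm_add_sq_le)
   thus "norm ((cmod (f x - F n x))\<^sup>2) \<le> 4 * w x" using bf[OF x] bd[OF x, of n] by simp
  qed
 qed (use w in auto)
 hence lim0: "(\<lambda>n. l2_norm M (\<lambda>x. f x - F n x)) ----> sqrt 0" unfolding l2_norm_def by (intro tendsto_real_sqrt) simp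
 show ?thesis unfolding l2_closure_def
 proof (intro CollectI conjI allI impI sqf)
  fix e :: real assume e: "e > 0"
  have "\<forall>\<^sub>F n in sequentially. l2_norm M (\<lambda>x. f x - F n x) < e / 2" by (rule order_tendstoD(2)[OF lim0]) (use e in simp)
  then obtain n where n: "l2_norm M (\<lambda>x. f x - F n x) < e / 2" unfolding eventually_sequentially by blast
  have e2: "e / 2 > 0" using e by simp
  obtain P where P: "P \<in> \<T>" "l2_norm M (\<lambda>x. F n x - P x) < e / 2" using cl_approx[OF fs e2] by blast
  have "l2_norm M (\<lambda>x. f x - P x) \<le> l2_norm M (\<lambda>x. f x - F n x) + l2_norm M (\<lambda>x. F n x - P x)"
   by (intro l2_norm_triangle3 sqf cl_square fs T_square P)
  thus "\<exists>P\<in>\<T>. l2_norm M (\<lambda>x. f x - P x) < e" using n P by (intro bexI[OF _ P(1)]) simp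
 qed
qed

lemma cl_continuous:
 assumes "continuous_on S (f :: 'x => real)" "f \<in> borel_measurable M"
 shows "(\<lambda>x. of_real (f x)) \<in> l2_closure M \<T>"
proof -
 have "\<exists>P\<in>\<T>. \<forall>x\<in>S. cmod (of_real (f x) - P x) < 1 / real (Suc n)" for n by (rule T_uniform[OF assms(1)]) simp
 then obtain P where P: "\<And>n. P n \<in> \<T>" "\<And>n x. x \<in> S ==> cmod (of_real (f x) - P n x) < 1 / real (Suc n)" by metis
 have bdf: "bounded (f ` S)" by (rule compact_imp_bounded[OF compact_continuous_image[OF assms(1) compact_S]])
 then obtain B where B: "\<And>x. x \<in> S ==> \<bar>f x\<bar> \<le> B" unfolding bounded_iff by auto
 show ?thesis
 proof (rule cl_limit[where F=P and w="\<lambda>_. (B + 1)\<^sup>2"])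
  show "P n \<in> l2_closure M \<T>" for n by (rule cl_basic[OF P(1)])
  show "(\<lambda>n. P n x) ----> of_real (f x)" if "x \<in> space M" for x
  proof (rule Lim_null[THEN iffD2], rule Lim_null_comparison)
   show "(\<lambda>n. 1 / real (Suc n)) ----> 0" by (rule LIMSEQ_Suc[OF lim_1_over_n])
   show "\<forall>\<^sub>F n in sequentially. norm (P n x - of_real (f x)) \<le> 1 / real (Suc n)"
    using P(2) that by (intro always_eventually allI less_imp_le) (simp add: space_M norm_minus_commute)
  qed
  show "(cmod (P n x))\<^sup>2 \<le> (B + 1)\<^sup>2" if "x \<in> space M" for n x
  proof (rule power_mono)
   have x: "x \<in> S" using that by (simp add: space_M)
   have "cmod (P n x) \<le> cmod (of_real (f x)) + cmod (P n x - of_real (f x))" by (metis norm_triangle_sub)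
   also have "... \<le> B + 1 / real (Suc n)" using B[OF x] P(2)[OF x, of n] by (simp add: norm_minus_commute)
   also have "1 / real (Suc n) \<le> 1" by simp
   finally show "cmod (P n x) \<le> B + 1" by simp
  qed simp
 qed (use assms(2) in auto)
qed

text \<open>The continuous functions \<open>max 0 (1 - n * infdist x C)\<close> are 1 on
  \<open>C\<close> and converge to 0 at every point outside it.\<close>

lemma cl_indicator_closed:
 assumes "closed C"
 shows "(\<lambda>x. indicator C x) \<in> l2_closure M \<T>"
proof (cases "C = {}")
 case True
 thus ?thesis using cl_sum[of "{}"] by simp
next
 case False
 have borelM: "f \<in> borel_measurable borel ==> f \<in> borel_measurable M" for f :: "'x => 'b :: topological_space"
  using measurable_cong_sets[OF sets_M refl] measurable_restrict_space1 by blast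
 define f where "f n x = max 0 (1 - real n * infdist x C)" for n x
 have cont: "continuous_on A (f n)" for A n unfolding f_def[abs_def] by (intro continuous_intros)
 show ?thesis
 proof (rule cl_limit[where F="\<lambda>n x. of_real (f n x)" and w="\<lambda>_. 1"])
  show "(\<lambda>x. of_real (f n x)) \<in> l2_closure M \<T>" for n by (rule cl_continuous[OF cont borelM[OF borel_measurable_continuous_onI[OF cont]]])
  show "(\<lambda>x. indicator C x :: complex) \<in> borel_measurable M"
   proof (rule borelM)
   have "C \<in> sets borel" using assms by simp
   thus "(\<lambda>x. indicator C x :: complex) \<in> borel_measurable borel" by (rule borel_measurable_indicator)
  qed
  show "(cmod (of_real (f n x)))\<^sup>2 \<le> 1" for n x by (simp add: f_def power_le_one infdist_nonneg)
  show "(\<lambda>n. complex_of_real (f n x)) ----> indicator C x" for x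
  proof (cases "x \<in> C")
   assume "x \<in> C"
   thus ?thesis by (simp add: f_def)
  next
   assume xC: "x \<notin> C"
   have pos: "infdist x C > 0"
   proof -
    have "infdist x C \<noteq> 0" by (simp add: in_closed_iff_infdist_zero[OF assms \<open>C \<noteq> {}\<close>, of x, symmetric] xC)
    thus ?thesis using infdist_nonneg[of x C] by linarith
   qed
   obtain N :: nat where N: "real N > 1 / infdist x C" using reals_Archimedean2 by blast
   have "\<forall>\<^sub>F n in sequentially. complex_of_real (f n x) = 0" unfolding eventually_sequentially
   proof (intro exI allI impI)
    fix n assume "N \<le> n"
    hence "real n \<ge> real N" by simp
    hence "real n * infdist x C \<ge> real N * infdist x C" using pos by simp
    moreover have "real N * infdist x C > 1" using N pos by (simp add: field_simps)
    ultimately show "complex_of_real (f n x) = 0" by (simp add: f_def)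
   qed
   thus ?thesis using xC by (simp add: tendsto_eventually)
  qed
 qed auto
qed

text \<open>Closed sets are stable under intersection and generate the Borel sets, so only
  complements and disjoint countable unions have to be treated.\<close>

lemma cl_indicator:
 assumes "A \<in> sets borel"
 shows "(\<lambda>x. indicator A x) \<in> l2_closure M \<T>"
proof -
 have borelM: "f \<in> borel_measurable borel ==> f \<in> borel_measurable M" for f :: "'x => 'b :: topological_space"
  using measurable_cong_sets[OF sets_M refl] measurable_restrict_space1 by blast
 have A: "A \<in> sigma_sets UNIV (Collect closed)" using assms by (simp add: borel_eq_closed)
 have Pow_UNIV_closed: "Collect (closed :: 'x set => bool) \<subseteq> Pow UNIV" by simp
 have "Int_stable (Collect (closed :: 'x set => bool))" by (auto simp: Int_stable_def)
 thus ?thesis using Pow_UNIV_closed A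
 proof (induction rule: sigma_sets_induct_disjoint)
  case (basic A)
  thus ?case by (simp add: cl_indicator_closed)
 next
  case empty
  thus ?case using cl_sum[of "{}"] by simp
 next
  case (compl A)
  have "(\<lambda>x. indicator UNIV x + (-1) * indicator A x) \<in> l2_closure M \<T>"
   by (intro cl_add cl_cmult compl.IH cl_indicator_closed closed_UNIV)
  also have "(\<lambda>x. indicator UNIV x + (-1) * indicator A x) = (\<lambda>x. indicator (UNIV - A) x :: complex)"
   by (auto simp: indicator_def fun_eq_iff)
  finally show ?case .
 next
  case (union A)
  have mb: "A i \<in> sets borel" for i using union.hyps(2) by (auto simp: borel_eq_closed)
  have eq: "(\<Sum>i<n. indicator (A i) x) = (indicator (\<Union>i<n. A i) x :: complex)" for n x
  proof -
   have "disjoint_family_on A {..<n}" using union.hyps(1) by (rule disjoint_family_on_mono[rotated]) simp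
   thus ?thesis by (simp add: indicator_UN_disjoint)
  qed
  show ?case
  proof (rule cl_limit[where F="\<lambda>n x. (\<Sum>i<n. indicator (A i) x)" and w="\<lambda>_. 1"])
   show "(\<lambda>x. \<Sum>i<n. indicator (A i) x) \<in> l2_closure M \<T>" for n by (rule cl_sum) (simp_all add: union.IH)
   show "(\<lambda>x. indicator (\<Union> (range A)) x :: complex) \<in> borel_measurable M"
   proof (rule borelM)
    have "\<Union> (range A) \<in> sets borel" using mb by auto
    thus "(\<lambda>x. indicator (\<Union> (range A)) x :: complex) \<in> borel_measurable borel" by (rule borel_measurable_indicator)
   qed
   show "(cmod (\<Sum>i<n. indicator (A i) x))\<^sup>2 \<le> 1" for n x unfolding eq by (simp add: indicator_def)
   show "(\<lambda>n. \<Sum>i<n. indicator (A i) x) ----> (indicator (\<Union> (range A)) x :: complex)" for x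
    unfolding eq by (rule LIMSEQ_indicator_UN)
  qed auto
 qed
qed

theorem l2_dense:
 assumes f: "sqi M f"
 shows "f \<in> l2_closure M \<T>"
proof -
 obtain F where F: "\<And>i. simple_function M (F i)" "\<And>x. x \<in> space M ==> (\<lambda>i. F i x) ----> f x"
  "\<And>i x. x \<in> space M ==> dist (F i x) 0 \<le> 2 * dist (f x) 0"
  using borel_measurable_implies_sequence_metric[OF square_integrableD(1)[OF f], of 0] by blast
 show ?thesis
 proof (rule cl_limit[where F=F and w="\<lambda>x. 4 * (cmod (f x))\<^sup>2"])
  show "F i \<in> l2_closure M \<T>" for i
  proof -
   have fin: "finite (F i ` space M)" using F(1) by (simp add: simple_function_def)
   \<comment> \<open>\<open>M\<close> carries the trace sigma-algebra on \<open>S\<close>: a level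
     set is the trace of a Borel set \<open>B y\<close>, and only inside \<open>S\<close> may one be
     exchanged for the other.\<close>
   have ind: "\<exists>B\<in>sets borel. F i -` {y} \<inter> space M = S \<inter> B" for y
   proof -
    have "F i -` {y} \<inter> space M \<in> sets M" by (rule simple_functionD(2)[OF F(1)])
    thus ?thesis unfolding sets_M sets_restrict_space by auto
   qed
   then obtain B where B: "\<And>y. B y \<in> sets borel" "\<And>y. F i -` {y} \<inter> space M = S \<inter> B y" by metis
   have cl: "(\<lambda>x. \<Sum>y\<in>F i ` space M. y * indicator (B y) x) \<in> l2_closure M \<T>" by (intro cl_sum fin cl_cmult cl_indicator B(1))
   have eq: "(\<Sum>y\<in>F i ` space M. y * indicator (B y) x) = F i x" if x: "x \<in> space M" for x
   proof -
    have "indicator (B y) x = (if y = F i x then 1 else (0::complex))" for y using B(2)[of y] x by (auto simp: indicator_def space_M)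
    hence "(\<Sum>y\<in>F i ` space M. y * indicator (B y) x) = (\<Sum>y\<in>F i ` space M. if y = F i x then y else 0)" by (intro sum.cong) auto
    thus ?thesis using fin x by simp
   qed
   have meas: "F i \<in> borel_measurable M" by (rule borel_measurable_simple_function[OF F(1)])
   have l2eq: "l2_norm M (\<lambda>x. F i x - P x) = l2_norm M (\<lambda>x. (\<Sum>y\<in>F i ` space M. y * indicator (B y) x) - P x)" for P
    unfolding l2_norm_def by (intro arg_cong[where f=sqrt] LINT_cong refl) (simp add: eq)
   have "integrable M (\<lambda>x. (cmod (F i x))\<^sup>2) \<longleftrightarrow> integrable M (\<lambda>x. (cmod (\<Sum>y\<in>F i ` space M. y * indicator (B y) x))\<^sup>2)"
    by (intro Bochner_Integration.integrable_cong refl) (simp add: eq)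
   hence "sqi M (F i)" using square_integrableD(2)[OF cl_square[OF cl]] meas unfolding square_integrable_def by blast
   thus ?thesis using cl unfolding l2_closure_def by (simp add: l2eq)
  qed
  show "f \<in> borel_measurable M" by (rule square_integrableD(1)[OF f])
  show "(cmod (F n x))\<^sup>2 \<le> 4 * (cmod (f x))\<^sup>2" if "x \<in> space M" for n x
   using power_mono[OF F(3)[OF that, of n], of 2] by (simp add: power_mult_distrib)
 qed (use F square_integrableD(2)[OF f] in auto)
qed

lemma l2_approx:
 assumes "sqi M f" "e > 0"
 obtains P where "P \<in> \<T>" "l2_norm M (\<lambda>x. f x - P x) < e" using cl_approx[OF l2_dense[OF assms(1)] assms(2)] by blast

end

section \<open>The circle\<close>

definition ee :: "real => complex" where "ee r = cis (2 * pi * r)"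

lemma ee_add: "ee (a + b) = ee a * ee b" by (simp add: ee_def cis_mult algebra_simps)

lemma ee_minus: "ee (- a) = cnj (ee a)" by (simp add: ee_def cis_cnj)

lemma norm_ee [simp]: "cmod (ee a) = 1" by (simp add: ee_def)

lemma ee_0 [simp]: "ee 0 = 1" by (simp add: ee_def)

lemma ee_of_int [simp]: "ee (of_int n) = 1" unfolding ee_def by (rule cis_multiple_2pi) simp

lemma ee_of_nat [simp]: "ee (of_nat n) = 1" using ee_of_int[of "int n"] by simp

lemma ee_power: "ee a ^ n = ee (real n * a)" by (induction n) (simp_all add: distrib_right ee_add)

lemma ee_powi: "ee a powi n = ee (of_int n * a)" unfolding ee_def cis_power_int by (simp only: mult_ac)

lemma ee_sum: "ee (\<Sum>i\<in>A. f i) = (\<Prod>i\<in>A. ee (f i))" by (induction A rule: infinite_finite_induct) (simp_all add: ee_add)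

lemma ee_eq_1_iff: "ee a = 1 \<longleftrightarrow> a \<in> \<int>"
proof
 assume "ee a = 1"
 hence "cos (2 * pi * a) = 1" by (simp add: ee_def complex_eq_iff)
 then obtain n :: int where "2 * pi * a = of_int n * 2 * pi" using cos_one_2pi_int by blast
 hence "a = of_int n" by simp
 thus "a \<in> \<int>" by simp
qed (auto elim: Ints_cases)

lemma ee_eqI: "a - b \<in> \<int> ==> ee a = ee b" using ee_add[of "a - b" b] ee_eq_1_iff[of "a - b"] by simp

lemma ee_Arg: "cmod z = 1 ==> ee (Arg z / (2 * pi)) = z" using rcis_cmod_Arg[of z] by (simp add: ee_def rcis_def)

lemma unit_powi_norm: "cmod z = 1 ==> cmod (z powi n) = 1" by (simp add: norm_power_int)

lemma space_circle [simp]: "space CM = sphere 0 1" by (simp add: circle_measure_def space_restrict_space)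

lemma sets_circle [measurable_cong]: "sets CM = sets (restrict_space borel (sphere 0 1))" by (simp add: circle_measure_def)

lemma cis_measurable: "(\<lambda>t::real. cis (2 * pi * t)) \<in> measurable borel (restrict_space borel (sphere 0 1))"
 by (rule measurable_restrict_space2) (auto intro!: borel_measurable_continuous_onI continuous_intros)

lemma prob_space_uniform01: "prob_space (uniform_measure lborel {0::real..<1})" by (rule prob_space_uniform_measure) auto

lemma prob_space_circle: "prob_space CM" unfolding circle_measure_def
 by (rule prob_space.prob_space_distr[OF prob_space_uniform01]) (use cis_measurable in simp)

text \<open>The shifted unit interval is cut at 1, and the part beyond 1 is moved back by one
  period.\<close>

lemma emeasure_periodic_shift:
 fixes B :: "real set"
 assumes B [measurable]: "B \<in> sets borel" and per: "\<And>t. t + 1 \<in> B \<longleftrightarrow> t \<in> B" and s: "0 \<le> s" "s < 1"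
 shows "emeasure lborel ({0..<1} \<inter> {t. t + s \<in> B}) = emeasure lborel ({0..<1} \<inter> B)"
proof -
 have shift: "emeasure lborel {t. c + t \<in> X} = emeasure lborel X" if "X \<in> sets borel" for c and X :: "real set"
 proof -
  have "emeasure lborel X = emeasure (distr lborel borel ((+) c)) X" by (simp only: lborel_distr_plus)
  also have "... = emeasure lborel ((+) c -` X \<inter> space lborel)" by (rule emeasure_distr) (use that in auto)
  also have "(+) c -` X \<inter> space lborel = {t. c + t \<in> X}" by auto
  finally show ?thesis ..
 qed
 have "emeasure lborel ({0..<1} \<inter> {t. t + s \<in> B}) = emeasure lborel {t. s + t \<in> {s..<1 + s} \<inter> B}"
  by (rule arg_cong[where f="emeasure lborel"]) (auto simp: add.commute)
 also have "... = emeasure lborel ({s..<1 + s} \<inter> B)" by (rule shift) simp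
 also have "{s..<1 + s} \<inter> B = ({s..<1} \<inter> B) \<union> ({1..<1 + s} \<inter> B)" using s by auto
 also have "emeasure lborel ... = emeasure lborel ({s..<1} \<inter> B) + emeasure lborel ({1..<1 + s} \<inter> B)" by (rule plus_emeasure[symmetric]) auto
 also have "emeasure lborel ({1..<1 + s} \<inter> B) = emeasure lborel {t. 1 + t \<in> {1..<1 + s} \<inter> B}" by (rule shift[symmetric]) simp
 also have "{t. 1 + t \<in> {1..<1 + s} \<inter> B} = {0..<s} \<inter> B" using per by (auto simp: add.commute)
 also have "emeasure lborel ({s..<1} \<inter> B) + emeasure lborel ({0..<s} \<inter> B)
   = emeasure lborel (({s..<1} \<inter> B) \<union> ({0..<s} \<inter> B))" by (rule plus_emeasure) auto
 also have "({s..<1} \<inter> B) \<union> ({0..<s} \<inter> B) = {0..<1} \<inter> B" using s by auto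
 finally show ?thesis .
qed

lemma circle_rotation_measurable:
 "w \<in> sphere 0 1 ==> (\<lambda>z. w * z) \<in> measurable CM CM" unfolding measurable_cong_sets[OF sets_circle sets_circle]
 by (rule measurable_restrict_space2)
  (auto simp: space_restrict_space norm_mult intro!: measurable_restrict_space1 borel_measurable_continuous_onI continuous_intros)

lemma circle_rotation:
 assumes w: "w \<in> sphere 0 1"
 shows "distr CM CM (\<lambda>z. w * z) = CM"
proof -
 \<comment> \<open>\<open>frac\<close> moves the normalised principal angle, which may be negative,
   into the parameter interval of \<open>circle_measure\<close>.\<close>
 define s where "s = frac (Arg w / (2 * pi))"
 have s: "0 \<le> s" "s < 1" by (simp_all add: s_def frac_lt_1)
 have ws: "w = cis (2 * pi * s)"
 proof -
  have "ee s = ee (Arg w / (2 * pi))" by (rule ee_eqI) (simp add: s_def frac_def)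
  thus ?thesis using ee_Arg[of w] w by (simp add: ee_def)
 qed
 let ?L = "uniform_measure lborel {0::real..<1}" and ?R = "restrict_space borel (sphere (0::complex) 1)"
 note mc = cis_measurable
 have mL: "(\<lambda>t::real. cis (2 * pi * t)) \<in> measurable ?L ?R" using mc by simp
 have rot: "(\<lambda>z. w * z) \<in> measurable ?R ?R"
  using circle_rotation_measurable[OF w] unfolding measurable_cong_sets[OF sets_circle sets_circle] .
 show ?thesis
 proof (rule measure_eqI)
  show "sets (distr CM CM (\<lambda>z. w * z)) = sets CM" by simp
  fix A assume "A \<in> sets (distr CM CM (\<lambda>z. w * z))"
  hence A: "A \<in> sets CM" and A': "A \<in> sets ?R" by (simp_all add: sets_circle)
  define B where "B = {t::real. cis (2 * pi * t) \<in> A}"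
  have B: "B \<in> sets borel" using measurable_sets[OF mc A'] by (simp add: B_def vimage_def)
  have emb: "emeasure CM C = emeasure lborel ({0..<1} \<inter> {t. cis (2 * pi * t) \<in> C})" if "C \<in> sets ?R" for C
  proof -
   have Cb: "{t::real. cis (2 * pi * t) \<in> C} \<in> sets borel" using measurable_sets[OF mc that] by (simp add: vimage_def)
   have "emeasure CM C = emeasure ?L ((\<lambda>t::real. cis (2 * pi * t)) -` C \<inter> space ?L)"
    unfolding circle_measure_def by (rule emeasure_distr[OF mL that])
   also have "(\<lambda>t::real. cis (2 * pi * t)) -` C \<inter> space ?L = {t. cis (2 * pi * t) \<in> C}" by auto
   also have "emeasure ?L {t. cis (2 * pi * t) \<in> C} = emeasure lborel ({0..<1} \<inter> {t. cis (2 * pi * t) \<in> C})"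
    using Cb by (subst emeasure_uniform_measure) (auto simp: divide_ennreal_def)
   finally show ?thesis .
  qed
  have C: "(\<lambda>z. w * z) -` A \<inter> space CM \<in> sets ?R" using measurable_sets[OF rot A'] by (simp add: space_restrict_space)
  have "emeasure (distr CM CM (\<lambda>z. w * z)) A = emeasure CM ((\<lambda>z. w * z) -` A \<inter> space CM)"
   by (rule emeasure_distr[OF circle_rotation_measurable[OF w] A])
  also have "... = emeasure lborel ({0..<1} \<inter> {t. t + s \<in> B})"
   unfolding emb[OF C] by (rule arg_cong[where f="emeasure lborel"]) (auto simp: B_def ws cis_mult algebra_simps)
  also have "... = emeasure lborel ({0..<1} \<inter> B)"
  proof (rule emeasure_periodic_shift[OF B _ s])
   fix t :: real
   have "cis (2 * pi * (t + 1)) = cis (2 * pi * t)" using ee_add[of t 1] ee_of_int[of 1] by (simp add: ee_def)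
   thus "t + 1 \<in> B \<longleftrightarrow> t \<in> B" by (simp add: B_def)
  qed
  also have "... = emeasure CM A" unfolding emb[OF A'] B_def ..
  finally show "emeasure (distr CM CM (\<lambda>z. w * z)) A = emeasure CM A" .
 qed
qed

lemma circle_powi_measurable [measurable]: "(\<lambda>z. z powi n) \<in> borel_measurable CM"
proof -
 have "(\<lambda>z::complex. z powi n) \<in> borel_measurable borel" unfolding power_int_def by measurable
 thus ?thesis unfolding measurable_cong_sets[OF sets_circle refl] by (rule measurable_restrict_space1)
qed

lemma circle_integral_rotate:
 fixes f :: "complex => 'b :: {banach, second_countable_topology}"
 assumes "w \<in> sphere 0 1" "f \<in> borel_measurable CM"
 shows "(LINT z|CM. f (w * z)) = (LINT z|CM. f z)"
 using integral_distr[OF circle_rotation_measurable[OF assms(1)] assms(2)] circle_rotation[OF assms(1)] by simp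

lemma circle_integral_powi:
 assumes "n \<noteq> 0"
 shows "(LINT z|CM. z powi n) = 0"
proof -
 \<comment> \<open>A rotation whose \<open>n\<close>-th power is -1; it reverses the sign of the
   integral.\<close>
 define w where "w = ee (1 / (2 * of_int n))"
 have w: "w \<in> sphere 0 1" by (simp add: w_def)
 have wn: "w powi n = - 1" using assms by (simp add: w_def ee_powi) (simp add: ee_def)
 have "(LINT z|CM. z powi n) = (LINT z|CM. (w * z) powi n)" by (rule circle_integral_rotate[OF w circle_powi_measurable, symmetric])
 also have "... = - (LINT z|CM. z powi n)" by (simp add: power_int_mult_distrib wn)
 finally show ?thesis by simp
qed

section \<open>The solenoid\<close>

text \<open>The primes in even and in odd position of the increasing enumeration form two infinite
  classes.\<close>

lemma ex_prime_splitting: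
 "\<exists>A::nat set. A \<subseteq> {p. prime p} \<and> infinite A \<and> infinite ({p. prime p} - A)"
proof -
 let ?e = "enumerate {p::nat. prime p}"
 have inf: "infinite {p::nat. prime p}" by (rule primes_infinite)
 have inj: "inj ?e" using bij_enumerate[OF inf] by (simp add: bij_betw_def)
 have rg: "?e n \<in> {p. prime p}" for n by (rule enumerate_in_set[OF inf])
 let ?A = "range (\<lambda>n. ?e (2 * n))" and ?B = "range (\<lambda>n. ?e (2 * n + 1))"
 have "infinite ?A" by (rule range_inj_infinite) (auto simp: inj_on_def dest!: injD[OF inj])
 moreover have "infinite ?B" by (rule range_inj_infinite) (auto simp: inj_on_def dest!: injD[OF inj])
 moreover have "?B \<subseteq> {p. prime p} - ?A"
 proof safe
  fix n m assume "?e (2 * n + 1) = ?e (2 * m)"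
  hence "2 * n + 1 = 2 * m" by (rule injD[OF inj])
  thus False by presburger
 qed (use rg in blast)
 ultimately have "infinite ({p. prime p} - ?A)" using infinite_super by blast
 moreover have "?A \<subseteq> {p. prime p}" using rg by blast
 ultimately show ?thesis using \<open>infinite ?A\<close> by blast
qed

definition split_primes :: "nat set" where
 "split_primes = (SOME A. A \<subseteq> {p. prime p} \<and> infinite A \<and> infinite ({p. prime p} - A))"

lemma split_primes: "split_primes \<subseteq> {p. prime p}" "infinite split_primes" "infinite ({p. prime p} - split_primes)"
 using someI_ex[OF ex_prime_splitting] unfolding split_primes_def[symmetric] by blast+

text \<open>The free coordinate whose root is stored at a prime. Fixing 0 and 1 themselves lets free
  coordinates and primes be compared by the same condition \<open>base p = base i\<close>.\<close>

definition base :: "nat => nat" where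
 "base i = (if i < 2 then i else if i \<in> split_primes then 0 else 1)"

lemma base_less: "base i < 2" and base_base [simp]: "base (base i) = base i"
 and base_0 [simp]: "base 0 = 0" and base_1 [simp]: "base (Suc 0) = Suc 0" by (auto simp: base_def)

lemma infinite_base:
 assumes "i < 2" shows "infinite {p. prime p \<and> base p = i}"
proof -
 have 1: "split_primes \<subseteq> {p. prime p \<and> base p = 0}"
 proof
  fix p assume "p \<in> split_primes"
  moreover from this have "prime p" using split_primes(1) by blast
  ultimately show "p \<in> {p. prime p \<and> base p = 0}" using prime_ge_2_nat[of p] by (simp add: base_def)
 qed
 have 2: "{p. prime p} - split_primes \<subseteq> {p. prime p \<and> base p = 1}"
 proof
  fix p assume "p \<in> {p. prime p} - split_primes"
  thus "p \<in> {p. prime p \<and> base p = 1}" using prime_ge_2_nat[of p] by (simp add: base_def)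
 qed
 from assms consider "i = 0" | "i = 1" by linarith
 thus ?thesis using infinite_super[OF 1 split_primes(2)] infinite_super[OF 2 split_primes(3)] by cases auto
qed

text \<open>The coordinates \<open>u 0\<close> and \<open>u 1\<close> are free points of the circle; the coordinate at a prime \<open>p\<close>
 is a \<open>p\<close>-th root of the coordinate \<open>base p\<close>. The remaining coordinates are dummies.\<close>

definition solen :: "sol set" where
 "solen = {u. (\<forall>i. cmod (u i) = 1) \<and> (\<forall>i\<ge>2. if prime i then u i ^ i = u (base i) else u i = 1)}"

definition solen_group :: "sol monoid" where
 "solen_group = \<lparr>carrier = solen, monoid.mult = (*), one = 1\<rparr>"

definition solen_top :: "sol topology" where
 "solen_top = top_of_set solen"

definition uinv :: "sol => sol" where
 "uinv u = (\<lambda>i. cnj (u i))"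

lemma solen_norm: "u \<in> solen ==> cmod (u i) = 1" by (simp add: solen_def)

lemma solen_nz: "u \<in> solen ==> u i \<noteq> 0" using solen_norm[of u i] by auto

lemma solen_power: "u \<in> solen ==> prime p ==> u p ^ p = u (base p)" using prime_ge_2_nat[of p] by (simp add: solen_def)

lemma solen_dummy: "u \<in> solen ==> i \<ge> 2 ==> \<not> prime i ==> u i = 1" by (simp add: solen_def)

lemma solenI:
 assumes "\<And>i. cmod (u i) = 1" "\<And>p. prime p ==> u p ^ p = u (base p)" "\<And>i. i \<ge> 2 ==> \<not> prime i ==> u i = 1"
 shows "u \<in> solen" using assms by (simp add: solen_def)

lemma solen_mult: "u \<in> solen ==> v \<in> solen ==> u * v \<in> solen"
 by (rule solenI) (simp_all add: norm_mult solen_norm power_mult_distrib solen_power solen_dummy times_fun_def)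

lemma solen_one: "1 \<in> solen" by (rule solenI) (simp_all add: one_fun_def)

lemma solen_uinv: "u \<in> solen ==> uinv u \<in> solen"
 by (rule solenI) (simp_all add: uinv_def solen_norm solen_dummy complex_cnj_power[symmetric] solen_power del: complex_cnj_power)

lemma cnj_mult_unit: "cmod z = 1 ==> cnj z * z = 1" using complex_norm_square[of z] by (simp add: mult.commute)

lemma uinv_mult: "u \<in> solen ==> uinv u * u = 1" by (auto simp: uinv_def fun_eq_iff times_fun_def one_fun_def cnj_mult_unit solen_norm)

lemma solen_cancel: "w \<in> solen ==> uinv w * (w * u) = u" "w \<in> solen ==> w * (uinv w * u) = u"
 using uinv_mult[of w] by (simp_all only: mult.assoc[symmetric] mult.commute[of w "uinv w"] mult_1)

lemma comm_group_solen: "comm_group solen_group"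
proof (rule comm_groupI)
 fix x assume "x \<in> carrier solen_group"
 thus "\<exists>y\<in>carrier solen_group. y \<otimes>\<^bsub>solen_group\<^esub> x = \<one>\<^bsub>solen_group\<^esub>"
  using solen_uinv uinv_mult by (auto simp: solen_group_def)
qed (auto simp: solen_group_def solen_mult solen_one mult.assoc mult.commute)

lemma inv_solen: "u \<in> solen ==> inv\<^bsub>solen_group\<^esub> u = uinv u"
proof -
 assume u: "u \<in> solen"
 interpret comm_group solen_group by (rule comm_group_solen)
 show ?thesis using inv_equality[of "uinv u" u] u solen_uinv[OF u] uinv_mult[OF u] by (simp add: solen_group_def)
qed

lemma continuous_on_coord [continuous_intros]: "continuous_on A (\<lambda>u. u i)" for A :: "('a => 'b::topological_space) set"
 by (rule continuous_on_subset[OF continuous_on_product_coordinates]) simp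

lemma closed_solen: "closed solen"
proof -
 have "solen = (\<Inter>i. {u. cmod (u i) = 1}) \<inter> (\<Inter>i\<in>{i. prime i}. {u. u i ^ i = u (base i)})
   \<inter> (\<Inter>i\<in>{i. i \<ge> 2 \<and> \<not> prime i}. {u. u i = 1})" by (auto simp: solen_def dest: prime_ge_2_nat)
 also have "closed ..." by (intro closed_Int closed_INT ballI closed_Collect_eq continuous_intros)
 finally show ?thesis .
qed

lemma compact_solen: "compact solen"
proof -
 have "compactin (product_topology (\<lambda>i::nat. euclidean) UNIV) (PiE UNIV (\<lambda>i. sphere (0::complex) 1))" by (simp add: compactin_PiE)
 hence "compact (PiE UNIV (\<lambda>i::nat. sphere (0::complex) 1))" unfolding euclidean_product_topology by (simp only: compactin_euclidean_iff)
 moreover have "solen = solen \<inter> PiE UNIV (\<lambda>i::nat. sphere (0::complex) 1)" by (auto simp: solen_norm PiE_def Pi_def)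
 ultimately show ?thesis using closed_Int_compact[OF closed_solen] by metis
qed

lemma topspace_solen [simp]: "topspace solen_top = solen" by (simp add: solen_top_def)

lemma compact_space_solen: "compact_space solen_top" using compact_solen by (simp add: solen_top_def compact_space_subtopology)

lemma Hausdorff_solen: "Hausdorff_space solen_top" unfolding solen_top_def by (simp add: Hausdorff_space_subtopology)

lemma continuous_on_mult_fun: "continuous_on A (\<lambda>(x, y). x * y)" for A :: "(sol \<times> sol) set"
proof -
 have "continuous_on A (\<lambda>x i. fst x i * snd x i)"
 proof (rule continuous_on_coordinatewise_then_product)
  fix i
  have "continuous_on A (\<lambda>x. fst x i)"
   by (rule continuous_on_compose2[OF continuous_on_coord[of UNIV i] continuous_on_fst[OF continuous_on_id]]) simp
  moreover have "continuous_on A (\<lambda>x. snd x i)"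
   by (rule continuous_on_compose2[OF continuous_on_coord[of UNIV i] continuous_on_snd[OF continuous_on_id]]) simp
  ultimately show "continuous_on A (\<lambda>x. fst x i * snd x i)" by (rule continuous_on_mult)
 qed
 thus ?thesis by (simp add: case_prod_unfold times_fun_def)
qed

lemma compact_abelian_solen: "compact_abelian_group solen_group solen_top"
proof -
 interpret comm_group solen_group by (rule comm_group_solen)
 have "continuous_map (prod_topology solen_top solen_top) solen_top (\<lambda>(x, y). x * y)" unfolding solen_top_def prod_topology_subtopology_eu
  using continuous_on_mult_fun solen_mult by (auto simp: continuous_map_in_subtopology image_subset_iff)
 moreover have "continuous_map solen_top solen_top (\<lambda>x. inv\<^bsub>solen_group\<^esub> x)"
 proof (rule continuous_map_eq)
  have "continuous_on solen uinv" unfolding uinv_def by (intro continuous_on_coordinatewise_then_product continuous_intros)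
  thus "continuous_map solen_top solen_top uinv" using solen_uinv unfolding solen_top_def by (auto simp: continuous_map_in_subtopology image_subset_iff)
 qed (simp add: inv_solen)
 ultimately show ?thesis unfolding compact_abelian_group_def topological_group_def
  using comm_group_axioms is_group compact_space_solen Hausdorff_solen by (simp add: solen_group_def)
qed

section \<open>Roots, the projection onto the two-torus, and finite dimension\<close>

definition proot :: "nat => complex => complex" where
 "proot p z = ee (Arg z / (2 * pi) / real p)"

lemma proot_power: "cmod z = 1 ==> p > 0 ==> proot p z ^ p = z" by (simp add: proot_def ee_power ee_Arg)

lemma proot_norm [simp]: "cmod (proot p z) = 1" by (simp add: proot_def)

lemma solen_extend:
 assumes "cmod a = 1" "cmod b = 1"
 obtains u where "u \<in> solen" "u 0 = a" "u 1 = b"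
proof -
 define c where "c i = (if i = 0 then a else b)" for i :: nat
 define u where "u i = (if i < 2 then c i else if prime i then proot i (c (base i)) else 1)" for i
 have c: "cmod (c i) = 1" for i using assms by (simp add: c_def)
 have "u \<in> solen"
 proof (rule solenI)
  show "cmod (u i) = 1" for i using c by (simp add: u_def)
  show "u p ^ p = u (base p)" if "prime p" for p using prime_ge_2_nat[OF that] base_less[of p] that by (simp add: u_def proot_power c)
 qed (simp add: u_def)
 thus thesis by (rule that) (simp_all add: u_def c_def)
qed

text \<open>As a group this is the product over all primes \<open>p\<close> of the groups of
  \<open>p\<close>-th roots of unity. It is the totally disconnected subgroup with quotient the
  two-torus.\<close>

definition kern :: "sol set" where
 "kern = {u \<in> solen. u 0 = 1 \<and> u 1 = 1}"

abbreviation "torus2 \<equiv> product_group {..<2::nat} (\<lambda>_. circle_group)"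
abbreviation "torus2_top \<equiv> product_topology (\<lambda>_. circle_topology) {..<2::nat}"

definition tproj :: "sol => nat => complex" where
 "tproj u = (\<lambda>i\<in>{..<2}. u i)"

lemma group_circle: "group circle_group"
proof (rule groupI)
 fix x assume x: "x \<in> carrier circle_group"
 show "\<exists>y\<in>carrier circle_group. y \<otimes>\<^bsub>circle_group\<^esub> x = \<one>\<^bsub>circle_group\<^esub>"
  by (rule bexI[of _ "cnj x"]) (use x in "simp_all add: circle_group_def cnj_mult_unit")
qed (auto simp: circle_group_def norm_mult)

lemma tproj_hom: "group_hom solen_group torus2 tproj"
proof -
 have G: "group solen_group" using comm_group_solen by (rule comm_group.axioms(2))
 have T: "group torus2" by (simp add: group_circle)
 have "tproj \<in> hom solen_group torus2"
 proof (rule homI)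
  fix x y assume "x \<in> carrier solen_group"
  thus "tproj x \<in> carrier torus2" by (simp add: tproj_def solen_group_def circle_group_def solen_norm)
  show "tproj (x \<otimes>\<^bsub>solen_group\<^esub> y) = tproj x \<otimes>\<^bsub>torus2\<^esub> tproj y"
   by (simp add: tproj_def solen_group_def circle_group_def product_group_def fun_eq_iff restrict_def)
 qed
 thus ?thesis using G T by (simp add: group_hom_def group_hom_axioms_def)
qed

lemma tproj_image: "tproj ` carrier solen_group = carrier torus2"
proof
 show "tproj ` carrier solen_group \<subseteq> carrier torus2" using tproj_hom by (meson group_hom.hom_closed image_subsetI)
 show "carrier torus2 \<subseteq> tproj ` carrier solen_group"
 proof
  fix x assume "x \<in> carrier torus2"
  hence x: "x \<in> extensional {..<2}" "cmod (x 0) = 1" "cmod (x 1) = 1" by (auto simp: circle_group_def PiE_def Pi_def)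
  obtain u where u: "u \<in> solen" "u 0 = x 0" "u 1 = x 1" using solen_extend[OF x(2,3)] .
  have "tproj u = x"
  proof
   fix i
   show "tproj u i = x i" using x(1) u(2,3) by (cases "i < 2") (auto simp: tproj_def extensional_def less_2_cases_iff)
  qed
  thus "x \<in> tproj ` carrier solen_group" using u(1) by (auto simp: solen_group_def)
 qed
qed

lemma tproj_kernel: "kernel solen_group torus2 tproj = kern"
 by (auto simp: kernel_def kern_def tproj_def solen_group_def circle_group_def product_group_def fun_eq_iff restrict_def less_2_cases_iff)

lemma tproj_continuous: "continuous_map solen_top torus2_top tproj" unfolding continuous_map_componentwise
proof (intro conjI ballI)
 show "tproj ` topspace solen_top \<subseteq> extensional {..<2}" by (auto simp: tproj_def)
 fix k assume k: "k \<in> {..<2::nat}"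
 have "continuous_map solen_top circle_topology (\<lambda>u. u k)" unfolding solen_top_def circle_topology_def
  using solen_norm by (auto simp: continuous_map_in_subtopology image_subset_iff intro!: continuous_intros)
 thus "continuous_map solen_top circle_topology (\<lambda>x. tproj x k)" using k by (simp add: tproj_def)
qed

lemma torus2_Hausdorff: "Hausdorff_space torus2_top" by (simp add: Hausdorff_space_product_topology circle_topology_def Hausdorff_space_subtopology)

text \<open>On \<open>kern\<close> each coordinate takes finitely many values, so a connected subset
  has constant coordinates.\<close>

lemma totally_disconnected_kern: "totally_disconnected_in solen_top kern" unfolding totally_disconnected_in_def
proof (intro allI impI ballI)
 fix C x y assume C: "C \<subseteq> kern" "connectedin solen_top C" "x \<in> C" "y \<in> C"
 have conn: "connected C" using C(2) unfolding solen_top_def connectedin_subtopology by simp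
 show "x = y"
 proof
  fix i
  show "x i = y i"
  proof (cases "i < 2")
   case True
   hence "i = 0 \<or> i = 1" by linarith
   moreover have "x \<in> kern" "y \<in> kern" using C by blast+
   ultimately show ?thesis by (auto simp: kern_def)
  next
   case i: False
   show ?thesis
   proof (cases "prime i")
    case True
    have "(\<lambda>u. u i) ` C \<subseteq> {z. z ^ i = 1}"
    proof safe
     fix u assume "u \<in> C"
     hence u: "u \<in> kern" using C(1) by blast
     have "base i = 0 \<or> base i = 1" using base_less[of i] by linarith
     hence "u \<in> solen" "u (base i) = 1" using u by (auto simp: kern_def)
     thus "u i ^ i = 1" using solen_power[OF _ True] by simp
    qed
    moreover have "finite {z::complex. z ^ i = 1}" by (rule finite_roots_unity) (use i in simp)
    ultimately have fin: "finite ((\<lambda>u. u i) ` C)" by (rule finite_subset)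
    have "connected ((\<lambda>u. u i) ` C)" by (rule connected_continuous_image[OF continuous_on_coord conn])
    hence "(\<lambda>u. u i) ` C = {} \<or> (\<exists>a. (\<lambda>u. u i) ` C = {a})" using fin connected_finite_iff_sing by blast
    then obtain a where "(\<lambda>u. u i) ` C = {a}" using C(3) by auto
    moreover have "x i \<in> (\<lambda>u. u i) ` C" "y i \<in> (\<lambda>u. u i) ` C"
     using imageI[OF C(3), of "\<lambda>u. u i"] imageI[OF C(4), of "\<lambda>u. u i"] by simp_all
    ultimately show ?thesis by simp
   next
    case False
    thus ?thesis using C i by (auto simp: kern_def solen_dummy subset_iff)
   qed
  qed
 qed
qed

text \<open>The algebraic isomorphism induced by \<open>tproj\<close> is a continuous bijection from
  a compact space to a Hausdorff space, hence a homeomorphism.\<close>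

lemma finite_dimensional_solen: "finite_dimensional solen_group solen_top" unfolding finite_dimensional_def
proof (intro exI conjI)
 interpret G: comm_group solen_group by (rule comm_group_solen)
 interpret h: group_hom solen_group torus2 tproj by (rule tproj_hom)
 have carr: "carrier solen_group = solen" by (simp add: solen_group_def)
 show sub: "subgroup kern solen_group" using h.subgroup_kernel by (simp add: tproj_kernel)
 have "kern = solen \<inter> ({u. u 0 = 1} \<inter> {u. u 1 = 1})" by (auto simp: kern_def)
 moreover have "closed ({u::nat => complex. u 0 = 1} \<inter> {u. u 1 = 1})" by (intro closed_Int closed_Collect_eq continuous_intros)
 ultimately have "compact kern" using compact_Int_closed[OF compact_solen] by metis
 thus "compactin solen_top kern" unfolding solen_top_def compactin_subtopology by (auto simp: kern_def)
 show "totally_disconnected_in solen_top kern" by (rule totally_disconnected_kern)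
 let ?Q = "coset_topology solen_group solen_top kern"
 define f where "f X = the_elem (tproj ` X)" for X
 have open_iff: "openin ?Q \<U> \<longleftrightarrow> \<U> \<subseteq> rcosets\<^bsub>solen_group\<^esub> kern \<and> openin solen_top (\<Union>\<U>)" for \<U>
  by (rule openin_coset_topology[OF G.is_group sub])
 have carQ: "carrier (solen_group Mod kern) = rcosets\<^bsub>solen_group\<^esub> kern" by (simp add: FactGroup_def)
 have iso: "f \<in> iso (solen_group Mod kern) torus2" using h.FactGroup_iso_set[OF tproj_image] unfolding tproj_kernel f_def[abs_def] .
 have un: "\<Union>(rcosets\<^bsub>solen_group\<^esub> kern) = solen" using G.rcosets_part_G[OF sub] by (simp add: carr)
 have topQ: "topspace ?Q = rcosets\<^bsub>solen_group\<^esub> kern"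
 proof
  show "topspace ?Q \<subseteq> rcosets\<^bsub>solen_group\<^esub> kern" using openin_topspace[of ?Q] open_iff by blast
  have "openin solen_top solen" using openin_topspace[of solen_top] by simp
  hence "openin ?Q (rcosets\<^bsub>solen_group\<^esub> kern)" unfolding open_iff un by simp
  thus "rcosets\<^bsub>solen_group\<^esub> kern \<subseteq> topspace ?Q" by (rule openin_subset)
 qed
 define pj where "pj u = kern #>\<^bsub>solen_group\<^esub> u" for u
 have pi_in: "pj u \<in> rcosets\<^bsub>solen_group\<^esub> kern" if "u \<in> solen" for u
  unfolding pj_def using G.rcosetsI[OF subgroup.subset[OF sub]] that by (simp add: carr)
 have self: "u \<in> pj u" if "u \<in> solen" for u unfolding pj_def using G.rcos_self[OF _ sub] that by (simp add: carr)
 have pi_eq: "pj u = X" if "X \<in> rcosets\<^bsub>solen_group\<^esub> kern" "u \<in> X" for u X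
 proof -
  have uS: "u \<in> solen" using that un by blast
  show ?thesis using G.rcos_disjoint[OF sub] pi_in[OF uS] self[OF uS] that unfolding pairwise_def disjnt_def by blast
 qed
 have f_pi: "f X = tproj u" if "X \<in> rcosets\<^bsub>solen_group\<^esub> kern" "u \<in> X" for X u
 proof -
  have "tproj v = tproj u" if v: "v \<in> X" for v
  proof -
   have uS: "u \<in> solen" using that \<open>X \<in> _\<close> \<open>u \<in> X\<close> un by blast
   have "v \<in> kern #>\<^bsub>solen_group\<^esub> u" using pi_eq[OF \<open>X \<in> _\<close> \<open>u \<in> X\<close>] v by (simp add: pj_def)
   then obtain k where k: "k \<in> kern" "v = k * u" by (auto simp: r_coset_def solen_group_def)
   show ?thesis using k by (auto simp: tproj_def kern_def fun_eq_iff restrict_def less_2_cases_iff)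
  qed
  hence "tproj ` X = {tproj u}" using \<open>u \<in> X\<close> by blast
  thus ?thesis by (simp add: f_def)
 qed
 have ne: "\<exists>u. u \<in> X" if "X \<in> rcosets\<^bsub>solen_group\<^esub> kern" for X
  using that self unfolding RCOSETS_def pj_def by (auto simp: carr)
 have pi_vim: "{u \<in> solen. pj u \<in> \<U>} = \<Union>\<U>" if "\<U> \<subseteq> rcosets\<^bsub>solen_group\<^esub> kern" for \<U>
 proof
  show "{u \<in> solen. pj u \<in> \<U>} \<subseteq> \<Union>\<U>" using self by blast
  show "\<Union>\<U> \<subseteq> {u \<in> solen. pj u \<in> \<U>}"
  proof safe
   fix u X assume "X \<in> \<U>" "u \<in> X"
   hence X: "X \<in> rcosets\<^bsub>solen_group\<^esub> kern" using that by blast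
   show "u \<in> solen" using X \<open>u \<in> X\<close> un by blast
   show "pj u \<in> \<U>" using pi_eq[OF X \<open>u \<in> X\<close>] \<open>X \<in> \<U>\<close> by simp
  qed
 qed
 have pi_cont: "continuous_map solen_top ?Q pj" unfolding continuous_map
 proof (intro conjI allI impI)
  show "pj ` topspace solen_top \<subseteq> topspace ?Q" using pi_in by (auto simp: topQ)
  fix \<U> assume "openin ?Q \<U>"
  thus "openin solen_top {x \<in> topspace solen_top. pj x \<in> \<U>}" unfolding open_iff using pi_vim by simp
 qed
 have pi_surj: "pj ` solen = topspace ?Q"
 proof
  show "pj ` solen \<subseteq> topspace ?Q" using pi_in by (auto simp: topQ)
  show "topspace ?Q \<subseteq> pj ` solen"
  proof
   fix X assume "X \<in> topspace ?Q"
   hence X: "X \<in> rcosets\<^bsub>solen_group\<^esub> kern" by (simp add: topQ)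
   obtain u where u: "u \<in> X" using ne[OF X] by blast
   hence "u \<in> solen" using X un by blast
   thus "X \<in> pj ` solen" using pi_eq[OF X u] by blast
  qed
 qed
 have compQ: "compact_space ?Q" using image_compactin[OF _ pi_cont, of solen] compact_space_solen unfolding compact_space_def pi_surj[symmetric] by simp
 have f_cont: "continuous_map ?Q torus2_top f" unfolding continuous_map
 proof (intro conjI allI impI)
  have timg: "tproj ` solen \<subseteq> topspace torus2_top" using continuous_map_image_subset_topspace[OF tproj_continuous] by simp
  show "f ` topspace ?Q \<subseteq> topspace torus2_top"
  proof safe
   fix X assume "X \<in> topspace ?Q"
   hence X: "X \<in> rcosets\<^bsub>solen_group\<^esub> kern" by (simp add: topQ)
   obtain u where u: "u \<in> X" using ne[OF X] by blast
   hence "u \<in> solen" using X un by blast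
   thus "f X \<in> topspace torus2_top" using timg f_pi[OF X u] by auto
  qed
  fix V assume V: "openin torus2_top V"
  have "\<Union>{X \<in> rcosets\<^bsub>solen_group\<^esub> kern. f X \<in> V} = {u \<in> topspace solen_top. tproj u \<in> V}"
  proof safe
   fix u X assume X: "X \<in> rcosets\<^bsub>solen_group\<^esub> kern" "u \<in> X" "f X \<in> V"
   thus "u \<in> topspace solen_top" using un by auto
   show "tproj u \<in> V" using f_pi[OF X(1,2)] X(3) by simp
  next
   fix u assume u: "u \<in> topspace solen_top" "tproj u \<in> V"
   hence uS: "u \<in> solen" by simp
   show "u \<in> \<Union>{X \<in> rcosets\<^bsub>solen_group\<^esub> kern. f X \<in> V}"
    using f_pi[OF pi_in[OF uS] self[OF uS]] u pi_in[OF uS] self[OF uS] by auto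
  qed
  moreover have "openin solen_top {u \<in> topspace solen_top. tproj u \<in> V}" using openin_continuous_map_preimage[OF tproj_continuous V] .
  ultimately show "openin ?Q {x \<in> topspace ?Q. f x \<in> V}" unfolding open_iff topQ by auto
 qed
 have bij: "bij_betw f (rcosets\<^bsub>solen_group\<^esub> kern) (carrier torus2)" using iso by (simp add: iso_def carQ)
 have "homeomorphic_map ?Q torus2_top f"
 proof (rule continuous_imp_homeomorphic_map[OF f_cont compQ torus2_Hausdorff])
  show "f ` topspace ?Q = topspace torus2_top" using bij by (simp add: bij_betw_def topQ circle_group_def circle_topology_def)
  show "inj_on f (topspace ?Q)" using bij by (simp add: bij_betw_def topQ)
 qed
 thus "topological_group_isomorphic (solen_group Mod kern) ?Q torus2 torus2_top" unfolding topological_group_isomorphic_def using iso by blast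
qed

section \<open>Failure of local connectedness\<close>

definition prime_unit :: "nat => nat => complex" where
 "prime_unit p = (\<lambda>i. if i = p then ee (1 / real p) else 1)"

text \<open>These elements differ from 1 in one coordinate only and tend to 1 as \<open>p\<close>
  grows. They refute the Lie property here and detect cancellation in the mixing estimate
  later.\<close>

lemma prime_unit_kern:
 assumes "prime p" shows "prime_unit p \<in> kern"
proof -
 have p2: "p \<ge> 2" by (rule prime_ge_2_nat[OF assms])
 have "prime_unit p \<in> solen"
 proof (rule solenI)
  show "cmod (prime_unit p i) = 1" for i by (simp add: prime_unit_def)
  show "prime_unit p q ^ q = prime_unit p (base q)" if "prime q" for q
  proof -
   have "prime_unit p (base q) = 1" using base_less[of q] p2 by (simp add: prime_unit_def)
   moreover have "prime_unit p q ^ q = 1" using p2 ee_of_nat[of 1] by (auto simp: prime_unit_def ee_power)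
   ultimately show ?thesis by simp
  qed
  show "prime_unit p i = 1" if "\<not> prime i" for i using that assms by (auto simp: prime_unit_def)
 qed
 thus ?thesis using p2 by (simp add: kern_def prime_unit_def)
qed

lemma ee_inverse_prime_neq_1: "p \<ge> 2 ==> ee (1 / real p) \<noteq> 1"
proof
 assume p: "p \<ge> 2" and "ee (1 / real p) = 1"
 then obtain k :: int where "1 / real p = of_int k" using ee_eq_1_iff[of "1 / real p"] by (auto elim: Ints_cases)
 hence "real_of_int (k * int p) = 1" using p by (simp add: field_simps)
 hence "k * int p = 1" by linarith
 hence "int p dvd 1" by (metis dvd_triv_right)
 thus False using p by simp
qed

text \<open>A chart would give a connected neighbourhood \<open>V\<close> of 1 as small as desired.
  It contains some \<open>prime_unit p\<close>, yet the ratio of \<open>u p\<close> to the principal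
  \<open>p\<close>-th root of \<open>u (base p)\<close> is continuous on \<open>V\<close> with
  finitely many values and separates \<open>prime_unit p\<close> from 1.\<close>

lemma not_lie_solen: "\<not> lie_group solen_group solen_top"
proof
 assume "lie_group solen_group solen_top"
 then obtain n \<A> where atl: "smooth_atlas n solen_top \<A>" unfolding lie_group_def by blast
 have "1 \<in> \<Union>(fst ` \<A>)" using atl solen_one by (simp add: smooth_atlas_def)
 then obtain D ph where D: "(D, ph) \<in> \<A>" "1 \<in> D" by auto
 hence "chart n solen_top (D, ph)" using atl by (auto simp: smooth_atlas_def)
 hence oD: "openin solen_top D" and oE: "openin (Euclidean_space n) (ph ` D)"
  and hom: "homeomorphic_map (subtopology solen_top D) (subtopology (Euclidean_space n) (ph ` D)) ph" by (auto simp: chart_def)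
 have "locally_connected_space (subtopology (Euclidean_space n) (ph ` D))"
  by (rule locally_connected_space_open_subset[OF locally_connected_Euclidean_space oE])
 hence lc: "locally_connected_space (subtopology solen_top D)"
  using homeomorphic_locally_connected_space[OF homeomorphic_map_imp_homeomorphic_space[OF hom]] by simp
 \<comment> \<open>The right half planes keep both free coordinates off the cut of the
   logarithm.\<close>
 define W where "W = D \<inter> {u. 0 < Re (u 0) \<and> 0 < Re (u 1)}"
 have "open {u::nat => complex. 0 < Re (u 0) \<and> 0 < Re (u 1)}" by (intro open_Collect_conj open_Collect_less continuous_intros)
 hence oW: "openin (subtopology solen_top D) W" unfolding W_def solen_top_def subtopology_subtopology
  using oD openin_subset[OF oD] by (auto simp: openin_subtopology solen_top_def)
 have "1 \<in> W" using D by (simp add: W_def one_fun_def)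
 then obtain V where V: "openin (subtopology solen_top D) V" "connectedin (subtopology solen_top D) V" "1 \<in> V" "V \<subseteq> W"
  using lc oW unfolding locally_connected_space by blast
 have "openin solen_top V" using V(1) oD by (simp add: openin_open_subtopology)
 then obtain V' where V': "open V'" "V = solen \<inter> V'" by (auto simp: solen_top_def openin_subtopology)
 have "openin (product_topology (\<lambda>i::nat. euclidean) UNIV) V'" using V'(1) by (simp add: euclidean_product_topology)
 moreover have "1 \<in> V'" using V(3) V'(2) by blast
 ultimately have "\<exists>X. 1 \<in> PiE UNIV X \<and> (\<forall>i. openin euclidean (X i)) \<and>
   finite {i. X i \<noteq> topspace (euclidean :: complex topology)} \<and> PiE UNIV X \<subseteq> V'" by (rule product_topology_open_contains_basis)
 then obtain X where X: "1 \<in> PiE UNIV X" "finite {i. X i \<noteq> (UNIV :: complex set)}" "PiE UNIV X \<subseteq> V'" by auto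
 \<comment> \<open>A basic open set of the product restricts finitely many coordinates, so some
   prime coordinate is left free.\<close>
 have "infinite ({p. prime p} - {i. X i \<noteq> UNIV})" using X(2) primes_infinite by (rule Diff_infinite_finite)
 hence "{p. prime p} - {i. X i \<noteq> UNIV} \<noteq> {}" by (rule infinite_imp_nonempty)
 then obtain p where p: "prime p" "X p = UNIV" by blast
 have p2: "p \<ge> 2" by (rule prime_ge_2_nat[OF p(1)])
 have "prime_unit p \<in> PiE UNIV X" using X(1) p(2) by (auto simp: prime_unit_def PiE_def Pi_def one_fun_def)
 hence puV: "prime_unit p \<in> V" using X(3) V'(2) prime_unit_kern[OF p(1)] by (auto simp: kern_def)
 have connV: "connected V" using V(2) by (simp add: connectedin_subtopology solen_top_def)
 define q where "q u = u p / exp (Ln (u (base p)) / of_nat p)" for u :: "nat => complex"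
 have "base p = 0 \<or> base p = 1" using base_less[of p] by linarith
 hence re: "0 < Re (u (base p))" if "u \<in> V" for u using that V(4) by (auto simp: W_def)
 have contq: "continuous_on V q" unfolding q_def
 proof (intro continuous_intros)
  show "u (base p) \<notin> \<real>\<^sub>\<le>\<^sub>0" if "u \<in> V" for u using re[OF that] by (auto simp: complex_nonpos_Reals_iff)
 qed (use p2 in auto)
 have qp: "q u ^ p = 1" if "u \<in> V" for u
 proof -
  have nz: "u (base p) \<noteq> 0" using re[OF that] by auto
  have "exp (Ln (u (base p)) / of_nat p) ^ p = u (base p)" using p2 nz by (simp add: exp_of_nat_mult[symmetric])
  moreover have "u \<in> solen" using that V'(2) by blast
  ultimately show ?thesis using nz solen_power[OF _ p(1), of u] by (simp add: q_def power_divide)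
 qed
 have "finite {z::complex. z ^ p = 1}" by (rule finite_roots_unity) (use p2 in simp)
 hence "finite (q ` V)" by (rule finite_subset[rotated]) (use qp in auto)
 moreover have "connected (q ` V)" by (rule connected_continuous_image[OF contq connV])
 ultimately have "q ` V = {} \<or> (\<exists>a. q ` V = {a})" using connected_finite_iff_sing by blast
 then obtain a where a: "q ` V = {a}" using V(3) by auto
 have "q (prime_unit p) = q 1" using imageI[OF puV, of q] imageI[OF V(3), of q] unfolding a by simp
 moreover have "q 1 = 1" by (simp add: q_def one_fun_def)
 moreover have "q (prime_unit p) = ee (1 / real p)" using base_less[of p] p2 by (simp add: q_def prime_unit_def)
 ultimately show False using ee_inverse_prime_neq_1[OF p2] by simp
qed

theorem solenoid_solen: "solenoid solen_group solen_top" unfolding solenoid_def using compact_abelian_solen finite_dimensional_solen not_lie_solen by blast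

section \<open>Haar measure on the solenoid\<close>

lemma measurable_Arg [measurable]: "Arg \<in> borel_measurable borel"
proof -
 have c: "continuous_on (- \<real>\<^sub>\<le>\<^sub>0) Arg" by (auto intro!: continuous_at_imp_continuous_on continuous_at_Arg)
 have m: "- \<real>\<^sub>\<le>\<^sub>0 \<in> sets (borel :: complex measure)" by (intro borel_open) (simp add: open_Compl)
 have n: "{z::complex. Re z < 0 \<and> Im z = 0} \<in> sets borel" by measurable
 \<comment> \<open>On the cut the value is \<open>pi\<close>, except at the origin, where
   \<open>Arg\<close> is 0 by convention; both summands vanish there.\<close>
 have eq: "Arg z = indicator (- \<real>\<^sub>\<le>\<^sub>0) z *\<^sub>R Arg z + pi * indicator {z. Re z < 0 \<and> Im z = 0} z" for z
 proof (cases "z \<in> \<real>\<^sub>\<le>\<^sub>0")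
  case True
  hence z: "Im z = 0" "Re z \<le> 0" by (auto simp: complex_nonpos_Reals_iff)
  show ?thesis
  proof (cases "Re z < 0")
   case True
   thus ?thesis using z \<open>z \<in> \<real>\<^sub>\<le>\<^sub>0\<close> Arg_eq_pi[of z] by simp
  next
   case False
   hence "z = 0" using z by (simp add: complex_eq_iff)
   thus ?thesis by (simp add: Arg_zero)
  qed
 next
  case False
  hence "\<not> (Re z < 0 \<and> Im z = 0)" by (auto simp: complex_nonpos_Reals_iff)
  thus ?thesis using False by simp
 qed
 have "(\<lambda>z. indicator (- \<real>\<^sub>\<le>\<^sub>0) z *\<^sub>R Arg z + pi * indicator {z. Re z < 0 \<and> Im z = 0} z) \<in> borel_measurable borel"
  by (intro borel_measurable_add borel_measurable_continuous_on_indicator[OF m c] borel_measurable_times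
    borel_measurable_const borel_measurable_indicator n)
 thus ?thesis using eq by (simp add: fun_eq_iff[symmetric] flip: eq)
qed

lemma measurable_ee [measurable]: "ee \<in> borel_measurable borel" unfolding ee_def[abs_def] by (intro borel_measurable_continuous_onI continuous_intros)

lemma measurable_proot [measurable]: "proot p \<in> borel_measurable borel" unfolding proot_def[abs_def] by measurable

lemma measurable_powi [measurable]: "(\<lambda>z::complex. z powi n) \<in> borel_measurable borel" unfolding power_int_def by measurable

lemma sets_borel_of:
 assumes S: "S \<in> sets borel"
 shows "sets (borel_of (top_of_set S)) = sets (restrict_space borel S)"
proof -
 have "S \<in> sigma_sets UNIV {A. open A}" using S by (simp add: borel_def)
 from sigma_sets_Int[OF this subset_UNIV]
 have "(\<inter>) S ` sigma_sets UNIV {A. open A} = sigma_sets S ((\<inter>) S ` {A. open A})" .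
 moreover have "(\<inter>) S ` {A. open A} = {A. openin (top_of_set S) A}" by (auto simp: openin_open)
 moreover have "sets (restrict_space borel S) = (\<inter>) S ` sigma_sets UNIV {A. open A}" by (simp add: sets_restrict_space borel_def)
 moreover have "{A. openin (top_of_set S) A} \<subseteq> Pow S" by (auto simp: openin_open)
 ultimately show ?thesis by (simp add: borel_of_def)
qed

section \<open>Haar measure as the image of a product of circles\<close>

definition hprod :: "sol measure" where "hprod = PiM UNIV (\<lambda>_. CM)"

interpretation hprod: product_prob_space "\<lambda>_::nat. CM" UNIV by (intro product_prob_spaceI prob_space_circle)

lemma prob_space_hprod: "prob_space hprod" unfolding hprod_def by (rule prob_space_PiM) (rule prob_space_circle)

lemma space_hprod: "space hprod = {v. \<forall>i. cmod (v i) = 1}" by (auto simp: hprod_def space_PiM PiE_def Pi_def)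

lemma hprod_coord [measurable]: "(\<lambda>v. v i) \<in> borel_measurable hprod"
proof -
 have "(\<lambda>v. v i) \<in> measurable hprod CM" unfolding hprod_def by (rule measurable_component_singleton) simp
 hence "(\<lambda>v. v i) \<in> measurable hprod (restrict_space borel (sphere 0 1))" by (simp cong: measurable_cong_sets add: sets_circle)
 thus ?thesis by (simp add: measurable_restrict_space2_iff)
qed

lemma distr_hprod_mult:
 assumes h: "\<And>i. cmod (h i) = 1"
 shows "distr hprod hprod (\<lambda>v. h * v) = hprod"
proof -
 have meas: "(\<lambda>v. h * v) \<in> measurable hprod hprod" unfolding hprod_def
 proof (rule measurable_PiM_single')
  fix i :: nat
  have "(\<lambda>v. v i) \<in> measurable (PiM UNIV (\<lambda>_::nat. CM)) CM" by (rule measurable_component_singleton) simp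
  moreover have "(\<lambda>z. h i * z) \<in> measurable CM CM" by (rule circle_rotation_measurable) (simp add: h)
  ultimately show "(\<lambda>v. (h * v) i) \<in> measurable (PiM UNIV (\<lambda>_::nat. CM)) CM" unfolding times_fun_def by (rule m_comp)
 next
  show "(\<lambda>v. h * v) \<in> space (PiM UNIV (\<lambda>_::nat. CM)) \<rightarrow> (UNIV \<rightarrow>\<^sub>E space CM)"
   using h by (auto simp: space_PiM norm_mult PiE_def Pi_def)
 qed
 have "distr hprod hprod (\<lambda>v. h * v) = PiM UNIV (\<lambda>_. CM)"
 proof (rule hprod.PiM_eq)
  show "sets (distr hprod hprod (\<lambda>v. h * v)) = sets (PiM UNIV (\<lambda>_. CM))" by (simp add: hprod_def)
  fix J and F :: "nat => complex set"
  assume J: "finite J" "J \<subseteq> UNIV" and F: "\<And>j. j \<in> J ==> F j \<in> sets CM"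
  define F' where "F' j = (\<lambda>z. h j * z) -` F j \<inter> space CM" for j
  have rm: "(\<lambda>z. h j * z) \<in> measurable CM CM" for j by (rule circle_rotation_measurable) (simp add: h)
  have F': "F' j \<in> sets CM" if "j \<in> J" for j unfolding F'_def by (rule measurable_sets[OF rm F[OF that]])
  have em: "emeasure CM (F' j) = emeasure CM (F j)" if "j \<in> J" for j
  proof -
   have "emeasure (distr CM CM (\<lambda>z. h j * z)) (F j) = emeasure CM (F' j)" unfolding F'_def by (rule emeasure_distr[OF rm F[OF that]])
   thus ?thesis using circle_rotation[of "h j"] h by simp
  qed
  let ?E = "prod_emb UNIV (\<lambda>_. CM) J (PiE J F)"
  have E: "?E \<in> sets hprod" unfolding hprod_def by (rule sets_PiM_I) (use J F in auto)
  have "(\<lambda>v. h * v) -` ?E \<inter> space hprod = prod_emb UNIV (\<lambda>_. CM) J (PiE J F')"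
   using h by (auto simp: prod_emb_def hprod_def space_PiM F'_def norm_mult PiE_def Pi_def)
  hence "emeasure (distr hprod hprod (\<lambda>v. h * v)) ?E = emeasure hprod (prod_emb UNIV (\<lambda>_. CM) J (PiE J F'))"
   by (simp add: emeasure_distr[OF meas E])
  also have "... = (\<Prod>j\<in>J. emeasure CM (F' j))" unfolding hprod_def by (rule hprod.emeasure_PiM_emb) (use J F' in auto)
  also have "... = (\<Prod>j\<in>J. emeasure CM (F j))" by (rule prod.cong) (simp_all add: em)
  finally show "emeasure (distr hprod hprod (\<lambda>v. h * v)) ?E = (\<Prod>j\<in>J. emeasure CM (F j))" .
 qed
 thus ?thesis by (simp add: hprod_def)
qed

text \<open>A measurable retraction of the full torus onto the solenoid. It commutes with translations by
 elements of the solenoid because the defect \<open>v p ^ p / v (base p)\<close> does not change under them.\<close>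

definition retr :: "sol => sol" where
 "retr v = (\<lambda>i. if i < 2 then v i else if prime i then v i / proot i (v i ^ i / v (base i)) else 1)"

lemma retr_solen:
 assumes v: "\<And>i. cmod (v i) = 1" shows "retr v \<in> solen"
proof (rule solenI)
 show "cmod (retr v i) = 1" for i using v by (simp add: retr_def norm_divide)
 show "retr v p ^ p = retr v (base p)" if p: "prime p" for p
 proof -
  have p2: "p \<ge> 2" by (rule prime_ge_2_nat[OF p])
  have nz: "v i \<noteq> 0" for i using v[of i] by auto
  have "cmod (v p ^ p / v (base p)) = 1" by (simp add: norm_divide norm_power v)
  hence "proot p (v p ^ p / v (base p)) ^ p = v p ^ p / v (base p)" by (rule proot_power) (use p2 in simp)
  thus ?thesis using p p2 base_less[of p] nz by (simp add: retr_def power_divide)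
 qed
 show "retr v i = 1" if "i \<ge> 2" "\<not> prime i" for i using that by (simp add: retr_def)
qed

lemma retr_mult:
 assumes "h \<in> solen" shows "retr (h * v) = h * retr v"
proof
 fix i :: nat
 consider "i < 2" | "i \<ge> 2" "prime i" | "i \<ge> 2" "\<not> prime i" by linarith
 thus "retr (h * v) i = (h * retr v) i"
 proof cases
  case 2
  have "h i ^ i = h (base i)" by (rule solen_power[OF assms 2(2)])
  hence "(h i * v i) ^ i / (h (base i) * v (base i)) = v i ^ i / v (base i)" using solen_nz[OF assms, of "base i"] by (simp add: power_mult_distrib)
  thus ?thesis using 2 by (simp add: retr_def)
 qed (simp_all add: retr_def solen_dummy[OF assms])
qed

lemma measurable_into_fun:
 assumes "\<And>i. (\<lambda>x. f x i) \<in> borel_measurable M"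
 shows "(f :: 'a => nat => complex) \<in> borel_measurable M"
proof -
 have "f \<in> measurable M (PiM UNIV (\<lambda>_. borel))" by (rule measurable_PiM_single') (auto simp: assms)
 thus ?thesis using measurable_cong_sets[OF refl sets_PiM_equal_borel] by blast
qed

lemma retr_measurable: "retr \<in> measurable hprod (restrict_space borel solen)"
proof (rule measurable_restrict_space2)
 show "retr \<in> space hprod \<rightarrow> solen" using retr_solen by (auto simp: space_hprod)
 show "retr \<in> borel_measurable hprod"
 proof (rule measurable_into_fun)
  fix i
  show "(\<lambda>x. retr x i) \<in> borel_measurable hprod" unfolding retr_def by measurable
 qed
qed

text \<open>Translation invariance is inherited from the full product, since \<open>retr\<close>
  commutes with the translations by elements of \<open>solen\<close>.\<close>

definition haar :: "sol measure" where
 "haar = distr hprod (restrict_space borel solen) retr"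

lemma space_haar [simp]: "space haar = solen" by (simp add: haar_def space_restrict_space)

lemma sets_haar [measurable_cong]: "sets haar = sets (restrict_space borel solen)" by (simp add: haar_def)

interpretation haar: prob_space haar unfolding haar_def by (rule prob_space.prob_space_distr[OF prob_space_hprod retr_measurable])

lemmas haar_prob = haar.prob_space_axioms

lemma haar_coord [measurable]: "(\<lambda>u. u i) \<in> borel_measurable haar"
 by (subst measurable_cong_sets[OF sets_haar refl], rule measurable_restrict_space1,
   rule borel_measurable_continuous_onI, rule continuous_on_coord)

lemma measurable_into_haar:
 assumes "\<And>i. (\<lambda>x. f x i) \<in> borel_measurable M" "\<And>x. x \<in> space M ==> f x \<in> solen"
 shows "f \<in> measurable M haar" unfolding measurable_cong_sets[OF refl sets_haar]
 by (rule measurable_restrict_space2[OF _ measurable_into_fun]) (use assms in auto)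

lemma measurable_solen_mult:
 assumes f: "f \<in> measurable M haar" and g: "g \<in> measurable M haar"
 shows "(\<lambda>x. f x * g x) \<in> measurable M haar"
proof (rule measurable_into_haar)
 fix i
 have "(\<lambda>x. f x i) \<in> borel_measurable M" "(\<lambda>x. g x i) \<in> borel_measurable M"
  using m_comp[OF f haar_coord] m_comp[OF g haar_coord] .
 thus "(\<lambda>x. (f x * g x) i) \<in> borel_measurable M" by simp
next
 fix x assume "x \<in> space M"
 thus "f x * g x \<in> solen" using measurable_space[OF f] measurable_space[OF g] by (simp add: solen_mult)
qed

lemma measurable_solen_uinv:
 assumes f: "f \<in> measurable M haar"
 shows "(\<lambda>x. uinv (f x)) \<in> measurable M haar"
proof (rule measurable_into_haar)
 fix i
 have "(\<lambda>x. f x i) \<in> borel_measurable M" using m_comp[OF f haar_coord] .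
 thus "(\<lambda>x. (uinv (f x)) i) \<in> borel_measurable M" by (simp add: uinv_def)
next
 fix x assume "x \<in> space M"
 thus "uinv (f x) \<in> solen" using measurable_space[OF f] by (simp add: solen_uinv)
qed

lemma translate_measurable: "h \<in> solen ==> (\<lambda>u. h * u) \<in> measurable haar haar" by (rule measurable_solen_mult) auto

lemma distr_haar_translate:
 assumes h: "h \<in> solen"
 shows "distr haar haar (\<lambda>u. h * u) = haar"
proof -
 let ?R = "restrict_space borel solen"
 have hm: "(\<lambda>v. h * v) \<in> measurable hprod hprod"
 proof -
  have "h * v \<in> space hprod" if "v \<in> space hprod" for v using that solen_norm[OF h] by (simp add: space_hprod norm_mult)
  moreover have "(\<lambda>v. (h * v) i) \<in> measurable hprod CM" for i unfolding measurable_cong_sets[OF refl sets_circle] times_fun_def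
   by (rule measurable_restrict_space2) (auto simp: space_hprod norm_mult solen_norm[OF h])
  ultimately show ?thesis unfolding hprod_def by (intro measurable_PiM_single') (auto simp: hprod_def[symmetric] space_hprod)
 qed
 have tm: "(\<lambda>u. h * u) \<in> measurable ?R ?R" using translate_measurable[OF h] by (simp cong: measurable_cong_sets add: sets_haar)
 have "distr haar haar (\<lambda>u. h * u) = distr haar ?R (\<lambda>u. h * u)" by (rule distr_cong) (simp_all add: sets_haar)
 also have "... = distr hprod ?R ((\<lambda>u. h * u) \<circ> retr)" unfolding haar_def by (rule distr_distr[OF tm retr_measurable])
 also have "(\<lambda>u. h * u) \<circ> retr = retr \<circ> (\<lambda>v. h * v)" using retr_mult[OF h] by auto
 also have "distr hprod ?R (retr \<circ> (\<lambda>v. h * v)) = distr (distr hprod hprod (\<lambda>v. h * v)) ?R retr"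
  by (rule distr_distr[OF retr_measurable hm, symmetric])
 also have "distr hprod hprod (\<lambda>v. h * v) = hprod" by (rule distr_hprod_mult) (rule solen_norm[OF h])
 finally show ?thesis unfolding haar_def[symmetric] .
qed

lemma haar_integral_translate:
 fixes f :: "sol => 'b :: {banach, second_countable_topology}"
 assumes "h \<in> solen" "f \<in> borel_measurable haar"
 shows "(LINT u|haar. f (h * u)) = (LINT u|haar. f u)"
 using integral_distr[OF translate_measurable[OF assms(1)] assms(2)] distr_haar_translate[OF assms(1)] by simp

lemma sets_haar_borel: "A \<in> sets haar \<longleftrightarrow> A \<in> sets borel \<and> A \<subseteq> solen"
proof -
 have "solen \<in> sets borel" using closed_solen by simp
 thus ?thesis by (auto simp: sets_haar sets_restrict_space_iff)
qed

text \<open>The image of \<open>haar\<close> on all sequences is a finite Borel measure on a Polish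
  space, where inner regularity is automatic; compact subsets of \<open>A\<close> lie in
  \<open>solen\<close>.\<close>

lemma haar_inner_regular:
 assumes A: "A \<in> sets haar" and e: "e > 0"
 shows "\<exists>K. compact K \<and> K \<subseteq> A \<and> measure haar A < measure haar K + e"
proof -
 define N where "N = distr haar borel (\<lambda>u. u)"
 have idm: "(\<lambda>u. u) \<in> measurable haar borel" by (rule measurable_into_fun) measurable
 interpret N: prob_space N unfolding N_def by (rule haar.prob_space_distr[OF idm])
 have NA: "measure N B = measure haar B" if "B \<in> sets haar" for B
 proof -
  have "(\<lambda>u. u) -` B \<inter> space haar = B" using that by (auto simp: sets_haar_borel)
  thus ?thesis unfolding N_def using measure_distr[OF idm, of B] that by (simp add: sets_haar_borel)
 qed
 have Ab: "A \<in> sets borel" using A by (simp add: sets_haar_borel)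
 show ?thesis
 proof (rule ccontr)
  assume "\<not> ?thesis"
  hence no: "measure haar A \<ge> measure haar K + e" if "compact K" "K \<subseteq> A" for K using that by (meson not_le)
  have "emeasure N A = (SUP K \<in> {K. K \<subseteq> A \<and> compact K}. emeasure N K)"
   by (rule inner_regular) (use Ab N.emeasure_finite in "auto simp: N_def")
  also have "... \<le> ennreal (measure haar A - e)"
  proof (rule SUP_least)
   fix K assume "K \<in> {K. K \<subseteq> A \<and> compact K}"
   hence K: "K \<subseteq> A" "compact K" by auto
   hence "K \<in> sets haar" using A by (auto simp: sets_haar_borel compact_imp_closed)
   hence "measure N K = measure haar K" by (rule NA)
   thus "emeasure N K \<le> ennreal (measure haar A - e)" using no[OF K(2,1)] by (simp add: N.emeasure_eq_measure ennreal_leI)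
  qed
  finally have le: "ennreal (measure haar A) \<le> ennreal (measure haar A - e)" by (simp add: N.emeasure_eq_measure NA[OF A])
  have "measure haar A - e \<ge> 0" using no[of "{}"] by simp
  thus False using le e by simp
 qed
qed

theorem haar_probability_solen: "haar_probability solen_group solen_top haar" unfolding haar_probability_def
proof (intro conjI ballI allI impI)
 show "space haar = topspace solen_top" by simp
 show "sets haar = sets (borel_of solen_top)" using closed_solen by (simp add: sets_haar solen_top_def sets_borel_of)
 show "prob_space haar" by (rule haar_prob)
next
 fix h A assume h: "h \<in> carrier solen_group" and A: "A \<in> sets haar"
 have hs: "h \<in> solen" using h by (simp add: solen_group_def)
 have As: "A \<subseteq> solen" using A by (simp add: sets_haar_borel)
 have "h <#\<^bsub>solen_group\<^esub> A = (\<lambda>u. uinv h * u) -` A \<inter> space haar"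
 proof
  show "h <#\<^bsub>solen_group\<^esub> A \<subseteq> (\<lambda>u. uinv h * u) -` A \<inter> space haar"
   using As hs by (auto simp: l_coset_def solen_group_def solen_cancel solen_mult)
  show "(\<lambda>u. uinv h * u) -` A \<inter> space haar \<subseteq> h <#\<^bsub>solen_group\<^esub> A"
  proof
   fix u assume "u \<in> (\<lambda>u. uinv h * u) -` A \<inter> space haar"
   hence "uinv h * u \<in> A" by simp
   hence "h * (uinv h * u) \<in> h <#\<^bsub>solen_group\<^esub> A" by (auto simp: l_coset_def solen_group_def)
   thus "u \<in> h <#\<^bsub>solen_group\<^esub> A" by (simp add: solen_cancel[OF hs])
  qed
 qed
 thus "emeasure haar (h <#\<^bsub>solen_group\<^esub> A) = emeasure haar A"
  using emeasure_distr[OF translate_measurable[OF solen_uinv[OF hs]] A] distr_haar_translate[OF solen_uinv[OF hs]] by simp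
next
 fix A and e :: real assume "A \<in> sets haar" "0 < e"
 then obtain K where K: "compact K" "K \<subseteq> A" "measure haar A < measure haar K + e" using haar_inner_regular by blast
 moreover have "A \<subseteq> solen" using \<open>A \<in> sets haar\<close> by (simp add: sets_haar_borel)
 ultimately show "\<exists>K. compactin solen_top K \<and> K \<subseteq> A \<and> measure haar A < measure haar K + e"
  by (intro exI[of _ K]) (auto simp: solen_top_def compactin_subtopology)
qed

section \<open>Characters of the solenoid\<close>

text \<open>All monomials in the coordinates and their conjugates; different monomials may define the same
 character.\<close>

inductive_set chars :: "(sol => complex) set" where
 one: "(\<lambda>u. 1) \<in> chars"
| coord: "xi \<in> chars ==> (\<lambda>u. u i * xi u) \<in> chars"
| cnj_coord: "xi \<in> chars ==> (\<lambda>u. cnj (u i) * xi u) \<in> chars"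

lemma chars_mult_closed: "xi \<in> chars ==> pz \<in> chars ==> (\<lambda>u. xi u * pz u) \<in> chars"
 by (induction rule: chars.induct) (auto simp: mult.assoc intro: chars.intros)

lemma chars_cnj_closed: "xi \<in> chars ==> (\<lambda>u. cnj (xi u)) \<in> chars" by (induction rule: chars.induct) (auto intro: chars.intros)

lemma chars_mult: "xi \<in> chars ==> xi (u * v) = xi u * xi v" by (induction rule: chars.induct) (auto simp: mult_ac)

lemma chars_1: "xi \<in> chars ==> xi 1 = 1" by (induction rule: chars.induct) auto

lemma chars_continuous: "xi \<in> chars ==> continuous_on A xi" by (induction rule: chars.induct) (auto intro!: continuous_intros)

lemma chars_norm: "xi \<in> chars ==> u \<in> solen ==> cmod (xi u) = 1" by (induction rule: chars.induct) (auto simp: norm_mult solen_norm)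

lemma chars_measurable: "xi \<in> chars ==> xi \<in> borel_measurable haar"
 by (induction rule: chars.induct) (auto intro: borel_measurable_times m_comp[OF haar_coord measurable_cnj])

lemma chars_power: "xi \<in> chars ==> xi (v ^ n) = xi v ^ n" by (induction n) (simp_all add: chars_1 chars_mult)

text \<open>A monomial involves finitely many coordinates; for all other primes \<open>p\<close> it
  does not see \<open>prime_unit p\<close>.\<close>

lemma chars_finite_dependence:
 assumes "xi \<in> chars"
 obtains I where "finite I" "\<And>w. (\<And>i. i \<in> I ==> w i = 1) ==> xi w = 1"
proof -
 from assms have "\<exists>I. finite I \<and> (\<forall>w. (\<forall>i\<in>I. w i = 1) \<longrightarrow> xi w = 1)"
 proof induction
  case one
  show ?case by (rule exI[of _ "{}"]) simp
 next
  case (coord xi i)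
  then obtain I where I: "finite I" "\<forall>w. (\<forall>i\<in>I. w i = 1) \<longrightarrow> xi w = 1" by auto
  show ?case by (rule exI[of _ "insert i I"]) (use I in simp)
 next
  case (cnj_coord xi i)
  then obtain I where I: "finite I" "\<forall>w. (\<forall>i\<in>I. w i = 1) \<longrightarrow> xi w = 1" by auto
  show ?case by (rule exI[of _ "insert i I"]) (use I in simp)
 qed
 then obtain I where I: "finite I" "\<forall>w. (\<forall>i\<in>I. w i = 1) \<longrightarrow> xi w = 1" by auto
 show thesis by (rule that[of I]) (use I in simp_all)
qed

lemma chars_integral:
 assumes xi: "xi \<in> chars" and h: "h \<in> solen" "xi h \<noteq> 1"
 shows "(LINT u|haar. xi u) = 0"
proof -
 have "(LINT u|haar. xi u) = (LINT u|haar. xi (h * u))" by (rule haar_integral_translate[OF h(1) chars_measurable[OF xi], symmetric])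
 also have "... = xi h * (LINT u|haar. xi u)" by (simp add: chars_mult[OF xi])
 finally show ?thesis using h(2) by simp
qed

lemma cnj_powi_unit: "cmod z = 1 ==> cnj z powi n = z powi (- n)"
proof -
 assume "cmod z = 1"
 hence "cnj z = inverse z" using cnj_mult_unit[of z] by (metis inverse_unique mult.commute)
 thus ?thesis by (simp add: power_int_inverse power_int_minus)
qed

lemma coord_power_base:
 "\<exists>m>0. \<exists>a b :: int. \<forall>u\<in>solen. u i ^ m = u 0 powi a * u 1 powi b"
proof -
 have base_form: "\<exists>a b :: int. \<forall>u\<in>solen. u j = u 0 powi a * u 1 powi b" if "j < 2" for j
 proof -
  from that consider "j = 0" | "j = 1" by linarith
  thus ?thesis
  proof cases
   case 1
   show ?thesis by (rule exI[of _ 1], rule exI[of _ 0]) (simp add: 1)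
  next
   case 2
   show ?thesis by (rule exI[of _ 0], rule exI[of _ 1]) (simp add: 2)
  qed
 qed
 consider "i < 2" | "i \<ge> 2" "prime i" | "i \<ge> 2" "\<not> prime i" by linarith
 thus ?thesis
 proof cases
  case 1
  thus ?thesis using base_form[of i] by (intro exI[of _ "1::nat"]) simp
 next
  case 2
  obtain a b :: int where "\<forall>u\<in>solen. u (base i) = u 0 powi a * u 1 powi b" using base_form[OF base_less] by blast
  hence "\<forall>u\<in>solen. u i ^ i = u 0 powi a * u 1 powi b" using solen_power[OF _ 2(2)] by simp
  thus ?thesis using 2 by (intro exI[of _ i]) auto
 next
  case 3
  hence "\<forall>u\<in>solen. u i ^ 1 = u 0 powi 0 * u 1 powi 0" by (simp add: solen_dummy)
  thus ?thesis by (metis zero_less_one)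
 qed
qed

text \<open>The dual group has rank two: some positive power of every character comes from the
  torus, because the same holds for every coordinate and exponents can be brought to a common
  multiple.\<close>

lemma chars_power_base:
 assumes "xi \<in> chars"
 shows "\<exists>m>0. \<exists>a b :: int. \<forall>u\<in>solen. xi u ^ m = u 0 powi a * u 1 powi b" using assms
proof induction
 case one
 have "\<forall>u\<in>solen. (1::complex) ^ 1 = u 0 powi 0 * u 1 powi 0" by simp
 thus ?case by (metis zero_less_one)
next
 case (coord xi i)
 obtain m a b where m: "m > 0" "\<And>u. u \<in> solen ==> xi u ^ m = u 0 powi a * u 1 powi b" using coord.IH by blast
 obtain n c d where n: "n > 0" "\<And>u. u \<in> solen ==> u i ^ n = u 0 powi c * u 1 powi d" using coord_power_base by blast
 have "(u i * xi u) ^ (n * m) = u 0 powi (c * m + a * n) * u 1 powi (d * m + b * n)" if u: "u \<in> solen" for u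
 proof -
  have "(u i * xi u) ^ (n * m) = (u i ^ n) ^ m * (xi u ^ m) ^ n" by (simp add: power_mult_distrib power_mult[symmetric] mult.commute)
  also have "... = u 0 powi (c * m + a * n) * u 1 powi (d * m + b * n)"
   using solen_nz[OF u] by (simp add: m(2)[OF u] n(2)[OF u] power_mult_distrib power_int_add power_int_mult mult_ac)
  finally show ?thesis .
 qed
 thus ?case using m(1) n(1) by (intro exI[of _ "n * m"]) auto
next
 case (cnj_coord xi i)
 obtain m a b where m: "m > 0" "\<And>u. u \<in> solen ==> xi u ^ m = u 0 powi a * u 1 powi b" using cnj_coord.IH by blast
 obtain n c d where n: "n > 0" "\<And>u. u \<in> solen ==> u i ^ n = u 0 powi c * u 1 powi d" using coord_power_base by blast
 have "(cnj (u i) * xi u) ^ (n * m) = u 0 powi ((-c) * m + a * n) * u 1 powi ((-d) * m + b * n)" if u: "u \<in> solen" for u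
 proof -
  have "(cnj (u i) * xi u) ^ (n * m) = (cnj (u i ^ n)) ^ m * (xi u ^ m) ^ n" by (simp add: power_mult_distrib power_mult[symmetric] mult.commute)
  also have "cnj (u i ^ n) = cnj (u 0) powi c * cnj (u 1) powi d" unfolding n(2)[OF u] by simp
  also have "... = u 0 powi (-c) * u 1 powi (-d)" by (simp only: cnj_powi_unit[OF solen_norm[OF u]])
  also have "(u 0 powi (-c) * u 1 powi (-d)) ^ m * (xi u ^ m) ^ n = u 0 powi ((-c) * m + a * n) * u 1 powi ((-d) * m + b * n)"
   using solen_nz[OF u] by (simp add: m(2)[OF u] power_mult_distrib power_int_add power_int_mult mult_ac
     del: power_int_minus mult_minus_left)
  finally show ?thesis .
 qed
 thus ?case using m(1) n(1) by (intro exI[of _ "n * m"]) auto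
qed

text \<open>A \<open>p\<close>-th root is chosen coordinatewise; the task is to make the choices at
  the primes compatible with those at 0 and 1.\<close>

lemma solen_divisible:
 assumes p: "prime p" and u: "u \<in> solen"
 shows "\<exists>v\<in>solen. v ^ p = u"
proof -
 have p2: "p \<ge> 2" by (rule prime_ge_2_nat[OF p])
 \<comment> \<open>At \<open>base p\<close> the root must be \<open>u p\<close> itself. The
   condition at the coordinate \<open>p\<close>, whose \<open>p\<close>-th power has to be both
   \<open>u p\<close> and \<open>c (base p)\<close>, is then a single condition.\<close>
 define c where "c j = (if j = base p then u p else proot p (u j))" for j
 have c_norm: "cmod (c j) = 1" for j by (simp add: c_def solen_norm[OF u])
 have c_pow: "c j ^ p = u j" if "j < 2" for j using solen_power[OF u p] p2 by (simp add: c_def proot_power solen_norm[OF u])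
 have "\<exists>z. cmod z = 1 \<and> z ^ q = c (base q) \<and> z ^ p = u q" if q: "prime q" for q
 proof (cases "q = p")
  case True
  show ?thesis by (rule exI[of _ "proot p (u p)"]) (use True p2 in "simp add: proot_power solen_norm[OF u] c_def")
 next
  case False
  hence "coprime (int p) (int q)" using primes_coprime[OF p q] by simp
  then obtain a b where ab: "a * int p + b * int q = 1" using bezout_int[of "int p" "int q"] by auto
  \<comment> \<open>The sought \<open>z\<close> satisfies \<open>u q = z ^ p\<close> and
    \<open>c (base q) = z ^ q\<close>, hence equals this product by the Bezout identity. The
    relation \<open>eq\<close> makes the formula a solution.\<close>
  define z where "z = u q powi a * c (base q) powi b"
  have nz: "u q \<noteq> 0" "c (base q) \<noteq> 0" using solen_nz[OF u] c_norm[of "base q"] by auto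
  have eq: "u q ^ q = c (base q) ^ p" using solen_power[OF u q] c_pow[OF base_less] by simp
  have "z ^ q = (u q powi a) ^ q * (c (base q) powi b) ^ q" by (simp only: z_def power_mult_distrib)
  also have "(u q powi a) ^ q = (u q ^ q) powi a" by (simp only: power_int_power power_int_power' mult.commute)
  also have "(u q ^ q) powi a = c (base q) powi (a * int p)" by (simp only: eq power_int_power mult.commute)
  also have "c (base q) powi (a * int p) * (c (base q) powi b) ^ q = c (base q) powi (a * int p + b * int q)"
   using nz by (simp add: power_int_add power_int_power')
  finally have 1: "z ^ q = c (base q)" by (simp add: ab)
  have "z ^ p = (u q powi a) ^ p * (c (base q) powi b) ^ p" by (simp only: z_def power_mult_distrib)
  also have "(c (base q) powi b) ^ p = (c (base q) ^ p) powi b" by (simp only: power_int_power power_int_power' mult.commute)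
  also have "(c (base q) ^ p) powi b = u q powi (b * int q)" by (simp only: eq[symmetric] power_int_power mult.commute)
  also have "(u q powi a) ^ p * u q powi (b * int q) = u q powi (a * int p + b * int q)" using nz by (simp add: power_int_add power_int_power')
  finally have 2: "z ^ p = u q" by (simp add: ab)
  have "cmod z = 1" by (simp add: z_def norm_mult unit_powi_norm solen_norm[OF u] c_norm)
  thus ?thesis using 1 2 by blast
 qed
 then obtain z where z: "\<And>q. prime q ==> cmod (z q) = 1 \<and> z q ^ q = c (base q) \<and> z q ^ p = u q" by metis
 define v where "v i = (if i < 2 then c i else if prime i then z i else 1)" for i
 have "v \<in> solen"
 proof (rule solenI)
  show "cmod (v i) = 1" for i using z c_norm by (simp add: v_def)
  show "v q ^ q = v (base q)" if "prime q" for q using z[OF that] prime_ge_2_nat[OF that] that base_less[of q] by (simp add: v_def)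
 qed (simp add: v_def)
 moreover have "v ^ p = u"
 proof
  fix i
  have "(v ^ n) i = v i ^ n" for n by (induction n) simp_all
  thus "(v ^ p) i = u i" using c_pow z solen_dummy[OF u, of i] by (simp add: v_def)
 qed
 ultimately show ?thesis by blast
qed

text \<open>The dual of a divisible group is torsion free. One prime factor of the exponent is
  removed at a time by evaluating at roots.\<close>

lemma chars_torsion_free:
 assumes xi: "xi \<in> chars" and m: "m > 0" and triv: "\<And>u. u \<in> solen ==> xi u ^ m = 1" and u: "u \<in> solen"
 shows "xi u = 1" using m triv u
proof (induction m arbitrary: u rule: less_induct)
 case (less m)
 show ?case
 proof (cases "m = 1")
  case True
  thus ?thesis using less.prems by simp
 next
  case False
  then obtain p where p: "prime p" "p dvd m" using prime_factor_nat by blast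
  then obtain k where k: "m = p * k" by blast
  have k0: "k > 0" using less.prems(1) unfolding k by simp
  have km: "k < m" unfolding k using n_less_m_mult_n[OF k0 prime_gt_Suc_0_nat[OF p(1)]] .
  have "xi w ^ k = 1" if w: "w \<in> solen" for w
  proof -
   obtain v where v: "v \<in> solen" "v ^ p = w" using solen_divisible[OF p(1) w] by (elim bexE)
   have "xi w ^ k = (xi v ^ p) ^ k" using chars_power[OF xi, of v p] v by simp
   also have "... = xi v ^ m" by (simp add: k power_mult)
   finally show ?thesis using less.prems(2)[OF v(1)] by simp
  qed
  thus ?thesis by (rule less.IH[OF km k0 _ less.prems(3)])
 qed
qed

section \<open>The acting group\<close>

abbreviation "PG \<equiv> prime_sum_group"
abbreviation "GG \<equiv> carrier PG"
abbreviation GM (infixl "\<cdot>" 70) where "g \<cdot> h \<equiv> g \<otimes>\<^bsub>PG\<^esub> h"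
abbreviation "ID \<equiv> \<one>\<^bsub>PG\<^esub>"

lemma carrier_PG: "GG = {x \<in> \<Pi>\<^sub>E p\<in>{p. prime p}. {0..<int p}. finite {p \<in> {p. prime p}. x p \<noteq> 0}}"
proof -
 have "GG = {x \<in> \<Pi>\<^sub>E p\<in>{p. prime p}. carrier (integer_mod_group p). finite {p \<in> {p. prime p}. x p \<noteq> \<one>\<^bsub>integer_mod_group p\<^esub>}}"
  unfolding prime_sum_group_def by (rule carrier_sum_group) simp
 moreover have "(\<Pi>\<^sub>E p\<in>{p. prime p}. carrier (integer_mod_group p)) = (\<Pi>\<^sub>E p\<in>{p::nat. prime p}. {0..<int p})"
  by (rule PiE_cong) (auto simp: carrier_integer_mod_group)
 ultimately show ?thesis by simp
qed

lemma mult_PG: "g \<cdot> h = (\<lambda>p\<in>{p. prime p}. (g p + h p) mod int p)" by (simp add: prime_sum_group_def)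

lemma one_PG: "ID = (\<lambda>p\<in>{p. prime p}. 0)" by (simp add: prime_sum_group_def)

lemma comm_group_PG: "comm_group PG"
proof (rule group.group_comm_groupI)
 show "group PG" unfolding prime_sum_group_def by (rule sum_group) simp
qed (simp add: mult_PG add.commute)

interpretation PG: comm_group PG by (rule comm_group_PG)

definition supp :: "(nat => int) => nat set" where
 "supp g = {p. prime p \<and> g p \<noteq> 0}"

lemma finite_supp: "g \<in> GG ==> finite (supp g)" by (simp add: carrier_PG supp_def)

lemma supp_prime: "p \<in> supp g ==> prime p" by (simp add: supp_def)

lemma PG_range: "g \<in> GG ==> prime p ==> 0 \<le> g p \<and> g p < int p" by (auto simp: carrier_PG PiE_def Pi_def)

lemma PG_eqI:
 assumes "g \<in> GG" "h \<in> GG" "\<And>p. prime p ==> g p = h p"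
 shows "g = h" using assms by (intro PiE_ext[of g "{p. prime p}" _ h]) (auto simp: carrier_PG)

definition single :: "nat => nat => int" where
 "single p = (\<lambda>q\<in>{q. prime q}. if q = p then 1 else 0)"

lemma single_carrier: "prime p ==> single p \<in> GG"
proof -
 assume p: "prime p"
 have "single p \<in> (\<Pi>\<^sub>E p\<in>{p. prime p}. {0..<int p})" using prime_gt_1_nat by (auto simp: single_def prime_gt_0_nat)
 moreover have "{q \<in> {q. prime q}. single p q \<noteq> 0} \<subseteq> {p}" by (auto simp: single_def)
 hence "finite {q \<in> {q. prime q}. single p q \<noteq> 0}" by (rule finite_subset) simp
 ultimately show ?thesis by (simp add: carrier_PG)
qed

lemma supp_single: "prime p ==> supp (single p) = {p}" by (auto simp: supp_def single_def)

lemma infinite_PG: "infinite (GG)"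
proof -
 have "inj_on single {p. prime p}"
 proof (rule inj_onI)
  fix p q assume "p \<in> {p. prime p}" "q \<in> {p. prime p}" "single p = single q"
  hence "{p} = {q}" using supp_single by (metis mem_Collect_eq)
  thus "p = q" by simp
 qed
 moreover have "single ` {p. prime p} \<subseteq> GG" using single_carrier by auto
 ultimately show ?thesis using primes_infinite finite_subset finite_imageD by metis
qed

text \<open>The weights make the \<open>p\<close>-th generator move the coordinate \<open>i\<close> of the solenoid by
 \<open>wt i p / p\<close>; the exponent \<open>i\<^sup>p\<^sup>-\<^sup>2\<close> is the inverse of \<open>i\<close> modulo \<open>p\<close>.\<close>

definition wt :: "nat => nat => nat" where
 "wt i p = (if base p = base i then 0 else if i < 2 then 1 else if prime i then i ^ (p - 2) else 0)"

definition shift :: "nat => (nat => int) => real" where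
 "shift i g = (\<Sum>p\<in>supp g. real (wt i p) * of_int (g p) / real p)"

definition iota :: "(nat => int) => sol" where
 "iota g = (\<lambda>i. ee (shift i g))"

lemma shift_superset:
 assumes "finite S" "supp g \<subseteq> S" "\<And>p. p \<in> S ==> prime p"
 shows "shift i g = (\<Sum>p\<in>S. real (wt i p) * of_int (g p) / real p)" unfolding shift_def
 by (rule sum.mono_neutral_left) (use assms in "auto simp: supp_def")

definition carry :: "(nat => int) => (nat => int) => nat => int" where
 "carry g h p = (g p + h p) div int p"

lemma PG_mult_apply:
 assumes "prime p"
 shows "(g \<cdot> h) p = g p + h p - int p * carry g h p" using assms by (simp add: mult_PG carry_def minus_mult_div_eq_mod)

lemma supp_mult: "supp (g \<cdot> h) \<subseteq> supp g \<union> supp h" by (auto simp: supp_def mult_PG)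

text \<open>The integer by which \<open>shift i\<close> fails to be additive when residues are
  represented by least nonnegative integers. In the cocycle it reappears as an exponent of a free
  coordinate.\<close>

definition total_carry :: "nat => (nat => int) => (nat => int) => int" where
 "total_carry i g h = (\<Sum>p\<in>supp g \<union> supp h. int (wt i p) * carry g h p)"

lemma shift_mult:
 assumes g: "g \<in> GG" and h: "h \<in> GG"
 shows "shift i (g \<cdot> h) = shift i g + shift i h - of_int (total_carry i g h)"
proof -
 let ?S = "supp g \<union> supp h"
 have S: "finite ?S" "\<And>p. p \<in> ?S ==> prime p" using finite_supp[OF g] finite_supp[OF h] supp_prime by auto
 have "shift i (g \<cdot> h) = (\<Sum>p\<in>?S. real (wt i p) * of_int ((g \<cdot> h) p) / real p)" by (rule shift_superset[OF S(1) supp_mult S(2)])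
 also have "... = (\<Sum>p\<in>?S. real (wt i p) * of_int (g p) / real p + real (wt i p) * of_int (h p) / real p
   - real_of_int (int (wt i p) * carry g h p))"
 proof (rule sum.cong[OF refl])
  fix p assume "p \<in> ?S"
  hence p: "prime p" by (rule S(2))
  hence "real p \<noteq> 0" by (simp add: prime_gt_0_nat)
  thus "real (wt i p) * of_int ((g \<cdot> h) p) / real p
   = real (wt i p) * of_int (g p) / real p + real (wt i p) * of_int (h p) / real p - real_of_int (int (wt i p) * carry g h p)"
   unfolding PG_mult_apply[OF p] by (simp add: field_simps)
 qed
 also have "... = (\<Sum>p\<in>?S. real (wt i p) * of_int (g p) / real p) + (\<Sum>p\<in>?S. real (wt i p) * of_int (h p) / real p)
   - of_int (total_carry i g h)" by (simp add: sum.distrib sum_subtractf total_carry_def)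
 also have "(\<Sum>p\<in>?S. real (wt i p) * of_int (g p) / real p) = shift i g" by (rule shift_superset[symmetric]) (use S in auto)
 also have "(\<Sum>p\<in>?S. real (wt i p) * of_int (h p) / real p) = shift i h" by (rule shift_superset[symmetric]) (use S in auto)
 finally show ?thesis .
qed

lemma iota_mult:
 assumes "g \<in> GG" "h \<in> GG"
 shows "iota (g \<cdot> h) = iota g * iota h"
proof
 fix i
 have "ee (shift i (g \<cdot> h)) = ee (shift i g + shift i h)" by (rule ee_eqI) (simp add: shift_mult[OF assms])
 thus "iota (g \<cdot> h) i = (iota g * iota h) i" by (simp add: iota_def ee_add)
qed

text \<open>Fermat's little theorem. This integrality is what makes the coordinate \<open>q\<close>
  of \<open>iota g\<close> a \<open>q\<close>-th root of its base coordinate.\<close>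

lemma wt_inverse:
 assumes q: "prime q" and p: "prime p"
 shows "(real q * real (wt q p) - real (wt (base q) p)) / real p \<in> \<int>"
proof (cases "base p = base q")
 case True
 thus ?thesis by (simp add: wt_def)
next
 case False
 hence ne: "p \<noteq> q" by auto
 hence "\<not> p dvd q" using primes_dvd_imp_eq[OF p q] by blast
 from fermat_theorem[OF p this] have "[q ^ (p - 1) = 1] (mod p)" .
 hence "[int (q ^ (p - 1)) = int 1] (mod int p)" by (simp only: cong_int_iff)
 hence "int p dvd int (q ^ (p - 1)) - 1" by (simp add: cong_iff_dvd_diff)
 then obtain k where k: "int (q ^ (p - 1)) - 1 = int p * k" by (rule dvdE)
 have p2: "p \<ge> 2" and q2: "q \<ge> 2" using prime_ge_2_nat p q by auto
 have "q * q ^ (p - 2) = q ^ (p - 1)"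
 proof -
  have "p - 1 = Suc (p - 2)" using p2 by simp
  thus ?thesis by simp
 qed
 moreover have "wt q p = q ^ (p - 2)" "wt (base q) p = 1" using False q q2 base_less[of q] by (simp_all add: wt_def)
 ultimately have "real q * real (wt q p) - real (wt (base q) p) = real (q ^ (p - 1)) - 1" by (simp only: of_nat_mult[symmetric] of_nat_1)
 also have "... = real_of_int (int (q ^ (p - 1)) - 1)" by simp
 also have "... = real p * of_int k" unfolding k by simp
 finally show ?thesis using p2 by simp
qed

lemma iota_solen:
 assumes g: "g \<in> GG"
 shows "iota g \<in> solen"
proof (rule solenI)
 show "cmod (iota g i) = 1" for i by (simp add: iota_def)
 show "iota g q ^ q = iota g (base q)" if q: "prime q" for q
 proof -
  have "real q * shift q g - shift (base q) g = (\<Sum>p\<in>supp g. (real q * real (wt q p) - real (wt (base q) p)) / real p * of_int (g p))"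
   unfolding shift_def sum_distrib_left sum_subtractf[symmetric] by (rule sum.cong) (simp_all add: diff_divide_distrib left_diff_distrib)
  also have "... \<in> \<int>" by (intro Ints_sum Ints_mult wt_inverse q supp_prime Ints_of_int)
  finally show ?thesis unfolding iota_def ee_power by (rule ee_eqI)
 qed
 show "iota g i = 1" if "i \<ge> 2" "\<not> prime i" for i
 proof -
  have "wt i p = 0" for p using that by (simp add: wt_def)
  thus ?thesis by (simp add: iota_def shift_def)
 qed
qed

lemma iota_one: "iota ID = 1"
proof -
 have "supp ID = {}" by (auto simp: supp_def one_PG)
 thus ?thesis by (simp add: iota_def shift_def fun_eq_iff)
qed

lemma shift_single: "prime p ==> shift i (single p) = real (wt i p) / real p" by (simp add: shift_def supp_single) (simp add: single_def)

text \<open>Every such prime divides \<open>a\<close>, and a nonzero integer has finitely many prime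
  divisors.\<close>

lemma powi_root_trivial:
 assumes "infinite P" "\<And>p. p \<in> P ==> prime p \<and> ee (1 / real p) powi a = 1"
 shows "a = 0"
proof (rule ccontr)
 assume a: "a \<noteq> 0"
 have "P \<subseteq> {p. p \<le> nat \<bar>a\<bar>}"
 proof
  fix p assume "p \<in> P"
  hence p: "prime p" "ee (1 / real p) powi a = 1" using assms(2) by auto
  hence "of_int a * (1 / real p) \<in> \<int>" unfolding ee_powi ee_eq_1_iff by simp
  then obtain k :: int where "of_int a * (1 / real p) = of_int k" by (auto elim: Ints_cases)
  hence "real_of_int a = real_of_int (k * int p)" using prime_gt_0_nat[OF p(1)] by (simp add: field_simps)
  hence "a = k * int p" by linarith
  hence "int p dvd a" by simp
  hence "int p \<le> \<bar>a\<bar>" using dvd_imp_le_int[OF a, of "int p"] by simp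
  thus "p \<in> {p. p \<le> nat \<bar>a\<bar>}" by simp
 qed
 hence "finite P" by (rule finite_subset) simp
 thus False using assms(1) by simp
qed

text \<open>The image of the acting group is dense in the solenoid, in the dual formulation.\<close>

lemma chars_trivial:
 assumes xi: "xi \<in> chars" and triv: "\<And>g. g \<in> GG ==> xi (iota g) = 1" and u: "u \<in> solen"
 shows "xi u = 1"
proof -
 obtain m a b where m: "m > 0" "\<And>u. u \<in> solen ==> xi u ^ m = u 0 powi a * u 1 powi b" using chars_power_base[OF xi] by blast
 have eq: "iota (single p) 0 powi a * iota (single p) 1 powi b = 1" if "prime p" for p
  using m(2)[OF iota_solen[OF single_carrier[OF that]]] triv[OF single_carrier[OF that]] by simp
 \<comment> \<open>The generators with \<open>base p = 1\<close> move the free coordinate 0 and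
   leave the free coordinate 1 fixed, so they isolate the exponent \<open>a\<close>.\<close>
 have "a = 0"
 proof (rule powi_root_trivial)
  show "infinite {p. prime p \<and> base p = 1}" by (rule infinite_base) simp
  fix p assume "p \<in> {p. prime p \<and> base p = 1}"
  thus "prime p \<and> ee (1 / real p) powi a = 1" using eq[of p] by (simp add: iota_def shift_single wt_def)
 qed
 moreover have "b = 0"
 proof (rule powi_root_trivial)
  show "infinite {p. prime p \<and> base p = 0}" by (rule infinite_base) simp
  fix p assume "p \<in> {p. prime p \<and> base p = 0}"
  thus "prime p \<and> ee (1 / real p) powi b = 1" using eq[of p] by (simp add: iota_def shift_single wt_def)
 qed
 ultimately have "xi v ^ m = 1" if "v \<in> solen" for v using m(2)[OF that] by simp
 thus ?thesis by (rule chars_torsion_free[OF xi m(1) _ u])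
qed

section \<open>The cocycle\<close>

text \<open>A branch of the argument of \<open>u 1\<close> in units of full turns, with values above
  -1/2 and at most 1/2. Its jump over \<open>u 1 = -1\<close> is the cut of the circle
  bundle.\<close>

definition angle :: "sol => real" where
 "angle u = Arg (u 1) / (2 * pi)"

lemma ee_angle: "u \<in> solen ==> ee (angle u) = u 1" by (simp add: angle_def ee_Arg solen_norm)

text \<open>The real number of which \<open>wind\<close> takes the integer part is an integer.\<close>

definition wind :: "(nat => int) => sol => int" where
 "wind g u = \<lfloor>angle u + shift 1 g - angle (iota g * u)\<rfloor>"

lemma wind_eq:
 assumes g: "g \<in> GG" and u: "u \<in> solen"
 shows "real_of_int (wind g u) = angle u + shift 1 g - angle (iota g * u)"
proof -
 have "ee (angle u + shift 1 g) = ee (angle (iota g * u))" using ee_angle[OF u] ee_angle[OF solen_mult[OF iota_solen[OF g] u]]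
  by (simp add: ee_add iota_def)
 hence "ee (angle u + shift 1 g - angle (iota g * u)) = 1"
  using ee_add[of "angle u + shift 1 g - angle (iota g * u)" "angle (iota g * u)"] norm_ee[of "angle (iota g * u)"]
  by (metis diff_add_cancel mult_cancel_right1 norm_zero zero_neq_one)
 hence "angle u + shift 1 g - angle (iota g * u) \<in> \<int>" by (simp only: ee_eq_1_iff)
 thus ?thesis unfolding wind_def by (metis Ints_cases floor_of_int)
qed

text \<open>The correction by adjoined roots. Roots of \<open>v 1\<close> are taken at the end point
  \<open>v\<close> of a step and roots of \<open>u 0\<close>, inverted, at its starting point
  \<open>u\<close>; keeping the points apart allows moving one of them at a time.\<close>

definition twist :: "(nat => int) => sol => sol => complex" where
 "twist g v u = (\<Prod>p\<in>supp g. if base p = 1 then v p powi g p else u p powi (- g p))"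

text \<open>The exponential is the Heisenberg commutator term, and the power of \<open>u 0\<close>
  is the transition function collected whenever the angle crosses the cut.\<close>

definition rho :: "(nat => int) => sol => complex" where
 "rho g u = twist g (iota g * u) u * ee (- (angle (iota g * u) * shift 0 g)) * u 0 powi wind g u"

lemma rho_norm:
 assumes "g \<in> GG" "u \<in> solen"
 shows "cmod (rho g u) = 1"
proof -
 have "cmod (twist g (iota g * u) u) = 1" unfolding twist_def prod_norm[symmetric]
 proof (intro prod.neutral ballI)
  fix p
  have 1: "cmod ((iota g * u) p powi g p) = 1" by (rule unit_powi_norm[OF solen_norm[OF solen_mult[OF iota_solen[OF assms(1)] assms(2)]]])
  have 2: "cmod (u p powi (- g p)) = 1" by (rule unit_powi_norm[OF solen_norm[OF assms(2)]])
  show "cmod (if base p = 1 then (iota g * u) p powi g p else u p powi (- g p)) = 1"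
   using 1 2 by (cases "base p = 1") (simp_all only: if_True if_False simp_thms)
 qed
 thus ?thesis by (simp add: rho_def norm_mult unit_powi_norm solen_norm[OF assms(2)])
qed

lemma twist_superset:
 assumes "finite S" "supp g \<subseteq> S" "\<And>p. p \<in> S ==> prime p"
 shows "twist g v u = (\<Prod>p\<in>S. if base p = 1 then v p powi g p else u p powi (- g p))" unfolding twist_def
 by (rule prod.mono_neutral_left) (use assms in "auto simp: supp_def")

text \<open>The reciprocity between the two families of roots that makes the local data fit together.\<close>

lemma weight_reciprocity:
 assumes p: "prime p" and q: "prime q" and bs: "base p \<noteq> base q"
 shows "real (wt p q) / real q + real (wt q p) / real p - 1 / (real p * real q) \<in> \<int>"
proof -
 have p2: "p \<ge> 2" and q2: "q \<ge> 2" using prime_ge_2_nat p q by auto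
 have ne: "p \<noteq> q" using bs by auto
 have wt: "wt p q = p ^ (q - 2)" "wt q p = q ^ (p - 2)" using bs p q p2 q2 by (simp_all add: wt_def)
 have pq: "p * p ^ (q - 2) = p ^ (q - 1)" "q * q ^ (p - 2) = q ^ (p - 1)"
 proof -
  have "q - 1 = Suc (q - 2)" "p - 1 = Suc (p - 2)" using p2 q2 by simp_all
  thus "p * p ^ (q - 2) = p ^ (q - 1)" "q * q ^ (p - 2) = q ^ (p - 1)" by simp_all
 qed
 have dv: "int a dvd int (a ^ (b - 1)) + int (b ^ (a - 1)) - 1" if a: "prime a" and b: "prime b" and "a \<noteq> b" for a b :: nat
 proof -
  have "\<not> a dvd b" using primes_dvd_imp_eq[OF a b] that by blast
  from fermat_theorem[OF a this] have "[int (b ^ (a - 1)) = int 1] (mod int a)" by (simp only: cong_int_iff)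
  hence "int a dvd int (b ^ (a - 1)) - 1" by (simp add: cong_iff_dvd_diff)
  moreover have "a dvd a ^ (b - 1)" using prime_ge_2_nat[OF b] by (intro dvd_power) simp
  hence "int a dvd int (a ^ (b - 1))" by (simp only: int_dvd_int_iff)
  ultimately have "int a dvd int (a ^ (b - 1)) + (int (b ^ (a - 1)) - 1)" by (rule dvd_add[rotated])
  thus ?thesis by (simp only: add_diff_eq)
 qed
 have "coprime (int p) (int q)" using primes_coprime[OF p q ne] by simp
 moreover have "int p dvd int (p ^ (q - 1)) + int (q ^ (p - 1)) - 1" by (rule dv[OF p q ne])
 moreover have "int q dvd int (p ^ (q - 1)) + int (q ^ (p - 1)) - 1" using dv[OF q p ne[symmetric]] by (simp only: add.commute)
 ultimately have "int p * int q dvd int (p ^ (q - 1)) + int (q ^ (p - 1)) - 1" by (rule divides_mult[rotated 2])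
 then obtain k where k: "int (p ^ (q - 1)) + int (q ^ (p - 1)) - 1 = int p * int q * k" by (rule dvdE)
 have "(real p * real q) * (real (wt p q) / real q + real (wt q p) / real p - 1 / (real p * real q))
   = real (p * p ^ (q - 2)) + real (q * q ^ (p - 2)) - 1" using p2 q2 by (simp add: wt field_simps)
 also have "... = real_of_int (int (p ^ (q - 1)) + int (q ^ (p - 1)) - 1)" by (simp only: pq of_int_add of_int_diff of_int_of_nat_eq of_int_1)
 also have "... = (real p * real q) * of_int k" unfolding k by simp
 finally have "real (wt p q) / real q + real (wt q p) / real p - 1 / (real p * real q) = of_int k" using p2 q2 by simp
 thus ?thesis by simp
qed

text \<open>For \<open>s p = shift p h\<close> this is the phase by which translation by
  \<open>iota h\<close> changes the factors of \<open>twist g\<close> belonging to the class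
  \<open>j\<close>, up to sign.\<close>

definition shiftsum :: "(nat => int) => (nat => real) => nat => real" where
 "shiftsum g s j = (\<Sum>p\<in>supp g. if base p = j then of_int (g p) * s p else 0)"

text \<open>The bilinear form of \<open>weight_reciprocity\<close>: all three terms expand into
  double sums to which only pairs with \<open>base p = 1\<close> and \<open>base q = 0\<close>
  contribute.\<close>

lemma shift_reciprocity:
 assumes g: "g \<in> GG" and h: "h \<in> GG"
 shows "shiftsum g (\<lambda>p. shift p h) 1 + shiftsum h (\<lambda>q. shift q g) 0 - shift 0 g * shift 1 h \<in> \<int>"
proof -
 have b2: "base p = 0 \<or> base p = 1" for p using base_less[of p] by linarith
 have A: "shiftsum g (\<lambda>p. shift p h) 1
   = (\<Sum>p\<in>supp g. \<Sum>q\<in>supp h. if base p = 1 \<and> base q = 0 then of_int (g p) * of_int (h q) * (real (wt p q) / real q) else 0)"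
  unfolding shiftsum_def
 proof (rule sum.cong[OF refl])
  fix p assume "p \<in> supp g"
  show "(if base p = 1 then of_int (g p) * shift p h else 0)
   = (\<Sum>q\<in>supp h. if base p = 1 \<and> base q = 0 then of_int (g p) * of_int (h q) * (real (wt p q) / real q) else 0)"
  proof (cases "base p = 1")
   case True
   have "of_int (g p) * shift p h = (\<Sum>q\<in>supp h. of_int (g p) * (real (wt p q) * of_int (h q) / real q))"
    unfolding shift_def by (rule sum_distrib_left)
   also have "... = (\<Sum>q\<in>supp h. if base p = 1 \<and> base q = 0 then of_int (g p) * of_int (h q) * (real (wt p q) / real q) else 0)"
   proof (rule sum.cong[OF refl])
    fix q
    show "of_int (g p) * (real (wt p q) * of_int (h q) / real q)
     = (if base p = 1 \<and> base q = 0 then of_int (g p) * of_int (h q) * (real (wt p q) / real q) else 0)"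
     using b2[of q] True by (auto simp: wt_def)
   qed
   finally show ?thesis using True by simp
  qed simp
 qed
 have B: "shiftsum h (\<lambda>q. shift q g) 0
   = (\<Sum>p\<in>supp g. \<Sum>q\<in>supp h. if base p = 1 \<and> base q = 0 then of_int (g p) * of_int (h q) * (real (wt q p) / real p) else 0)"
  unfolding shiftsum_def
 proof (subst sum.swap, rule sum.cong[OF refl])
  fix q assume "q \<in> supp h"
  show "(if base q = 0 then of_int (h q) * shift q g else 0)
   = (\<Sum>p\<in>supp g. if base p = 1 \<and> base q = 0 then of_int (g p) * of_int (h q) * (real (wt q p) / real p) else 0)"
  proof (cases "base q = 0")
   case True
   have "of_int (h q) * shift q g = (\<Sum>p\<in>supp g. of_int (h q) * (real (wt q p) * of_int (g p) / real p))"
    unfolding shift_def by (rule sum_distrib_left)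
   also have "... = (\<Sum>p\<in>supp g. if base p = 1 \<and> base q = 0 then of_int (g p) * of_int (h q) * (real (wt q p) / real p) else 0)"
   proof (rule sum.cong[OF refl])
    fix p
    show "of_int (h q) * (real (wt q p) * of_int (g p) / real p)
     = (if base p = 1 \<and> base q = 0 then of_int (g p) * of_int (h q) * (real (wt q p) / real p) else 0)"
     using b2[of p] True by (auto simp: wt_def)
   qed
   finally show ?thesis using True by simp
  qed simp
 qed
 have C: "shift 0 g * shift 1 h
   = (\<Sum>p\<in>supp g. \<Sum>q\<in>supp h. if base p = 1 \<and> base q = 0 then of_int (g p) * of_int (h q) * (1 / (real p * real q)) else 0)"
  unfolding shift_def sum_product
 proof (intro sum.cong refl)
  fix p q
  show "real (wt 0 p) * of_int (g p) / real p * (real (wt 1 q) * of_int (h q) / real q)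
   = (if base p = 1 \<and> base q = 0 then of_int (g p) * of_int (h q) * (1 / (real p * real q)) else 0)" using b2[of p] b2[of q] by (auto simp: wt_def)
 qed
 have "shiftsum g (\<lambda>p. shift p h) 1 + shiftsum h (\<lambda>q. shift q g) 0 - shift 0 g * shift 1 h
   = (\<Sum>p\<in>supp g. \<Sum>q\<in>supp h. if base p = 1 \<and> base q = 0 then
     of_int (g p * h q) * (real (wt p q) / real q + real (wt q p) / real p - 1 / (real p * real q)) else 0)"
  unfolding A B C sum.distrib[symmetric] sum_subtractf[symmetric] by (intro sum.cong refl) (auto simp: algebra_simps)
 also have "... \<in> \<int>"
 proof (intro Ints_sum)
  fix p q assume "p \<in> supp g" "q \<in> supp h"
  hence pr: "prime p" "prime q" by (auto dest: supp_prime)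
  show "(if base p = 1 \<and> base q = 0 then
     of_int (g p * h q) * (real (wt p q) / real q + real (wt q p) / real p - 1 / (real p * real q)) else 0) \<in> \<int>"
  proof (cases "base p = 1 \<and> base q = 0")
   case True
   hence "base p \<noteq> base q" by simp
   from Ints_mult[OF Ints_of_int[of "g p * h q"] weight_reciprocity[OF pr this]] show ?thesis using True by (simp only: if_True simp_thms)
  next
   case False
   thus ?thesis by (simp only: if_False Ints_0)
  qed
 qed
 finally show ?thesis .
qed

section \<open>The cocycle identity\<close>

lemma powi_sum: "z \<noteq> 0 ==> z powi (\<Sum>i\<in>A. f i) = (\<Prod>i\<in>A. z powi f i)" for z :: complex
 by (induction A rule: infinite_finite_induct) (simp_all add: power_int_add)

text \<open>A carry at \<open>p\<close> changes an exponent by a multiple of \<open>p\<close>, and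
  the \<open>p\<close>-th power of a root is a free coordinate; so all carries collect in
  \<open>v 1\<close> and \<open>u 0\<close>.\<close>

lemma twist_mult:
 assumes g: "g \<in> GG" and h: "h \<in> GG" and v: "v \<in> solen" and u: "u \<in> solen"
 shows "twist (g \<cdot> h) v u = twist g v u * twist h v u * v 1 powi (- total_carry 0 g h) * u 0 powi (total_carry 1 g h)"
proof -
 let ?S = "supp g \<union> supp h"
 have S: "finite ?S" "\<And>p. p \<in> ?S ==> prime p" using finite_supp[OF g] finite_supp[OF h] supp_prime by auto
 have b2: "base p = 0 \<or> base p = 1" for p using base_less[of p] by linarith
 have tc0: "v 1 powi (- total_carry 0 g h) = (\<Prod>p\<in>?S. if base p = 1 then v 1 powi (- carry g h p) else 1)"
 proof -
  have "- total_carry 0 g h = (\<Sum>p\<in>?S. if base p = 1 then - carry g h p else 0)" unfolding total_carry_def sum_negf[symmetric]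
  proof (rule sum.cong[OF refl])
   fix p
   show "- (int (wt 0 p) * carry g h p) = (if base p = 1 then - carry g h p else 0)" using b2[of p] by (auto simp: wt_def)
  qed
  hence "v 1 powi (- total_carry 0 g h) = (\<Prod>p\<in>?S. v 1 powi (if base p = 1 then - carry g h p else 0))"
   using solen_nz[OF v] by (simp add: powi_sum)
  also have "... = (\<Prod>p\<in>?S. if base p = 1 then v 1 powi (- carry g h p) else 1)" by (rule prod.cong) auto
  finally show ?thesis .
 qed
 have tc1: "u 0 powi (total_carry 1 g h) = (\<Prod>p\<in>?S. if base p = 1 then 1 else u 0 powi (carry g h p))"
 proof -
  have "total_carry 1 g h = (\<Sum>p\<in>?S. if base p = 1 then 0 else carry g h p)" unfolding total_carry_def
  proof (rule sum.cong[OF refl])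
   fix p
   show "int (wt 1 p) * carry g h p = (if base p = 1 then 0 else carry g h p)" using b2[of p] by (auto simp: wt_def)
  qed
  hence "u 0 powi (total_carry 1 g h) = (\<Prod>p\<in>?S. u 0 powi (if base p = 1 then 0 else carry g h p))" using solen_nz[OF u] by (simp add: powi_sum)
  also have "... = (\<Prod>p\<in>?S. if base p = 1 then 1 else u 0 powi (carry g h p))" by (rule prod.cong) auto
  finally show ?thesis .
 qed
 have "twist (g \<cdot> h) v u = (\<Prod>p\<in>?S. if base p = 1 then v p powi (g \<cdot> h) p else u p powi (- (g \<cdot> h) p))"
  by (rule twist_superset[OF S(1) supp_mult S(2)])
 also have "... = (\<Prod>p\<in>?S. (if base p = 1 then v p powi g p else u p powi (- g p)) * (if base p = 1 then v p powi h p else u p powi (- h p))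
   * (if base p = 1 then v 1 powi (- carry g h p) else 1) * (if base p = 1 then 1 else u 0 powi (carry g h p)))"
 proof (rule prod.cong[OF refl])
  fix p assume "p \<in> ?S"
  hence p: "prime p" by (rule S(2))
  show "(if base p = 1 then v p powi (g \<cdot> h) p else u p powi (- (g \<cdot> h) p)) = (if base p = 1 then v p powi g p else u p powi (- g p))
   * (if base p = 1 then v p powi h p else u p powi (- h p))
   * (if base p = 1 then v 1 powi (- carry g h p) else 1) * (if base p = 1 then 1 else u 0 powi (carry g h p))"
  proof (cases "base p = 1")
   case True
   have e: "(g \<cdot> h) p = g p + h p + int p * (- carry g h p)" by (simp add: PG_mult_apply[OF p])
   have "v p powi (g \<cdot> h) p = v p powi g p * v p powi h p * v p powi (int p * (- carry g h p))"
    unfolding e using solen_nz[OF v, of p] by (simp only: power_int_add simp_thms)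
   also have "v p powi (int p * (- carry g h p)) = v 1 powi (- carry g h p)" using solen_power[OF v p] True by (simp only: power_int_power[symmetric])
   finally show ?thesis using True by simp
  next
   case False
   hence b0: "base p = 0" using b2[of p] by simp
   have e: "- (g \<cdot> h) p = - g p + - h p + int p * carry g h p" by (simp add: PG_mult_apply[OF p])
   have "u p powi (- (g \<cdot> h) p) = u p powi (- g p) * u p powi (- h p) * u p powi (int p * carry g h p)"
    unfolding e using solen_nz[OF u, of p] by (simp only: power_int_add simp_thms)
   also have "u p powi (int p * carry g h p) = u 0 powi carry g h p" using solen_power[OF u p] b0 by (simp only: power_int_power[symmetric])
   finally show ?thesis using False by simp
  qed
 qed
 also have "... = twist g v u * twist h v u * v 1 powi (- total_carry 0 g h) * u 0 powi (total_carry 1 g h)" unfolding tc0 tc1 prod.distrib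
  using twist_superset[OF S(1) Un_upper1 S(2), of v u] twist_superset[OF S(1) Un_upper2 S(2), of v u] by simp
 finally show ?thesis .
qed

lemma twist_left:
 assumes "w \<in> solen" "v \<in> solen" "g \<in> GG"
 shows "twist g (w * v) u = twist g v u * (\<Prod>p\<in>supp g. if base p = 1 then w p powi g p else 1)" unfolding twist_def prod.distrib[symmetric]
 by (rule prod.cong) (auto simp: power_int_mult_distrib)

lemma twist_right:
 assumes "w \<in> solen" "u \<in> solen" "g \<in> GG"
 shows "twist g v (w * u) = twist g v u * (\<Prod>p\<in>supp g. if base p = 1 then 1 else w p powi (- g p))" unfolding twist_def prod.distrib[symmetric]
 by (rule prod.cong) (auto simp: power_int_mult_distrib)

lemma iota_prod_left:
 "(\<Prod>p\<in>supp g. if base p = 1 then iota h p powi g p else 1) = ee (shiftsum g (\<lambda>p. shift p h) 1)"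
 unfolding shiftsum_def ee_sum by (rule prod.cong) (auto simp: iota_def ee_powi)

lemma iota_prod_right:
 "(\<Prod>p\<in>supp h. if base p = 1 then 1 else iota g p powi (- h p)) = ee (- shiftsum h (\<lambda>p. shift p g) 0)"
 unfolding shiftsum_def sum_negf[symmetric] ee_sum
proof (rule prod.cong[OF refl])
 fix p
 have "base p = 0 \<or> base p = 1" using base_less[of p] by linarith
 thus "(if base p = 1 then 1 else iota g p powi (- h p)) = ee (- (if base p = 0 then of_int (h p) * shift p g else 0))" by (auto simp: iota_def ee_powi)
qed

text \<open>The carries of \<open>twist\<close> cancel against those of \<open>shift 0\<close> and
  of the winding number. What is left is a phase depending on \<open>g\<close> and \<open>h\<close>
  alone, and reciprocity makes it an integer.\<close>

theorem rho_mult: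
 assumes g: "g \<in> GG" and h: "h \<in> GG" and u: "u \<in> solen"
 shows "rho (g \<cdot> h) u = rho g u * rho h (iota g * u)"
proof -
 define u1 where "u1 = iota g * u"
 define u2 where "u2 = iota h * u1"
 have ig: "iota g \<in> solen" and ih: "iota h \<in> solen" using iota_solen g h by auto
 have u1: "u1 \<in> solen" and u2: "u2 \<in> solen" using solen_mult ig ih u by (auto simp: u1_def u2_def)
 have gh: "g \<cdot> h \<in> GG" using g h by simp
 have i2: "iota (g \<cdot> h) * u = u2" unfolding iota_mult[OF g h] u1_def u2_def by (simp only: mult_ac)
 define a b c where "a = shift 0 g" and "b = shift 0 h" and "c = shift 1 h"
 define C0 C1 where "C0 = total_carry 0 g h" and "C1 = total_carry 1 g h"
 define k1 k2 where "k1 = wind g u" and "k2 = wind h u1"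
 have k1: "real_of_int k1 = angle u + shift 1 g - angle u1" using wind_eq[OF g u] by (simp add: k1_def u1_def)
 have k2: "real_of_int k2 = angle u1 + c - angle u2" using wind_eq[OF h u1] by (simp add: k2_def u2_def c_def)
 have "real_of_int (wind (g \<cdot> h) u) = angle u + (shift 1 g + shift 1 h - of_int C1) - angle u2"
  using wind_eq[OF gh u] by (simp add: i2 shift_mult[OF g h] C1_def)
 also have "... = real_of_int (k1 + k2 - C1)" using k1 k2 by (simp add: c_def)
 finally have kk: "wind (g \<cdot> h) u = k1 + k2 - C1" by linarith
 have nz0: "u 0 \<noteq> 0" by (rule solen_nz[OF u])
 have L: "rho (g \<cdot> h) u = twist g u2 u * twist h u2 u * ee (- (angle u2 * (a + b))) * (u 0 powi k1 * u 0 powi k2)"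
 proof -
  \<comment> \<open>Since \<open>u2 1\<close> is \<open>ee (angle u2)\<close>, the carry
    \<open>C0\<close> of the twist undoes the reduction of \<open>shift 0\<close>; \<open>C1\<close>
    is treated in the same way with the winding number.\<close>
  have "u2 1 powi (- C0) = ee (- (angle u2 * of_int C0))" using ee_angle[OF u2] by (metis ee_powi mult.commute mult_minus_left of_int_minus)
  moreover have "ee (- (angle u2 * (a + b - of_int C0))) = ee (- (angle u2 * (a + b))) * ee (angle u2 * of_int C0)"
   by (simp add: ee_add[symmetric] algebra_simps)
  moreover have "ee (- (angle u2 * of_int C0)) * ee (angle u2 * of_int C0) = 1" by (simp add: ee_add[symmetric])
  moreover have "u 0 powi C1 * u 0 powi (k1 + k2 - C1) = u 0 powi k1 * u 0 powi k2" using nz0 by (simp add: power_int_add[symmetric])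
  ultimately show ?thesis unfolding rho_def i2 twist_mult[OF g h u2 u] shift_mult[OF g h] kk C0_def[symmetric] C1_def[symmetric]
    a_def[symmetric] b_def[symmetric] by (simp add: mult_ac) (simp add: mult.assoc[symmetric])
 qed
 have tg: "twist g u2 u = twist g u1 u * ee (shiftsum g (\<lambda>p. shift p h) 1)" unfolding u2_def twist_left[OF ih u1 g] iota_prod_left ..
 have th: "twist h u2 u1 = twist h u2 u * ee (- shiftsum h (\<lambda>p. shift p g) 0)" unfolding u1_def twist_right[OF ig u h] iota_prod_right ..
 have x1: "u1 0 powi k2 = ee (of_int k2 * a) * u 0 powi k2" by (simp add: u1_def power_int_mult_distrib iota_def ee_powi a_def)
 have R: "rho g u * rho h u1 = twist g u1 u * ee (- (angle u1 * a)) * u 0 powi k1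
   * (twist h u2 u * ee (- shiftsum h (\<lambda>p. shift p g) 0) * ee (- (angle u2 * b)) * (ee (of_int k2 * a) * u 0 powi k2))"
  unfolding rho_def u1_def[symmetric] u2_def[symmetric] k1_def[symmetric] k2_def[symmetric] th x1 a_def[symmetric] b_def[symmetric]
  by (simp only: mult_ac)
 \<comment> \<open>Inserting the value of \<open>k2\<close> leaves exactly the expression that
   \<open>shift_reciprocity\<close> places among the integers.\<close>
 have key: "ee (shiftsum g (\<lambda>p. shift p h) 1 + - (angle u2 * (a + b)))
   = ee (- (angle u1 * a) + - shiftsum h (\<lambda>p. shift p g) 0 + - (angle u2 * b) + of_int k2 * a)"
 proof (rule ee_eqI)
  have "shiftsum g (\<lambda>p. shift p h) 1 + - (angle u2 * (a + b))
    - (- (angle u1 * a) + - shiftsum h (\<lambda>p. shift p g) 0 + - (angle u2 * b) + of_int k2 * a)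
   = shiftsum g (\<lambda>p. shift p h) 1 + shiftsum h (\<lambda>p. shift p g) 0 - a * c" unfolding k2 by (simp add: algebra_simps)
  also have "... \<in> \<int>" using shift_reciprocity[OF g h] by (simp only: a_def c_def)
  finally show "shiftsum g (\<lambda>p. shift p h) 1 + - (angle u2 * (a + b))
    - (- (angle u1 * a) + - shiftsum h (\<lambda>p. shift p g) 0 + - (angle u2 * b) + of_int k2 * a) \<in> \<int>" .
 qed
 have "rho (g \<cdot> h) u = twist g u1 u * twist h u2 u * (u 0 powi k1 * u 0 powi k2)
   * ee (shiftsum g (\<lambda>p. shift p h) 1 + - (angle u2 * (a + b)))" unfolding L tg ee_add by (simp only: mult_ac)
 also have "... = rho g u * rho h u1"
  apply (subst key) unfolding R ee_add by (simp only: mult_ac)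
 finally show ?thesis by (simp only: u1_def)
qed

text \<open>Equivariance under the kernel of the projection to the torus. This forces the extension to be
 relatively mixing.\<close>

lemma rho_kern:
 assumes g: "g \<in> GG" and u: "u \<in> solen" and w: "w \<in> kern"
 shows "rho g (w * u) = rho g u * (\<Prod>p\<in>supp g. w p powi (if base p = 1 then g p else - g p))"
proof -
 have ws: "w \<in> solen" and w0: "w 0 = 1" and w1: "w 1 = 1" using w by (auto simp: kern_def)
 have ig: "iota g \<in> solen" by (rule iota_solen[OF g])
 have ang: "angle (w * v) = angle v" for v using w1 by (simp add: angle_def)
 have c: "iota g * (w * u) = w * (iota g * u)" by (simp only: mult_ac)
 have wd: "wind g (w * u) = wind g u" by (simp only: wind_def c ang)
 have "twist g (w * (iota g * u)) (w * u) = twist g (iota g * u) u * (\<Prod>p\<in>supp g. if base p = 1 then w p powi g p else 1)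
    * (\<Prod>p\<in>supp g. if base p = 1 then 1 else w p powi (- g p))"
  unfolding twist_left[OF ws solen_mult[OF ig u] g] twist_right[OF ws u g] by (simp only: mult_ac)
 also have "... = twist g (iota g * u) u * (\<Prod>p\<in>supp g. w p powi (if base p = 1 then g p else - g p))"
  unfolding mult.assoc prod.distrib[symmetric] by (intro arg_cong2[where f="(*)"] refl prod.cong) auto
 finally show ?thesis unfolding rho_def c ang wd using w0 by (simp add: mult_ac)
qed

lemma angle_measurable [measurable]: "angle \<in> borel_measurable haar" unfolding angle_def[abs_def] by measurable

lemma rho_measurable:
 assumes g: "g \<in> GG"
 shows "rho g \<in> borel_measurable haar"
proof -
 have [measurable]: "(\<lambda>u. iota g * u) \<in> measurable haar haar" by (rule translate_measurable[OF iota_solen[OF g]])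
 have m [measurable]: "(\<lambda>u. angle (iota g * u)) \<in> borel_measurable haar" by (rule m_comp[OF _ angle_measurable]) measurable
 have pw: "(\<lambda>u. (v u) powi n) \<in> borel_measurable haar" if "v \<in> borel_measurable haar" for v :: "sol => complex" and n
  by (rule m_comp[OF that measurable_powi])
 have tw: "(\<lambda>u. twist g (iota g * u) u) \<in> borel_measurable haar" unfolding twist_def
 proof (rule borel_measurable_prod)
  fix p
  have "(\<lambda>u. (iota g * u) p) \<in> borel_measurable haar" by simp
  from pw[OF this] pw[OF haar_coord]
  show "(\<lambda>u. if base p = 1 then (iota g * u) p powi g p else u p powi (- g p)) \<in> borel_measurable haar"
   by (cases "base p = 1") (simp_all only: if_True if_False simp_thms)
 qed
 have wm: "(\<lambda>u. wind g u) \<in> measurable haar (count_space UNIV)" unfolding wind_def by measurable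
 have wp: "(\<lambda>u. u 0 powi wind g u) \<in> borel_measurable haar"
  by (rule measurable_compose_countable[where f="\<lambda>i u. u 0 powi i" and g="wind g"]) (rule pw[OF haar_coord], rule wm)
 have e: "(\<lambda>u. ee (- (angle (iota g * u) * shift 0 g))) \<in> borel_measurable haar" by measurable
 show ?thesis unfolding rho_def[abs_def] by (intro borel_measurable_times tw e wp)
qed

section \<open>The skew product\<close>

lemma circle_id_measurable [measurable]: "(\<lambda>z. z) \<in> borel_measurable CM"
 unfolding measurable_cong_sets[OF sets_circle refl] by (rule measurable_restrict_space1) simp

lemma measurable_into_circle:
 assumes "f \<in> borel_measurable M" "\<And>x. x \<in> space M ==> cmod (f x) = 1"
 shows "f \<in> measurable M CM" unfolding measurable_cong_sets[OF refl sets_circle] by (rule measurable_restrict_space2) (use assms in auto)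

lemma circle_valuedI:
 assumes "f \<in> borel_measurable M" "\<And>x. x \<in> space M ==> cmod (f x) = 1"
 shows "circle_valued M f" unfolding circle_valued_def by (rule measurable_restrict_space2) (use assms in auto)

lemma circle_valuedD:
 assumes "circle_valued M f"
 shows "f \<in> borel_measurable M" "\<And>x. x \<in> space M ==> cmod (f x) = 1"
proof -
 have f: "f \<in> measurable M (restrict_space borel (sphere 0 1))" using assms by (simp add: circle_valued_def)
 thus "f \<in> borel_measurable M" by (simp add: measurable_restrict_space2_iff)
 show "cmod (f x) = 1" if "x \<in> space M" for x using measurable_space[OF f that] by (simp add: space_restrict_space)
qed

lemma sigma_finite_circle: "sigma_finite_measure CM" by (rule prob_space_imp_sigma_finite[OF prob_space_circle])

text \<open>The base is arbitrary, since the construction is also iterated four times over the space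
  of parallelograms.\<close>

definition skew :: "('b => 'b) => ('b => complex) => 'b \<times> complex => 'b \<times> complex" where
 "skew ta r z = (ta (fst z), r (fst z) * snd z)"

lemma skew_measurable:
 assumes [measurable]: "ta \<in> measurable B B" "r \<in> borel_measurable B" and r1: "\<And>b. b \<in> space B ==> cmod (r b) = 1"
 shows "skew ta r \<in> measurable (B \<Otimes>\<^sub>M CM) (B \<Otimes>\<^sub>M CM)" unfolding skew_def[abs_def]
proof (rule measurable_Pair)
 show "(\<lambda>z. ta (fst z)) \<in> measurable (B \<Otimes>\<^sub>M CM) B" by measurable
 have "(\<lambda>z. snd z) \<in> borel_measurable (B \<Otimes>\<^sub>M CM)" by (rule m_comp[OF measurable_snd circle_id_measurable])
 thus "(\<lambda>z. r (fst z) * snd z) \<in> measurable (B \<Otimes>\<^sub>M CM) CM"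
  by (intro measurable_into_circle) (auto simp: space_pair_measure norm_mult r1)
qed

text \<open>Fubini: for fixed \<open>b\<close> the fibre is rotated, which preserves arc length, and
  the remaining function of \<open>b\<close> is composed with a measure-preserving map.\<close>

lemma skew_distr:
 assumes B: "prob_space B" and tm: "ta \<in> measurable B B" and td: "distr B B ta = B"
  and rm: "r \<in> borel_measurable B" and r1: "\<And>b. b \<in> space B ==> cmod (r b) = 1"
 shows "distr (B \<Otimes>\<^sub>M CM) (B \<Otimes>\<^sub>M CM) (skew ta r) = B \<Otimes>\<^sub>M CM"
proof (rule measure_eqI)
 interpret B: prob_space B by (rule B)
 let ?P = "B \<Otimes>\<^sub>M CM"
 note sm = skew_measurable[OF tm rm r1]
 show "sets (distr ?P ?P (skew ta r)) = sets ?P" by simp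
 fix A assume "A \<in> sets (distr ?P ?P (skew ta r))"
 hence A: "A \<in> sets ?P" by simp
 have A': "skew ta r -` A \<inter> space ?P \<in> sets ?P" by (rule measurable_sets[OF sm A])
 define H where "H b = (\<integral>\<^sup>+z. indicator A (b, z) \<partial>CM)" for b
 have Hm: "H \<in> borel_measurable B"
  unfolding H_def[abs_def] by (rule sigma_finite_measure.borel_measurable_nn_integral_fst[OF sigma_finite_circle, of "indicator A"]) (use A in simp)
 have "emeasure (distr ?P ?P (skew ta r)) A = emeasure ?P (skew ta r -` A \<inter> space ?P)" by (rule emeasure_distr[OF sm A])
 also have "... = (\<integral>\<^sup>+b. \<integral>\<^sup>+z. indicator (skew ta r -` A \<inter> space ?P) (b, z) \<partial>CM \<partial>B)"
  by (rule sigma_finite_measure.emeasure_pair_measure[OF sigma_finite_circle A'])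
 also have "... = (\<integral>\<^sup>+b. H (ta b) \<partial>B)"
 proof (rule nn_integral_cong)
  fix b assume b: "b \<in> space B"
  have tb: "ta b \<in> space B" by (rule measurable_space[OF tm b])
  have rb: "r b \<in> sphere 0 1" using r1[OF b] by simp
  have m: "(\<lambda>z. indicator A (ta b, z) :: ennreal) \<in> borel_measurable CM"
  proof -
   have "(\<lambda>z. (ta b, z)) \<in> measurable CM ?P" by (rule measurable_Pair1'[OF tb])
   from m_comp[OF this borel_measurable_indicator[OF A]] show ?thesis .
  qed
  have "(\<integral>\<^sup>+z. indicator (skew ta r -` A \<inter> space ?P) (b, z) \<partial>CM)
    = (\<integral>\<^sup>+z. indicator A (ta b, r b * z) \<partial>CM)"
   by (rule nn_integral_cong) (auto simp: indicator_def skew_def space_pair_measure b)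
  also have "... = (\<integral>\<^sup>+z. indicator A (ta b, z) \<partial>distr CM CM (\<lambda>z. r b * z))"
   by (rule nn_integral_distr[OF circle_rotation_measurable[OF rb], symmetric]) (use m in simp)
  also have "... = H (ta b)" unfolding H_def circle_rotation[OF rb] ..
  finally show "(\<integral>\<^sup>+z. indicator (skew ta r -` A \<inter> space ?P) (b, z) \<partial>CM) = H (ta b)" .
 qed
 also have "... = (\<integral>\<^sup>+b. H b \<partial>distr B B ta)" by (rule nn_integral_distr[OF tm, symmetric]) (use Hm in simp)
 also have "... = (\<integral>\<^sup>+b. H b \<partial>B)" unfolding td ..
 also have "... = emeasure ?P A" unfolding H_def by (rule sigma_finite_measure.emeasure_pair_measure[OF sigma_finite_circle A, symmetric])
 finally show "emeasure (distr ?P ?P (skew ta r)) A = emeasure ?P A" .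
qed

definition alpha :: "(nat => int) => sol => sol" where
 "alpha g = (\<lambda>u\<in>solen. iota g * u)"

abbreviation "XM \<equiv> extension_measure haar"
abbreviation "TX \<equiv> extension_action haar alpha rho"

lemma XM_def: "XM = haar \<Otimes>\<^sub>M CM" by (rule extension_measure_def)

lemma space_XM: "space XM = solen \<times> sphere 0 1" by (simp add: XM_def space_pair_measure)

interpretation X: pair_prob_space haar CM ..
interpretation XM: prob_space XM unfolding XM_def by (rule X.prob_space_axioms)

lemma alpha_eq: "u \<in> solen ==> alpha g u = iota g * u" by (simp add: alpha_def)

lemma TX_eq: "x \<in> space XM ==> TX g x = (iota g * fst x, rho g (fst x) * snd x)" by (auto simp: extension_action_def space_XM alpha_eq)

lemma TX_skew: "x \<in> space XM ==> TX g x = skew (\<lambda>u. iota g * u) (rho g) x" by (simp add: TX_eq skew_def)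

lemma mp_alpha: "mp_action PG haar alpha"
proof (unfold_locales)
 fix g assume g: "g \<in> GG"
 have m: "(\<lambda>u. iota g * u) \<in> measurable haar haar" by (rule translate_measurable[OF iota_solen[OF g]])
 show "alpha g \<in> measurable haar haar" using m by (rule measurable_cong[THEN iffD1, rotated]) (simp add: alpha_eq)
 have "distr haar haar (alpha g) = distr haar haar (\<lambda>u. iota g * u)" by (rule distr_cong) (simp_all add: alpha_eq)
 thus "distr haar haar (alpha g) = haar" using distr_haar_translate[OF iota_solen[OF g]] by simp
next
 fix g h x assume gh: "g \<in> GG" "h \<in> GG" and x: "x \<in> space haar"
 thus "alpha (g \<cdot> h) x = alpha g (alpha h x)" using iota_solen[OF gh(2)] by (simp add: alpha_eq solen_mult iota_mult mult.assoc)
qed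

lemma mp_TX: "mp_action PG XM TX"
proof (unfold_locales)
 fix g assume g: "g \<in> GG"
 have ig: "iota g \<in> solen" by (rule iota_solen[OF g])
 have m: "skew (\<lambda>u. iota g * u) (rho g) \<in> measurable XM XM"
  unfolding XM_def by (rule skew_measurable[OF translate_measurable[OF ig] rho_measurable[OF g]]) (simp add: rho_norm g)
 show "TX g \<in> measurable XM XM" using m by (rule measurable_cong[THEN iffD1, rotated]) (simp add: TX_skew)
 have "distr XM XM (TX g) = distr XM XM (skew (\<lambda>u. iota g * u) (rho g))" by (rule distr_cong) (simp_all add: TX_skew)
 also have "... = XM" unfolding XM_def by (rule skew_distr[OF haar_prob translate_measurable[OF ig] distr_haar_translate[OF ig] rho_measurable[OF g]])
   (simp add: rho_norm g)
 finally show "distr XM XM (TX g) = XM" .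
next
 fix g h x assume gh: "g \<in> GG" "h \<in> GG" and x: "x \<in> space XM"
 have u: "fst x \<in> solen" using x by (auto simp: space_XM)
 have ih: "iota h * fst x \<in> solen" by (rule solen_mult[OF iota_solen[OF gh(2)] u])
 have hx: "TX h x \<in> space XM" using x ih rho_norm[OF gh(2) u] by (auto simp: TX_eq[OF x] space_XM norm_mult)
 \<comment> \<open>\<open>rho_mult\<close> lets the left factor act first, the action law the right
   one; commutativity of the group reconciles the two.\<close>
 have "rho (h \<cdot> g) (fst x) = rho h (fst x) * rho g (iota h * fst x)" by (rule rho_mult[OF gh(2,1) u])
 hence "rho (g \<cdot> h) (fst x) = rho h (fst x) * rho g (iota h * fst x)" using PG.m_comm[OF gh] by simp
 thus "TX (g \<cdot> h) x = TX g (TX h x)" unfolding TX_eq[OF hx] unfolding TX_eq[OF x] by (simp only: fst_conv snd_conv iota_mult[OF gh] mult_ac)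
qed

interpretation UA: mp_action PG haar alpha by (rule mp_alpha)
interpretation XA: mp_action PG XM TX by (rule mp_TX)

lemma XM_fst [measurable]: "fst \<in> measurable XM haar" unfolding XM_def by (rule measurable_fst)

lemma XM_snd [measurable]: "snd \<in> borel_measurable XM" unfolding XM_def by (rule m_comp[OF measurable_snd circle_id_measurable])

lemma integral_XM_fst:
 fixes f :: "sol => 'b :: {banach, second_countable_topology}"
 assumes "f \<in> borel_measurable haar"
 shows "(LINT x|XM. f (fst x)) = (LINT u|haar. f u)"
proof -
 have "distr XM haar fst = haar" unfolding XM_def by (rule prob_space.distr_pair_fst[OF prob_space_circle])
 thus ?thesis using integral_distr[OF XM_fst assms] by simp
qed

lemma integral_XM:
 fixes f :: "sol \<times> complex => complex"
 assumes "integrable XM f"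
 shows "(LINT x|XM. f x) = (LINT u|haar. (LINT z|CM. f (u, z)))" using X.integral_fst'[of f] assms by (simp add: XM_def)

section \<open>Trigonometric polynomials\<close>

definition xchar :: "(sol => complex) => int => sol \<times> complex => complex" where
 "xchar xi n x = xi (fst x) * snd x powi n"

inductive_set trigX :: "(sol \<times> complex => complex) set" where
 basic: "xi \<in> chars ==> (\<lambda>x. c * xchar xi n x) \<in> trigX"
| add: "f \<in> trigX ==> g \<in> trigX ==> (\<lambda>x. f x + g x) \<in> trigX"

inductive_set trigU :: "(sol => complex) set" where
 basic: "xi \<in> chars ==> (\<lambda>u. c * xi u) \<in> trigU"
| add: "f \<in> trigU ==> g \<in> trigU ==> (\<lambda>u. f u + g u) \<in> trigU"

abbreviation "XS \<equiv> solen \<times> sphere (0::complex) 1"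

text \<open>The extension measure lives on the product sigma-algebra, while systems and the density
  argument refer to Borel sets of the topology. Both are generated by countably many
  coordinates.\<close>

lemma sets_XM: "sets XM = sets (restrict_space borel XS)"
proof (rule antisym)
 let ?R = "restrict_space (borel :: (sol \<times> complex) measure) XS"
 have spR: "space ?R = XS" by (simp add: space_restrict_space)
 have f: "(\<lambda>x. fst x) \<in> borel_measurable ?R" "(\<lambda>x. snd x) \<in> borel_measurable ?R"
  by (intro measurable_restrict_space1 borel_measurable_continuous_onI continuous_intros)+
 have c: "(\<lambda>u::nat => complex. u i) \<in> borel_measurable borel" for i by (rule borel_measurable_continuous_onI[OF continuous_on_coord])
 have "(\<lambda>x. (fst x, snd x)) \<in> measurable ?R XM" unfolding XM_def
 proof (rule measurable_Pair)
  show "(\<lambda>x. fst x) \<in> measurable ?R haar" by (rule measurable_into_haar) (use m_comp[OF f(1) c] spR in auto)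
  show "(\<lambda>x. snd x) \<in> measurable ?R CM" by (rule measurable_into_circle) (use f(2) spR in auto)
 qed
 hence id1: "(\<lambda>x. x) \<in> measurable ?R XM" by simp
 show "sets XM \<subseteq> sets ?R"
 proof
  fix A assume A: "A \<in> sets XM"
  have "(\<lambda>x. x) -` A \<inter> space ?R = A" using sets.sets_into_space[OF A] by (auto simp: space_XM spR)
  thus "A \<in> sets ?R" using measurable_sets[OF id1 A] by simp
 qed
 have "(\<lambda>u. u) \<in> borel_measurable haar" by (rule measurable_into_fun) measurable
 from m_comp[OF XM_fst this] have "(\<lambda>x. fst x) \<in> borel_measurable XM" .
 hence "(\<lambda>x. (fst x, snd x)) \<in> measurable XM (borel \<Otimes>\<^sub>M borel)" by (rule measurable_Pair) (rule XM_snd)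
 hence "(\<lambda>x. x) \<in> borel_measurable XM" by (simp add: borel_prod)
 hence id2: "(\<lambda>x. x) \<in> measurable XM ?R" by (rule measurable_restrict_space2[rotated]) (simp add: space_XM)
 show "sets ?R \<subseteq> sets XM"
 proof
  fix A assume A: "A \<in> sets ?R"
  have "(\<lambda>x. x) -` A \<inter> space XM = A" using sets.sets_into_space[OF A] by (auto simp: space_XM spR)
  thus "A \<in> sets XM" using measurable_sets[OF id2 A] by simp
 qed
qed

lemma xchar_norm: "xi \<in> chars ==> x \<in> space XM ==> cmod (xchar xi n x) = 1" by (auto simp: xchar_def space_XM norm_mult chars_norm unit_powi_norm)

lemma xchar_measurable: "xi \<in> chars ==> xchar xi n \<in> borel_measurable XM" unfolding xchar_def[abs_def]
 by (intro borel_measurable_times m_comp[OF XM_fst chars_measurable] m_comp[OF XM_snd measurable_powi])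

lemma xchar_square: "xi \<in> chars ==> sqi XM (xchar xi n)"
 by (rule XM.sqi_bounded[where B=1]) (auto intro: xchar_measurable simp: xchar_norm intro!: AE_I2)

lemma trigX_cmult: "f \<in> trigX ==> (\<lambda>x. c * f x) \<in> trigX"
 by (induction rule: trigX.induct) (auto simp: mult.assoc[symmetric] distrib_left intro: trigX.intros)

lemma trigX_square: "f \<in> trigX ==> sqi XM f" by (induction rule: trigX.induct) (auto intro: sqi_cmult xchar_square sqi_add)

lemma trigX_const: "(\<lambda>_. c) \<in> trigX" using trigX.basic[OF chars.one, of c 0] by (simp add: xchar_def)

text \<open>The product is replaced by a polynomial that agrees with it on \<open>XS\<close>: adding
  integer exponents requires a nonzero fibre coordinate.\<close>

lemma trigX_mult:
 assumes f: "f \<in> trigX" and g: "g \<in> trigX"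
 shows "\<exists>h\<in>trigX. \<forall>x\<in>XS. h x = f x * g x" using f
proof induction
 case (basic xi c n)
 from g show ?case
 proof induction
  case (basic pz d m)
  show ?case
  proof (rule bexI)
   show "(\<lambda>x. (c * d) * xchar (\<lambda>u. xi u * pz u) (n + m) x) \<in> trigX"
    by (rule trigX.basic) (rule chars_mult_closed[OF \<open>xi \<in> chars\<close> \<open>pz \<in> chars\<close>])
   show "\<forall>x\<in>XS. (c * d) * xchar (\<lambda>u. xi u * pz u) (n + m) x = c * xchar xi n x * (d * xchar pz m x)"
   proof
    fix x :: "sol \<times> complex" assume "x \<in> XS"
    hence "snd x \<noteq> 0" by auto
    thus "(c * d) * xchar (\<lambda>u. xi u * pz u) (n + m) x = c * xchar xi n x * (d * xchar pz m x)" by (simp add: xchar_def power_int_add)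
   qed
  qed
 next
  case (add g1 g2)
  obtain h1 where h1: "h1 \<in> trigX" "\<forall>x\<in>XS. h1 x = c * xchar xi n x * g1 x" using add.IH(1) by (elim bexE)
  obtain h2 where h2: "h2 \<in> trigX" "\<forall>x\<in>XS. h2 x = c * xchar xi n x * g2 x" using add.IH(2) by (elim bexE)
  show ?case by (rule bexI[OF _ trigX.add[OF h1(1) h2(1)]]) (simp add: distrib_left h1(2) h2(2))
 qed
next
 case (add f1 f2)
 obtain h1 where h1: "h1 \<in> trigX" "\<forall>x\<in>XS. h1 x = f1 x * g x" using add.IH(1) by (elim bexE)
 obtain h2 where h2: "h2 \<in> trigX" "\<forall>x\<in>XS. h2 x = f2 x * g x" using add.IH(2) by (elim bexE)
 show ?case by (rule bexI[OF _ trigX.add[OF h1(1) h2(1)]]) (simp add: distrib_right h1(2) h2(2))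
qed

lemma compact_XS: "compact XS" by (rule compact_Times[OF compact_solen]) simp

lemma trigX_coord:
 "(\<lambda>x. of_real (Re (fst x i))) \<in> trigX" "(\<lambda>x. of_real (Im (fst x i))) \<in> trigX"
proof -
 have u: "(\<lambda>x. c * xchar (\<lambda>u. u i * 1) 0 x) \<in> trigX" "(\<lambda>x. c * xchar (\<lambda>u. cnj (u i) * 1) 0 x) \<in> trigX" for c
  by (intro trigX.basic chars.intros)+
 have "(\<lambda>x. 1 / 2 * xchar (\<lambda>u. u i * 1) 0 x + 1 / 2 * xchar (\<lambda>u. cnj (u i) * 1) 0 x) \<in> trigX"
  by (rule trigX.add[OF u(1) u(2)])
 moreover have "1 / 2 * xchar (\<lambda>u. u i * 1) 0 x + 1 / 2 * xchar (\<lambda>u. cnj (u i) * 1) 0 x = of_real (Re (fst x i))" for x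
  by (simp add: xchar_def complex_eq_iff)
 ultimately show "(\<lambda>x. of_real (Re (fst x i))) \<in> trigX" by simp
 have "(\<lambda>x. - \<i> / 2 * xchar (\<lambda>u. u i * 1) 0 x + \<i> / 2 * xchar (\<lambda>u. cnj (u i) * 1) 0 x) \<in> trigX"
  by (rule trigX.add[OF u(1) u(2)])
 moreover have "- \<i> / 2 * xchar (\<lambda>u. u i * 1) 0 x + \<i> / 2 * xchar (\<lambda>u. cnj (u i) * 1) 0 x = of_real (Im (fst x i))" for x
  by (simp add: xchar_def complex_eq_iff)
 ultimately show "(\<lambda>x. of_real (Im (fst x i))) \<in> trigX" by simp
qed

lemma trigX_fibre:
 "\<exists>Q\<in>trigX. \<forall>x\<in>XS. Q x = of_real (Re (snd x))" "\<exists>Q\<in>trigX. \<forall>x\<in>XS. Q x = of_real (Im (snd x))"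
proof -
 have u: "(\<lambda>x. c * xchar (\<lambda>u. 1) n x) \<in> trigX" for c n by (intro trigX.basic chars.intros)
 have inv: "snd x powi (-1) = cnj (snd x)" if "x \<in> XS" for x :: "sol \<times> complex" using cnj_powi_unit[of "snd x" 1] that by auto
 have "1 / 2 * xchar (\<lambda>u. 1) 1 x + 1 / 2 * xchar (\<lambda>u. 1) (-1) x = of_real (Re (snd x))" if "x \<in> XS" for x
  unfolding xchar_def inv[OF that] by (simp add: complex_eq_iff)
 thus "\<exists>Q\<in>trigX. \<forall>x\<in>XS. Q x = of_real (Re (snd x))" by (intro bexI[OF _ trigX.add[OF u[of "1/2" 1] u[of "1/2" "-1"]]]) blast
 have "- \<i> / 2 * xchar (\<lambda>u. 1) 1 x + \<i> / 2 * xchar (\<lambda>u. 1) (-1) x = of_real (Im (snd x))" if "x \<in> XS" for x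
  unfolding xchar_def inv[OF that] by (simp add: complex_eq_iff)
 thus "\<exists>Q\<in>trigX. \<forall>x\<in>XS. Q x = of_real (Im (snd x))"
  by (intro bexI[OF _ trigX.add[OF u[of "-\<i>/2" 1] u[of "\<i>/2" "-1"]]]) blast
qed

text \<open>Stone-Weierstrass; the points of \<open>XS\<close> are separated by real and imaginary
  parts of the coordinates and of the fibre variable.\<close>

lemma trigX_uniform:
 fixes r :: "sol \<times> complex => real"
 assumes r: "continuous_on XS r" and e: "e > 0"
 shows "\<exists>P\<in>trigX. \<forall>x\<in>XS. cmod (of_real (r x) - P x) < e"
proof -
 \<comment> \<open>The real algebra to which the theorem is applied: continuous functions that
   coincide on \<open>XS\<close> with some complex trigonometric polynomial.\<close>
 define R where "R f \<longleftrightarrow> continuous_on XS f \<and> (\<exists>Q. Q \<in> trigX \<and> (\<forall>x\<in>XS. Q x = of_real (f x)))"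
  for f :: "sol \<times> complex => real"
 define Q where "Q f = (SOME Q. Q \<in> trigX \<and> (\<forall>x\<in>XS. Q x = complex_of_real (f x)))" for f :: "sol \<times> complex => real"
 have R1: "continuous_on XS f" if "R f" for f using that by (simp add: R_def)
 have Q: "Q f \<in> trigX \<and> (\<forall>x\<in>XS. Q f x = of_real (f x))" if "R f" for f
  unfolding Q_def by (rule someI_ex[OF conjunct2[OF that[unfolded R_def]]])
 have RI: "R f" if "continuous_on XS f" "P \<in> trigX" "\<And>x. x \<in> XS ==> P x = of_real (f x)" for f P
  unfolding R_def using that(1) by (rule conjI) (rule exI[of _ P], rule conjI[OF that(2)], rule ballI, rule that(3))
 have "\<exists>g. R g \<and> (\<forall>x\<in>XS. \<bar>r x - g x\<bar> < e)"
 proof (rule Stone_Weierstrass_HOL[OF compact_XS _ _ _ _ _ r e])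
  show "R (\<lambda>x. c)" for c by (rule RI[OF continuous_on_const trigX_const[of "of_real c"]]) simp
  show "continuous_on XS f" if "R f" for f using R1[OF that] .
  show "R (\<lambda>x. f x + g x)" if "R f \<and> R g" for f g
  proof -
   have fg: "R f" "R g" using that by auto
   show ?thesis by (rule RI[OF continuous_on_add[OF R1[OF fg(1)] R1[OF fg(2)]] trigX.add[OF conjunct1[OF Q[OF fg(1)]] conjunct1[OF Q[OF fg(2)]]]])
     (simp add: Q fg)
  qed
  show "R (\<lambda>x. f x * g x)" if "R f \<and> R g" for f g
  proof -
   have fg: "R f" "R g" using that by auto
   obtain h where h: "h \<in> trigX" "\<forall>x\<in>XS. h x = Q f x * Q g x"
    using trigX_mult[OF conjunct1[OF Q[OF fg(1)]] conjunct1[OF Q[OF fg(2)]]] by (elim bexE)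
   show ?thesis by (rule RI[OF continuous_on_mult[OF R1[OF fg(1)] R1[OF fg(2)]] h(1)]) (simp add: Q fg h(2))
  qed
  show "\<exists>f. R f \<and> f x \<noteq> f y" if "x \<in> XS \<and> y \<in> XS \<and> x \<noteq> y" for x y
  proof -
   have cf: "continuous_on XS (\<lambda>x. fst x i)" for i
    by (rule continuous_on_compose2[OF continuous_on_coord[of UNIV i] continuous_on_fst[OF continuous_on_id]]) simp
   have Rf1: "R (\<lambda>x. Re (fst x i))" for i by (rule RI[OF continuous_on_Re[OF cf] trigX_coord(1)]) simp
   have Rf2: "R (\<lambda>x. Im (fst x i))" for i by (rule RI[OF continuous_on_Im[OF cf] trigX_coord(2)]) simp
   obtain Q1 where Q1: "Q1 \<in> trigX" "\<forall>x\<in>XS. Q1 x = of_real (Re (snd x))" using trigX_fibre(1) by (elim bexE)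
   obtain Q2 where Q2: "Q2 \<in> trigX" "\<forall>x\<in>XS. Q2 x = of_real (Im (snd x))" using trigX_fibre(2) by (elim bexE)
   have cs: "continuous_on XS (\<lambda>x. snd x)" by (intro continuous_intros)
   have Rs1: "R (\<lambda>x. Re (snd x))" by (rule RI[OF continuous_on_Re[OF cs] Q1(1)]) (simp add: Q1(2))
   have Rs2: "R (\<lambda>x. Im (snd x))" by (rule RI[OF continuous_on_Im[OF cs] Q2(1)]) (simp add: Q2(2))
   from that consider "fst x \<noteq> fst y" | "snd x \<noteq> snd y" by (auto simp: prod_eq_iff)
   thus ?thesis
   proof cases
    case 1
    then obtain i where "fst x i \<noteq> fst y i" by (auto simp: fun_eq_iff)
    then consider "Re (fst x i) \<noteq> Re (fst y i)" | "Im (fst x i) \<noteq> Im (fst y i)" by (auto simp: complex_eq_iff)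
    thus ?thesis
    proof cases
     case 1
     thus ?thesis by (intro exI[of _ "\<lambda>x. Re (fst x i)"] conjI Rf1)
    next
     case 2
     thus ?thesis by (intro exI[of _ "\<lambda>x. Im (fst x i)"] conjI Rf2)
    qed
   next
    case 2
    then consider "Re (snd x) \<noteq> Re (snd y)" | "Im (snd x) \<noteq> Im (snd y)" by (auto simp: complex_eq_iff)
    thus ?thesis
    proof cases
     case 1
     thus ?thesis by (intro exI[of _ "\<lambda>x. Re (snd x)"] conjI Rs1)
    next
     case 2
     thus ?thesis by (intro exI[of _ "\<lambda>x. Im (snd x)"] conjI Rs2)
    qed
   qed
  qed
 qed
 then obtain g where g: "R g" "\<forall>x\<in>XS. \<bar>r x - g x\<bar> < e" by (elim exE conjE)
 show ?thesis
 proof (rule bexI[OF _ conjunct1[OF Q[OF g(1)]]], rule ballI)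
  fix x :: "sol \<times> complex" assume x: "x \<in> XS"
  have "Q g x = of_real (g x)" by (rule bspec[OF conjunct2[OF Q[OF g(1)]] x])
  hence "of_real (r x) - Q g x = complex_of_real (r x - g x)" by (simp only: of_real_diff)
  thus "cmod (of_real (r x) - Q g x) < e" using g(2) x by (simp only: norm_of_real)
 qed
qed

interpretation XD: l2_dense_setup XM XS trigX by unfold_locales
  (rule sets_XM compact_XS trigX.add trigX_cmult trigX_square trigX_const trigX_uniform; assumption)+

lemma trigX_slice: "P \<in> trigX ==> (\<lambda>u. P (u, 1)) \<in> trigU"
proof (induction rule: trigX.induct)
 case (basic xi c n)
 have "(\<lambda>u. c * xchar xi n (u, 1)) = (\<lambda>u. c * xi u)" by (simp add: xchar_def)
 thus ?case using trigU.basic[OF basic] by simp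
qed (rule trigU.add)

text \<open>A function on the solenoid is lifted to the skew product, approximated there, and the
  approximation restricted to the slice with fibre coordinate 1.\<close>

lemma trigU_uniform:
 fixes r :: "sol => real"
 assumes r: "continuous_on solen r" and e: "e > 0"
 shows "\<exists>P\<in>trigU. \<forall>u\<in>solen. cmod (of_real (r u) - P u) < e"
proof -
 have "continuous_on XS (\<lambda>x. r (fst x))" by (rule continuous_on_compose2[OF r continuous_on_fst[OF continuous_on_id]]) auto
 from trigX_uniform[OF this e] obtain P where P: "P \<in> trigX" "\<forall>x\<in>XS. cmod (of_real (r (fst x)) - P x) < e" by (elim bexE)
 show ?thesis
 proof (rule bexI[OF _ trigX_slice[OF P(1)]], rule ballI)
  fix u assume "u \<in> solen"
  thus "cmod (of_real (r u) - P (u, 1)) < e" using bspec[OF P(2), of "(u, 1)"] by simp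
 qed
qed

lemma trigU_cmult: "f \<in> trigU ==> (\<lambda>x. c * f x) \<in> trigU"
 by (induction rule: trigU.induct) (auto simp: mult.assoc[symmetric] distrib_left intro: trigU.intros)

lemma trigU_square: "f \<in> trigU ==> sqi haar f"
proof (induction rule: trigU.induct)
 case (basic xi c)
 have "sqi haar xi" by (rule haar.sqi_bounded[where B=1]) (auto intro: chars_measurable[OF basic] simp: chars_norm[OF basic] intro!: AE_I2)
 thus ?case by (rule sqi_cmult)
qed (rule sqi_add)

lemma trigU_const: "(\<lambda>_. c) \<in> trigU" using trigU.basic[OF chars.one, of c] by simp

interpretation UD: l2_dense_setup haar solen trigU by unfold_locales
  (rule sets_haar compact_solen trigU.add trigU_cmult trigU_square trigU_const trigU_uniform; assumption)+

section \<open>Mixing relative to the solenoid\<close>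

text \<open>Convergence to 0 at infinity on the discrete group. Such sequences have Foelner averages
  tending to 0.\<close>

definition vanishing :: "((nat => int) => complex) => bool" where
 "vanishing c \<longleftrightarrow> (\<forall>e>0. finite {g \<in> GG. cmod (c g) \<ge> e})"

lemma vanishing_finite_support:
 assumes "finite {g \<in> GG. c g \<noteq> 0}" shows "vanishing c" unfolding vanishing_def
proof (intro allI impI)
 fix e :: real assume "e > 0"
 hence "{g \<in> GG. cmod (c g) \<ge> e} \<subseteq> {g \<in> GG. c g \<noteq> 0}" by auto
 thus "finite {g \<in> GG. cmod (c g) \<ge> e}" using assms by (rule finite_subset)
qed

lemma vanishing_approx:
 assumes "\<And>e. e > 0 ==> \<exists>d. vanishing d \<and> (\<forall>g\<in>GG. cmod (c g - d g) \<le> e)"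
 shows "vanishing c" unfolding vanishing_def
proof (intro allI impI)
 fix e :: real assume e: "e > 0"
 hence "e / 2 > 0" by simp
 from assms[OF this] obtain d where d: "vanishing d" "\<And>g. g \<in> GG ==> cmod (c g - d g) \<le> e / 2" by blast
 have "{g \<in> GG. cmod (c g) \<ge> e} \<subseteq> {g \<in> GG. cmod (d g) \<ge> e / 2}"
 proof
  fix g assume g: "g \<in> {g \<in> GG. cmod (c g) \<ge> e}"
  hence "cmod (c g) \<le> cmod (d g) + cmod (c g - d g)" using norm_triangle_sub by blast
  thus "g \<in> {g \<in> GG. cmod (d g) \<ge> e / 2}" using g d(2)[of g] by auto
 qed
 moreover have "finite {g \<in> GG. cmod (d g) \<ge> e / 2}" using d(1) \<open>e / 2 > 0\<close> unfolding vanishing_def by blast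
 ultimately show "finite {g \<in> GG. cmod (c g) \<ge> e}" by (rule finite_subset)
qed

lemma vanishing_cong:
 assumes "vanishing d" "\<And>g. g \<in> GG ==> c g = d g"
 shows "vanishing c"
proof (rule vanishing_approx)
 fix e :: real assume "e > 0"
 thus "\<exists>d. vanishing d \<and> (\<forall>g\<in>GG. cmod (c g - d g) \<le> e)" by (intro exI[of _ d] conjI assms(1)) (simp add: assms(2))
qed

lemma vanishing_add:
 assumes "vanishing c" "vanishing d" shows "vanishing (\<lambda>g. c g + d g)" unfolding vanishing_def
proof (intro allI impI)
 fix e :: real assume e: "e > 0"
 have "{g \<in> GG. cmod (c g + d g) \<ge> e} \<subseteq> {g \<in> GG. cmod (c g) \<ge> e / 2} \<union> {g \<in> GG. cmod (d g) \<ge> e / 2}"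
 proof
  fix g assume g: "g \<in> {g \<in> GG. cmod (c g + d g) \<ge> e}"
  have "cmod (c g + d g) \<le> cmod (c g) + cmod (d g)" by (rule norm_triangle_ineq)
  thus "g \<in> {g \<in> GG. cmod (c g) \<ge> e / 2} \<union> {g \<in> GG. cmod (d g) \<ge> e / 2}" using g by auto
 qed
 moreover have "finite ({g \<in> GG. cmod (c g) \<ge> e / 2} \<union> {g \<in> GG. cmod (d g) \<ge> e / 2})"
 proof (rule finite_UnI)
  have e2: "e / 2 > 0" using e by simp
  show "finite {g \<in> GG. cmod (c g) \<ge> e / 2}" "finite {g \<in> GG. cmod (d g) \<ge> e / 2}"
   using assms[unfolded vanishing_def, rule_format, OF e2] .
 qed
 ultimately show "finite {g \<in> GG. cmod (c g + d g) \<ge> e}" by (rule finite_subset)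
qed

lemma vanishing_cmult:
 assumes "vanishing c" shows "vanishing (\<lambda>g. a * c g)" unfolding vanishing_def
proof (intro allI impI)
 fix e :: real assume e: "e > 0"
 show "finite {g \<in> GG. cmod (a * c g) \<ge> e}"
 proof (cases "a = 0")
  case True
  thus ?thesis using e by simp
 next
  case False
  hence "{g \<in> GG. cmod (a * c g) \<ge> e} = {g \<in> GG. cmod (c g) \<ge> e / cmod a}" by (auto simp: norm_mult field_simps)
  thus ?thesis using assms e False unfolding vanishing_def by simp
 qed
qed

lemma finite_bounded_support:
 assumes "finite J" shows "finite {g \<in> GG. supp g \<subseteq> J}"
proof -
 let ?J = "J \<inter> {p. prime p}"
 let ?r = "\<lambda>g. restrict g ?J"
 let ?G = "{g \<in> GG. supp g \<subseteq> J}"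
 have inj: "inj_on ?r ?G"
 proof (rule inj_onI)
  fix g h assume g: "g \<in> ?G" and h: "h \<in> ?G" and eq: "?r g = ?r h"
  have gc: "g \<in> GG" "h \<in> GG" using g h by auto
  show "g = h"
  proof (rule PG_eqI[OF gc])
   fix p :: nat assume p: "prime p"
   show "g p = h p"
   proof (cases "p \<in> J")
    case True
    thus ?thesis using fun_cong[OF eq, of p] p by simp
   next
    case False
    hence "p \<notin> supp g" "p \<notin> supp h" using g h by auto
    thus ?thesis using p by (simp add: supp_def)
   qed
  qed
 qed
 have sub: "?r ` ?G \<subseteq> PiE ?J (\<lambda>p. {0..<int p})"
 proof
  fix f assume "f \<in> ?r ` ?G"
  then obtain g where g: "g \<in> GG" "f = ?r g" by auto
  show "f \<in> PiE ?J (\<lambda>p. {0..<int p})" unfolding g(2) restrict_PiE_iff using PG_range[OF g(1)] by simp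
 qed
 have "finite (PiE ?J (\<lambda>p. {0..<int p}))" by (rule finite_PiE) (use assms in auto)
 thus ?thesis by (rule finite_imageD[OF finite_subset[OF sub] inj])
qed

lemma prime_unit_powi_neq_1:
 assumes p: "prime p" and a: "\<not> int p dvd a"
 shows "ee (1 / real p) powi a \<noteq> 1"
proof
 assume "ee (1 / real p) powi a = 1"
 hence "of_int a * (1 / real p) \<in> \<int>" unfolding ee_powi ee_eq_1_iff .
 then obtain k :: int where "of_int a * (1 / real p) = of_int k" by (auto elim: Ints_cases)
 hence "real_of_int a = real_of_int (k * int p)" using prime_gt_0_nat[OF p] by (simp add: field_simps)
 hence "a = k * int p" by linarith
 thus False using a by simp
qed

lemma rho_powi_measurable: "g \<in> GG ==> (\<lambda>u. rho g u powi n) \<in> borel_measurable haar" by (rule m_comp[OF rho_measurable measurable_powi])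

text \<open>Translating by a root of unity in a single coordinate \<open>p\<close> multiplies the integrand by a
 nontrivial constant.\<close>

lemma rho_mixing:
 assumes n: "n \<noteq> 0" and pz: "pz \<in> chars"
 shows "finite {g \<in> GG. (LINT u|haar. pz u * rho g u powi n) \<noteq> 0}"
proof -
 have "\<exists>I. finite I \<and> (\<forall>w. (\<forall>i\<in>I. w i = 1) \<longrightarrow> pz w = 1)"
 proof (rule chars_finite_dependence[OF pz])
  fix I assume I: "finite I" "\<And>w. (\<And>i. i \<in> I ==> w i = 1) ==> pz w = 1"
  show "\<exists>I. finite I \<and> (\<forall>w. (\<forall>i\<in>I. w i = 1) \<longrightarrow> pz w = 1)" by (rule exI[of _ I]) (use I in simp)
 qed
 then obtain I where I: "finite I" "\<forall>w. (\<forall>i\<in>I. w i = 1) \<longrightarrow> pz w = 1" by (elim exE conjE)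
 \<comment> \<open>For a prime \<open>p\<close> outside this set the character does not see
   \<open>prime_unit p\<close>, and \<open>p\<close> does not divide \<open>n\<close>; so the
   constant that appears is different from 1.\<close>
 let ?J = "I \<union> {p. p \<le> nat \<bar>n\<bar>}"
 have key: "p \<in> ?J" if g: "g \<in> GG" and ne: "(LINT u|haar. pz u * rho g u powi n) \<noteq> 0"
  and p: "p \<in> supp g" for g p
 proof (rule ccontr)
  assume "p \<notin> ?J"
  hence nI: "p \<notin> I" and nle: "\<not> p \<le> nat \<bar>n\<bar>" by auto
  have pp: "prime p" and gp: "g p \<noteq> 0" using p by (auto simp: supp_def)
  define w where "w = prime_unit p"
  have wk: "w \<in> kern" unfolding w_def by (rule prime_unit_kern[OF pp])
  hence ws: "w \<in> solen" by (simp add: kern_def)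
  have "\<forall>i\<in>I. w i = 1" using nI by (auto simp: w_def prime_unit_def)
  hence "pz w = 1" using I(2) by simp
  define a where "a = (if base p = 1 then g p else - g p)"
  have pr: "(\<Prod>q\<in>supp g. w q powi (if base q = 1 then g q else - g q)) = ee (1 / real p) powi a"
  proof -
   have "(\<Prod>q\<in>supp g. w q powi (if base q = 1 then g q else - g q)) = (\<Prod>q\<in>supp g. if q = p then ee (1 / real p) powi a else 1)"
    by (rule prod.cong) (auto simp: w_def prime_unit_def a_def)
   also have "... = ee (1 / real p) powi a" using p finite_supp[OF g] by simp
   finally show ?thesis .
  qed
  have np: "\<not> int p dvd a * n"
  proof
   assume "int p dvd a * n"
   hence "int p dvd a \<or> int p dvd n" using pp by (simp add: prime_dvd_mult_iff)
   thus False
   proof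
    assume "int p dvd a"
    hence "int p dvd g p" by (auto simp: a_def split: if_splits)
    thus False using PG_range[OF g pp] gp zdvd_not_zless[of "g p" "int p"] by linarith
   next
    assume "int p dvd n"
    hence "\<bar>int p\<bar> \<le> \<bar>n\<bar>" using n by (intro dvd_imp_le_int)
    thus False using nle by linarith
   qed
  qed
  have meas: "(\<lambda>u. pz u * rho g u powi n) \<in> borel_measurable haar"
   by (intro borel_measurable_times chars_measurable[OF pz] rho_powi_measurable[OF g])
  have "(LINT u|haar. pz u * rho g u powi n) = (LINT u|haar. pz (w * u) * rho g (w * u) powi n)" by (rule haar_integral_translate[OF ws meas, symmetric])
  also have "... = (LINT u|haar. ee (1 / real p) powi (a * n) * (pz u * rho g u powi n))"
  proof (rule LINT_cong[OF refl])
   fix u assume "u \<in> space haar"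
   hence u: "u \<in> solen" by simp
   have "pz (w * u) = pz u" using chars_mult[OF pz, of w u] \<open>pz w = 1\<close> by simp
   moreover have "rho g (w * u) powi n = rho g u powi n * ee (1 / real p) powi (a * n)"
    unfolding rho_kern[OF g u wk] pr by (simp add: power_int_mult_distrib power_int_mult)
   ultimately show "pz (w * u) * rho g (w * u) powi n = ee (1 / real p) powi (a * n) * (pz u * rho g u powi n)" by simp
  qed
  also have "... = ee (1 / real p) powi (a * n) * (LINT u|haar. pz u * rho g u powi n)" by simp
  finally have "ee (1 / real p) powi (a * n) = 1" using ne by simp
  thus False using prime_unit_powi_neq_1[OF pp np] by simp
 qed
 have "{g \<in> GG. (LINT u|haar. pz u * rho g u powi n) \<noteq> 0} \<subseteq> {g \<in> GG. supp g \<subseteq> ?J}"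
 proof (rule subsetI, rule CollectI)
  fix g assume "g \<in> {g \<in> GG. (LINT u|haar. pz u * rho g u powi n) \<noteq> 0}"
  hence g: "g \<in> GG" "(LINT u|haar. pz u * rho g u powi n) \<noteq> 0" by simp_all
  show "g \<in> GG \<and> supp g \<subseteq> ?J" using key[OF g] g(1) by (intro conjI subsetI)
 qed
 thus ?thesis by (rule finite_subset) (use finite_bounded_support I(1) in simp)
qed

lemma xchar_TX:
 assumes "xi \<in> chars" "x \<in> space XM"
 shows "xchar xi n (TX g x) = xi (iota g) * xi (fst x) * (rho g (fst x) powi n * snd x powi n)"
 by (simp add: TX_eq[OF assms(2)] xchar_def chars_mult[OF assms(1)] power_int_mult_distrib)

text \<open>Integration over the fibre leaves only \<open>n = m\<close>, and then a constant times a
  base integral, which by \<open>rho_mixing\<close> is nonzero for finitely many \<open>g\<close>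
  only.\<close>

lemma xchar_mixing:
 assumes xi: "xi \<in> chars" and pz: "pz \<in> chars" and n: "n \<noteq> 0"
 shows "vanishing (\<lambda>g. LINT x|XM. xchar xi n (TX g x) * cnj (xchar pz m x))"
proof -
 let ?tz = "\<lambda>u. xi u * cnj (pz u)"
 have tz: "?tz \<in> chars" by (intro chars_mult_closed chars_cnj_closed xi pz)
 have eq: "(LINT x|XM. xchar xi n (TX g x) * cnj (xchar pz m x))
   = (if n = m then xi (iota g) * (LINT u|haar. ?tz u * rho g u powi n) else 0)" if g: "g \<in> GG" for g
 proof -
  have int: "integrable XM (\<lambda>x. xchar xi n (TX g x) * cnj (xchar pz m x))"
   by (intro integrable_mult_square XA.sqi_T g sqi_cnj xchar_square xi pz)
  have "(LINT x|XM. xchar xi n (TX g x) * cnj (xchar pz m x)) = (LINT u|haar. (LINT z|CM. xchar xi n (TX g (u, z)) * cnj (xchar pz m (u, z))))"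
   by (rule integral_XM[OF int])
  also have "... = (LINT u|haar. (xi (iota g) * (?tz u * rho g u powi n)) * (if n = m then 1 else 0))"
  proof (rule LINT_cong[OF refl])
   fix u assume "u \<in> space haar"
   hence u: "u \<in> solen" by simp
   have "(LINT z|CM. xchar xi n (TX g (u, z)) * cnj (xchar pz m (u, z))) = (LINT z|CM. (xi (iota g) * (?tz u * rho g u powi n)) * z powi (n - m))"
   proof (rule LINT_cong[OF refl])
    fix z assume "z \<in> space CM"
    hence z: "cmod z = 1" by simp
    hence z0: "z \<noteq> 0" by auto
    have x: "(u, z) \<in> space XM" using u z by (simp add: space_XM)
    have "cnj (z powi m) = z powi (- m)" using cnj_powi_unit[OF z, of m] by simp
    moreover have "z powi n * z powi (- m) = z powi (n - m)" using z0 power_int_add[of z n "- m"] by simp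
    ultimately show "xchar xi n (TX g (u, z)) * cnj (xchar pz m (u, z)) = (xi (iota g) * (?tz u * rho g u powi n)) * z powi (n - m)"
     unfolding xchar_TX[OF xi x] by (simp add: xchar_def mult_ac)
   qed
   also have "... = (xi (iota g) * (?tz u * rho g u powi n)) * (LINT z|CM. z powi (n - m))" by simp
   also have "(LINT z|CM. z powi (n - m)) = (if n = m then 1 else 0)"
   proof (cases "n = m")
    case True
    thus ?thesis by (simp add: prob_space.prob_space[OF prob_space_circle, simplified])
   next
    case False
    thus ?thesis using circle_integral_powi[of "n - m"] by simp
   qed
   finally show "(LINT z|CM. xchar xi n (TX g (u, z)) * cnj (xchar pz m (u, z)))
    = (xi (iota g) * (?tz u * rho g u powi n)) * (if n = m then 1 else 0)" .
  qed
  also have "... = (if n = m then xi (iota g) * (LINT u|haar. ?tz u * rho g u powi n) else 0)" by simp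
  finally show ?thesis .
 qed
 have "{g \<in> GG. (LINT x|XM. xchar xi n (TX g x) * cnj (xchar pz m x)) \<noteq> 0}
   \<subseteq> {g \<in> GG. (LINT u|haar. ?tz u * rho g u powi n) \<noteq> 0}" using eq by (auto split: if_splits)
 thus ?thesis by (intro vanishing_finite_support) (rule finite_subset[OF _ rho_mixing[OF n tz]])
qed

lemma xchar_mixing_square:
 assumes xi: "xi \<in> chars" and n: "n \<noteq> 0" and f: "sqi XM f"
 shows "vanishing (\<lambda>g. LINT x|XM. xchar xi n (TX g x) * cnj (f x))"
proof (rule vanishing_approx)
 fix e :: real assume "e > 0"
 then obtain P where P: "P \<in> trigX" "l2_norm XM (\<lambda>x. f x - P x) < e" using XD.l2_approx[OF f] by blast
 have T: "sqi XM (\<lambda>x. xchar xi n (TX g x))" if "g \<in> GG" for g by (rule XA.sqi_T[OF that xchar_square[OF xi]])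
 have van: "vanishing (\<lambda>g. LINT x|XM. xchar xi n (TX g x) * cnj (Q x))" if "Q \<in> trigX" for Q using that
 proof induction
  case (basic pz c m)
  have "(\<lambda>g. LINT x|XM. xchar xi n (TX g x) * cnj (c * xchar pz m x))
    = (\<lambda>g. cnj c * (LINT x|XM. xchar xi n (TX g x) * cnj (xchar pz m x)))" by (simp add: mult.left_commute)
  thus ?case using vanishing_cmult[OF xchar_mixing[OF xi basic n]] by simp
 next
  case (add P Q)
  have eq: "(LINT x|XM. xchar xi n (TX g x) * cnj (P x + Q x))
   = (LINT x|XM. xchar xi n (TX g x) * cnj (P x)) + (LINT x|XM. xchar xi n (TX g x) * cnj (Q x))" if "g \<in> GG" for g
  proof -
   have "integrable XM (\<lambda>x. xchar xi n (TX g x) * cnj (P x))" "integrable XM (\<lambda>x. xchar xi n (TX g x) * cnj (Q x))"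
    by (intro integrable_mult_square T that sqi_cnj trigX_square add.hyps)+
   thus ?thesis by (simp add: distrib_left)
  qed
  show ?case by (rule vanishing_cong[OF vanishing_add[OF add.IH] eq])
 qed
 have "cmod ((LINT x|XM. xchar xi n (TX g x) * cnj (f x)) - (LINT x|XM. xchar xi n (TX g x) * cnj (P x))) \<le> e" if g: "g \<in> GG" for g
 proof -
  have i: "integrable XM (\<lambda>x. xchar xi n (TX g x) * cnj (f x))" "integrable XM (\<lambda>x. xchar xi n (TX g x) * cnj (P x))"
   by (intro integrable_mult_square T g sqi_cnj trigX_square P(1) f)+
  have "(LINT x|XM. xchar xi n (TX g x) * cnj (f x)) - (LINT x|XM. xchar xi n (TX g x) * cnj (P x)) = (LINT x|XM. xchar xi n (TX g x) * cnj (f x - P x))"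
   using i by (simp add: right_diff_distrib)
  also have "cmod ... \<le> l2_norm XM (\<lambda>x. xchar xi n (TX g x)) * l2_norm XM (\<lambda>x. f x - P x)"
   by (rule Cauchy_Schwarz_l2[OF T[OF g] sqi_diff[OF f trigX_square[OF P(1)]]])
  also have "l2_norm XM (\<lambda>x. xchar xi n (TX g x)) = l2_norm XM (xchar xi n)" by (rule XA.l2_norm_T[OF g xchar_measurable[OF xi]])
  also have "l2_norm XM (xchar xi n) = 1"
  proof -
   have "(LINT x|XM. (cmod (xchar xi n x))\<^sup>2) = (LINT x|XM. 1)" by (rule LINT_cong) (simp_all add: xchar_norm[OF xi])
   thus ?thesis by (simp add: l2_norm_def XM.prob_space)
  qed
  finally show ?thesis using P(2) by simp
 qed
 thus "\<exists>d. vanishing d \<and> (\<forall>g\<in>GG. cmod ((LINT x|XM. xchar xi n (TX g x) * cnj (f x)) - d g) \<le> e)"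
  by (intro exI[of _ "\<lambda>g. LINT x|XM. xchar xi n (TX g x) * cnj (P x)"] conjI van[OF P(1)] ballI)
qed

section \<open>Eigenfunctions and ergodicity\<close>

text \<open>Otherwise \<open>f\<close> would be orthogonal to all trigonometric polynomials, and its
  norm could not exceed its distance from any of them, contrary to density.\<close>

lemma ex_fourier_coefficient:
 assumes f: "sqi XM f" and ne: "\<not> (AE x in XM. f x = 0)"
 shows "\<exists>xi n. xi \<in> chars \<and> (LINT x|XM. f x * cnj (xchar xi n x)) \<noteq> 0"
proof (rule ccontr)
 assume no: "\<not> (\<exists>xi n. xi \<in> chars \<and> (LINT x|XM. f x * cnj (xchar xi n x)) \<noteq> 0)"
 have z: "(LINT x|XM. f x * cnj (xchar xi n x)) = 0" if "xi \<in> chars" for xi n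
 proof (rule ccontr)
  assume "(LINT x|XM. f x * cnj (xchar xi n x)) \<noteq> 0"
  with that have "\<exists>xi n. xi \<in> chars \<and> (LINT x|XM. f x * cnj (xchar xi n x)) \<noteq> 0" by (intro exI conjI)
  with no show False by (rule notE)
 qed
 have zP: "(LINT x|XM. f x * cnj (P x)) = 0" if "P \<in> trigX" for P using that
 proof induction
  case (basic xi c n)
  thus ?case using z[OF basic] by (simp add: mult.left_commute)
 next
  case (add P Q)
  have "integrable XM (\<lambda>x. f x * cnj (P x))" "integrable XM (\<lambda>x. f x * cnj (Q x))"
   by (intro integrable_mult_square f sqi_cnj trigX_square add.hyps)+
  thus ?case using add.IH by (simp add: distrib_left)
 qed
 define N where "N = l2_norm XM f"
 have "N \<noteq> 0" using l2_norm_eq_0_AE[OF f] ne by (auto simp: N_def)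
 hence N: "N > 0" using l2_norm_nonneg[of XM f] by (simp add: N_def)
 obtain P where P: "P \<in> trigX" "l2_norm XM (\<lambda>x. f x - P x) < N" using XD.l2_approx[OF f N] .
 have i: "integrable XM (\<lambda>x. f x * cnj (f x))" "integrable XM (\<lambda>x. f x * cnj (P x))"
  by (intro integrable_mult_square f sqi_cnj trigX_square P(1))+
 have "of_real (N\<^sup>2) = (LINT x|XM. f x * cnj (f x)) - (LINT x|XM. f x * cnj (P x))" by (simp add: zP[OF P(1)] integral_self_cnj N_def)
 also have "... = (LINT x|XM. f x * cnj (f x - P x))" using i by (simp add: right_diff_distrib)
 finally have "cmod (of_real (N\<^sup>2)) \<le> N * l2_norm XM (\<lambda>x. f x - P x)"
  using Cauchy_Schwarz_l2[OF f sqi_diff[OF f trigX_square[OF P(1)]]] by (simp only: N_def)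
 hence "N\<^sup>2 \<le> N * l2_norm XM (\<lambda>x. f x - P x)" by (simp only: norm_of_real abs_power2)
 also have "... < N * N" using P(2) N by (intro mult_strict_left_mono)
 finally show False by (simp add: power2_eq_square)
qed

text \<open>A nonzero Fourier coefficient of \<open>f\<close> keeps its modulus when the test
  character is moved by \<open>g\<close>. Mixing excludes this for a character that is nontrivial on
  the fibre, and a character of the base determines the eigenvalue.\<close>

theorem eigenfunction:
 assumes f: "sqi XM f" and ne: "\<not> (AE x in XM. f x = 0)"
  and ev: "\<And>g. g \<in> GG ==> AE x in XM. f (TX g x) = c g * f x"
 shows "\<exists>xi\<in>chars. (\<forall>g\<in>GG. c g = xi (iota g)) \<and> (LINT x|XM. f x * cnj (xi (fst x))) \<noteq> 0"
proof -
 obtain xi n where xi: "xi \<in> chars" and ne0: "(LINT x|XM. f x * cnj (xchar xi n x)) \<noteq> 0"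
  using ex_fourier_coefficient[OF f ne] by (elim exE conjE)
 let ?I = "LINT x|XM. f x * cnj (xchar xi n x)"
 have fm [measurable]: "f \<in> borel_measurable XM" by (rule square_integrableD(1)[OF f])
 have xm [measurable]: "xchar xi n \<in> borel_measurable XM" by (rule xchar_measurable[OF xi])
 have key: "?I = c g * (LINT x|XM. f x * cnj (xchar xi n (TX g x)))" if g: "g \<in> GG" for g
 proof -
  have [measurable]: "TX g \<in> measurable XM XM" by (rule XA.T_measurable[OF g])
  have "?I = (LINT x|XM. f (TX g x) * cnj (xchar xi n (TX g x)))" by (rule XA.integral_T[OF g, symmetric]) measurable
  also have "... = (LINT x|XM. c g * (f x * cnj (xchar xi n (TX g x))))" by (rule integral_cong_AE) (use ev[OF g] in "auto simp: mult.assoc")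
  finally show ?thesis by simp
 qed
 have c1: "cmod (c g) = 1" if g: "g \<in> GG" for g
 proof -
  have [measurable]: "TX g \<in> measurable XM XM" by (rule XA.T_measurable[OF g])
  have "l2_norm XM f = l2_norm XM (\<lambda>x. f (TX g x))" by (rule XA.l2_norm_T[OF g fm, symmetric])
  also have "... = l2_norm XM (\<lambda>x. c g * f x)" by (rule l2_norm_cong_AE) (use ev[OF g] in auto)
  also have "... = cmod (c g) * l2_norm XM f" by (rule l2_norm_cmult)
  finally show ?thesis using l2_norm_eq_0_AE[OF f] ne by auto
 qed
 \<comment> \<open>For \<open>n\<close> different from 0 the correlations tend to 0 at infinity but
   have constant positive modulus on an infinite group.\<close>
 have n0: "n = 0"
 proof (rule ccontr)
  assume n: "n \<noteq> 0"
  have "cmod (LINT x|XM. xchar xi n (TX g x) * cnj (f x)) = cmod ?I" if g: "g \<in> GG" for g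
  proof -
   have "(LINT x|XM. xchar xi n (TX g x) * cnj (f x)) = cnj (LINT x|XM. f x * cnj (xchar xi n (TX g x)))"
    unfolding Bochner_Integration.integral_cnj[symmetric] by (simp add: mult.commute)
   thus ?thesis using key[OF g] c1[OF g] by (simp add: norm_mult)
  qed
  hence "{g \<in> GG. cmod (LINT x|XM. xchar xi n (TX g x) * cnj (f x)) \<ge> cmod ?I} = GG" by auto
  moreover have "finite {g \<in> GG. cmod (LINT x|XM. xchar xi n (TX g x) * cnj (f x)) \<ge> cmod ?I}"
   using xchar_mixing_square[OF xi n f] ne0 unfolding vanishing_def by simp
  ultimately show False using infinite_PG by simp
 qed
 have cg: "c g = xi (iota g)" if g: "g \<in> GG" for g
 proof -
  have "(LINT x|XM. f x * cnj (xchar xi n (TX g x))) = (LINT x|XM. cnj (xi (iota g)) * (f x * cnj (xchar xi n x)))"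
  proof (rule LINT_cong[OF refl])
   fix x assume x: "x \<in> space XM"
   show "f x * cnj (xchar xi n (TX g x)) = cnj (xi (iota g)) * (f x * cnj (xchar xi n x))" unfolding xchar_TX[OF xi x] by (simp add: n0 xchar_def)
  qed
  hence "?I = c g * (cnj (xi (iota g)) * ?I)" using key[OF g] by simp
  hence "c g * cnj (xi (iota g)) = 1" using ne0 by (simp add: mult.assoc[symmetric])
  moreover have "cnj (xi (iota g)) * xi (iota g) = 1" by (rule cnj_mult_unit[OF chars_norm[OF xi iota_solen[OF g]]])
  ultimately show ?thesis by (metis mult.assoc mult.left_neutral mult.right_neutral)
 qed
 have "(LINT x|XM. f x * cnj (xi (fst x))) \<noteq> 0" using ne0 by (simp add: n0 xchar_def)
 thus ?thesis by (intro bexI[OF _ xi] conjI ballI cg)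
qed

text \<open>After subtraction of the mean, an invariant function is an eigenfunction of eigenvalue
  1. Its character is trivial on the dense image, hence everywhere, so the nonzero coefficient would
  be the mean, which is 0.\<close>

theorem ergodic_X: "g_ergodic PG XM TX" unfolding g_ergodic_def
proof (intro allI impI, elim conjE)
 fix f assume f: "sqi XM f" and inv: "\<forall>g\<in>GG. AE x in XM. f (TX g x) = f x"
 define m where "m = (LINT x|XM. f x)"
 define f' where "f' x = f x - m" for x
 have const: "sqi XM (\<lambda>x. c)" for c by (rule XM.sqi_bounded[where B="cmod c"]) auto
 have f': "sqi XM f'" unfolding f'_def by (intro sqi_diff f const)
 have fint: "integrable XM f" using integrable_mult_square[OF f const[of 1]] by simp
 have z: "(LINT x|XM. f' x) = 0" unfolding f'_def using fint by (simp add: m_def XM.prob_space)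
 have "AE x in XM. f' x = 0"
 proof (rule ccontr)
  assume ne: "\<not> (AE x in XM. f' x = 0)"
  have ev: "AE x in XM. f' (TX g x) = 1 * f' x" if "g \<in> GG" for g
  proof -
   have "AE x in XM. f (TX g x) = f x" using inv that by blast
   thus ?thesis by eventually_elim (simp add: f'_def)
  qed
  have "\<exists>xi\<in>chars. (\<forall>g\<in>GG. 1 = xi (iota g)) \<and> (LINT x|XM. f' x * cnj (xi (fst x))) \<noteq> 0"
   by (rule eigenfunction[OF f' ne]) (rule ev)
  then obtain xi where xi: "xi \<in> chars" "\<forall>g\<in>GG. 1 = xi (iota g)" "(LINT x|XM. f' x * cnj (xi (fst x))) \<noteq> 0" by (elim bexE conjE)
  have "(LINT x|XM. f' x * cnj (xi (fst x))) = (LINT x|XM. f' x)"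
  proof (rule LINT_cong[OF refl])
   fix x assume "x \<in> space XM"
   hence "xi (fst x) = 1" using chars_trivial[OF xi(1) bspec[OF xi(2), symmetric]] by (auto simp: space_XM)
   thus "f' x * cnj (xi (fst x)) = f' x" by simp
  qed
  thus False using xi(3) z by simp
 qed
 hence "AE x in XM. f x = m" by eventually_elim (simp add: f'_def)
 thus "\<exists>c. AE x in XM. f x = c" by blast
qed

lemma sqi_fst:
 assumes "sqi haar f" shows "sqi XM (\<lambda>x. f (fst x))"
proof -
 have [measurable]: "f \<in> borel_measurable haar" by (rule square_integrableD(1)[OF assms])
 have d: "distr XM haar fst = haar" unfolding XM_def by (rule prob_space.distr_pair_fst[OF prob_space_circle])
 have "integrable XM (\<lambda>x. (cmod (f (fst x)))\<^sup>2)"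
  using integrable_distr[OF XM_fst, of "\<lambda>u. (cmod (f u))\<^sup>2"] square_integrableD(2)[OF assms] by (simp add: d)
 thus ?thesis by (simp add: square_integrable_def)
qed

lemma AE_fst:
 assumes "AE u in haar. P u" shows "AE x in XM. P (fst x)"
proof (rule AE_distrD[OF XM_fst])
 have "distr XM haar fst = haar" unfolding XM_def by (rule prob_space.distr_pair_fst[OF prob_space_circle])
 thus "AE u in distr XM haar fst. P u" using assms by (simp only:)
qed

lemma AE_fst_iff:
 assumes "{u \<in> space haar. P u} \<in> sets haar"
 shows "(AE x in XM. P (fst x)) \<longleftrightarrow> (AE u in haar. P u)"
proof -
 have "distr XM haar fst = haar" unfolding XM_def by (rule prob_space.distr_pair_fst[OF prob_space_circle])
 thus ?thesis using AE_distr_iff[OF XM_fst assms] by (simp only:)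
qed

lemma fst_TX: "x \<in> space XM ==> fst (TX g x) = alpha g (fst x)" by (auto simp: TX_eq alpha_eq space_XM)

theorem ergodic_U: "g_ergodic PG haar alpha" unfolding g_ergodic_def
proof (intro allI impI, elim conjE)
 fix f assume f: "sqi haar f" and inv: "\<forall>g\<in>GG. AE x in haar. f (alpha g x) = f x"
 have [measurable]: "f \<in> borel_measurable haar" by (rule square_integrableD(1)[OF f])
 have "AE x in XM. f (fst (TX g x)) = f (fst x)" if "g \<in> GG" for g
 proof -
  have "AE u in haar. f (alpha g u) = f u" using inv that by blast
  from AE_fst[OF this] show ?thesis
  proof (rule AE_mp, intro AE_I2 impI)
   fix x assume "x \<in> space XM" "f (alpha g (fst x)) = f (fst x)"
   thus "f (fst (TX g x)) = f (fst x)" by (simp only: fst_TX)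
  qed
 qed
 then obtain c where "AE x in XM. f (fst x) = c" using ergodic_X sqi_fst[OF f] unfolding g_ergodic_def by blast
 hence "AE u in haar. f u = c" by (subst (asm) AE_fst_iff) measurable
 thus "\<exists>c. AE x in haar. f x = c" by blast
qed

section \<open>Gowers norms of the skew product\<close>

text \<open>An increasing chain of finite subgroups exhausting the group; a given element finally
  belongs to them, and translation by it then changes nothing.\<close>

definition fol :: "nat => (nat => int) set" where
 "fol N = {g \<in> GG. supp g \<subseteq> {..N}}"

lemma folner_fol: "folner_sequence PG fol" unfolding folner_sequence_def
proof (intro conjI allI ballI)
 show "finite (fol N)" for N unfolding fol_def by (rule finite_bounded_support) simp
 show "fol N \<noteq> {}" for N
 proof -
  have "ID \<in> fol N" by (simp add: fol_def) (simp add: supp_def one_PG subset_iff)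
  thus ?thesis by blast
 qed
 show "fol N \<subseteq> GG" for N by (auto simp: fol_def)
 fix g assume g: "g \<in> GG"
 obtain K where K: "supp g \<subseteq> {..K}" using finite_supp[OF g] by (meson finite_nat_iff_bounded_le)
 have "g <#\<^bsub>PG\<^esub> fol N = fol N" if N: "N \<ge> K" for N
 proof -
  have fin: "finite (fol N)" unfolding fol_def by (rule finite_bounded_support) simp
  have sub: "(\<lambda>a. g \<cdot> a) ` fol N \<subseteq> fol N"
  proof
   fix y assume "y \<in> (\<lambda>a. g \<cdot> a) ` fol N"
   then obtain a where a: "a \<in> GG" "supp a \<subseteq> {..N}" "y = g \<cdot> a" by (auto simp: fol_def)
   have "supp y \<subseteq> {..N}" using supp_mult[of g a] K N a(2) unfolding a(3) by fastforce
   thus "y \<in> fol N" using g a by (simp add: fol_def)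
  qed
  have "inj_on (\<lambda>a. g \<cdot> a) (fol N)" by (rule PG.inj_on_mult_left[OF g]) (auto simp: fol_def)
  from endo_inj_surj[OF fin sub this] show ?thesis by (simp add: PG.l_coset_eq_image)
 qed
 hence "\<forall>\<^sub>F N in sequentially. real (card (sym_diff (g <#\<^bsub>PG\<^esub> fol N) (fol N))) / real (card (fol N)) = 0"
  unfolding eventually_sequentially by (intro exI[of _ K]) simp
 thus "(\<lambda>N. real (card (sym_diff (g <#\<^bsub>PG\<^esub> fol N) (fol N))) / real (card (fol N))) ----> 0" by (rule tendsto_eventually)
qed

lemma folner_lim_cong:
 assumes "\<And>A. A \<subseteq> carrier G ==> a A = b A"
 shows "folner_lim G a = folner_lim G b"
proof -
 have "(\<lambda>N. a (Ph N)) = (\<lambda>N. b (Ph N))" if "folner_sequence G Ph" for Ph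
  using assms folner_sequenceD(3)[OF that] by (simp add: fun_eq_iff)
 thus ?thesis unfolding folner_lim_def by (intro arg_cong[where f=The] ext) auto
qed

lemma (in mp_action) AE_T:
 assumes "g \<in> carrier G" "AE x in M. P x"
 shows "AE x in M. P (T g x)" using AE_distrD[OF T_measurable[OF assms(1)], of P] assms(2) by (simp only: T_distr[OF assms(1)])

text \<open>Allows essentially bounded functions to be replaced by representatives bounded at every
  point.\<close>

lemma (in mp_action) gowers_norm_cong_AE:
 assumes "f \<in> borel_measurable M" "f' \<in> borel_measurable M" "AE x in M. f x = f' x"
 shows "gowers_norm G M T k f = gowers_norm G M T k f'" using assms
proof (induction k arbitrary: f f')
 case 0
 show ?case by simp
next
 case (Suc k)
 have fT: "(\<lambda>x. h (T g x)) \<in> borel_measurable M" if "g \<in> carrier G" "h \<in> borel_measurable M" for g and h :: "'x => complex"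
  by (rule m_comp[OF T_measurable[OF that(1)] that(2)])
 show ?case
 proof (cases k)
  case 0
  have "l2_norm M (\<lambda>x. (\<Sum>g\<in>A. f (T g x)) / of_nat (card A)) = l2_norm M (\<lambda>x. (\<Sum>g\<in>A. f' (T g x)) / of_nat (card A))"
   if A: "A \<subseteq> carrier G" for A
  proof (cases "finite A")
   case True
   show ?thesis
   proof (rule l2_norm_cong_AE)
    show "(\<lambda>x. (\<Sum>g\<in>A. f (T g x)) / of_nat (card A)) \<in> borel_measurable M"
     "(\<lambda>x. (\<Sum>g\<in>A. f' (T g x)) / of_nat (card A)) \<in> borel_measurable M"
     by (intro borel_measurable_divide borel_measurable_sum borel_measurable_const fT[OF subsetD[OF A]] Suc.prems; assumption)+
    have "AE x in M. \<forall>g\<in>A. f (T g x) = f' (T g x)"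
    proof (rule AE_finite_allI[OF True])
     fix g assume "g \<in> A"
     from AE_T[OF subsetD[OF A this] Suc.prems(3)] show "AE x in M. f (T g x) = f' (T g x)" .
    qed
    thus "AE x in M. (\<Sum>g\<in>A. f (T g x)) / of_nat (card A) = (\<Sum>g\<in>A. f' (T g x)) / of_nat (card A)" by eventually_elim simp
   qed
  qed simp
  thus ?thesis unfolding 0 gowers_norm.simps by (rule folner_lim_cong)
 next
  case (Suc j)
  have "gowers_norm G M T (Suc j) (\<lambda>x. f (T g x) * cnj (f x)) = gowers_norm G M T (Suc j) (\<lambda>x. f' (T g x) * cnj (f' x))"
   if g: "g \<in> carrier G" for g
  proof -
   have "AE x in M. f (T g x) * cnj (f x) = f' (T g x) * cnj (f' x)" using AE_T[OF g Suc.prems(3)] Suc.prems(3) by eventually_elim simp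
   moreover have "(\<lambda>x. h (T g x) * cnj (h x)) \<in> borel_measurable M" if "h \<in> borel_measurable M" for h :: "'x => complex"
    by (rule borel_measurable_times[OF fT[OF g that] m_comp[OF that measurable_cnj]])
   ultimately show ?thesis using Suc.IH[OF _ _ \<open>AE x in M. f (T g x) * cnj (f x) = f' (T g x) * cnj (f' x)\<close>] Suc.prems(1,2)
    unfolding \<open>k = Suc j\<close> by simp
  qed
  hence "(\<Sum>g\<in>A. gowers_norm G M T (Suc j) (\<lambda>x. f (T g x) * cnj (f x)) ^ (2 ^ Suc j))
    = (\<Sum>g\<in>A. gowers_norm G M T (Suc j) (\<lambda>x. f' (T g x) * cnj (f' x)) ^ (2 ^ Suc j))" if "A \<subseteq> carrier G" for A
   using that by (intro sum.cong) auto
  thus ?thesis unfolding \<open>k = Suc j\<close> gowers_norm.simps by (intro folner_lim_cong) simp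
 qed
qed

text \<open>The bound holds at every point and not just almost everywhere, so that it passes to
  slices, fibres and single orbits.\<close>

definition bdd :: "'x measure => ('x => complex) => real => bool" where
 "bdd M f B \<longleftrightarrow> f \<in> borel_measurable M \<and> (\<forall>x\<in>space M. cmod (f x) \<le> B)"

lemma bdd_measurable: "bdd M f B ==> f \<in> borel_measurable M" by (simp add: bdd_def)

lemma bdd_le: "bdd M f B ==> x \<in> space M ==> cmod (f x) \<le> B" by (simp add: bdd_def)

lemma (in prob_space) bdd_nonneg: "bdd M f B ==> B \<ge> 0" using not_empty norm_ge_zero order_trans unfolding bdd_def by (metis ex_in_conv)

lemma (in prob_space) bdd_integrable: "bdd M f B ==> integrable M f" by (rule integrable_const_bound[where B=B]) (auto simp: bdd_def)

lemma (in prob_space) bdd_square: "bdd M f B ==> sqi M f" by (rule sqi_bounded[where B=B]) (auto simp: bdd_def)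

lemma bdd_mult: "bdd M f B ==> bdd M g B' ==> bdd M (\<lambda>x. f x * g x) (B * B')"
 unfolding bdd_def by (auto simp: norm_mult intro!: mult_mono order_trans[OF norm_ge_zero])

lemma bdd_cnj: "bdd M f B ==> bdd M (\<lambda>x. cnj (f x)) B" unfolding bdd_def by (auto intro: m_comp[OF _ measurable_cnj])

lemma bdd_compose: "bdd M f B ==> t \<in> measurable N M ==> bdd N (\<lambda>x. f (t x)) B"
 unfolding bdd_def by (auto intro: m_comp dest: measurable_space)

lemma (in prob_space) norm_integral_le_bdd: "bdd M f B ==> cmod (LINT x|M. f x) \<le> B"
proof -
 assume f: "bdd M f B"
 have "cmod (LINT x|M. f x) \<le> (LINT x|M. cmod (f x))" by (rule integral_norm_bound)
 also have "... \<le> (LINT x|M. B)" by (rule integral_mono) (use bdd_integrable[OF f] bdd_le[OF f] in auto)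
 finally show ?thesis by (simp add: prob_space)
qed

section \<open>Integration over fibres and products\<close>

lemma fibre_bdd:
 assumes D: "prob_space D" and f: "bdd (D \<Otimes>\<^sub>M CM) f B"
 shows "bdd D (\<lambda>d. LINT z|CM. f (d, z)) B" unfolding bdd_def
proof
 have fm: "f \<in> borel_measurable (D \<Otimes>\<^sub>M CM)" by (rule bdd_measurable[OF f])
 show "(\<lambda>d. LINT z|CM. f (d, z)) \<in> borel_measurable D"
  by (rule sigma_finite_measure.borel_measurable_lebesgue_integral[OF sigma_finite_circle]) (use fm in simp)
 show "\<forall>d\<in>space D. cmod (LINT z|CM. f (d, z)) \<le> B"
 proof
  fix d assume d: "d \<in> space D"
  have "bdd CM (\<lambda>z. f (d, z)) B" by (rule bdd_compose[OF f measurable_Pair1'[OF d]])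
  thus "cmod (LINT z|CM. f (d, z)) \<le> B" by (rule prob_space.norm_integral_le_bdd[OF prob_space_circle])
 qed
qed

lemma fibre_integral:
 assumes D: "prob_space D" and K: "bdd D K B" and f: "bdd (D \<Otimes>\<^sub>M CM) f B'"
 shows "(LINT y|(D \<Otimes>\<^sub>M CM). K (fst y) * f y) = (LINT d|D. K d * (LINT z|CM. f (d, z)))"
proof -
 interpret D: prob_space D by (rule D)
 interpret P: pair_prob_space D CM using D prob_space_circle by (simp add: pair_prob_space_def pair_sigma_finite_def prob_space_imp_sigma_finite)
 have b: "bdd (D \<Otimes>\<^sub>M CM) (\<lambda>y. K (fst y) * f y) (B * B')" by (rule bdd_mult[OF bdd_compose[OF K measurable_fst] f])
 have "integrable (D \<Otimes>\<^sub>M CM) (\<lambda>y. K (fst y) * f y)" by (rule P.bdd_integrable[OF b])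
 from P.integral_fst'[OF this] show ?thesis by simp
qed

lemma pair_prob_spaceI: "prob_space M ==> prob_space N ==> pair_prob_space M N"
 by (simp add: pair_prob_space_def pair_sigma_finite_def prob_space_imp_sigma_finite)

lemma pair_integral_bdd:
 assumes M: "prob_space M" and N: "prob_space N" and f: "bdd (M \<Otimes>\<^sub>M N) f B"
 shows "(LINT y|(M \<Otimes>\<^sub>M N). f y) = (LINT x|M. (LINT y|N. f (x, y)))"
  "(LINT x|M. (LINT y|N. f (x, y))) = (LINT y|N. (LINT x|M. f (x, y)))"
proof -
 interpret P: pair_prob_space M N by (rule pair_prob_spaceI[OF M N])
 have i: "integrable (M \<Otimes>\<^sub>M N) f" by (rule P.bdd_integrable[OF f])
 show "(LINT y|(M \<Otimes>\<^sub>M N). f y) = (LINT x|M. (LINT y|N. f (x, y)))" using P.integral_fst'[OF i] by simp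
 show "(LINT x|M. (LINT y|N. f (x, y))) = (LINT y|N. (LINT x|M. f (x, y)))" using P.Fubini_integral[of "\<lambda>x y. f (x, y)"] i by simp
qed

lemma prob_pair: "prob_space M ==> prob_space N ==> prob_space (M \<Otimes>\<^sub>M N)"
proof -
 assume "prob_space M" "prob_space N"
 then interpret P: pair_prob_space M N by (rule pair_prob_spaceI)
 show ?thesis by (rule P.prob_space_axioms)
qed

definition mean0 :: "(sol \<times> complex => complex) => sol => complex" where
 "mean0 h u = (LINT z|CM. h (u, z))"

text \<open>The autocorrelation on the group. It is continuous, and the correlations of the system
  are its samples along \<open>iota\<close> up to a sequence tending to 0.\<close>

definition acorr :: "(sol => complex) => sol => complex" where
 "acorr f v = (LINT u|haar. f (v * u) * cnj (f u))"

lemma mean0_bdd: "bdd XM h B ==> bdd haar (mean0 h) B" unfolding mean0_def[abs_def] XM_def by (rule fibre_bdd[OF haar_prob])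

lemma translate_bdd: "bdd haar f B ==> v \<in> solen ==> bdd haar (\<lambda>u. f (v * u)) B" by (rule bdd_compose[OF _ translate_measurable])

text \<open>\<open>h\<close> is split into its fibre mean and a part \<open>H\<close> of fibre mean
  0. Correlations against \<open>H\<close> vanish at infinity by mixing and density; the others
  depend on the base rotation alone.\<close>

lemma corr_decomposition:
 assumes h: "bdd XM h B"
 shows "vanishing (\<lambda>g. XA.corr h g - acorr (mean0 h) (iota g))"
proof -
 let ?h0 = "mean0 h"
 define H where "H x = h x - ?h0 (fst x)" for x
 have h0: "bdd haar ?h0 B" by (rule mean0_bdd[OF h])
 have F0: "bdd XM (\<lambda>x. ?h0 (fst x)) B" by (rule bdd_compose[OF h0 XM_fst])
 have hs: "sqi XM h" by (rule XM.bdd_square[OF h])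
 have F0s: "sqi XM (\<lambda>x. ?h0 (fst x))" by (rule XM.bdd_square[OF F0])
 have Hs: "sqi XM H" unfolding H_def by (rule sqi_diff[OF hs F0s])
 have Hb: "bdd XM H (B + B)" unfolding bdd_def
 proof
  show "H \<in> borel_measurable XM" by (rule square_integrableD(1)[OF Hs])
  show "\<forall>x\<in>space XM. cmod (H x) \<le> B + B"
   unfolding H_def using bdd_le[OF h] bdd_le[OF F0] norm_triangle_ineq4 by (meson add_mono order_trans)
 qed
 have fh: "bdd CM (\<lambda>z. h (u, z)) B" if "u \<in> solen" for u by (rule bdd_compose[OF h]) (use that in "simp add: XM_def measurable_Pair1'")
 have Hz: "(LINT x|XM. K (fst x) * cnj (H x)) = 0" if K: "bdd haar K C" for K C
 proof -
  have "(LINT z|CM. H (u, z)) = 0" if "u \<in> solen" for u unfolding H_def using prob_space.bdd_integrable[OF prob_space_circle fh[OF that]]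
   by (simp add: mean0_def prob_space.prob_space[OF prob_space_circle, simplified])
  hence "(LINT u|haar. K u * (LINT z|CM. cnj (H (u, z)))) = (LINT u|haar. 0)" by (intro LINT_cong) simp_all
  thus ?thesis using fibre_integral[OF haar_prob K bdd_cnj[OF Hb, unfolded XM_def]] by (simp add: XM_def)
 qed
 have van: "vanishing (\<lambda>g. LINT x|XM. xchar pz m (TX g x) * cnj (H x))" if pz: "pz \<in> chars" for pz m
 proof (cases "m = 0")
  case True
  have "(LINT x|XM. xchar pz m (TX g x) * cnj (H x)) = 0" if g: "g \<in> GG" for g
  proof -
   have "bdd haar (\<lambda>u. pz (iota g * u)) 1"
    by (rule translate_bdd[OF _ iota_solen[OF g]]) (simp add: bdd_def chars_measurable[OF pz] chars_norm[OF pz])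
   from Hz[OF this] have "(LINT x|XM. pz (iota g * fst x) * cnj (H x)) = 0" .
   moreover have "(LINT x|XM. xchar pz m (TX g x) * cnj (H x)) = (LINT x|XM. pz (iota g * fst x) * cnj (H x))"
    by (rule LINT_cong) (simp_all add: True xchar_def TX_eq)
   ultimately show ?thesis by simp
  qed
  hence e: "{g \<in> GG. (LINT x|XM. xchar pz m (TX g x) * cnj (H x)) \<noteq> 0} = {}" by blast
  show ?thesis by (rule vanishing_finite_support) (simp only: e finite.emptyI)
 qed (rule xchar_mixing_square[OF pz _ Hs])
 have vanP: "vanishing (\<lambda>g. LINT x|XM. P (TX g x) * cnj (H x))" if "P \<in> trigX" for P using that
 proof induction
  case (basic pz c m)
  from vanishing_cmult[OF van[OF basic], of c m] show ?case by (simp add: mult.assoc)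
 next
  case (add P Q)
  have "(LINT x|XM. (P (TX g x) + Q (TX g x)) * cnj (H x)) = (LINT x|XM. P (TX g x) * cnj (H x)) + (LINT x|XM. Q (TX g x) * cnj (H x))"
   if "g \<in> GG" for g
  proof -
   have "integrable XM (\<lambda>x. P (TX g x) * cnj (H x))" "integrable XM (\<lambda>x. Q (TX g x) * cnj (H x))"
    by (intro integrable_mult_square XA.sqi_T that Hs sqi_cnj trigX_square add.hyps)+
   thus ?thesis by (simp add: distrib_right)
  qed
  thus ?case by (rule vanishing_cong[OF vanishing_add[OF add.IH]])
 qed
 have vanh: "vanishing (\<lambda>g. LINT x|XM. h (TX g x) * cnj (H x))"
 proof (rule vanishing_approx)
  fix e :: real assume e: "e > 0"
  define N where "N = l2_norm XM H + 1"
  have N: "N > 0" "l2_norm XM H \<le> N" using l2_norm_nonneg[of XM H] by (simp_all add: N_def)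
  have eN: "e / N > 0" using e N by simp
  obtain P where P: "P \<in> trigX" "l2_norm XM (\<lambda>x. h x - P x) < e / N" using XD.l2_approx[OF hs eN] .
  have d: "sqi XM (\<lambda>x. h x - P x)" by (rule sqi_diff[OF hs trigX_square[OF P(1)]])
  have "cmod ((LINT x|XM. h (TX g x) * cnj (H x)) - (LINT x|XM. P (TX g x) * cnj (H x))) \<le> e" if g: "g \<in> GG" for g
  proof -
   have i: "integrable XM (\<lambda>x. h (TX g x) * cnj (H x))" "integrable XM (\<lambda>x. P (TX g x) * cnj (H x))"
    by (intro integrable_mult_square XA.sqi_T g sqi_cnj trigX_square P(1) hs Hs)+
   have "(LINT x|XM. h (TX g x) * cnj (H x)) - (LINT x|XM. P (TX g x) * cnj (H x)) = (LINT x|XM. (h (TX g x) - P (TX g x)) * cnj (H x))"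
    using i by (simp add: left_diff_distrib)
   also have "cmod ... \<le> l2_norm XM (\<lambda>x. h (TX g x) - P (TX g x)) * l2_norm XM H" by (rule Cauchy_Schwarz_l2[OF XA.sqi_T[OF g d] Hs])
   also have "... = l2_norm XM (\<lambda>x. h x - P x) * l2_norm XM H" using XA.l2_norm_T[OF g square_integrableD(1)[OF d]] by (simp only:)
   also have "... \<le> e / N * N" using N P(2) eN by (intro mult_mono l2_norm_nonneg) auto
   finally show ?thesis using N by simp
  qed
  thus "\<exists>d. vanishing d \<and> (\<forall>g\<in>GG. cmod ((LINT x|XM. h (TX g x) * cnj (H x)) - d g) \<le> e)"
   by (intro exI[of _ "\<lambda>g. LINT x|XM. P (TX g x) * cnj (H x)"] conjI vanP[OF P(1)] ballI)
 qed
 show ?thesis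
 proof (rule vanishing_cong[OF vanh])
  fix g assume g: "g \<in> GG"
  have i: "integrable XM (\<lambda>x. h (TX g x) * cnj (H x))" "integrable XM (\<lambda>x. h (TX g x) * cnj (?h0 (fst x)))"
   by (intro integrable_mult_square XA.sqi_T g sqi_cnj hs Hs F0s)+
  have "XA.corr h g = (LINT x|XM. h (TX g x) * cnj (H x) + h (TX g x) * cnj (?h0 (fst x)))" unfolding XA.corr_def H_def by (simp add: right_diff_distrib)
  also have "... = (LINT x|XM. h (TX g x) * cnj (H x)) + (LINT x|XM. h (TX g x) * cnj (?h0 (fst x)))" by (rule Bochner_Integration.integral_add[OF i])
  also have "(LINT x|XM. h (TX g x) * cnj (?h0 (fst x))) = (LINT u|haar. (LINT z|CM. h (TX g (u, z)) * cnj (?h0 u)))" using integral_XM[OF i(2)] by simp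
  also have "... = acorr ?h0 (iota g)" unfolding acorr_def
  proof (rule LINT_cong[OF refl])
   fix u assume "u \<in> space haar"
   hence u: "u \<in> solen" by simp
   have "(LINT z|CM. h (TX g (u, z)) * cnj (?h0 u)) = (LINT z|CM. h (iota g * u, rho g u * z) * cnj (?h0 u))"
    by (rule LINT_cong[OF refl]) (use u in "simp add: TX_eq space_XM")
   also have "... = (LINT z|CM. h (iota g * u, rho g u * z)) * cnj (?h0 u)" by (rule Bochner_Integration.integral_mult_left_zero)
   also have "(LINT z|CM. h (iota g * u, rho g u * z)) = ?h0 (iota g * u)"
    unfolding mean0_def using rho_norm[OF g u] bdd_measurable[OF fh[OF solen_mult[OF iota_solen[OF g] u]]] by (intro circle_integral_rotate) simp_all
   finally show "(LINT z|CM. h (TX g (u, z)) * cnj (?h0 u)) = ?h0 (iota g * u) * cnj (?h0 u)" .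
  qed
  finally show "XA.corr h g - acorr ?h0 (iota g) = (LINT x|XM. h (TX g x) * cnj (H x))" by simp
 qed
qed

lemma continuous_on_uniform_approx:
 fixes f :: "'a::topological_space => 'b::metric_space"
 assumes "\<And>e. e > 0 ==> \<exists>g. continuous_on S g \<and> (\<forall>x\<in>S. dist (f x) (g x) < e)"
 shows "continuous_on S f"
proof -
 have "\<forall>n. \<exists>g. continuous_on S g \<and> (\<forall>x\<in>S. dist (f x) (g x) < 1 / real (Suc n))" using assms by simp
 then obtain g where g: "\<And>n. continuous_on S (g n)" "\<And>n x. x \<in> S ==> dist (f x) (g n x) < 1 / real (Suc n)" by metis
 show ?thesis
 proof (rule uniform_limit_theorem)
  show "\<forall>\<^sub>F n in sequentially. continuous_on S (g n)" by (simp add: g(1))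
  show "uniform_limit S g f sequentially"
  proof (rule uniform_limitI)
   fix e :: real assume e: "e > 0"
   obtain N where N: "inverse (real (Suc N)) < e" using reals_Archimedean[OF e] by blast
   show "\<forall>\<^sub>F n in sequentially. \<forall>x\<in>S. dist (g n x) (f x) < e" unfolding eventually_sequentially
   proof (intro exI allI impI ballI)
    fix n x assume n: "N \<le> n" and x: "x \<in> S"
    have "dist (g n x) (f x) < 1 / real (Suc n)" using g(2)[OF x] by (simp only: dist_commute)
    also have "... \<le> 1 / real (Suc N)" using n by (intro divide_left_mono) auto
    also have "... < e" using N by (simp only: inverse_eq_divide)
    finally show "dist (g n x) (f x) < e" .
   qed
  qed
 qed simp
qed

lemma haar_square_translate:
 assumes "sqi haar f" "v \<in> solen"
 shows "sqi haar (\<lambda>u. f (v * u))" "l2_norm haar (\<lambda>u. f (v * u)) = l2_norm haar f"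
proof -
 have fm: "f \<in> borel_measurable haar" by (rule square_integrableD(1)[OF assms(1)])
 have "integrable haar (\<lambda>u. (cmod (f (v * u)))\<^sup>2)"
  using integrable_distr[OF translate_measurable[OF assms(2)], of "\<lambda>u. (cmod (f u))\<^sup>2"]
   square_integrableD(2)[OF assms(1)] by (simp add: distr_haar_translate[OF assms(2)])
 thus "sqi haar (\<lambda>u. f (v * u))" using m_comp[OF translate_measurable[OF assms(2)] fm] by (simp add: square_integrable_def)
 have "(\<lambda>u. (cmod (f u))\<^sup>2) \<in> borel_measurable haar" using fm by measurable
 from haar_integral_translate[OF assms(2) this] show "l2_norm haar (\<lambda>u. f (v * u)) = l2_norm haar f" by (simp only: l2_norm_def)
qed

text \<open>If one factor is replaced by a trigonometric polynomial, the correlation becomes a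
  finite combination of characters of \<open>v\<close>; by Cauchy-Schwarz the approximation is
  uniform in \<open>v\<close>.\<close>

lemma acorr_continuous:
 assumes f: "sqi haar f"
 shows "continuous_on solen (acorr f)"
proof (rule continuous_on_uniform_approx)
 fix e :: real assume e: "e > 0"
 define N where "N = l2_norm haar f + 1"
 have N: "N > 0" "l2_norm haar f \<le> N" using l2_norm_nonneg[of haar f] by (simp_all add: N_def)
 have eN: "e / (2 * N) > 0" using e N by simp
 obtain P where P: "P \<in> trigU" "l2_norm haar (\<lambda>u. f u - P u) < e / (2 * N)" using UD.l2_approx[OF f eN] .
 have cont: "continuous_on solen (\<lambda>v. LINT u|haar. Q (v * u) * cnj (f u))" if "Q \<in> trigU" for Q using that
 proof induction
  case (basic xi c)
  have eq: "(\<lambda>v. LINT u|haar. c * xi (v * u) * cnj (f u)) = (\<lambda>v. c * xi v * (LINT u|haar. xi u * cnj (f u)))"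
   by (simp add: chars_mult[OF basic] mult.assoc)
  show ?case unfolding eq by (intro continuous_on_mult continuous_on_const chars_continuous[OF basic])
 next
  case (add Q R)
  have "(LINT u|haar. (Q (v * u) + R (v * u)) * cnj (f u)) = (LINT u|haar. Q (v * u) * cnj (f u)) + (LINT u|haar. R (v * u) * cnj (f u))"
   if v: "v \<in> solen" for v
  proof -
   have "integrable haar (\<lambda>u. Q (v * u) * cnj (f u))" "integrable haar (\<lambda>u. R (v * u) * cnj (f u))"
    by (intro integrable_mult_square haar_square_translate(1) v sqi_cnj f trigU_square add.hyps)+
   thus ?thesis by (simp add: distrib_right)
  qed
  thus ?case by (subst continuous_on_cong[OF refl]) (auto intro: continuous_on_add add.IH)
 qed
 have "dist (acorr f v) (LINT u|haar. P (v * u) * cnj (f u)) < e" if v: "v \<in> solen" for v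
 proof -
  have d: "sqi haar (\<lambda>u. f u - P u)" by (rule sqi_diff[OF f trigU_square[OF P(1)]])
  have i: "integrable haar (\<lambda>u. f (v * u) * cnj (f u))" "integrable haar (\<lambda>u. P (v * u) * cnj (f u))"
   by (intro integrable_mult_square haar_square_translate(1) v sqi_cnj f trigU_square[OF P(1)])+
  have "acorr f v - (LINT u|haar. P (v * u) * cnj (f u)) = (LINT u|haar. (f (v * u) - P (v * u)) * cnj (f u))"
   unfolding acorr_def using i by (simp add: left_diff_distrib)
  also have "cmod ... \<le> l2_norm haar (\<lambda>u. f (v * u) - P (v * u)) * l2_norm haar f"
   by (rule Cauchy_Schwarz_l2[OF haar_square_translate(1)[OF d v] f])
  also have "l2_norm haar (\<lambda>u. f (v * u) - P (v * u)) = l2_norm haar (\<lambda>u. f u - P u)" by (rule haar_square_translate(2)[OF d v])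
  also have "... * l2_norm haar f \<le> e / (2 * N) * N" using N P(2) eN by (intro mult_mono l2_norm_nonneg) auto
  also have "e / (2 * N) * N = e / 2" using N by simp
  also have "e / 2 < e" using e by simp
  finally show ?thesis by (simp only: dist_norm)
 qed
 thus "\<exists>g. continuous_on solen g \<and> (\<forall>x\<in>solen. dist (acorr f x) (g x) < e)"
  using cont[OF P(1)] by (intro exI[of _ "\<lambda>v. LINT u|haar. P (v * u) * cnj (f u)"] conjI ballI)
qed

section \<open>Equidistribution of the acting group in the solenoid\<close>

lemma equidistribution_trigU:
 assumes Ph: "folner_sequence PG Ph" and P: "P \<in> trigU"
 shows "(\<lambda>N. (\<Sum>g\<in>Ph N. P (iota g)) / of_nat (card (Ph N))) ----> (LINT u|haar. P u)" using P
proof induction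
 case (basic xi c)
 note FS = folner_sequenceD[OF Ph]
 have "(\<lambda>N. (\<Sum>g\<in>Ph N. xi (iota g)) / of_nat (card (Ph N))) ----> (LINT u|haar. xi u)"
 proof (cases "\<forall>g\<in>GG. xi (iota g) = 1")
  case True
  have e1: "(\<Sum>g\<in>Ph N. xi (iota g)) / of_nat (card (Ph N)) = 1" for N
  proof -
   have "(\<Sum>g\<in>Ph N. xi (iota g)) = (\<Sum>g\<in>Ph N. 1)" using True FS(3)[of N] by (intro sum.cong) auto
   thus ?thesis using FS(4)[of N] by simp
  qed
  have "(LINT u|haar. xi u) = (LINT u|haar. 1)" by (rule LINT_cong) (use chars_trivial[OF basic] True in simp_all)
  hence e2: "(LINT u|haar. xi u) = 1" by (simp add: haar.prob_space[simplified])
  show ?thesis unfolding e1 e2 by simp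
 next
  case False
  then obtain g0 where g0: "g0 \<in> GG" "xi (iota g0) \<noteq> 1" by blast
  have "(LINT u|haar. xi u) = 0" by (rule chars_integral[OF basic iota_solen[OF g0(1)] g0(2)])
  moreover have "(\<lambda>N. (\<Sum>g\<in>Ph N. xi (iota g)) / of_nat (card (Ph N))) ----> 0"
   by (rule PG.folner_average_character[OF Ph, where c="\<lambda>g. xi (iota g)" and ?g0.0=g0])
    (simp_all add: g0 iota_mult chars_mult[OF basic] chars_norm[OF basic] iota_solen)
  ultimately show ?thesis by simp
 qed
 from tendsto_mult_left[OF this, of c] show ?case by (simp add: sum_distrib_left)
next
 case (add P Q)
 have "integrable haar P" "integrable haar Q" using integrable_mult_square[OF trigU_square[OF add.hyps(1)] trigU_square[OF trigU_const[of 1]]]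
   integrable_mult_square[OF trigU_square[OF add.hyps(2)] trigU_square[OF trigU_const[of 1]]] by simp_all
 thus ?case using tendsto_add[OF add.IH] by (simp add: sum.distrib add_divide_distrib)
qed

lemma continuous_haar_measurable: "continuous_on solen (f :: _ => 'b::topological_space) ==> f \<in> borel_measurable haar"
 unfolding measurable_cong_sets[OF sets_haar refl] by (rule borel_measurable_continuous_on_restrict)

text \<open>Weyl's criterion: uniform approximation changes the averages and the integral by at most
  the same small amount.\<close>

lemma equidistribution_real:
 fixes f :: "sol => real"
 assumes Ph: "folner_sequence PG Ph" and f: "continuous_on solen f"
 shows "(\<lambda>N. (\<Sum>g\<in>Ph N. f (iota g)) / real (card (Ph N))) ----> (LINT u|haar. f u)"
proof (rule tendstoI)
 fix e :: real assume e: "e > 0"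
 note FS = folner_sequenceD[OF Ph]
 have e3: "e / 3 > 0" using e by simp
 obtain P where P: "P \<in> trigU" "\<forall>u\<in>solen. cmod (of_real (f u) - P u) < e / 3" using trigU_uniform[OF f e3] by (elim bexE)
 have fm: "f \<in> borel_measurable haar" by (rule continuous_haar_measurable[OF f])
 obtain B where B: "\<And>u. u \<in> solen ==> \<bar>f u\<bar> \<le> B"
  using compact_imp_bounded[OF compact_continuous_image[OF f compact_solen]] unfolding bounded_iff by auto
 have fi: "integrable haar f" by (rule haar.integrable_const_bound[where B=B]) (use B fm in auto)
 have Pi: "integrable haar P" using integrable_mult_square[OF trigU_square[OF P(1)] trigU_square[OF trigU_const[of 1]]] by simp
 have I: "cmod (of_real (LINT u|haar. f u) - (LINT u|haar. P u)) \<le> e / 3"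
 proof -
  have eq: "of_real (LINT u|haar. f u) - (LINT u|haar. P u) = (LINT u|haar. of_real (f u) - P u)" using fi Pi by (simp add: integral_complex_of_real)
  have "(\<lambda>u. complex_of_real (f u) - P u) \<in> borel_measurable haar" using fm borel_measurable_integrable[OF Pi] by measurable
  hence b: "bdd haar (\<lambda>u. of_real (f u) - P u) (e / 3)" unfolding bdd_def using P(2) by (simp add: less_imp_le)
  show ?thesis unfolding eq by (rule haar.norm_integral_le_bdd[OF b])
 qed
 have "\<forall>\<^sub>F N in sequentially. dist ((\<Sum>g\<in>Ph N. P (iota g)) / of_nat (card (Ph N))) (LINT u|haar. P u) < e / 3"
  by (rule tendstoD[OF equidistribution_trigU[OF Ph P(1)] e3])
 thus "\<forall>\<^sub>F N in sequentially. dist ((\<Sum>g\<in>Ph N. f (iota g)) / real (card (Ph N))) (LINT u|haar. f u) < e"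
 proof eventually_elim
  case (elim N)
  define a where "a = (\<Sum>g\<in>Ph N. f (iota g)) / real (card (Ph N))"
  define b where "b = (\<Sum>g\<in>Ph N. P (iota g)) / of_nat (card (Ph N))"
  have "of_real a - b = (\<Sum>g\<in>Ph N. of_real (f (iota g)) - P (iota g)) / of_nat (card (Ph N))"
   by (simp add: a_def b_def sum_subtractf diff_divide_distrib)
  moreover have "cmod (\<Sum>g\<in>Ph N. of_real (f (iota g)) - P (iota g)) \<le> real (card (Ph N)) * (e / 3)"
  proof (rule sum_norm_bound)
   fix g assume "g \<in> Ph N"
   hence "iota g \<in> solen" using FS(3)[of N] iota_solen by blast
   thus "cmod (of_real (f (iota g)) - P (iota g)) \<le> e / 3" using P(2) by (simp add: less_imp_le)
  qed
  ultimately have 1: "cmod (of_real a - b) \<le> e / 3" using FS(4)[of N] by (simp add: norm_divide divide_le_eq mult.commute)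
  have tri: "cmod (x + y - z) \<le> cmod x + cmod y + cmod z" for x y z :: complex
   using norm_triangle_ineq4[of "x + y" z] norm_triangle_ineq[of x y] by linarith
  have "of_real (a - (LINT u|haar. f u)) = (of_real a - b) + (b - (LINT u|haar. P u)) - (of_real (LINT u|haar. f u) - (LINT u|haar. P u))" by simp
  hence "cmod (of_real (a - (LINT u|haar. f u))) \<le> cmod (of_real a - b) + cmod (b - (LINT u|haar. P u)) + cmod (of_real (LINT u|haar. f u) - (LINT u|haar. P u))"
   by (simp only: tri)
  also have "... < e" using 1 I elim by (simp add: dist_norm b_def)
  finally show ?case by (simp add: dist_real_def a_def norm_of_real del: of_real_diff)
 qed
qed

lemma acorr_bound:
 assumes f: "bdd haar f B" and v: "v \<in> solen"
 shows "cmod (acorr f v) \<le> B * B" unfolding acorr_def by (rule haar.norm_integral_le_bdd[OF bdd_mult[OF translate_bdd[OF f v] bdd_cnj[OF f]]])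

text \<open>The correlations differ from samples of a continuous function by a sequence vanishing at
  infinity. The averages of the difference tend to 0, and the samples equidistribute.\<close>

lemma avg_corr_limit:
 assumes Ph: "folner_sequence PG Ph" and h: "bdd XM h B"
 shows "(\<lambda>N. (\<Sum>g\<in>Ph N. (cmod (XA.corr h g))\<^sup>2) / real (card (Ph N))) ----> (LINT v|haar. (cmod (acorr (mean0 h) v))\<^sup>2)"
  "(\<lambda>N. (\<Sum>g\<in>Ph N. Re (XA.corr h g)) / real (card (Ph N))) ----> (LINT v|haar. Re (acorr (mean0 h) v))"
proof -
 let ?a = "\<lambda>v. acorr (mean0 h) v"
 note FS = folner_sequenceD[OF Ph]
 have h0: "bdd haar (mean0 h) B" by (rule mean0_bdd[OF h])
 have ca: "continuous_on solen ?a" by (rule acorr_continuous[OF haar.bdd_square[OF h0]])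
 have ab: "cmod (?a (iota g)) \<le> B * B" if "g \<in> GG" for g by (rule acorr_bound[OF h0 iota_solen[OF that]])
 have cb: "cmod (XA.corr h g) \<le> B * B" if g: "g \<in> GG" for g unfolding XA.corr_def
  by (rule XM.norm_integral_le_bdd[OF bdd_mult[OF bdd_compose[OF h XA.T_measurable[OF g]] bdd_cnj[OF h]]])
 have B0: "B \<ge> 0" by (rule XM.bdd_nonneg[OF h])
 have van: "vanishing (\<lambda>g. XA.corr h g - ?a (iota g))" by (rule corr_decomposition[OF h])
 have avg0: "(\<lambda>N. (\<Sum>g\<in>Ph N. complex_of_real (d g)) / of_nat (card (Ph N))) ----> 0"
  if d: "\<And>g. g \<in> GG ==> \<bar>d g\<bar> \<le> K * cmod (XA.corr h g - ?a (iota g))" and K: "K > 0" for d :: "(nat => int) => real" and K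
 proof (rule PG.folner_average_vanishing[OF Ph infinite_PG])
  fix g assume g: "g \<in> GG"
  have "cmod (XA.corr h g - ?a (iota g)) \<le> B * B + B * B" using norm_triangle_ineq4[of "XA.corr h g" "?a (iota g)"] ab[OF g] cb[OF g] by linarith
  hence "K * cmod (XA.corr h g - ?a (iota g)) \<le> K * (B * B + B * B)" using K by simp
  thus "cmod (complex_of_real (d g)) \<le> K * (B * B + B * B)" using d[OF g] by simp
 next
  fix e :: real assume e: "e > 0"
  have "{g \<in> GG. e \<le> cmod (complex_of_real (d g))} \<subseteq> {g \<in> GG. cmod (XA.corr h g - ?a (iota g)) \<ge> e / K}"
  proof
   fix g assume g: "g \<in> {g \<in> GG. e \<le> cmod (complex_of_real (d g))}"
   hence "e \<le> K * cmod (XA.corr h g - ?a (iota g))" using d[of g] by simp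
   thus "g \<in> {g \<in> GG. cmod (XA.corr h g - ?a (iota g)) \<ge> e / K}" using g K by (simp add: field_simps)
  qed
  moreover have "finite {g \<in> GG. cmod (XA.corr h g - ?a (iota g)) \<ge> e / K}" using van e K by (simp add: vanishing_def)
  ultimately show "finite {g \<in> GG. e \<le> cmod (complex_of_real (d g))}" by (rule finite_subset)
 qed
 \<comment> \<open>Stated for a function \<open>r\<close> with a Lipschitz bound on the values in
   question, since it is applied both to the real part and to the squared modulus.\<close>
 have lim: "(\<lambda>N. (\<Sum>g\<in>Ph N. r (XA.corr h g)) / real (card (Ph N))) ----> (LINT v|haar. r (?a v))"
  if r: "continuous_on UNIV r" and d: "\<And>g. g \<in> GG ==> \<bar>r (XA.corr h g) - r (?a (iota g))\<bar> \<le> K * cmod (XA.corr h g - ?a (iota g))"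
   and K: "K > 0" for r :: "complex => real" and K
 proof -
  have "continuous_on solen (\<lambda>v. r (?a v))" by (rule continuous_on_compose2[OF r ca]) simp
  from equidistribution_real[OF Ph this]
  have 1: "(\<lambda>N. (\<Sum>g\<in>Ph N. r (?a (iota g))) / real (card (Ph N))) ----> (LINT v|haar. r (?a v))" .
  have "(\<lambda>N. Re ((\<Sum>g\<in>Ph N. complex_of_real (r (XA.corr h g) - r (?a (iota g)))) / of_nat (card (Ph N)))) ----> Re 0"
   by (rule tendsto_Re[OF avg0[OF d K]])
  hence 2: "(\<lambda>N. (\<Sum>g\<in>Ph N. r (XA.corr h g) - r (?a (iota g))) / real (card (Ph N))) ----> 0" by (simp del: of_real_diff)
  from tendsto_add[OF 2 1] show ?thesis by (simp add: sum_subtractf diff_divide_distrib)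
 qed
 show "(\<lambda>N. (\<Sum>g\<in>Ph N. Re (XA.corr h g)) / real (card (Ph N))) ----> (LINT v|haar. Re (?a v))"
 proof (rule lim[of Re 1])
  show "\<bar>Re (XA.corr h g) - Re (?a (iota g))\<bar> \<le> 1 * cmod (XA.corr h g - ?a (iota g))" for g
   using abs_Re_le_cmod[of "XA.corr h g - ?a (iota g)"] by simp
 qed (auto intro: continuous_intros)
 show "(\<lambda>N. (\<Sum>g\<in>Ph N. (cmod (XA.corr h g))\<^sup>2) / real (card (Ph N))) ----> (LINT v|haar. (cmod (?a v))\<^sup>2)"
 \<comment> \<open>A Lipschitz constant of the squared modulus on the disc of radius
   \<open>B * B\<close>, increased by 1 to be positive also for \<open>B = 0\<close>.\<close>
 proof (rule lim[of "\<lambda>c. (cmod c)\<^sup>2" "2 * (B * B) + 1"])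
  fix g assume g: "g \<in> GG"
  let ?c = "XA.corr h g" and ?b = "?a (iota g)"
  have "(cmod ?c)\<^sup>2 - (cmod ?b)\<^sup>2 = (cmod ?c + cmod ?b) * (cmod ?c - cmod ?b)" by (simp add: power2_eq_square algebra_simps)
  hence "\<bar>(cmod ?c)\<^sup>2 - (cmod ?b)\<^sup>2\<bar> = (cmod ?c + cmod ?b) * \<bar>cmod ?c - cmod ?b\<bar>" by (simp add: abs_mult)
  also have "... \<le> (2 * (B * B) + 1) * cmod (?c - ?b)" using ab[OF g] cb[OF g] norm_triangle_ineq3[of ?c ?b] by (intro mult_mono) auto
  finally show "\<bar>(cmod ?c)\<^sup>2 - (cmod ?b)\<^sup>2\<bar> \<le> (2 * (B * B) + 1) * cmod (?c - ?b)" .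
 qed (use B0 in "auto intro!: continuous_intros add_nonneg_pos")
qed

section \<open>The first two Gowers norms\<close>

lemma integral_acorr:
 assumes f: "bdd haar f B"
 shows "(LINT v|haar. acorr f v) = of_real ((cmod (LINT u|haar. f u))\<^sup>2)"
proof -
 have m: "(\<lambda>p. fst p * snd p) \<in> measurable (haar \<Otimes>\<^sub>M haar) haar"
  by (rule measurable_solen_mult[OF measurable_fst measurable_snd])
 have b: "bdd (haar \<Otimes>\<^sub>M haar) (\<lambda>p. f (fst p * snd p) * cnj (f (snd p))) (B * B)"
  by (rule bdd_mult[OF bdd_compose[OF f m] bdd_cnj[OF bdd_compose[OF f measurable_snd]]])
 have "(LINT v|haar. acorr f v) = (LINT u|haar. (LINT v|haar. f (v * u) * cnj (f u)))"
  unfolding acorr_def using pair_integral_bdd(2)[OF haar_prob haar_prob b] by simp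
 also have "... = (LINT u|haar. (LINT v|haar. f v) * cnj (f u))"
 proof (rule LINT_cong[OF refl])
  fix u assume "u \<in> space haar"
  hence u: "u \<in> solen" by simp
  have "(LINT v|haar. f (v * u) * cnj (f u)) = (LINT v|haar. f (u * v)) * cnj (f u)" by (simp add: mult.commute[of u])
  thus "(LINT v|haar. f (v * u) * cnj (f u)) = (LINT v|haar. f v) * cnj (f u)" by (simp only: haar_integral_translate[OF u bdd_measurable[OF f]])
 qed
 also have "... = (LINT v|haar. f v) * cnj (LINT u|haar. f u)" by simp
 finally show ?thesis by (simp only: complex_norm_square)
qed

lemma integral_mean0:
 assumes "bdd XM h B" shows "(LINT u|haar. mean0 h u) = (LINT x|XM. h x)"
 unfolding mean0_def by (rule integral_XM[OF XM.bdd_integrable[OF assms], symmetric])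

text \<open>The limit is \<open>hull_norm h\<close>, whose square is the mean correlation; by
  equidistribution this is the integral of the autocorrelation of the fibre mean.\<close>

theorem gowers_1:
 assumes h: "bdd XM h B"
 shows "gowers_norm PG XM TX (Suc 0) h = cmod (LINT x|XM. h x)"
proof -
 let ?a = "\<lambda>v. acorr (mean0 h) v"
 have h0: "bdd haar (mean0 h) B" by (rule mean0_bdd[OF h])
 have hs: "sqi XM h" by (rule XM.bdd_square[OF h])
 have ca: "continuous_on solen ?a" by (rule acorr_continuous[OF haar.bdd_square[OF h0]])
 have "bdd haar ?a (B * B)" unfolding bdd_def using continuous_haar_measurable[OF ca] acorr_bound[OF h0] by simp
 hence ai: "integrable haar ?a" by (rule haar.bdd_integrable)
 have "(LINT v|haar. Re (?a v)) = Re (LINT v|haar. ?a v)" by (rule integral_Re[OF ai])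
 also have "... = (cmod (LINT x|XM. h x))\<^sup>2" unfolding integral_acorr[OF h0] integral_mean0[OF h] by simp
 finally have I: "(LINT v|haar. Re (?a v)) = (cmod (LINT x|XM. h x))\<^sup>2" .
 have "(\<lambda>N. Re ((\<Sum>g\<in>fol N. XA.corr h g) / of_nat (card (fol N)))) ----> Re (of_real ((XA.hull_norm h)\<^sup>2))"
  by (rule tendsto_Re[OF XA.avg_corr_tendsto[OF folner_fol hs]])
 hence "(\<lambda>N. (\<Sum>g\<in>fol N. Re (XA.corr h g)) / real (card (fol N))) ----> (XA.hull_norm h)\<^sup>2" by simp
 hence "(XA.hull_norm h)\<^sup>2 = (cmod (LINT x|XM. h x))\<^sup>2" using LIMSEQ_unique[OF _ avg_corr_limit(2)[OF folner_fol h]] I by simp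
 hence hn: "XA.hull_norm h = cmod (LINT x|XM. h x)" using XA.hull_norm_nonneg[of h] by (simp add: power2_eq_iff_nonneg)
 show ?thesis unfolding gowers_norm.simps
 proof (rule folner_limI[OF folner_fol])
  fix Ph assume "folner_sequence PG Ph"
  from XA.avg_norm_tendsto[OF this hs]
  show "(\<lambda>N. l2_norm XM (\<lambda>x. (\<Sum>g\<in>Ph N. h (TX g x)) / of_nat (card (Ph N)))) ----> cmod (LINT x|XM. h x)"
   unfolding hn XA.avg_def[abs_def] .
 qed
qed

lemma bdd_derivative:
 assumes "bdd XM h B" "g \<in> GG"
 shows "bdd XM (\<lambda>x. h (TX g x) * cnj (h x)) (B * B)"
 by (rule bdd_mult[OF bdd_compose[OF assms(1) XA.T_measurable[OF assms(2)]] bdd_cnj[OF assms(1)]])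

text \<open>By \<open>gowers_1\<close> the inner norm of a derivative is the modulus of a
  correlation. In the limit only the fibre mean of \<open>h\<close> remains visible.\<close>

theorem gowers_2:
 assumes h: "bdd XM h B"
 shows "gowers_norm PG XM TX (Suc (Suc 0)) h = root 4 (LINT v|haar. (cmod (acorr (mean0 h) v))\<^sup>2)"
proof -
 have f: "(2::nat) ^ Suc (Suc 0) = 4" "(2::nat) ^ Suc 0 = 2" by simp_all
 show ?thesis unfolding gowers_norm.simps(3) f
 proof (rule folner_limI[OF folner_fol])
  fix Ph assume Ph: "folner_sequence PG Ph"
  note FS = folner_sequenceD[OF Ph]
  have "(\<Sum>g\<in>Ph N. gowers_norm PG XM TX (Suc 0) (\<lambda>x. h (TX g x) * cnj (h x)) ^ 2) = (\<Sum>g\<in>Ph N. (cmod (XA.corr h g))\<^sup>2)" for N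
  proof (rule sum.cong[OF refl])
   fix g assume "g \<in> Ph N"
   hence g: "g \<in> GG" using FS(3)[of N] by blast
   show "gowers_norm PG XM TX (Suc 0) (\<lambda>x. h (TX g x) * cnj (h x)) ^ 2 = (cmod (XA.corr h g))\<^sup>2"
    unfolding gowers_1[OF bdd_derivative[OF h g]] XA.corr_def ..
  qed
  thus "(\<lambda>N. root 4 ((\<Sum>g\<in>Ph N. gowers_norm PG XM TX (Suc 0) (\<lambda>x. h (TX g x) * cnj (h x)) ^ 2) / real (card (Ph N))))
   ----> root 4 (LINT v|haar. (cmod (acorr (mean0 h) v))\<^sup>2)" using tendsto_real_root[OF avg_corr_limit(1)[OF Ph h], of 4] by simp
 qed
qed

text \<open>By compactness finitely many translates of the set cover the solenoid, and all of them
  have the same measure.\<close>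

lemma haar_open_pos:
 assumes W: "open W" "1 \<in> W"
 shows "measure haar (W \<inter> solen) > 0"
proof (rule ccontr)
 assume "\<not> measure haar (W \<inter> solen) > 0"
 hence z: "measure haar (W \<inter> solen) = 0" using measure_nonneg[of haar "W \<inter> solen"] by linarith
 define V where "V h = {u. uinv h * u \<in> W}" for h :: "nat => complex"
 have oV: "open (V h)" for h
 proof -
  have "continuous_on UNIV (\<lambda>u. uinv h * u)" unfolding times_fun_def
   by (intro continuous_on_coordinatewise_then_product continuous_intros continuous_on_coord)
  from open_vimage[OF W(1) this] show ?thesis by (simp add: V_def vimage_def)
 qed
 have cov: "solen \<subseteq> (\<Union>h\<in>solen. V h)"
 proof
  fix u assume u: "u \<in> solen"
  hence "u \<in> V u" using W(2) by (simp add: V_def uinv_mult)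
  thus "u \<in> (\<Union>h\<in>solen. V h)" using u by blast
 qed
 obtain D where D: "D \<subseteq> solen" "finite D" "solen \<subseteq> (\<Union>h\<in>D. V h)" using compactE_image[OF compact_solen oV cov] by blast
 have WS: "W \<inter> solen \<in> sets haar" using W(1) closed_solen by (simp add: sets_haar_borel)
 have Vm: "V h \<inter> solen \<in> sets haar \<and> measure haar (V h \<inter> solen) = 0" if h: "h \<in> solen" for h
 proof
  show 1: "V h \<inter> solen \<in> sets haar" using oV closed_solen by (simp add: sets_haar_borel)
  have "V h \<inter> solen = (\<lambda>u. uinv h * u) -` (W \<inter> solen) \<inter> space haar"
   using solen_mult[OF solen_uinv[OF h]] by (auto simp: V_def)
  hence "measure haar (V h \<inter> solen) = measure (distr haar haar (\<lambda>u. uinv h * u)) (W \<inter> solen)"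
   using measure_distr[OF translate_measurable[OF solen_uinv[OF h]] WS] by simp
  thus "measure haar (V h \<inter> solen) = 0" using z by (simp add: distr_haar_translate[OF solen_uinv[OF h]])
 qed
 have eq: "solen = (\<Union>h\<in>D. V h \<inter> solen)" using D(3) by auto
 have "measure haar solen \<le> (\<Sum>h\<in>D. measure haar (V h \<inter> solen))"
  by (subst eq, rule haar.finite_measure_subadditive_finite[OF D(2)]) (use Vm D(1) in auto)
 also have "... = 0" using Vm D(1) by (intro sum.neutral) auto
 finally show False using haar.prob_space by simp
qed

lemma acorr_one:
 assumes "sqi haar f" shows "acorr f 1 = of_real ((l2_norm haar f)\<^sup>2)" unfolding acorr_def by (simp add: integral_self_cnj)

lemma continuous_on_solen_nbhd:
 fixes f :: "sol => 'b::metric_space"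
 assumes "continuous_on solen f" "e > 0"
 obtains W where "open W" "1 \<in> W" "\<And>u. u \<in> W ==> u \<in> solen ==> dist (f u) (f 1) < e"
proof -
 have "\<exists>A. open A \<and> A \<inter> solen = f -` ball (f 1) e \<inter> solen" using assms(1) unfolding continuous_on_open_invariant by blast
 then obtain A where A: "open A" "A \<inter> solen = f -` ball (f 1) e \<inter> solen" by blast
 show thesis
 proof (rule that[OF A(1)])
  have "1 \<in> f -` ball (f 1) e \<inter> solen" using assms(2) solen_one by simp
  thus "1 \<in> A" using A(2) by blast
  fix u assume "u \<in> A" "u \<in> solen"
  hence "u \<in> f -` ball (f 1) e \<inter> solen" using A(2) by blast
  thus "dist (f u) (f 1) < e" by (simp add: dist_commute)
 qed
qed

text \<open>The autocorrelation is continuous with value the squared norm of \<open>f\<close> at 1;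
  if this were positive, it would be nonzero on an open set of positive measure.\<close>

lemma acorr_zero:
 assumes f: "bdd haar f B" and z: "(LINT v|haar. (cmod (acorr f v))\<^sup>2) = 0"
 shows "AE u in haar. f u = 0"
proof -
 have fs: "sqi haar f" by (rule haar.bdd_square[OF f])
 have ca: "continuous_on solen (acorr f)" by (rule acorr_continuous[OF fs])
 have am: "acorr f \<in> borel_measurable haar" by (rule continuous_haar_measurable[OF ca])
 have ab: "bdd haar (acorr f) (B * B)" unfolding bdd_def using am acorr_bound[OF f] by simp
 have as: "sqi haar (acorr f)" by (rule haar.bdd_square[OF ab])
 have "l2_norm haar (acorr f) = 0" using z by (simp add: l2_norm_def)
 hence ae: "AE v in haar. acorr f v = 0" by (rule l2_norm_eq_0_AE[OF as])
 show ?thesis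
 proof (rule l2_norm_eq_0_AE[OF fs], rule ccontr)
  assume ne: "l2_norm haar f \<noteq> 0"
  hence pos: "(l2_norm haar f)\<^sup>2 > 0" by simp
  obtain W where W: "open W" "1 \<in> W" "\<And>u. u \<in> W ==> u \<in> solen ==> dist (acorr f u) (acorr f 1) < (l2_norm haar f)\<^sup>2"
   using continuous_on_solen_nbhd[OF ca pos] by metis
  have WS: "W \<inter> solen \<in> sets haar" using W(1) closed_solen by (simp add: sets_haar_borel)
  have "acorr f u \<noteq> 0" if "u \<in> W \<inter> solen" for u
  proof
   assume "acorr f u = 0"
   hence "cmod (acorr f 1) < (l2_norm haar f)\<^sup>2" using W(3)[of u] that by (simp add: dist_norm)
   thus False unfolding acorr_one[OF fs] by (simp only: norm_of_real)
  qed
  hence "AE v in haar. v \<notin> W \<inter> solen" using ae by (auto elim: eventually_mono)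
  moreover have e: "{v \<in> space haar. \<not> v \<notin> W \<inter> solen} = W \<inter> solen" by auto
  ultimately have "emeasure haar (W \<inter> solen) = 0" by (intro iffD1[OF AE_iff_measurable[OF WS e]])
  hence "measure haar (W \<inter> solen) = 0" by (simp add: measure_def)
  thus False using haar_open_pos[OF W(1,2)] by simp
 qed
qed

text \<open>The rotation is a factor of the skew product, so its norms are read off from those
  computed above.\<close>

lemma gowers_lift:
 assumes "f \<in> borel_measurable haar"
 shows "gowers_norm PG haar alpha k f = gowers_norm PG XM TX k (\<lambda>x. f (fst x))" using assms
proof (induction k arbitrary: f)
 case 0
 show ?case by simp
next
 case (Suc k)
 have fT: "(\<lambda>u. f (alpha g u)) \<in> borel_measurable haar" if "g \<in> GG" for g by (rule m_comp[OF UA.T_measurable[OF that] Suc.prems])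
 have l2: "l2_norm XM (\<lambda>x. F (fst x)) = l2_norm haar F" if "F \<in> borel_measurable haar" for F :: "_ => complex"
 proof -
  have "(\<lambda>u. (cmod (F u))\<^sup>2) \<in> borel_measurable haar" using that by measurable
  from integral_XM_fst[OF this] show ?thesis by (simp only: l2_norm_def)
 qed
 show ?case
 proof (cases k)
  case 0
  have "l2_norm haar (\<lambda>x. (\<Sum>g\<in>A. f (alpha g x)) / of_nat (card A))
   = l2_norm XM (\<lambda>x. (\<Sum>g\<in>A. f (fst (TX g x))) / of_nat (card A))" if A: "A \<subseteq> GG" for A
  proof -
   have m: "(\<lambda>u. (\<Sum>g\<in>A. f (alpha g u)) / of_nat (card A)) \<in> borel_measurable haar"
    using A fT by (intro borel_measurable_divide borel_measurable_sum borel_measurable_const) auto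
   have "l2_norm XM (\<lambda>x. (\<Sum>g\<in>A. f (fst (TX g x))) / of_nat (card A))
     = l2_norm XM (\<lambda>x. (\<Sum>g\<in>A. f (alpha g (fst x))) / of_nat (card A))" unfolding l2_norm_def
    by (intro arg_cong[where f=sqrt] LINT_cong refl) (simp add: fst_TX)
   thus ?thesis using l2[OF m] by simp
  qed
  thus ?thesis unfolding 0 gowers_norm.simps by (rule folner_lim_cong)
 next
  case (Suc j)
  have "gowers_norm PG haar alpha (Suc j) (\<lambda>x. f (alpha g x) * cnj (f x))
   = gowers_norm PG XM TX (Suc j) (\<lambda>x. f (fst (TX g x)) * cnj (f (fst x)))" if g: "g \<in> GG" for g
  proof -
   have fc: "(\<lambda>u. cnj (f u)) \<in> borel_measurable haar" by (rule m_comp[OF Suc.prems measurable_cnj])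
   have m: "(\<lambda>u. f (alpha g u) * cnj (f u)) \<in> borel_measurable haar" by (rule borel_measurable_times[OF fT[OF g] fc])
   have 1: "gowers_norm PG haar alpha (Suc j) (\<lambda>x. f (alpha g x) * cnj (f x))
    = gowers_norm PG XM TX (Suc j) (\<lambda>x. f (alpha g (fst x)) * cnj (f (fst x)))" using Suc.IH[OF m] \<open>k = Suc j\<close> by simp
   also have "... = gowers_norm PG XM TX (Suc j) (\<lambda>x. f (fst (TX g x)) * cnj (f (fst x)))"
   proof (rule XA.gowers_norm_cong_AE)
    show m1: "(\<lambda>x. f (alpha g (fst x)) * cnj (f (fst x))) \<in> borel_measurable XM" by (rule m_comp[OF XM_fst m])
    show "(\<lambda>x. f (fst (TX g x)) * cnj (f (fst x))) \<in> borel_measurable XM"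
     using m1 by (rule measurable_cong[THEN iffD1, rotated]) (simp add: fst_TX)
    show "AE x in XM. f (alpha g (fst x)) * cnj (f (fst x)) = f (fst (TX g x)) * cnj (f (fst x))" by (rule AE_I2) (simp add: fst_TX)
   qed
   finally show ?thesis .
  qed
  hence "(\<Sum>g\<in>A. gowers_norm PG haar alpha (Suc j) (\<lambda>x. f (alpha g x) * cnj (f x)) ^ (2 ^ Suc j))
    = (\<Sum>g\<in>A. gowers_norm PG XM TX (Suc j) (\<lambda>x. f (fst (TX g x)) * cnj (f (fst x))) ^ (2 ^ Suc j))" if "A \<subseteq> GG" for A
   using that by (intro sum.cong) auto
  thus ?thesis unfolding \<open>k = Suc j\<close> gowers_norm.simps by (intro folner_lim_cong) simp
 qed
qed

section \<open>A criterion for the order, and the order of the rotation\<close>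

lemma ess_bounded_bdd:
 assumes "ess_bounded M f"
 obtains f' B where "bdd M f' B" "AE x in M. f x = f' x"
proof -
 obtain C where C: "f \<in> borel_measurable M" "AE x in M. cmod (f x) \<le> C" using assms by (auto simp: ess_bounded_def)
 define f' where "f' x = (if cmod (f x) \<le> C then f x else 0)" for x
 have [measurable]: "f \<in> borel_measurable M" by (rule C(1))
 have "f' \<in> borel_measurable M" unfolding f'_def[abs_def] by measurable
 hence "bdd M f' (max C 0)" by (auto simp: bdd_def f'_def)
 moreover have "AE x in M. f x = f' x" using C(2) by eventually_elim (simp add: f'_def)
 ultimately show thesis by (rule that)
qed

lemma complex_cond_exp_self:
 assumes "prob_space M" "ess_bounded M f"
 shows "AE x in M. complex_cond_exp M M f x = f x"
proof -
 interpret prob_space M by fact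
 interpret S: finite_measure_subalgebra M M by unfold_locales (auto simp: subalgebra_def)
 obtain C where C: "f \<in> borel_measurable M" "AE x in M. cmod (f x) \<le> C" using assms(2) by (auto simp: ess_bounded_def)
 have i: "integrable M (\<lambda>x. Re (f x))" "integrable M (\<lambda>x. Im (f x))"
 proof -
  have "integrable M f" by (rule integrable_const_bound[OF C(2) C(1)])
  thus "integrable M (\<lambda>x. Re (f x))" "integrable M (\<lambda>x. Im (f x))" by auto
 qed
 have "AE x in M. real_cond_exp M M (\<lambda>x. Re (f x)) x = Re (f x)" by (rule S.real_cond_exp_F_meas[OF i(1)]) (use i in auto)
 moreover have "AE x in M. real_cond_exp M M (\<lambda>x. Im (f x)) x = Im (f x)" by (rule S.real_cond_exp_F_meas[OF i(2)]) (use i in auto)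
 ultimately show ?thesis by eventually_elim (simp add: complex_cond_exp_def complex_eq_iff)
qed

text \<open>The whole sigma-algebra serves as the factor; conditional expectation onto it is the
  identity almost everywhere.\<close>

lemma (in mp_action) order_lessI:
 assumes "\<And>f B. bdd M f B ==> gowers_norm G M T k f = 0 \<longleftrightarrow> (AE x in M. f x = 0)"
 shows "order_less G M T k" unfolding order_less_def
proof (intro exI[of _ M] conjI)
 show "is_Z_factor G M T k M" unfolding is_Z_factor_def is_factor_def
 proof (intro conjI allI impI ballI)
  show "subalgebra M M" by (simp add: subalgebra_def)
  show "T g -` A \<inter> space M \<in> sets M" if "g \<in> carrier G" "A \<in> sets M" for g A
   by (rule measurable_sets[OF T_measurable[OF that(1)] that(2)])
  fix f assume f: "ess_bounded M f"
  obtain f' B where f': "bdd M f' B" "AE x in M. f x = f' x" using ess_bounded_bdd[OF f] .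
  have "gowers_norm G M T k f = gowers_norm G M T k f'" by (rule gowers_norm_cong_AE) (use f f' in "auto simp: ess_bounded_def bdd_def")
  also have "... = 0 \<longleftrightarrow> (AE x in M. f' x = 0)" by (rule assms[OF f'(1)])
  also have "... \<longleftrightarrow> (AE x in M. complex_cond_exp M M f x = 0)"
  proof
   assume "AE x in M. f' x = 0"
   with f'(2) complex_cond_exp_self[OF prob_space_axioms f]
   show "AE x in M. complex_cond_exp M M f x = 0" by eventually_elim simp
  next
   assume "AE x in M. complex_cond_exp M M f x = 0"
   with f'(2) complex_cond_exp_self[OF prob_space_axioms f]
   show "AE x in M. f' x = 0" by eventually_elim simp
  qed
  finally show "gowers_norm G M T k f = 0 \<longleftrightarrow> (AE x in M. complex_cond_exp M M f x = 0)" .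
 qed
 show "\<forall>A\<in>sets M. \<exists>B\<in>sets M. emeasure M (sym_diff A B) = 0" by (intro ballI bexI) auto
qed

theorem order_2_U: "order_less PG haar alpha 2"
proof (rule UA.order_lessI)
 fix f B assume f: "bdd haar f B"
 have lf: "bdd XM (\<lambda>x. f (fst x)) B" by (rule bdd_compose[OF f XM_fst])
 have m0: "mean0 (\<lambda>x. f (fst x)) = f" by (simp add: mean0_def prob_space.prob_space[OF prob_space_circle, simplified] fun_eq_iff)
 have "gowers_norm PG haar alpha 2 f = root 4 (LINT v|haar. (cmod (acorr f v))\<^sup>2)"
  using gowers_lift[OF bdd_measurable[OF f], of 2] gowers_2[OF lf] unfolding m0 by (simp add: numeral_2_eq_2)
 hence "gowers_norm PG haar alpha 2 f = 0 \<longleftrightarrow> (LINT v|haar. (cmod (acorr f v))\<^sup>2) = 0" by simp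
 also have "... \<longleftrightarrow> (AE u in haar. f u = 0)"
 proof
  assume "(LINT v|haar. (cmod (acorr f v))\<^sup>2) = 0"
  thus "AE u in haar. f u = 0" by (rule acorr_zero[OF f])
 next
  assume ae: "AE u in haar. f u = 0"
  have "acorr f v = 0" if v: "v \<in> solen" for v
  proof -
   have "bdd haar (\<lambda>u. f (v * u) * cnj (f u)) (B * B)" by (rule bdd_mult[OF translate_bdd[OF f v] bdd_cnj[OF f]])
   hence "(\<lambda>u. f (v * u) * cnj (f u)) \<in> borel_measurable haar" by (rule bdd_measurable)
   hence "acorr f v = (LINT u|haar. 0)" unfolding acorr_def by (rule integral_cong_AE) (use ae in auto)
   thus ?thesis by simp
  qed
  hence "(LINT v|haar. (cmod (acorr f v))\<^sup>2) = (LINT v|haar. 0)" by (intro LINT_cong) auto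
  thus "(LINT v|haar. (cmod (acorr f v))\<^sup>2) = 0" by simp
 qed
 finally show "gowers_norm PG haar alpha 2 f = 0 \<longleftrightarrow> (AE u in haar. f u = 0)" .
qed

section \<open>Parallelograms in the solenoid\<close>

lemma ee_add_minus: "ee (a - b) = ee a * cnj (ee b)" using ee_add[of a "- b"] by (simp add: ee_minus)

lemma floor_ee: "ee a = 1 ==> real_of_int \<lfloor>a\<rfloor> = a" by (auto simp: ee_eq_1_iff elim: Ints_cases)

text \<open>The cocycle \<open>rho g\<close> is a quasi-coboundary along parallelograms \<open>u, v u, b u, v b u\<close>, with
 transfer function \<open>psi\<close>. All arguments of the floor function are integers.\<close>

definition psi :: "sol => sol => sol => complex" where
 "psi v b u = u 0 powi \<lfloor>angle u - angle (v * u) - angle (b * u) + angle (v * (b * u))\<rfloor>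
  * v 0 powi \<lfloor>angle (v * (b * u)) - angle (v * u) - angle b\<rfloor> * b 0 powi \<lfloor>angle (v * (b * u)) - angle (b * u) - angle v\<rfloor>"

lemma psi_floor:
 assumes v: "v \<in> solen" and b: "b \<in> solen" and u: "u \<in> solen"
 shows "real_of_int \<lfloor>angle u - angle (v * u) - angle (b * u) + angle (v * (b * u))\<rfloor>
   = angle u - angle (v * u) - angle (b * u) + angle (v * (b * u))"
  "real_of_int \<lfloor>angle (v * (b * u)) - angle (v * u) - angle b\<rfloor> = angle (v * (b * u)) - angle (v * u) - angle b"
  "real_of_int \<lfloor>angle (v * (b * u)) - angle (b * u) - angle v\<rfloor> = angle (v * (b * u)) - angle (b * u) - angle v"
proof -
 have c: "cnj (z 1) * z 1 = 1" if "z \<in> solen" for z using that by (simp add: cnj_mult_unit solen_norm)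
 have 1: "ee (angle u - angle (v * u) - angle (b * u) + angle (v * (b * u)))
  = (cnj (u 1) * u 1) * (cnj (v 1) * v 1) * (cnj (b 1) * b 1) * (cnj (u 1) * u 1)"
  using v b u by (simp add: ee_add ee_add_minus ee_angle solen_mult mult_ac)
 show "real_of_int \<lfloor>angle u - angle (v * u) - angle (b * u) + angle (v * (b * u))\<rfloor>
   = angle u - angle (v * u) - angle (b * u) + angle (v * (b * u))" by (rule floor_ee) (simp only: 1 c v b u mult_1)
 have 2: "ee (angle (v * (b * u)) - angle (v * u) - angle b) = (cnj (u 1) * u 1) * (cnj (v 1) * v 1) * (cnj (b 1) * b 1)"
  using v b u by (simp add: ee_add_minus ee_angle solen_mult mult_ac)
 show "real_of_int \<lfloor>angle (v * (b * u)) - angle (v * u) - angle b\<rfloor> = angle (v * (b * u)) - angle (v * u) - angle b"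
  by (rule floor_ee) (simp only: 2 c v b u mult_1)
 have 3: "ee (angle (v * (b * u)) - angle (b * u) - angle v) = (cnj (u 1) * u 1) * (cnj (v 1) * v 1) * (cnj (b 1) * b 1)"
  using v b u by (simp add: ee_add_minus ee_angle solen_mult mult_ac)
 show "real_of_int \<lfloor>angle (v * (b * u)) - angle (b * u) - angle v\<rfloor> = angle (v * (b * u)) - angle (b * u) - angle v"
  by (rule floor_ee) (simp only: 3 c v b u mult_1)
qed

lemma psi_norm: "v \<in> solen ==> b \<in> solen ==> u \<in> solen ==> cmod (psi v b u) = 1" by (simp add: psi_def norm_mult unit_powi_norm solen_norm)

text \<open>Each argument enters through powers of its coordinates, hence multiplicatively, and
  opposite corners have the same product.\<close>

lemma twist_quad:
 "twist g x u * twist g (v * (b * x)) (v * (b * u)) = twist g (v * x) (v * u) * twist g (b * x) (b * u)" unfolding twist_def prod.distrib[symmetric]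
 by (rule prod.cong) (auto simp: power_int_mult_distrib)

text \<open>Exponent bookkeeping for the next theorem, with \<open>a\<close>, \<open>p\<close>,
  \<open>q\<close> the coordinates 0 of \<open>u\<close>, \<open>v\<close>, \<open>b\<close>; the
  three equations compare the exponents of each.\<close>

lemma powi_collect:
 fixes a p q :: complex
 assumes nz: "a \<noteq> 0" "p \<noteq> 0" "q \<noteq> 0"
  and W: "W1 + W4 + n' = W2 + W3 + n" "W4 + j' = W2 + j" "W4 + k' = W3 + k"
 shows "a powi W1 * (p * (q * a)) powi W4 * (a powi n' * p powi j' * q powi k') = (p * a) powi W2 * (q * a) powi W3 * (a powi n * p powi j * q powi k)"
proof -
 have "a powi W1 * (p * (q * a)) powi W4 * (a powi n' * p powi j' * q powi k') = a powi (W1 + W4 + n') * p powi (W4 + j') * q powi (W4 + k')"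
  using nz by (simp add: power_int_mult_distrib power_int_add mult_ac)
 also have "... = a powi (W2 + W3 + n) * p powi (W2 + j) * q powi (W3 + k)" by (simp only: W)
 also have "... = (p * a) powi W2 * (q * a) powi W3 * (a powi n * p powi j * q powi k)"
  using nz by (simp add: power_int_mult_distrib power_int_add mult_ac)
 finally show ?thesis .
qed

text \<open>The three factors of \<open>rho\<close> are treated separately. The twists cancel, the
  winding numbers change exactly as the integers in \<open>psi\<close> do, and the angle terms leave
  a phase that the motion of \<open>u 0\<close> inside \<open>psi\<close> supplies.\<close>

theorem rho_quad:
 assumes g: "g \<in> GG" and v: "v \<in> solen" and b: "b \<in> solen" and u: "u \<in> solen"
 shows "rho g u * rho g (v * (b * u)) * psi v b (iota g * u) = rho g (v * u) * rho g (b * u) * psi v b u"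
proof -
 define x where "x = iota g * u"
 have x: "x \<in> solen" unfolding x_def by (rule solen_mult[OF iota_solen[OF g] u])
 have tr: "iota g * (v * u) = v * x" "iota g * (b * u) = b * x" "iota g * (v * (b * u)) = v * (b * x)" "iota g * u = x"
  unfolding x_def by (simp_all only: mult_ac)
 note sm = solen_mult[OF v solen_mult[OF b u]] solen_mult[OF v u] solen_mult[OF b u]
 define W1 W2 W3 W4 where "W1 = wind g u" "W2 = wind g (v * u)" "W3 = wind g (b * u)" "W4 = wind g (v * (b * u))"
 note Wd = W1_W2_W3_W4_def
 define n where "n = \<lfloor>angle u - angle (v * u) - angle (b * u) + angle (v * (b * u))\<rfloor>"
 define j where "j = \<lfloor>angle (v * (b * u)) - angle (v * u) - angle b\<rfloor>"
 define k where "k = \<lfloor>angle (v * (b * u)) - angle (b * u) - angle v\<rfloor>"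
 define n' where "n' = \<lfloor>angle x - angle (v * x) - angle (b * x) + angle (v * (b * x))\<rfloor>"
 define j' where "j' = \<lfloor>angle (v * (b * x)) - angle (v * x) - angle b\<rfloor>"
 define k' where "k' = \<lfloor>angle (v * (b * x)) - angle (b * x) - angle v\<rfloor>"
 have Wr: "real_of_int W1 = angle u + shift 1 g - angle x" "real_of_int W2 = angle (v * u) + shift 1 g - angle (v * x)"
  "real_of_int W3 = angle (b * u) + shift 1 g - angle (b * x)"
  "real_of_int W4 = angle (v * (b * u)) + shift 1 g - angle (v * (b * x))"
  unfolding Wd wind_eq[OF g u] wind_eq[OF g sm(1)] wind_eq[OF g sm(2)] wind_eq[OF g sm(3)] tr by simp_all
 note pr = psi_floor[OF v b u, folded n_def j_def k_def] psi_floor[OF v b x, folded n'_def j'_def k'_def]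
 have "real_of_int (W1 + W4 + n') = real_of_int (W2 + W3 + n)" using Wr pr by simp
 hence c1: "W1 + W4 + n' = W2 + W3 + n" by (simp only: of_int_eq_iff)
 have "real_of_int (W4 + j') = real_of_int (W2 + j)" using Wr pr by simp
 hence c2: "W4 + j' = W2 + j" by (simp only: of_int_eq_iff)
 have "real_of_int (W4 + k') = real_of_int (W3 + k)" using Wr pr by simp
 hence c3: "W4 + k' = W3 + k" by (simp only: of_int_eq_iff)
 define s where "s = shift 0 g"
 define e where "e t = ee (- (t * s))" for t
 have nz: "u 0 \<noteq> 0" "v 0 \<noteq> 0" "b 0 \<noteq> 0" using solen_nz[OF u] solen_nz[OF v] solen_nz[OF b] by auto
 have x0: "x 0 = ee s * u 0" by (simp add: x_def iota_def s_def)
 have xn: "x 0 powi n' = ee (of_int n' * s) * u 0 powi n'" unfolding x0 power_int_mult_distrib ee_powi ..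
 \<comment> \<open>\<open>n'\<close> is the alternating sum of the four angles after the motion, so
   the phase of \<open>x 0\<close> raised to the power \<open>n'\<close> balances the angle
   terms.\<close>
 have ec: "e (angle x) * e (angle (v * (b * x))) * ee (of_int n' * s) = e (angle (v * x)) * e (angle (b * x))"
  unfolding e_def ee_add[symmetric] pr(4) by (rule arg_cong[where f=ee]) (simp add: algebra_simps)
 have coll: "u 0 powi W1 * (v 0 * (b 0 * u 0)) powi W4 * (u 0 powi n' * v 0 powi j' * b 0 powi k')
  = (v 0 * u 0) powi W2 * (b 0 * u 0) powi W3 * (u 0 powi n * v 0 powi j * b 0 powi k)" by (rule powi_collect[OF nz c1 c2 c3])
 have r: "rho g u = twist g x u * e (angle x) * u 0 powi W1"
  "rho g (v * u) = twist g (v * x) (v * u) * e (angle (v * x)) * (v 0 * u 0) powi W2"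
  "rho g (b * u) = twist g (b * x) (b * u) * e (angle (b * x)) * (b 0 * u 0) powi W3"
  "rho g (v * (b * u)) = twist g (v * (b * x)) (v * (b * u)) * e (angle (v * (b * x))) * (v 0 * (b 0 * u 0)) powi W4"
  unfolding rho_def tr e_def s_def Wd by (simp_all only: times_fun_def)
 have ps: "psi v b u = u 0 powi n * v 0 powi j * b 0 powi k"
  "psi v b x = ee (of_int n' * s) * u 0 powi n' * v 0 powi j' * b 0 powi k'"
  unfolding psi_def n_def j_def k_def xn[symmetric] unfolding n'_def j'_def k'_def by (rule refl)+
 have "rho g u * rho g (v * (b * u)) * psi v b x
  = (twist g x u * twist g (v * (b * x)) (v * (b * u))) * (e (angle x) * e (angle (v * (b * x))) * ee (of_int n' * s))
   * (u 0 powi W1 * (v 0 * (b 0 * u 0)) powi W4 * (u 0 powi n' * v 0 powi j' * b 0 powi k'))" unfolding r ps by (simp only: mult_ac)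
 also have "... = rho g (v * u) * rho g (b * u) * psi v b u" unfolding twist_quad ec coll r ps by (simp only: mult_ac)
 finally show ?thesis unfolding x_def .
qed

lemma powi_int_measurable:
 assumes z: "z \<in> borel_measurable M" and n: "n \<in> measurable M (count_space UNIV)"
 shows "(\<lambda>x. (z x :: complex) powi n x) \<in> borel_measurable M"
 by (rule measurable_compose_countable[where f="\<lambda>i x. z x powi i" and g=n]) (rule m_comp[OF z measurable_powi], rule n)

lemma psi_measurable:
 assumes v: "v \<in> measurable M haar" and b: "b \<in> measurable M haar" and u: "u \<in> measurable M haar"
 shows "(\<lambda>x. psi (v x) (b x) (u x)) \<in> borel_measurable M"
proof -
 note bu = measurable_solen_mult[OF b u]
 note a [measurable] = m_comp[OF v angle_measurable] m_comp[OF b angle_measurable]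
  m_comp[OF u angle_measurable]
  m_comp[OF measurable_solen_mult[OF v u] angle_measurable] m_comp[OF bu angle_measurable]
  m_comp[OF measurable_solen_mult[OF v bu] angle_measurable]
 show ?thesis unfolding psi_def by (intro borel_measurable_times powi_int_measurable m_comp[OF v haar_coord]
    m_comp[OF b haar_coord] m_comp[OF u haar_coord]) measurable
qed

lemma angle_bound: "\<bar>angle u\<bar> \<le> 1 / 2"
proof -
 have "\<bar>Arg (u 1)\<bar> \<le> pi" using Arg_bounded[of "u 1"] by (simp add: abs_le_iff)
 thus ?thesis by (simp add: angle_def abs_divide field_simps)
qed

lemma angle_add:
 assumes v: "v \<in> solen" and u: "u \<in> solen" and lt: "\<bar>angle v + angle u\<bar> < 1 / 2"
 shows "angle (v * u) = angle v + angle u"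
proof -
 have "ee (angle (v * u) - (angle v + angle u)) = (cnj (v 1) * v 1) * (cnj (u 1) * u 1)"
  using v u by (simp add: ee_add_minus ee_add ee_angle solen_mult mult_ac)
 hence "ee (angle (v * u) - (angle v + angle u)) = 1" using v u by (simp add: cnj_mult_unit solen_norm)
 hence f: "real_of_int \<lfloor>angle (v * u) - (angle v + angle u)\<rfloor> = angle (v * u) - (angle v + angle u)" by (rule floor_ee)
 have "\<bar>angle (v * u) - (angle v + angle u)\<bar> < 1" using angle_bound[of "v * u"] lt by linarith
 hence "\<bar>real_of_int \<lfloor>angle (v * u) - (angle v + angle u)\<rfloor>\<bar> < 1" by (simp only: f)
 hence "\<lfloor>angle (v * u) - (angle v + angle u)\<rfloor> = 0" by linarith
 thus ?thesis using f by simp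
qed

text \<open>For short sides and a starting point away from the cut the angles add without a jump, so
  all three exponents are 0.\<close>

lemma psi_near:
 assumes v: "v \<in> solen" and b: "b \<in> solen" and u: "u \<in> solen"
  and d: "\<bar>angle v\<bar> < d" "\<bar>angle b\<bar> < d" "\<bar>angle u\<bar> < 1 / 2 - 2 * d"
 shows "psi v b u = 1"
proof -
 have 1: "angle (v * u) = angle v + angle u" by (rule angle_add[OF v u]) (use d in linarith)
 have 2: "angle (b * u) = angle b + angle u" by (rule angle_add[OF b u]) (use d in linarith)
 have 3: "angle (v * (b * u)) = angle v + (angle b + angle u)" using angle_add[OF v solen_mult[OF b u]] 2 d by linarith
 have z: "angle u - (angle v + angle u) - (angle b + angle u) + (angle v + (angle b + angle u)) = 0"
  "angle v + (angle b + angle u) - (angle v + angle u) - angle b = 0"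
  "angle v + (angle b + angle u) - (angle b + angle u) - angle v = 0" by simp_all
 show ?thesis unfolding psi_def 1 2 3 z by simp
qed

text \<open>Infinitely many translates of the fibre over \<open>-1\<close> are disjoint.\<close>

lemma null_angle: "measure haar {u \<in> solen. 1 / 2 \<le> \<bar>angle u\<bar>} = 0"
proof (rule ccontr)
 let ?E = "{u \<in> solen. 1 / 2 \<le> \<bar>angle u\<bar>}"
 assume ne: "measure haar ?E \<noteq> 0"
 hence pos: "measure haar ?E > 0" using measure_nonneg[of haar ?E] by linarith
 \<comment> \<open>These primes move the coordinate 1, on which the angle depends, by
   \<open>ee (1 / real p)\<close>, and the values for different primes are distinct.\<close>
 define P where "P = {p. prime p \<and> base p = 0}"
 have inf: "infinite P" unfolding P_def by (rule infinite_base) simp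
 have Em: "?E \<in> sets haar"
 proof -
  have "{u \<in> space haar. 1 / 2 \<le> \<bar>angle u\<bar>} \<in> sets haar" by measurable
  thus ?thesis by simp
 qed
 have E1: "u 1 = - 1" if "u \<in> ?E" for u
 proof -
  have u: "u \<in> solen" "\<bar>angle u\<bar> = 1 / 2" using that angle_bound[of u] by auto
  have e: "ee (1 / 2) = - 1" "ee (- (1 / 2)) = - 1" by (simp_all add: ee_def complex_eq_iff)
  have "angle u = 1 / 2 \<or> angle u = - (1 / 2)" using u(2) by linarith
  hence "ee (angle u) = - 1" by (elim disjE) (simp_all only: e)
  thus ?thesis using ee_angle[OF u(1)] by simp
 qed
 obtain F where F: "F \<subseteq> P" "finite F" "card F > nat \<lceil>1 / measure haar ?E\<rceil>"
 proof -
  obtain F where "F \<subseteq> P" "finite F" "card F = Suc (nat \<lceil>1 / measure haar ?E\<rceil>)"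
   using infinite_arbitrarily_large[OF inf, of "Suc (nat \<lceil>1 / measure haar ?E\<rceil>)"] by (elim exE conjE)
  thus thesis by (intro that) auto
 qed
 define t where "t p = iota (single p)" for p
 have ts: "t p \<in> solen" if "p \<in> F" for p using that F(1) by (auto simp: t_def P_def intro: iota_solen single_carrier)
 have t1: "t p 1 = ee (1 / real p)" if "p \<in> F" for p using that F(1) by (auto simp: t_def P_def iota_def shift_single wt_def)
 define A where "A p = (\<lambda>u. t p * u) -` ?E \<inter> space haar" for p
 have Am: "A p \<in> sets haar \<and> measure haar (A p) = measure haar ?E" if p: "p \<in> F" for p
  unfolding A_def using measurable_sets[OF translate_measurable[OF ts[OF p]] Em]
   measure_distr[OF translate_measurable[OF ts[OF p]] Em] by (simp add: distr_haar_translate[OF ts[OF p]])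
 have dj: "disjoint_family_on A F" unfolding disjoint_family_on_def
 proof (intro ballI impI, rule ccontr)
  fix p q assume pq: "p \<in> F" "q \<in> F" "p \<noteq> q" and "A p \<inter> A q \<noteq> {}"
  then obtain u where u: "u \<in> A p" "u \<in> A q" by blast
  hence us: "u \<in> solen" "t p * u \<in> ?E" "t q * u \<in> ?E" by (simp_all add: A_def)
  hence "t p 1 * u 1 = t q 1 * u 1" using E1[OF us(2)] E1[OF us(3)] by simp
  hence "ee (1 / real p) = ee (1 / real q)" using solen_nz[OF us(1), of 1] t1 pq by simp
  hence "ee (1 / real p - 1 / real q) = 1" using cnj_mult_unit[of "ee (1 / real q)"] by (simp add: ee_add_minus mult.commute)
  hence f: "real_of_int \<lfloor>1 / real p - 1 / real q\<rfloor> = 1 / real p - 1 / real q" by (rule floor_ee)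
  have "p \<ge> 2" "q \<ge> 2" using pq F(1) prime_ge_2_nat by (auto simp: P_def)
  hence i: "0 < 1 / real p" "1 / real p \<le> 1 / 2" "0 < 1 / real q" "1 / real q \<le> 1 / 2" by (auto simp: field_simps)
  have "\<bar>1 / real p - 1 / real q\<bar> < 1" using i by linarith
  hence "\<bar>real_of_int \<lfloor>1 / real p - 1 / real q\<rfloor>\<bar> < 1" by (simp only: f)
  hence "\<lfloor>1 / real p - 1 / real q\<rfloor> = 0" by linarith
  hence "1 / real p = 1 / real q" using f by simp
  thus False using pq(3) \<open>p \<ge> 2\<close> \<open>q \<ge> 2\<close> by (simp add: field_simps)
 qed
 have "measure haar (\<Union>p\<in>F. A p) = (\<Sum>p\<in>F. measure haar (A p))"
  by (rule haar.finite_measure_finite_Union[OF F(2) _ dj]) (use Am in blast)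
 also have "... = real (card F) * measure haar ?E" using Am by simp
 finally have le: "real (card F) * measure haar ?E \<le> 1" using haar.prob_le_1[of "\<Union>p\<in>F. A p"] by simp
 have "real (card F) > 1 / measure haar ?E" using F(3) by linarith
 hence "real (card F) * measure haar ?E > 1" using pos by (simp add: field_simps)
 thus False using le by simp
qed

text \<open>Continuity from above: the sets decrease to the null set over the cut.\<close>

lemma small_angle_complement:
 assumes e: "e > 0"
 shows "\<exists>d>0. measure haar {u \<in> solen. 1 / 2 - 2 * d \<le> \<bar>angle u\<bar>} < e"
proof -
 define D where "D n = {u \<in> solen. 1 / 2 - 2 * (1 / real (Suc n)) \<le> \<bar>angle u\<bar>}" for n
 have Dm: "D n \<in> sets haar" for n
 proof -
  have "{u \<in> space haar. 1 / 2 - 2 * (1 / real (Suc n)) \<le> \<bar>angle u\<bar>} \<in> sets haar" by measurable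
  thus ?thesis by (simp add: D_def)
 qed
 have dec: "decseq D"
 proof (rule decseq_SucI)
  fix n
  have "1 / real (Suc (Suc n)) \<le> 1 / real (Suc n)" by (simp add: field_simps)
  thus "D (Suc n) \<subseteq> D n" by (auto simp: D_def simp del: of_nat_Suc)
 qed
 have int: "(\<Inter>n. D n) = {u \<in> solen. 1 / 2 \<le> \<bar>angle u\<bar>}"
 proof (rule equalityI; rule subsetI)
  fix u assume u: "u \<in> (\<Inter>n. D n)"
  have "1 / 2 \<le> \<bar>angle u\<bar>"
  proof (rule field_le_epsilon)
   fix e :: real assume e: "e > 0"
   obtain n where n: "inverse (real (Suc n)) < e / 2" using reals_Archimedean[of "e / 2"] e by auto
   have "1 / 2 - 2 * (1 / real (Suc n)) \<le> \<bar>angle u\<bar>" using u by (auto simp: D_def)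
   thus "1 / 2 \<le> \<bar>angle u\<bar> + e" using n unfolding inverse_eq_divide by linarith
  qed
  thus "u \<in> {u \<in> solen. 1 / 2 \<le> \<bar>angle u\<bar>}" using u by (auto simp: D_def)
 next
  fix u assume u: "u \<in> {u \<in> solen. 1 / 2 \<le> \<bar>angle u\<bar>}"
  have "1 / 2 - 2 * (1 / real (Suc n)) \<le> \<bar>angle u\<bar>" for n
  proof -
   have "0 \<le> 1 / real (Suc n)" by simp
   moreover have "1 / 2 \<le> \<bar>angle u\<bar>" using u by blast
   ultimately show ?thesis by linarith
  qed
  thus "u \<in> (\<Inter>n. D n)" using u by (auto simp: D_def)
 qed
 have "(\<lambda>n. measure haar (D n)) ----> measure haar (\<Inter>n. D n)" by (rule haar.finite_Lim_measure_decseq[OF _ dec]) (use Dm in blast)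
 hence "(\<lambda>n. measure haar (D n)) ----> 0" unfolding int null_angle .
 hence "\<forall>\<^sub>F n in sequentially. measure haar (D n) < e" using e by (rule order_tendstoD)
 then obtain n where "measure haar (D n) < e" unfolding eventually_sequentially by blast
 thus ?thesis by (intro exI[of _ "1 / real (Suc n)"] conjI) (simp_all add: D_def)
qed

lemma angle_nbhd:
 assumes "d > 0"
 shows "\<exists>W. open W \<and> 1 \<in> W \<and> (\<forall>u\<in>W. \<bar>angle u\<bar> < d)"
proof -
 have "isCont Arg 1" by (rule continuous_at_Arg) simp
 hence "(Arg \<longlongrightarrow> Arg 1) (nhds 1)" unfolding isCont_def tendsto_at_iff_tendsto_nhds .
 hence "\<forall>\<^sub>F z in nhds 1. dist (Arg z) (Arg 1) < 2 * pi * d" using assms by (intro tendstoD) simp_all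
 then obtain A where A: "open A" "1 \<in> A" "\<forall>z\<in>A. dist (Arg z) (Arg 1) < 2 * pi * d" unfolding eventually_nhds by (elim exE conjE)
 have "open ((\<lambda>u::nat => complex. u 1) -` A)" by (rule open_vimage[OF A(1) continuous_on_coord])
 moreover have "\<bar>angle u\<bar> < d" if "u 1 \<in> A" for u
  using bspec[OF A(3) that] by (simp add: angle_def dist_real_def abs_divide divide_less_eq mult.commute)
 ultimately show ?thesis using A(2) by (intro exI[of _ "(\<lambda>u. u 1) -` A"]) auto
qed

section \<open>Fourfold fibre products of the skew product\<close>

abbreviation ext :: "'b measure => ('b \<times> complex) measure" where
 "ext D \<equiv> D \<Otimes>\<^sub>M CM"

lemma mp_skew:
 assumes mp: "mp_action PG D ta"
  and rm: "\<And>g. g \<in> GG ==> r g \<in> borel_measurable D"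
  and rn: "\<And>g d. g \<in> GG ==> d \<in> space D ==> cmod (r g d) = 1"
  and rc: "\<And>g h d. g \<in> GG ==> h \<in> GG ==> d \<in> space D ==> r (g \<cdot> h) d = r g (ta h d) * r h d"
 shows "mp_action PG (ext D) (\<lambda>g. skew (ta g) (r g))"
proof -
 interpret D: mp_action PG D ta by (rule mp)
 interpret P: pair_prob_space D CM by (rule pair_prob_spaceI[OF D.prob_space_axioms prob_space_circle])
 show ?thesis
 proof unfold_locales
  fix g assume g: "g \<in> GG"
  show "skew (ta g) (r g) \<in> measurable (ext D) (ext D)" by (rule skew_measurable[OF D.T_measurable[OF g] rm[OF g] rn[OF g]])
  show "distr (ext D) (ext D) (skew (ta g) (r g)) = ext D"
   by (rule skew_distr[OF D.prob_space_axioms D.T_measurable[OF g] D.T_distr[OF g] rm[OF g] rn[OF g]])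
 next
  fix g h x assume gh: "g \<in> GG" "h \<in> GG" and x: "x \<in> space (ext D)"
  have d: "fst x \<in> space D" using x by (auto simp: space_pair_measure)
  show "skew (ta (g \<cdot> h)) (r (g \<cdot> h)) x = skew (ta g) (r g) (skew (ta h) (r h) x)"
   by (simp add: skew_def rc[OF gh d] D.T_mult[OF gh d] mult.assoc)
 qed
qed

section \<open>Parallelograms and the quadruples of points above them\<close>

abbreviation "hh \<equiv> haar \<Otimes>\<^sub>M haar"
abbreviation "DM \<equiv> hh \<Otimes>\<^sub>M haar"

lemma prob_hh: "prob_space hh" by (rule prob_pair[OF haar_prob haar_prob])
lemma prob_DM: "prob_space DM" by (rule prob_pair[OF prob_hh haar_prob])

text \<open>A point \<open>((v, b), u)\<close> encodes the parallelogram \<open>u\<close>,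
  \<open>v * u\<close>, \<open>b * u\<close>, \<open>v * (b * u)\<close>. The rotation fixes the
  sides, so every function of \<open>v\<close> and \<open>b\<close> is invariant.\<close>

definition tau :: "(nat => int) => dpt => dpt" where
 "tau g d = (fst d, iota g * snd d)"

lemma mp_tau: "mp_action PG DM tau"
proof -
 interpret D: prob_space DM by (rule prob_DM)
 show ?thesis
 proof unfold_locales
  fix g assume g: "g \<in> GG"
  have t: "(\<lambda>u. iota g * u) \<in> measurable haar haar" by (rule translate_measurable[OF iota_solen[OF g]])
  show "tau g \<in> measurable DM DM" unfolding tau_def[abs_def] by (intro measurable_Pair measurable_fst m_comp[OF measurable_snd t])
  have "distr hh hh (\<lambda>x. x) \<Otimes>\<^sub>M distr haar haar (\<lambda>u. iota g * u) = distr DM DM (\<lambda>(x, y). (x, iota g * y))"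
  proof (rule pair_measure_distr[OF _ t])
   show "sigma_finite_measure (distr haar haar (\<lambda>u. iota g * u))"
    unfolding distr_haar_translate[OF iota_solen[OF g]] by (rule prob_space_imp_sigma_finite[OF haar_prob])
  qed simp
  hence "DM = distr DM DM (\<lambda>(x, y). (x, iota g * y))" unfolding distr_haar_translate[OF iota_solen[OF g]] distr_id .
  moreover have "(\<lambda>(x, y). (x, iota g * y)) = tau g" by (simp add: fun_eq_iff tau_def)
  ultimately show "distr DM DM (tau g) = DM" by (simp only:)
 next
  fix g h x assume gh: "g \<in> GG" "h \<in> GG"
  show "tau (g \<cdot> h) x = tau g (tau h x)" by (simp only: tau_def fst_conv snd_conv iota_mult[OF gh] mult.assoc)
 qed
qed

definition corner :: "nat => dpt => nat => complex" where
 "corner i d = (if i = 0 then snd d else if i = 1 then fst (fst d) * snd d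
   else if i = 2 then snd (fst d) * snd d else fst (fst d) * (snd (fst d) * snd d))"

lemma corner_measurable [measurable]: "corner i \<in> measurable DM haar"
proof -
 have m: "(\<lambda>d. snd d) \<in> measurable DM haar" "(\<lambda>d. fst (fst d)) \<in> measurable DM haar" "(\<lambda>d. snd (fst d)) \<in> measurable DM haar"
  by measurable
 consider "i = 0" | "i = 1" | "i = 2" | "i > 2" by linarith
 thus ?thesis unfolding corner_def[abs_def] by cases (simp_all add: m measurable_solen_mult del: times_fun_apply)
qed

lemma corner_tau: "corner i (tau g d) = iota g * corner i d"
 by (simp only: corner_def tau_def fst_conv snd_conv mult_ac if_distrib[of "\<lambda>x. iota g * x"])

lemma corner_space: "d \<in> space DM ==> corner i d \<in> solen" using measurable_space[OF corner_measurable] by simp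

abbreviation "YM \<equiv> ext (ext (ext (ext DM)))"

text \<open>Four successive circle extensions, one per corner, so that measure preservation follows
  from one lemma applied four times.\<close>

definition TY :: "(nat => int) => ypt => ypt" where
 "TY g = skew (skew (skew (skew (tau g) (\<lambda>d. rho g (corner 0 d))) (\<lambda>y. rho g (corner 1 (fst y))))
   (\<lambda>y. rho g (corner 2 (fst (fst y))))) (\<lambda>y. rho g (corner 3 (fst (fst (fst y)))))"

lemma mp_TY: "mp_action PG YM TY"
proof -
 have m: "(\<lambda>d. rho g (corner i d)) \<in> borel_measurable DM" if "g \<in> GG" for g i
  by (rule m_comp[OF corner_measurable rho_measurable[OF that]])
 have n: "cmod (rho g (corner i d)) = 1" if "g \<in> GG" "d \<in> space DM" for g i d by (rule rho_norm[OF that(1) corner_space[OF that(2)]])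
 have c: "rho (g \<cdot> h) (corner i d) = rho g (corner i (tau h d)) * rho h (corner i d)"
  if gh: "g \<in> GG" "h \<in> GG" and d: "d \<in> space DM" for g h i d
  using rho_mult[OF gh(2,1) corner_space[OF d]] PG.m_comm[OF gh] by (simp add: corner_tau mult.commute)
 show ?thesis unfolding TY_def[abs_def] by (intro mp_skew mp_tau) (auto simp: space_pair_measure skew_def n c intro!: m m_comp[OF measurable_fst m]
    m_comp[OF m_comp[OF measurable_fst measurable_fst] m]
    m_comp[OF m_comp[OF m_comp[OF measurable_fst measurable_fst] measurable_fst] m])
qed

interpretation YA: mp_action PG YM TY by (rule mp_TY)

definition pt :: "nat => ypt => sol \<times> complex" where
 "pt i y = (corner i (fst (fst (fst (fst y)))),
   if i = 0 then snd (fst (fst (fst y))) else if i = 1 then snd (fst (fst y)) else if i = 2 then snd (fst y) else snd y)"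

lemma pt_measurable [measurable]: "pt i \<in> measurable YM XM"
proof -
 have m: "(\<lambda>y. snd (fst (fst (fst y)))) \<in> measurable YM CM" "(\<lambda>y. snd (fst (fst y))) \<in> measurable YM CM"
  "(\<lambda>y. snd (fst y)) \<in> measurable YM CM" "(\<lambda>y. snd y) \<in> measurable YM CM" by measurable
 have z: "(\<lambda>y. if i = 0 then snd (fst (fst (fst y))) else if i = 1 then snd (fst (fst y)) else if i = 2 then snd (fst y) else snd y)
   \<in> measurable YM CM" by (cases "i = 0"; cases "i = 1"; cases "i = 2") (simp_all only: if_True if_False simp_thms m)
 show ?thesis unfolding pt_def[abs_def] XM_def by (rule measurable_Pair[OF _ z]) measurable
qed

lemma pt_TY: "y \<in> space YM ==> i < 4 ==> pt i (TY g y) = TX g (pt i y)"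
proof -
 assume y: "y \<in> space YM" and i: "i < 4"
 have s: "pt i y \<in> space XM" by (rule measurable_space[OF pt_measurable y])
 consider "i = 0" | "i = 1" | "i = 2" | "i = 3" using i by linarith
 thus ?thesis unfolding TX_eq[OF s] by cases (simp_all add: pt_def TY_def skew_def corner_tau)
qed

lemma fibre_step:
 assumes E: "prob_space E" and pj: "pj \<in> measurable E D" and D: "prob_space D"
  and K: "bdd D K B" and A: "bdd E A B'" and f: "bdd (ext D) f B''"
 shows "(\<integral>y. K (pj (fst y)) * A (fst y) * f (pj (fst y), snd y) \<partial>ext E) = (LINT e|E. (K (pj e) * (LINT z|CM. f (pj e, z))) * A e)"
proof -
 have "(\<lambda>y. (pj (fst y), snd y)) \<in> measurable (ext E) (ext D)" by (intro measurable_Pair measurable_snd m_comp[OF measurable_fst pj])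
 hence b: "bdd (ext E) (\<lambda>y. f (pj (fst y), snd y)) B''" by (rule bdd_compose[OF f])
 have "bdd E (\<lambda>e. K (pj e) * A e) (B * B')" by (rule bdd_mult[OF bdd_compose[OF K pj] A])
 from fibre_integral[OF E this b] show ?thesis by (simp add: mult_ac)
qed

lemma corner_ext_measurable: "(\<lambda>p. (corner i (fst p), snd p)) \<in> measurable (ext DM) XM"
 unfolding XM_def by (intro measurable_Pair measurable_snd m_comp[OF measurable_fst corner_measurable])

text \<open>The fibres are integrated out one after the other. As \<open>K\<close> depends on the
  parallelogram only, each corner contributes just its fibre mean.\<close>

lemma quad_integral:
 fixes h :: "nat => sol \<times> complex => complex"
 assumes K: "bdd DM K B" and h: "\<And>i. bdd XM (h i) (C i)"
 shows "(LINT y|YM. K (fst (fst (fst (fst y)))) * h 0 (pt 0 y) * h 1 (pt 1 y) * h 2 (pt 2 y) * h 3 (pt 3 y))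
  = (LINT d|DM. K d * mean0 (h 0) (corner 0 d) * mean0 (h 1) (corner 1 d) * mean0 (h 2) (corner 2 d) * mean0 (h 3) (corner 3 d))"
proof -
 define f where "f i p = h i (corner i (fst p), snd p)" for i :: nat and p :: "(dpt) \<times> complex"
 define m where "m i d = mean0 (h i) (corner i d)" for i :: nat and d
 have fb: "bdd (ext DM) (f i) (C i)" for i unfolding f_def[abs_def] by (rule bdd_compose[OF h corner_ext_measurable])
 have mb: "bdd DM (m i) (C i)" for i unfolding m_def[abs_def] by (rule bdd_compose[OF mean0_bdd[OF h] corner_measurable])
 have mi: "(LINT z|CM. f i (d, z)) = m i d" for i d by (simp add: f_def m_def mean0_def)
 note p1 = prob_pair[OF prob_DM prob_space_circle]
 note p2 = prob_pair[OF p1 prob_space_circle]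
 note p3 = prob_pair[OF p2 prob_space_circle]
 note m1 = measurable_fst[of DM CM]
 note m2 = m_comp[OF measurable_fst[of "ext DM" CM] m1]
 note m3 = m_comp[OF measurable_fst[of "ext (ext DM)" CM] m2]
 have A0: "bdd (ext DM) (\<lambda>e. f 0 (fst e, snd e)) (C 0)" using fb[of 0] by simp
 have q2: "(\<lambda>e. (fst (fst e), snd e)) \<in> measurable (ext (ext DM)) (ext DM)" by (intro measurable_Pair measurable_snd m2)
 have q3: "(\<lambda>e. (fst (fst (fst e)), snd e)) \<in> measurable (ext (ext (ext DM))) (ext DM)" by (intro measurable_Pair measurable_snd m3)
 have A1: "bdd (ext (ext DM)) (\<lambda>e. f 0 (fst (fst e), snd (fst e)) * f 1 (fst (fst e), snd e)) (C 0 * C 1)"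
  by (rule bdd_mult[OF bdd_compose[OF A0 measurable_fst] bdd_compose[OF fb q2]])
 have A2: "bdd (ext (ext (ext DM))) (\<lambda>e. f 0 (fst (fst (fst e)), snd (fst (fst e))) * f 1 (fst (fst (fst e)), snd (fst e))
   * f 2 (fst (fst (fst e)), snd e)) (C 0 * C 1 * C 2)" by (rule bdd_mult[OF bdd_compose[OF A1 measurable_fst] bdd_compose[OF fb q3]])
 have K3: "bdd DM (\<lambda>d. K d * m 3 d) (B * C 3)" by (rule bdd_mult[OF K mb])
 have K2: "bdd DM (\<lambda>d. K d * m 3 d * m 2 d) (B * C 3 * C 2)" by (rule bdd_mult[OF K3 mb])
 have K1: "bdd DM (\<lambda>d. K d * m 3 d * m 2 d * m 1 d) (B * C 3 * C 2 * C 1)" by (rule bdd_mult[OF K2 mb])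
 have "(LINT y|YM. K (fst (fst (fst (fst y)))) * h 0 (pt 0 y) * h 1 (pt 1 y) * h 2 (pt 2 y) * h 3 (pt 3 y))
  = (LINT y|YM. K (fst (fst (fst (fst y)))) * (f 0 (fst (fst (fst (fst y))), snd (fst (fst (fst y)))) * f 1 (fst (fst (fst (fst y))), snd (fst (fst y)))
    * f 2 (fst (fst (fst (fst y))), snd (fst y))) * f 3 (fst (fst (fst (fst y))), snd y))" by (simp add: f_def pt_def mult.assoc)
 also have "... = (\<integral>e. (K (fst (fst (fst e))) * m 3 (fst (fst (fst e)))) * (f 0 (fst (fst (fst e)), snd (fst (fst e)))
    * f 1 (fst (fst (fst e)), snd (fst e)) * f 2 (fst (fst (fst e)), snd e)) \<partial>ext (ext (ext DM)))"
  using fibre_step[OF p3 m3 prob_DM K A2 fb[of 3]] unfolding mi .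
 also have "... = (\<integral>e. (K (fst (fst (fst e))) * m 3 (fst (fst (fst e)))) * (f 0 (fst (fst (fst e)), snd (fst (fst e)))
    * f 1 (fst (fst (fst e)), snd (fst e))) * f 2 (fst (fst (fst e)), snd e) \<partial>ext (ext (ext DM)))" by (simp only: mult.assoc)
 also have "... = (\<integral>e. (K (fst (fst e)) * m 3 (fst (fst e)) * m 2 (fst (fst e))) * (f 0 (fst (fst e), snd (fst e))
    * f 1 (fst (fst e), snd e)) \<partial>ext (ext DM))" using fibre_step[OF p2 m2 prob_DM K3 A1 fb[of 2]] unfolding mi .
 also have "... = (\<integral>e. (K (fst (fst e)) * m 3 (fst (fst e)) * m 2 (fst (fst e))) * f 0 (fst (fst e), snd (fst e))
    * f 1 (fst (fst e), snd e) \<partial>ext (ext DM))" by (simp only: mult.assoc)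
 also have "... = (\<integral>e. (K (fst e) * m 3 (fst e) * m 2 (fst e) * m 1 (fst e)) * f 0 (fst e, snd e) \<partial>ext DM)"
  using fibre_step[OF p1 m1 prob_DM K2 A0 fb[of 1]] unfolding mi .
 also have "... = (LINT d|DM. (K d * m 3 d * m 2 d * m 1 d) * m 0 d)" using fibre_integral[OF prob_DM K1 fb[of 0]] unfolding mi prod.collapse .
 finally show ?thesis unfolding m_def by (simp add: mult_ac)
qed

lemma mean0_cnj: "mean0 (\<lambda>x. cnj (h x)) u = cnj (mean0 h u)" by (simp add: mean0_def)

lemma DM_integral:
 assumes "bdd DM F B"
 shows "(LINT d|DM. F d) = (LINT p|hh. (LINT u|haar. F (p, u)))" by (rule pair_integral_bdd(1)[OF prob_hh haar_prob assms])

lemma one_bdd: "bdd M (\<lambda>_. 1) 1" by (simp add: bdd_def)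

text \<open>For a fixed side \<open>v\<close>, substituting \<open>b * u\<close> for one variable
  makes the integral over the other two variables a product of the autocorrelation and its
  conjugate.\<close>

lemma quad_acorr:
 assumes f: "bdd haar f B"
 shows "(LINT d|DM. f (corner 0 d) * cnj (f (corner 1 d)) * cnj (f (corner 2 d)) * f (corner 3 d)) = of_real (LINT v|haar. (cmod (acorr f v))\<^sup>2)"
proof -
 define F where "F d = f (corner 0 d) * cnj (f (corner 1 d)) * cnj (f (corner 2 d)) * f (corner 3 d)" for d
 have fc: "bdd DM (\<lambda>d. f (corner i d)) B" for i by (rule bdd_compose[OF f corner_measurable])
 have Fb: "bdd DM F (B * B * B * B)" unfolding F_def[abs_def] by (intro bdd_mult bdd_cnj fc)
 define G where "G p = (LINT u|haar. F (p, u))" for p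
 have Gb: "bdd hh G (B * B * B * B)" unfolding bdd_def
 proof
  show "G \<in> borel_measurable hh" unfolding G_def[abs_def] using bdd_measurable[OF Fb] by measurable
  show "\<forall>p\<in>space hh. cmod (G p) \<le> B * B * B * B"
   unfolding G_def by (intro ballI haar.norm_integral_le_bdd bdd_compose[OF Fb measurable_Pair1'])
 qed
 have inner: "(LINT b|haar. G (v, b)) = of_real ((cmod (acorr f v))\<^sup>2)" if v: "v \<in> solen" for v
 proof -
  have vm: "(\<lambda>q. ((v, fst q), snd q)) \<in> measurable hh DM"
   using v by (intro measurable_Pair measurable_const measurable_fst measurable_snd) simp
  have Fv: "bdd hh (\<lambda>q. F ((v, fst q), snd q)) (B * B * B * B)" by (rule bdd_compose[OF Fb vm])
  have "(LINT b|haar. G (v, b)) = (LINT u|haar. (LINT b|haar. F ((v, b), u)))"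
   unfolding G_def using pair_integral_bdd(2)[OF haar_prob haar_prob Fv] by simp
  also have "... = (LINT u|haar. acorr f v * cnj (f (v * u) * cnj (f u)))"
  proof (rule LINT_cong[OF refl])
   fix u assume "u \<in> space haar"
   hence u: "u \<in> solen" by simp
   have m: "(\<lambda>w. f (v * w) * cnj (f w)) \<in> borel_measurable haar"
    by (rule bdd_measurable[OF bdd_mult[OF translate_bdd[OF f v] bdd_cnj[OF f]]])
   have "(LINT b|haar. F ((v, b), u)) = (LINT b|haar. (f (v * (u * b)) * cnj (f (u * b))) * cnj (f (v * u) * cnj (f u)))"
    unfolding F_def corner_def by (simp add: mult_ac del: times_fun_apply)
   also have "... = (LINT b|haar. f (v * (u * b)) * cnj (f (u * b))) * cnj (f (v * u) * cnj (f u))"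
    by (rule Bochner_Integration.integral_mult_left_zero)
   also have "... = acorr f v * cnj (f (v * u) * cnj (f u))" unfolding acorr_def haar_integral_translate[OF u m] ..
   finally show "(LINT b|haar. F ((v, b), u)) = acorr f v * cnj (f (v * u) * cnj (f u))" .
  qed
  also have "... = acorr f v * (LINT u|haar. cnj (f (v * u) * cnj (f u)))" by (rule Bochner_Integration.integral_mult_right_zero)
  also have "(LINT u|haar. cnj (f (v * u) * cnj (f u))) = cnj (acorr f v)" unfolding acorr_def by (rule Bochner_Integration.integral_cnj)
  finally show ?thesis by (simp only: complex_norm_square)
 qed
 have "(LINT d|DM. F d) = (LINT p|hh. G p)" unfolding G_def by (rule DM_integral[OF Fb])
 also have "... = (LINT v|haar. (LINT b|haar. G (v, b)))" by (rule pair_integral_bdd(1)[OF haar_prob haar_prob Gb])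
 also have "... = (LINT v|haar. of_real ((cmod (acorr f v))\<^sup>2))" by (rule LINT_cong) (simp_all only: inner space_haar)
 also have "... = of_real (LINT v|haar. (cmod (acorr f v))\<^sup>2)" by (rule integral_complex_of_real)
 finally show ?thesis by (simp only: F_def)
qed

definition quad :: "(sol \<times> complex => complex) => ypt => complex" where
 "quad f y = f (pt 0 y) * cnj (f (pt 1 y)) * cnj (f (pt 2 y)) * f (pt 3 y)"

lemma quad_bdd: "bdd XM f B ==> bdd YM (quad f) (B * B * B * B)" unfolding quad_def[abs_def] by (intro bdd_mult bdd_cnj bdd_compose[OF _ pt_measurable])

lemma quad_mean:
 assumes K: "bdd DM K B" and h: "bdd XM h C"
 shows "(LINT y|YM. K (fst (fst (fst (fst y)))) * quad h y)
  = (LINT d|DM. K d * (mean0 h (corner 0 d) * cnj (mean0 h (corner 1 d)) * cnj (mean0 h (corner 2 d)) * mean0 h (corner 3 d)))"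
proof -
 let ?h = "\<lambda>i::nat. if i = 1 \<or> i = 2 then (\<lambda>x. cnj (h x)) else h"
 have "bdd XM (?h i) C" for i using h bdd_cnj[OF h] by simp
 from quad_integral[where h="?h" and C="\<lambda>_. C", OF K this] show ?thesis by (simp add: quad_def mean0_cnj mult.assoc)
qed

text \<open>\<open>quad\<close> is multiplicative, so the correlation at \<open>g\<close> is the
  integral of \<open>quad\<close> of a derivative of \<open>f\<close>; the fibres reduce it to the
  formula for the second norm.\<close>

lemma corr_quad:
 assumes f: "bdd XM f B" and g: "g \<in> GG"
 shows "YA.corr (quad f) g = of_real (gowers_norm PG XM TX 2 (\<lambda>x. f (TX g x) * cnj (f x)) ^ 4)"
proof -
 define h where "h x = f (TX g x) * cnj (f x)" for x
 have h: "bdd XM h (B * B)" unfolding h_def by (rule bdd_derivative[OF f g])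
 have "YA.corr (quad f) g = (LINT y|YM. 1 * quad h y)" unfolding YA.corr_def by (rule LINT_cong) (simp_all add: quad_def h_def pt_TY mult_ac)
 also have "... = (LINT d|DM. 1 * (mean0 h (corner 0 d) * cnj (mean0 h (corner 1 d)) * cnj (mean0 h (corner 2 d)) * mean0 h (corner 3 d)))"
  by (rule quad_mean[OF one_bdd h])
 also have "... = of_real (LINT v|haar. (cmod (acorr (mean0 h) v))\<^sup>2)" unfolding mult_1 by (rule quad_acorr[OF mean0_bdd[OF h]])
 also have "(LINT v|haar. (cmod (acorr (mean0 h) v))\<^sup>2) = gowers_norm PG XM TX 2 h ^ 4" using gowers_2[OF h] by (simp add: numeral_2_eq_2)
 finally show ?thesis unfolding h_def .
qed

text \<open>The averages in the definition are averages of correlations of \<open>quad f\<close>.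
  The eighth power of the norm is thus the squared length of the projection of \<open>quad f\<close>
  to the invariant functions.\<close>

theorem gowers_3:
 assumes f: "bdd XM f B"
 shows "gowers_norm PG XM TX 3 f = root 8 ((YA.hull_norm (quad f))\<^sup>2)"
proof -
 have n: "Suc (Suc 0) = 2" "Suc 2 = 3" "(2::nat) ^ 3 = 8" "(2::nat) ^ 2 = 4" by simp_all
 have qs: "sqi YM (quad f)" by (rule YA.bdd_square[OF quad_bdd[OF f]])
 have g3: "gowers_norm PG XM TX 3 f = folner_lim PG (\<lambda>A. root 8
   ((\<Sum>g\<in>A. gowers_norm PG XM TX 2 (\<lambda>x. f (TX g x) * cnj (f x)) ^ 4) / real (card A)))"
  using gowers_norm.simps(3)[of PG XM TX "Suc 0" f] unfolding n .
 show ?thesis unfolding g3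
 proof (rule folner_limI[OF folner_fol])
  fix Ph assume Ph: "folner_sequence PG Ph"
  note FS = folner_sequenceD[OF Ph]
  have eq: "(\<Sum>g\<in>Ph N. gowers_norm PG XM TX 2 (\<lambda>x. f (TX g x) * cnj (f x)) ^ 4) / real (card (Ph N))
   = Re ((\<Sum>g\<in>Ph N. YA.corr (quad f) g) / of_nat (card (Ph N)))" for N
  proof -
   have "(\<Sum>g\<in>Ph N. YA.corr (quad f) g) = (\<Sum>g\<in>Ph N. of_real (gowers_norm PG XM TX 2 (\<lambda>x. f (TX g x) * cnj (f x)) ^ 4))"
    by (rule sum.cong[OF refl], rule corr_quad[OF f]) (use FS(3)[of N] in blast)
   thus ?thesis by (simp add: of_real_sum[symmetric] del: of_real_sum of_real_power)
  qed
  show "(\<lambda>N. root 8 ((\<Sum>g\<in>Ph N. gowers_norm PG XM TX 2 (\<lambda>x. f (TX g x) * cnj (f x)) ^ 4) / real (card (Ph N))))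
   ----> root 8 ((YA.hull_norm (quad f))\<^sup>2)" unfolding eq using tendsto_real_root[OF tendsto_Re[OF YA.avg_corr_tendsto[OF Ph qs]], of 8] by simp
 qed
qed

section \<open>The skew product has order less than three\<close>

text \<open>The squared distance between \<open>f\<close> and its translate is twice the real part
  of \<open>acorr f 1 - acorr f v\<close>, and the mean of a modulus is at most its quadratic
  mean.\<close>

lemma l1_modulus:
 assumes f: "bdd haar f B" and e: "e > 0"
 shows "\<exists>W. open W \<and> 1 \<in> W \<and> (\<forall>v\<in>W \<inter> solen. (LINT u|haar. cmod (f (v * u) - f u)) < e)"
proof -
 have fs: "sqi haar f" by (rule haar.bdd_square[OF f])
 have ca: "continuous_on solen (acorr f)" by (rule acorr_continuous[OF fs])
 have e2: "e\<^sup>2 / 2 > 0" using e by simp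
 obtain W where W: "open W" "1 \<in> W" "\<And>u. u \<in> W ==> u \<in> solen ==> dist (acorr f u) (acorr f 1) < e\<^sup>2 / 2"
  using continuous_on_solen_nbhd[OF ca e2] by metis
 have "(LINT u|haar. cmod (f (v * u) - f u)) < e" if v: "v \<in> W" "v \<in> solen" for v
 proof -
  define d where "d u = f (v * u) - f u" for u
  have fv: "sqi haar (\<lambda>u. f (v * u))" by (rule haar_square_translate(1)[OF fs v(2)])
  have d: "sqi haar d" unfolding d_def by (rule sqi_diff[OF fv fs])
  have c: "sqi haar (\<lambda>u. complex_of_real (cmod (d u)))"
  proof -
   have [measurable]: "d \<in> borel_measurable haar" by (rule square_integrableD(1)[OF d])
   show ?thesis using square_integrableD(2)[OF d] by (simp add: square_integrable_def)
  qed
  have one: "sqi haar (\<lambda>_. 1)" by (rule haar.bdd_square[OF one_bdd])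
  have "(LINT u|haar. complex_of_real (cmod (d u)) * cnj 1) = of_real (LINT u|haar. cmod (d u))" by (simp add: integral_complex_of_real)
  hence "(LINT u|haar. cmod (d u)) \<le> l2_norm haar (\<lambda>u. complex_of_real (cmod (d u))) * l2_norm haar (\<lambda>_. 1)"
   using Cauchy_Schwarz_l2[OF c one] by (simp add: norm_of_real)
  also have "... = l2_norm haar d" by (simp add: l2_norm_def haar.prob_space[simplified])
  finally have 1: "(LINT u|haar. cmod (d u)) \<le> l2_norm haar d" .
  have i: "integrable haar (\<lambda>u. f (v * u) * cnj (f u))" "integrable haar (\<lambda>u. (cmod (f (v * u)))\<^sup>2)"
   "integrable haar (\<lambda>u. (cmod (f u))\<^sup>2)"
   using integrable_mult_square[OF fv sqi_cnj[OF fs]] square_integrableD(2)[OF fv] square_integrableD(2)[OF fs] .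
  have "(l2_norm haar d)\<^sup>2 = (LINT u|haar. (cmod (f (v * u)))\<^sup>2 + (cmod (f u))\<^sup>2 - 2 * Re (f (v * u) * cnj (f u)))"
   unfolding l2_norm_power2 d_def by (simp only: cmod_power2 complex_cnj minus_complex.sel times_complex.sel cnj.sel)
    (simp add: power2_eq_square algebra_simps)
  also have "... = (l2_norm haar (\<lambda>u. f (v * u)))\<^sup>2 + (l2_norm haar f)\<^sup>2 - 2 * Re (acorr f v)"
  proof -
   define R where "R u = Re (f (v * u) * cnj (f u))" for u
   have R: "integrable haar R" "(LINT u|haar. R u) = Re (acorr f v)" unfolding R_def acorr_def using integrable_Re[OF i(1)] integral_Re[OF i(1)] .
   show ?thesis unfolding l2_norm_power2 R_def[symmetric] R(2)[symmetric] using i(2,3) R(1) by simp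
  qed
  also have "... = 2 * (Re (acorr f 1) - Re (acorr f v))" unfolding haar_square_translate(2)[OF fs v(2)] acorr_one[OF fs] by simp
  also have "... < e\<^sup>2" using W(3)[OF v] abs_Re_le_cmod[of "acorr f v - acorr f 1"] by (simp add: dist_norm)
  finally have "l2_norm haar d < e" using e by (rule power_less_imp_less_base[OF _ less_imp_le])
  thus ?thesis using 1 unfolding d_def by simp
 qed
 thus ?thesis using W(1,2) by (intro exI[of _ W]) blast
qed

text \<open>Telescoping: \<open>t\<close> is split off, then the factors are exchanged for
  \<open>p1\<close> one at a time. \<open>s\<close> will be the indicator of a small set outside
  which \<open>t\<close> is 1.\<close>

lemma quad_product_bound:
 fixes p1 p2 p3 p4 t :: complex
 assumes b: "cmod p1 \<le> B" "cmod p2 \<le> B" "cmod p3 \<le> B" "cmod p4 \<le> B" and t: "cmod t = 1"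
  and s: "t \<noteq> 1 ==> s = (1 :: real)" "s \<ge> 0"
 shows "cmod (p1 * cnj p2 * cnj p3 * p4 * t - p1 * cnj p1 * cnj p1 * p1) \<le> B ^ 3 * (cmod (p2 - p1) + cmod (p3 - p1) + cmod (p4 - p1)) + 2 * B ^ 4 * s"
proof -
 have B: "B \<ge> 0" using b(1) norm_ge_zero order_trans by blast
 have m: "cmod (x * y * z * w) \<le> B ^ 3 * cmod w" if "cmod x \<le> B" "cmod y \<le> B" "cmod z \<le> B" for x y z w
  unfolding norm_mult power3_eq_cube using that B by (intro mult_mono order_refl) auto
 have eq: "p1 * cnj p2 * cnj p3 * p4 * t - p1 * cnj p1 * cnj p1 * p1
  = (p1 * cnj p3 * p4 * cnj (p2 - p1) + p1 * cnj p1 * p4 * cnj (p3 - p1) + p1 * cnj p1 * cnj p1 * (p4 - p1)) + p1 * cnj p2 * cnj p3 * p4 * (t - 1)"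
  by (simp add: algebra_simps)
 have 1: "cmod (p1 * cnj p3 * p4 * cnj (p2 - p1)) \<le> B ^ 3 * cmod (p2 - p1)"
  "cmod (p1 * cnj p1 * p4 * cnj (p3 - p1)) \<le> B ^ 3 * cmod (p3 - p1)"
  "cmod (p1 * cnj p1 * cnj p1 * (p4 - p1)) \<le> B ^ 3 * cmod (p4 - p1)"
  using m[of p1 "cnj p3" p4 "cnj (p2 - p1)"] m[of p1 "cnj p1" p4 "cnj (p3 - p1)"] m[of p1 "cnj p1" "cnj p1" "p4 - p1"] b
  by (simp_all only: complex_mod_cnj)
 have 2: "cmod (p1 * cnj p2 * cnj p3 * p4 * (t - 1)) \<le> 2 * B ^ 4 * s"
 proof (cases "t = 1")
  case True
  thus ?thesis using B s(2) by simp
 next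
  case False
  have "cmod (p1 * cnj p2 * cnj p3 * p4) \<le> B ^ 3 * cmod p4" using m[of p1 "cnj p2" "cnj p3" p4] b by simp
  also have "... \<le> B ^ 3 * B" using b(4) B by (intro mult_left_mono) auto
  finally have "cmod (p1 * cnj p2 * cnj p3 * p4) \<le> B ^ 4" by (simp add: eval_nat_numeral mult_ac)
  moreover have "cmod (t - 1) \<le> 2" using norm_triangle_ineq4[of t 1] t by simp
  ultimately have "cmod (p1 * cnj p2 * cnj p3 * p4) * cmod (t - 1) \<le> B ^ 4 * 2" using B by (intro mult_mono) auto
  thus ?thesis using s(1)[OF False] by (simp add: norm_mult mult_ac)
 qed
 have "cmod (p1 * cnj p2 * cnj p3 * p4 * t - p1 * cnj p1 * cnj p1 * p1)
  \<le> cmod (p1 * cnj p3 * p4 * cnj (p2 - p1)) + cmod (p1 * cnj p1 * p4 * cnj (p3 - p1)) + cmod (p1 * cnj p1 * cnj p1 * (p4 - p1))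
   + cmod (p1 * cnj p2 * cnj p3 * p4 * (t - 1))" unfolding eq by (intro order_trans[OF norm_triangle_ineq] add_mono order_refl)
 thus ?thesis using 1 2 unfolding distrib_left by linarith
qed

text \<open>The part of the test integral over a fixed pair of sides, with the transfer function of
  \<open>rho ^ n\<close> compensated.\<close>

definition twisted :: "(sol => complex) => int => sol => sol => complex" where
 "twisted f n v b = (LINT u|haar. f u * cnj (f (v * u)) * cnj (f (b * u)) * f (v * (b * u)) * cnj (psi v b u powi n))"

text \<open>For short sides the translates of \<open>f\<close> are close to \<open>f\<close> in
  mean, and the factor from \<open>psi\<close> is 1 outside a set of small measure near the
  cut.\<close>

lemma quad_near_diagonal:
 assumes f: "bdd haar f B" and e: "e > 0"
 shows "\<exists>W. open W \<and> 1 \<in> W \<and> (\<forall>v\<in>W \<inter> solen. \<forall>b\<in>W \<inter> solen.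
  cmod (twisted f n v b
   - (LINT u|haar. f u * cnj (f u) * cnj (f u) * f u)) < e)"
proof -
 have B: "B \<ge> 0" by (rule haar.bdd_nonneg[OF f])
 \<comment> \<open>The three mean distances are below \<open>r\<close>, \<open>r\<close> and
   \<open>2 * r\<close>, each with weight \<open>B ^ 3\<close>; the exceptional set has measure
   below \<open>r\<close> and weight \<open>2 * B ^ 4\<close>; the 1 makes the final inequality
   strict.\<close>
 define c where "c = 4 * B ^ 3 + 2 * B ^ 4 + 1"
 have c: "c > 0" using B by (auto simp: c_def intro!: add_nonneg_pos)
 define r where "r = e / c"
 have r: "r > 0" using e c by (simp add: r_def)
 obtain d where d: "d > 0" "measure haar {u \<in> solen. 1 / 2 - 2 * d \<le> \<bar>angle u\<bar>} < r"
  using small_angle_complement[OF r] by (elim exE conjE)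
 obtain W1 where W1: "open W1" "1 \<in> W1" "\<forall>u\<in>W1. \<bar>angle u\<bar> < d" using angle_nbhd[OF d(1)] by (elim exE conjE)
 obtain W2 where W2: "open W2" "1 \<in> W2" "\<forall>v\<in>W2 \<inter> solen. (LINT u|haar. cmod (f (v * u) - f u)) < r"
  using l1_modulus[OF f r] by (elim exE conjE)
 let ?D = "{u \<in> solen. 1 / 2 - 2 * d \<le> \<bar>angle u\<bar>}"
 have Dm: "?D \<in> sets haar"
 proof -
  have "{u \<in> space haar. 1 / 2 - 2 * d \<le> \<bar>angle u\<bar>} \<in> sets haar" by measurable
  thus ?thesis by simp
 qed
 show ?thesis
 proof (intro exI[of _ "W1 \<inter> W2"] conjI ballI)
  show "open (W1 \<inter> W2)" "1 \<in> W1 \<inter> W2" using W1 W2 by auto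
  fix v b assume "v \<in> W1 \<inter> W2 \<inter> solen" "b \<in> W1 \<inter> W2 \<inter> solen"
  hence v: "v \<in> W1" "v \<in> W2" "v \<in> solen" and b: "b \<in> W1" "b \<in> W2" "b \<in> solen" by auto
  have vb: "v * b \<in> solen" by (rule solen_mult[OF v(3) b(3)])
  define tz where "tz u = cnj (psi v b u powi n)" for u
  have pm: "(\<lambda>u. psi v b u) \<in> borel_measurable haar" by (rule psi_measurable) (use v(3) b(3) in simp_all)
  have tzm: "bdd haar tz 1" unfolding bdd_def
  proof
   show "tz \<in> borel_measurable haar" unfolding tz_def[abs_def] by (rule m_comp[OF m_comp[OF pm measurable_powi] measurable_cnj])
   show "\<forall>u\<in>space haar. cmod (tz u) \<le> 1" by (simp add: tz_def unit_powi_norm psi_norm v(3) b(3))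
  qed
  define f2 where "f2 u = f (v * u)" for u
  define f3 where "f3 u = f (b * u)" for u
  define f4 where "f4 u = f (v * (b * u))" for u
  have f2: "bdd haar f2 B" unfolding f2_def by (rule translate_bdd[OF f v(3)])
  have f3: "bdd haar f3 B" unfolding f3_def by (rule translate_bdd[OF f b(3)])
  have f4: "bdd haar f4 B" using translate_bdd[OF f vb] unfolding f4_def by (simp only: mult.assoc)
  have id: "integrable haar (\<lambda>u. cmod (p u - q u))" if "bdd haar p B" "bdd haar q B" for p q :: "_ => complex"
   by (intro integrable_norm Bochner_Integration.integrable_diff haar.bdd_integrable[OF that(1)] haar.bdd_integrable[OF that(2)])
  have l2: "(LINT u|haar. cmod (f2 u - f u)) < r" unfolding f2_def using W2(3) v by blast
  have l3: "(LINT u|haar. cmod (f3 u - f u)) < r" unfolding f3_def using W2(3) b by blast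
  have m42: "(\<lambda>u. cmod (f2 u - f u)) \<in> borel_measurable haar" using id[OF f2 f] by (rule borel_measurable_integrable)
  \<comment> \<open>\<open>f4 - f3\<close> is the translate by \<open>b\<close> of
    \<open>f2 - f\<close>, so both have the same mean modulus.\<close>
  have l43: "(LINT u|haar. cmod (f4 u - f3 u)) < r" using haar_integral_translate[OF b(3) m42] l2 by (simp only: f4_def f3_def f2_def)
  have "(LINT u|haar. cmod (f4 u - f u)) \<le> (LINT u|haar. cmod (f4 u - f3 u) + cmod (f3 u - f u))"
  proof (rule integral_mono)
   show "integrable haar (\<lambda>u. cmod (f4 u - f u))" by (rule id[OF f4 f])
   show "integrable haar (\<lambda>u. cmod (f4 u - f3 u) + cmod (f3 u - f u))" by (intro Bochner_Integration.integrable_add id f3 f4 f)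
   show "cmod (f4 u - f u) \<le> cmod (f4 u - f3 u) + cmod (f3 u - f u)" for u using norm_triangle_ineq[of "f4 u - f3 u" "f3 u - f u"] by simp
  qed
  also have "... = (LINT u|haar. cmod (f4 u - f3 u)) + (LINT u|haar. cmod (f3 u - f u))"
   by (rule Bochner_Integration.integral_add[OF id[OF f4 f3] id[OF f3 f]])
  finally have l4: "(LINT u|haar. cmod (f4 u - f u)) < 2 * r" using l43 l3 by simp
  define P where "P u = f u * cnj (f2 u) * cnj (f3 u) * f4 u * tz u" for u
  define Q where "Q u = f u * cnj (f u) * cnj (f u) * f u" for u
  have "bdd haar P (B * B * B * B * 1)" unfolding P_def[abs_def] by (intro bdd_mult bdd_cnj f f2 f3 f4 tzm)
  hence Pi: "integrable haar P" by (rule haar.bdd_integrable)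
  have "bdd haar Q (B * B * B * B)" unfolding Q_def[abs_def] by (intro bdd_mult bdd_cnj f)
  hence Qi: "integrable haar Q" by (rule haar.bdd_integrable)
  define R where "R u = B ^ 3 * (cmod (f2 u - f u) + cmod (f3 u - f u) + cmod (f4 u - f u)) + 2 * B ^ 4 * indicator ?D u" for u
  have Di: "integrable haar (indicator ?D :: _ => real)" by (rule integrable_real_indicator[OF Dm]) (simp add: less_top[symmetric])
  have Ri: "integrable haar R" unfolding R_def[abs_def]
   by (intro Bochner_Integration.integrable_add Bochner_Integration.integrable_mult_right id f2 f3 f4 f Di)
  have "cmod ((LINT u|haar. P u) - (LINT u|haar. Q u)) = cmod (LINT u|haar. P u - Q u)" using Pi Qi by simp
  also have "... \<le> (LINT u|haar. cmod (P u - Q u))" by (rule integral_norm_bound)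
  also have "... \<le> (LINT u|haar. R u)"
  proof (rule integral_mono)
   show "integrable haar (\<lambda>u. cmod (P u - Q u))" by (rule integrable_norm[OF Bochner_Integration.integrable_diff[OF Pi Qi]])
   show "integrable haar R" by (rule Ri)
   fix u assume us: "u \<in> space haar"
   hence u: "u \<in> solen" by simp
   show "cmod (P u - Q u) \<le> R u" unfolding P_def Q_def R_def
   proof (rule quad_product_bound)
    show "cmod (f u) \<le> B" "cmod (f2 u) \<le> B" "cmod (f3 u) \<le> B" "cmod (f4 u) \<le> B"
     using bdd_le[OF f us] bdd_le[OF f2 us] bdd_le[OF f3 us] bdd_le[OF f4 us] .
    show "cmod (tz u) = 1" by (simp add: tz_def unit_powi_norm psi_norm v(3) b(3) u)
    show "(0::real) \<le> indicator ?D u" by simp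
    assume "tz u \<noteq> 1"
    hence "psi v b u \<noteq> 1" by (auto simp: tz_def)
    hence "\<not> \<bar>angle u\<bar> < 1 / 2 - 2 * d" using psi_near[OF v(3) b(3) u] W1(3) v(1) b(1) by blast
    thus "indicator ?D u = (1::real)" using u by simp
   qed
  qed
  also have "... = B ^ 3 * ((LINT u|haar. cmod (f2 u - f u)) + (LINT u|haar. cmod (f3 u - f u)) + (LINT u|haar. cmod (f4 u - f u)))
    + 2 * B ^ 4 * measure haar ?D"
  proof -
   have "?D \<inter> solen = ?D" by blast
   thus ?thesis unfolding R_def using id[OF f2 f] id[OF f3 f] id[OF f4 f] Di Dm by simp
  qed
  also have "... \<le> B ^ 3 * (r + r + 2 * r) + 2 * B ^ 4 * r" using B l2 l3 l4 d(2) by (intro add_mono mult_left_mono) auto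
  also have "... = (c - 1) * r" by (simp add: c_def algebra_simps)
  also have "... < c * r" using r by simp
  also have "... = e" using c by (simp add: r_def)
  finally show "cmod (twisted f n v b
   - (LINT u|haar. f u * cnj (f u) * cnj (f u) * f u)) < e" unfolding P_def Q_def f2_def f3_def f4_def tz_def twisted_def .
 qed
qed

text \<open>\<open>quad f\<close> is orthogonal to all invariant functions. Tested against one
  supported on short sides, it yields approximately the fourth moment of the vertical coefficient
  \<open>F\<close> times the measure of the support; so this moment is 0.\<close>

lemma fourier_vanishes:
 fixes n :: int
 assumes f: "bdd XM f B" and hull: "YA.hull_norm (quad f) = 0"
 shows "AE u in haar. mean0 (\<lambda>x. f x * cnj (snd x powi n)) u = 0"
proof -
 define k where "k x = f x * cnj (snd x powi n)" for x
 have sb: "bdd XM (\<lambda>x. snd x powi n) 1" unfolding bdd_def using m_comp[OF XM_snd measurable_powi[of n]] by (auto simp: space_XM unit_powi_norm)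
 have kb: "bdd XM k B" using bdd_mult[OF f bdd_cnj[OF sb]] by (simp add: k_def[abs_def])
 define F where "F = mean0 k"
 have F: "bdd haar F B" unfolding F_def by (rule mean0_bdd[OF kb])
 define c where "c = (LINT u|haar. F u * cnj (F u) * cnj (F u) * F u)"
 have cr: "c = of_real (LINT u|haar. (cmod (F u)) ^ 4)"
 proof -
  have "F u * cnj (F u) * cnj (F u) * F u = of_real ((cmod (F u)) ^ 4)" for u
  proof -
   have "F u * cnj (F u) * cnj (F u) * F u = (F u * cnj (F u)) * (F u * cnj (F u))" by (simp only: mult_ac)
   also have "... = of_real ((cmod (F u))\<^sup>2 * (cmod (F u))\<^sup>2)" by (simp only: complex_norm_square[symmetric] of_real_mult)
   finally show ?thesis by (simp add: power_add[symmetric])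
  qed
  thus ?thesis unfolding c_def by (simp only: integral_complex_of_real)
 qed
 have "c = 0"
 proof (rule ccontr)
  assume ne: "c \<noteq> 0"
  hence c2: "cmod c / 2 > 0" by simp
  obtain W where W: "open W" "1 \<in> W" and near: "\<forall>v\<in>W \<inter> solen. \<forall>b\<in>W \<inter> solen.
   cmod (twisted F n v b - c) < cmod c / 2" using quad_near_diagonal[OF F c2, of n] unfolding c_def[symmetric] by (elim exE conjE)
  have WS: "W \<inter> solen \<in> sets haar" using W(1) closed_solen by (simp add: sets_haar_borel)
  define q where "q p = (indicator (W \<inter> solen) (fst p) * indicator (W \<inter> solen) (snd p) :: complex)" for p
  have qb: "bdd hh q 1"
  proof -
   have "(indicator (W \<inter> solen) :: _ => complex) \<in> borel_measurable haar" by (rule borel_measurable_indicator[OF WS])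
   hence "bdd haar (indicator (W \<inter> solen) :: _ => complex) 1" by (simp add: bdd_def indicator_def)
   from bdd_mult[OF bdd_compose[OF this measurable_fst] bdd_compose[OF this measurable_snd]]
   show ?thesis unfolding q_def[abs_def] by simp
  qed
  define Om where "Om p = twisted F n (fst p) (snd p)" for p
  define tz where "tz d = psi (fst (fst d)) (snd (fst d)) (snd d)" for d
  have tz1: "cmod (tz d) = 1" if "d \<in> space DM" for d using that by (auto simp: tz_def space_pair_measure psi_norm)
  have tzb: "bdd DM (\<lambda>d. tz d powi n) 1" unfolding bdd_def
  proof
   have "tz \<in> borel_measurable DM" unfolding tz_def[abs_def] by (rule psi_measurable) measurable
   thus "(\<lambda>d. tz d powi n) \<in> borel_measurable DM" by (rule m_comp[OF _ measurable_powi])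
   show "\<forall>d\<in>space DM. cmod (tz d powi n) \<le> 1" by (simp add: unit_powi_norm tz1)
  qed
  define K where "K d = q (fst d) * cnj (tz d powi n)" for d
  have Kb: "bdd DM K 1" using bdd_mult[OF bdd_compose[OF qb measurable_fst] bdd_cnj[OF tzb]] unfolding K_def[abs_def] by simp
  \<comment> \<open>The product of the fibre coordinates changes under \<open>TY\<close> by the
    alternating product of \<open>rho\<close> at the corners, and \<open>psi\<close> compensates
    this change by \<open>rho_quad\<close>; the cutoff depends on the sides alone.\<close>
  define J where "J y = cnj (K (fst (fst (fst (fst y))))) * quad (\<lambda>x. snd x powi n) y" for y
  have b1: "(\<lambda>y. fst (fst (fst (fst y)))) \<in> measurable YM DM" by measurable
  have "bdd YM J (1 * (1 * 1 * 1 * 1))" unfolding J_def[abs_def] by (intro bdd_mult bdd_cnj bdd_compose[OF Kb b1] quad_bdd sb)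
  hence Js: "sqi YM J" by (rule YA.bdd_square)
  have inv: "AE y in YM. J (TY g y) = J y" if g: "g \<in> GG" for g
  proof (rule AE_I2)
   fix y assume y: "y \<in> space YM"
   define d where "d = fst (fst (fst (fst y)))"
   have d: "d \<in> space DM" unfolding d_def by (rule measurable_space[OF b1 y])
   have ds: "fst (fst d) \<in> solen" "snd (fst d) \<in> solen" "snd d \<in> solen" using d by (auto simp: space_pair_measure)
   have td: "fst (fst (fst (fst (TY g y)))) = tau g d" by (simp add: TY_def skew_def d_def)
   define r where "r i = rho g (corner i d)" for i
   have r1: "cmod (r i) = 1" for i unfolding r_def by (rule rho_norm[OF g corner_space[OF d]])
   have rc: "cnj (r i) * r i = 1" for i by (rule cnj_mult_unit[OF r1])
   have sp: "snd (pt i (TY g y)) = r i * snd (pt i y)" if "i < 4" for i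
    unfolding pt_TY[OF y that] TX_eq[OF measurable_space[OF pt_measurable y]] by (simp add: r_def pt_def d_def)
   have rq: "r 0 * r 3 * tz (tau g d) = r 1 * r 2 * tz d" using rho_quad[OF g ds] by (simp add: r_def corner_def tz_def tau_def)
   have "tz d = (cnj (r 1) * r 1) * (cnj (r 2) * r 2) * tz d" by (simp only: rc mult_1)
   also have "... = cnj (r 1) * cnj (r 2) * (r 1 * r 2 * tz d)" by (simp only: mult_ac)
   also have "... = r 0 * cnj (r 1) * cnj (r 2) * r 3 * tz (tau g d)" unfolding rq[symmetric] by (simp only: mult_ac)
   finally have "tz d powi n = (r 0 * cnj (r 1) * cnj (r 2) * r 3) powi n * tz (tau g d) powi n" by (simp only: power_int_mult_distrib)
   moreover have "quad (\<lambda>x. snd x powi n) (TY g y) = (r 0 * cnj (r 1) * cnj (r 2) * r 3) powi n * quad (\<lambda>x. snd x powi n) y"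
    by (simp add: quad_def sp power_int_mult_distrib complex_cnj_power_int mult_ac)
   ultimately show "J (TY g y) = J y" unfolding J_def K_def td d_def[symmetric] by (simp add: tau_def mult_ac)
  qed
  have "sqi YM (quad f)" by (rule YA.bdd_square[OF quad_bdd[OF f]])
  from YA.hull_norm_0_orthogonal[OF this Js inv hull]
  have "0 = (LINT y|YM. quad f y * cnj (J y))" by simp
  also have "... = (LINT y|YM. K (fst (fst (fst (fst y)))) * quad k y)" by (rule LINT_cong) (simp_all add: J_def quad_def k_def mult_ac)
  also have "... = (LINT d|DM. K d * (F (corner 0 d) * cnj (F (corner 1 d)) * cnj (F (corner 2 d)) * F (corner 3 d)))"
   unfolding F_def by (rule quad_mean[OF Kb kb])
  also have "... = (LINT p|hh. (LINT u|haar. K (p, u) * (F (corner 0 (p, u)) * cnj (F (corner 1 (p, u))) * cnj (F (corner 2 (p, u))) * F (corner 3 (p, u)))))"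
  proof (rule DM_integral)
   show "bdd DM (\<lambda>d. K d * (F (corner 0 d) * cnj (F (corner 1 d)) * cnj (F (corner 2 d)) * F (corner 3 d))) (1 * (B * B * B * B))"
    by (intro bdd_mult bdd_cnj Kb bdd_compose[OF F corner_measurable])
  qed
  also have "... = (LINT p|hh. q p * twisted F n (fst p) (snd p))"
   unfolding K_def tz_def corner_def twisted_def by (simp add: mult_ac flip: Bochner_Integration.integral_mult_right_zero del: times_fun_apply)
  finally have zero: "(LINT p|hh. q p * Om p) = 0" unfolding Om_def by (rule sym)
  interpret hh: prob_space hh by (rule prob_hh)
  have Omm: "Om \<in> borel_measurable hh"
  proof -
   have "bdd DM (\<lambda>d. F (corner 0 d) * cnj (F (corner 1 d)) * cnj (F (corner 2 d)) * F (corner 3 d) * cnj (tz d powi n)) (B * B * B * B * 1)"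
    by (intro bdd_mult bdd_cnj tzb bdd_compose[OF F corner_measurable])
   hence "(\<lambda>d. F (corner 0 d) * cnj (F (corner 1 d)) * cnj (F (corner 2 d)) * F (corner 3 d) * cnj (tz d powi n)) \<in> borel_measurable DM"
    by (rule bdd_measurable)
   hence "(\<lambda>p. LINT u|haar. F (corner 0 (p, u)) * cnj (F (corner 1 (p, u))) * cnj (F (corner 2 (p, u))) * F (corner 3 (p, u)) * cnj (tz (p, u) powi n)) \<in> borel_measurable hh"
    by measurable
   thus ?thesis unfolding Om_def[abs_def] tz_def corner_def twisted_def by (simp del: times_fun_apply)
  qed
  have nr: "cmod (q p * (c - Om p)) \<le> cmod c / 2 * Re (q p)" for p
  proof (cases "fst p \<in> W \<inter> solen \<and> snd p \<in> W \<inter> solen")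
   case True
   hence "cmod (Om p - c) < cmod c / 2" using near unfolding Om_def by blast
   thus ?thesis using True by (simp add: q_def norm_minus_commute)
  next
   case False
   hence "q p = 0" by (auto simp: q_def indicator_def)
   thus ?thesis by simp
  qed
  have Omb: "bdd hh (\<lambda>p. q p * (c - Om p)) (cmod c / 2)" unfolding bdd_def
  proof
   show "(\<lambda>p. q p * (c - Om p)) \<in> borel_measurable hh" using bdd_measurable[OF qb] Omm by measurable
   have "Re (q p) \<le> 1" for p by (simp add: q_def indicator_def)
   thus "\<forall>p\<in>space hh. cmod (q p * (c - Om p)) \<le> cmod c / 2"
    using nr order_trans[OF nr mult_left_mono[of "Re (q _)" 1 "cmod c / 2"]] by simp
  qed
  have qi: "integrable hh q" by (rule hh.bdd_integrable[OF qb])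
  have i1: "integrable hh (\<lambda>p. q p * (c - Om p))" by (rule hh.bdd_integrable[OF Omb])
  have i2: "integrable hh (\<lambda>p. q p * Om p)"
  proof -
   have "integrable hh (\<lambda>p. q p * c - q p * (c - Om p))" by (intro Bochner_Integration.integrable_diff i1 integrable_mult_left qi)
   thus ?thesis by (simp add: right_diff_distrib)
  qed
  have mq: "(LINT p|hh. q p) = of_real ((measure haar (W \<inter> solen))\<^sup>2)"
  proof -
   have "(LINT p|hh. q p) = (LINT v|haar. (LINT b|haar. indicator (W \<inter> solen) v * indicator (W \<inter> solen) b))"
    using pair_integral_bdd(1)[OF haar_prob haar_prob qb] by (simp add: q_def)
   also have "... = (LINT v|haar. indicator (W \<inter> solen) v) * (\<integral>b. indicator (W \<inter> solen) b \<partial>haar :: complex)" by simp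
   also have "(\<integral>b. indicator (W \<inter> solen) b \<partial>haar :: complex) = of_real (measure haar (W \<inter> solen))"
   proof -
    have "(\<lambda>b. indicator (W \<inter> solen) b :: complex) = (\<lambda>b. of_real (indicator (W \<inter> solen) b))"
     by (simp add: fun_eq_iff indicator_def)
    thus ?thesis using WS by (simp only: integral_complex_of_real) simp
   qed
   finally show ?thesis by (simp add: power2_eq_square)
  qed
  have mpos: "(measure haar (W \<inter> solen))\<^sup>2 > 0" using haar_open_pos[OF W] by simp
  \<comment> \<open>As the integral of \<open>q * Om\<close> is 0, \<open>c\<close> times the
    integral of \<open>q\<close> equals the integral of \<open>q * (c - Om)\<close>, which is at
    most half of that in modulus.\<close>
  have "c * (LINT p|hh. q p) = (LINT p|hh. q p * (c - Om p) + q p * Om p)" by (simp add: right_diff_distrib mult.commute)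
  also have "... = (LINT p|hh. q p * (c - Om p))" using i1 i2 zero by simp
  finally have "cmod (c * complex_of_real ((measure haar (W \<inter> solen))\<^sup>2)) = cmod (LINT p|hh. q p * (c - Om p))"
   unfolding mq by (rule arg_cong)
  hence "cmod c * (measure haar (W \<inter> solen))\<^sup>2 = cmod (LINT p|hh. q p * (c - Om p))" by (simp only: norm_mult norm_of_real abs_power2)
  also have "... \<le> (LINT p|hh. cmod (q p * (c - Om p)))" by (rule integral_norm_bound)
  also have "... \<le> (LINT p|hh. cmod c / 2 * Re (q p))" by (rule integral_mono[OF integrable_norm[OF i1]]) (use qi nr in simp_all)
  also have "... = cmod c / 2 * (measure haar (W \<inter> solen))\<^sup>2"
  proof -
   have "(LINT p|hh. Re (q p)) = (measure haar (W \<inter> solen))\<^sup>2" using integral_Re[OF qi] mq by simp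
   thus ?thesis by simp
  qed
  finally show False using mpos ne by simp
 qed
 hence "(LINT u|haar. (cmod (F u)) ^ 4) = 0" using cr by simp
 moreover have "bdd haar (\<lambda>u. F u * cnj (F u) * cnj (F u) * F u) (B * B * B * B)" by (intro bdd_mult bdd_cnj F)
 have i4: "integrable haar (\<lambda>u. (cmod (F u)) ^ 4)"
 proof (rule haar.integrable_const_bound[where B="B ^ 4"])
  have [measurable]: "F \<in> borel_measurable haar" by (rule bdd_measurable[OF F])
  show "(\<lambda>u. (cmod (F u)) ^ 4) \<in> borel_measurable haar" by measurable
  show "AE u in haar. norm ((cmod (F u)) ^ 4) \<le> B ^ 4" using bdd_le[OF F] by (intro AE_I2) (auto intro!: power_mono)
 qed
 ultimately have "AE u in haar. (cmod (F u)) ^ 4 = 0" using integral_nonneg_eq_0_iff_AE[OF i4] by simp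
 thus ?thesis unfolding F_def k_def by simp
qed

text \<open>A Fourier coefficient of \<open>f\<close> is an integral of a character of the base
  against one of its vertical coefficients; when all of these vanish, \<open>f\<close> is 0 by
  density.\<close>

theorem order_3_X: "order_less PG XM TX 3"
proof (rule XA.order_lessI)
 fix f B assume f: "bdd XM f B"
 have hull0: "gowers_norm PG XM TX 3 f = 0 \<longleftrightarrow> YA.hull_norm (quad f) = 0" unfolding gowers_3[OF f] by simp
 show "gowers_norm PG XM TX 3 f = 0 \<longleftrightarrow> (AE x in XM. f x = 0)"
 proof
  assume "gowers_norm PG XM TX 3 f = 0"
  hence hull: "YA.hull_norm (quad f) = 0" using hull0 by simp
  have fs: "sqi XM f" by (rule XM.bdd_square[OF f])
  show "AE x in XM. f x = 0"
  proof (rule ccontr)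
   assume ne: "\<not> (AE x in XM. f x = 0)"
   obtain xi n where xi: "xi \<in> chars" and ne0: "(LINT x|XM. f x * cnj (xchar xi n x)) \<noteq> 0"
    using ex_fourier_coefficient[OF fs ne] by (elim exE conjE)
   have k: "AE u in haar. mean0 (\<lambda>x. f x * cnj (snd x powi n)) u = 0" by (rule fourier_vanishes[OF f hull])
   have int: "integrable XM (\<lambda>x. f x * cnj (xchar xi n x))" by (intro integrable_mult_square fs sqi_cnj xchar_square xi)
   have "(LINT x|XM. f x * cnj (xchar xi n x)) = (LINT u|haar. (LINT z|CM. f (u, z) * cnj (xchar xi n (u, z))))" by (rule integral_XM[OF int])
   also have "... = (LINT u|haar. cnj (xi u) * mean0 (\<lambda>x. f x * cnj (snd x powi n)) u)"
    unfolding mean0_def by (simp add: xchar_def mult_ac flip: Bochner_Integration.integral_mult_right_zero)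
   also have "... = 0" by (rule integral_eq_zero_AE) (use k in auto)
   finally show False using ne0 by simp
  qed
 next
  assume z: "AE x in XM. f x = 0"
  have "gowers_norm PG XM TX 3 f = gowers_norm PG XM TX 3 (\<lambda>_. 0)" by (rule XA.gowers_norm_cong_AE[OF bdd_measurable[OF f] _ z]) simp
  also have "... = 0"
  proof -
   have b: "bdd XM (\<lambda>_. 0) 0" by (simp add: bdd_def)
   have "quad (\<lambda>_. 0) = (\<lambda>_. 0)" by (simp add: quad_def fun_eq_iff)
   hence "(\<lambda>N. (\<Sum>g\<in>fol N. YA.corr (quad (\<lambda>_. 0)) g) / of_nat (card (fol N))) = (\<lambda>N. 0)" by (simp add: YA.corr_def)
   moreover have "sqi YM (quad (\<lambda>_. 0))" by (rule YA.bdd_square[OF quad_bdd[OF b]])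
   ultimately have "(YA.hull_norm (quad (\<lambda>_. 0)))\<^sup>2 = 0"
    using YA.avg_corr_tendsto[OF folner_fol, of "quad (\<lambda>_. 0)"] by (simp add: tendsto_const_iff)
   thus ?thesis unfolding gowers_3[OF b] by simp
  qed
  finally show "gowers_norm PG XM TX 3 f = 0" .
 qed
qed

section \<open>Cube measures of the rotation\<close>

definition tr :: "nat => sol => (int list => nat => complex) => int list => nat => complex" where
 "tr k h z = (\<lambda>w\<in>cube_vertices k. h * z w)"

definition join :: "nat => (int list => 'x) => (int list => 'x) => int list => 'x" where
 "join k z z' = (\<lambda>w\<in>cube_vertices (Suc k). if hd w = - 1 then z (tl w) else z' (tl w))"

lemma cube_vertices_Suc: "w \<in> cube_vertices (Suc k) ==> tl w \<in> cube_vertices k" by (cases w) (auto simp: cube_vertices_def)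

lemma cube_vertices_Cons: "e \<in> {-1, 1} ==> w \<in> cube_vertices k ==> e # w \<in> cube_vertices (Suc k)" by (auto simp: cube_vertices_def)

lemma cube_face_join:
 assumes "z \<in> extensional (cube_vertices k)" "z' \<in> extensional (cube_vertices k)"
 shows "cube_face k (-1) (join k z z') = z" "cube_face k 1 (join k z z') = z'"
proof -
 show "cube_face k (-1) (join k z z') = z" by (rule extensionalityI[OF _ assms(1)]) (simp_all add: cube_face_def join_def cube_vertices_Cons)
 show "cube_face k 1 (join k z z') = z'" by (rule extensionalityI[OF _ assms(2)]) (simp_all add: cube_face_def join_def cube_vertices_Cons)
qed

lemma tr_tr: "tr k h (tr k h' z) = tr k (h * h') z" by (rule ext) (simp add: tr_def restrict_def mult.assoc del: times_fun_apply)

lemma tr_join: "tr (Suc k) h (join k z z') = join k (tr k h z) (tr k h z')"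
 by (rule ext) (auto simp: tr_def join_def cube_vertices_Suc restrict_def simp del: times_fun_apply)

lemma tr_extensional: "tr k h z \<in> extensional (cube_vertices k)" by (simp add: tr_def)

text \<open>What has to be carried from one cube to the next: invariance under diagonal translation
  by every element of the solenoid. Averaging over these translations, the operator
  \<open>P\<close>, then computes conditional expectations on diagonally invariant sets.\<close>

locale cube_level = prob_space N for N :: "(int list => nat => complex) measure" +
 fixes k :: nat
 assumes sets_N: "sets N = sets (cube_algebra haar k)"
  and tr_distr: "h \<in> solen ==> distr N N (tr k h) = N"
begin

lemma space_N: "space N = (\<Pi>\<^sub>E w\<in>cube_vertices k. solen)" using sets_eq_imp_space_eq[OF sets_N] by (simp add: cube_algebra_def space_PiM)

lemma N_extensional: "z \<in> space N ==> z \<in> extensional (cube_vertices k)" by (simp add: space_N PiE_def)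

lemma coord_measurable: "w \<in> cube_vertices k ==> (\<lambda>z. z w) \<in> measurable N haar"
 unfolding measurable_cong_sets[OF sets_N refl] cube_algebra_def by (rule measurable_component_singleton)

lemma tr_measurable2:
 assumes "f \<in> measurable M N" "h \<in> measurable M haar"
 shows "(\<lambda>x. tr k (h x) (f x)) \<in> measurable M N" unfolding measurable_cong_sets[OF refl sets_N] cube_algebra_def tr_def
 by (rule measurable_restrict) (rule measurable_solen_mult[OF assms(2) m_comp[OF assms(1) coord_measurable]])

lemma tr_measurable: "h \<in> solen ==> tr k h \<in> measurable N N" using tr_measurable2[OF measurable_ident, of "\<lambda>_. h"] by simp

lemma tr_pair_measurable: "(\<lambda>p. tr k (snd p) (fst p)) \<in> measurable (N \<Otimes>\<^sub>M haar) N" by (rule tr_measurable2) auto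

lemma orbit_measurable: "z \<in> space N ==> (\<lambda>h. tr k h z) \<in> measurable haar N" by (rule tr_measurable2) auto

lemma tr_space: "h \<in> solen ==> z \<in> space N ==> tr k h z \<in> space N" by (rule measurable_space[OF tr_measurable])

definition P :: "((int list => nat => complex) => complex) => (int list => nat => complex) => complex" where
 "P f z = (LINT h|haar. f (tr k h z))"

lemma orbit_bdd: "bdd N f B ==> z \<in> space N ==> bdd haar (\<lambda>h. f (tr k h z)) B" by (rule bdd_compose[OF _ orbit_measurable])

lemma pair_bdd: "bdd N f B ==> bdd (N \<Otimes>\<^sub>M haar) (\<lambda>p. f (tr k (snd p) (fst p))) B" by (rule bdd_compose[OF _ tr_pair_measurable])

lemma P_bdd:
 assumes f: "bdd N f B" shows "bdd N (P f) B" unfolding bdd_def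
proof
 have "(\<lambda>p. f (tr k (snd p) (fst p))) \<in> borel_measurable (N \<Otimes>\<^sub>M haar)" by (rule bdd_measurable[OF pair_bdd[OF f]])
 hence "(\<lambda>z. LINT h|haar. f (tr k (snd (z, h)) (fst (z, h)))) \<in> borel_measurable N" by measurable
 thus "P f \<in> borel_measurable N" unfolding P_def[abs_def] by simp
 show "\<forall>z\<in>space N. cmod (P f z) \<le> B" unfolding P_def by (intro ballI haar.norm_integral_le_bdd orbit_bdd[OF f])
qed

lemma P_tr:
 assumes f: "bdd N f B" and h: "h \<in> solen" and z: "z \<in> space N"
 shows "P f (tr k h z) = P f z"
proof -
 have "P f (tr k h z) = (LINT h'|haar. f (tr k (h * h') z))" unfolding P_def tr_tr by (simp only: mult.commute)
 also have "... = P f z" unfolding P_def by (rule haar_integral_translate[OF h bdd_measurable[OF orbit_bdd[OF f z]]])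
 finally show ?thesis .
qed

lemma integral_P:
 assumes f: "bdd N f B"
 shows "(LINT z|N. P f z) = (LINT z|N. f z)"
proof -
 have "(LINT z|N. P f z) = (LINT h|haar. (LINT z|N. f (tr k h z)))"
  unfolding P_def using pair_integral_bdd(2)[OF prob_space_axioms haar_prob pair_bdd[OF f]] by simp
 also have "... = (LINT h|haar. (LINT z|N. f z))"
 proof (rule LINT_cong[OF refl])
  fix h assume "h \<in> space haar"
  hence h: "h \<in> solen" by simp
  have "f \<in> borel_measurable N" by (rule bdd_measurable[OF f])
  from integral_distr[OF tr_measurable[OF h] this] show "(LINT z|N. f (tr k h z)) = (LINT z|N. f z)" by (simp only: tr_distr[OF h])
 qed
 finally show ?thesis by (simp add: haar.prob_space[simplified])
qed

abbreviation "act \<equiv> cube_action k alpha"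
abbreviation "I \<equiv> invariant_algebra PG N act"

lemma act_tr: "z \<in> space N ==> act g z = tr k (iota g) z"
proof (rule ext)
 fix w assume "z \<in> space N"
 hence "z w \<in> solen" if "w \<in> cube_vertices k" using that by (auto simp: space_N dest: PiE_mem)
 thus "act g z w = tr k (iota g) z w" by (simp add: cube_action_def tr_def alpha_eq restrict_def del: times_fun_apply)
qed

lemma sets_I: "sets I = {A \<in> sets N. \<forall>g\<in>GG. act g -` A \<inter> space N = A}"
proof -
 let ?C = "{A \<in> sets N. \<forall>g\<in>GG. act g -` A \<inter> space N = A}"
 have sp: "act g z \<in> space N" if "g \<in> GG" "z \<in> space N" for g z
  unfolding act_tr[OF that(2)] by (rule tr_space[OF iota_solen[OF that(1)] that(2)])
 have "sigma_algebra (space N) ?C" unfolding sigma_algebra_iff2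
 proof (intro conjI ballI allI impI)
  show "?C \<subseteq> Pow (space N)" using sets.sets_into_space by blast
  show "{} \<in> ?C" by simp
  show "space N - A \<in> ?C" if A: "A \<in> ?C" for A
  proof -
   have "act g -` (space N - A) \<inter> space N = space N - A" if g: "g \<in> GG" for g
   proof -
    have "act g -` A \<inter> space N = A" using A g by blast
    thus ?thesis using sp[OF g] by blast
   qed
   thus ?thesis using A by auto
  qed
  show "(\<Union>i::nat. A i) \<in> ?C" if A: "range A \<subseteq> ?C" for A
  proof -
   have "act g -` (\<Union>i. A i) \<inter> space N = (\<Union>i. A i)" if g: "g \<in> GG" for g
   proof -
    have "act g -` A i \<inter> space N = A i" for i using A g by blast
    thus ?thesis by blast
   qed
   moreover have "(\<Union>i. A i) \<in> sets N" using A by (intro sets.countable_UN) blast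
   ultimately show ?thesis by blast
  qed
 qed
 hence "sigma_sets (space N) ?C = ?C" by (rule sigma_algebra.sigma_sets_eq)
 moreover have "?C \<subseteq> Pow (space N)" using sets.sets_into_space by blast
 ultimately show ?thesis unfolding invariant_algebra_def by (simp add: sets_measure_of)
qed

lemma space_I: "space I = space N" unfolding invariant_algebra_def by (rule space_measure_of) (use sets.sets_into_space in blast)

lemma subalgebra_I: "subalgebra N I" unfolding subalgebra_def space_I sets_I by blast

lemma P_measurable_I:
 assumes f: "bdd N f B" shows "P f \<in> borel_measurable I"
proof (rule measurableI)
 fix S :: "complex set" assume S: "S \<in> sets borel"
 have "act g -` (P f -` S \<inter> space N) \<inter> space N = P f -` S \<inter> space N" if g: "g \<in> GG" for g
 proof -
  have "act g z \<in> space N \<and> P f (act g z) = P f z" if z: "z \<in> space N" for z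
   unfolding act_tr[OF z] using tr_space[OF iota_solen[OF g] z] P_tr[OF f iota_solen[OF g] z] by simp
  thus ?thesis by auto
 qed
 thus "P f -` S \<inter> space I \<in> sets I" unfolding sets_I space_I using measurable_sets[OF bdd_measurable[OF P_bdd[OF f]] S] by simp
qed simp

text \<open>By ergodicity of the rotation, a strictly invariant set contains almost all or almost none of
 the diagonal orbit of any point.\<close>

lemma invariant_orbit:
 assumes A: "A \<in> sets I" and z: "z \<in> space N"
 shows "AE h in haar. indicator A (tr k h z) = P (indicator A) z"
proof -
 have AN: "A \<in> sets N" and Ai: "\<And>g. g \<in> GG ==> act g -` A \<inter> space N = A" using A by (auto simp: sets_I)
 define F where "F h = (indicator A (tr k h z) :: complex)" for h
 have ib: "bdd N (indicator A :: _ => complex) 1" using borel_measurable_indicator[OF AN] by (simp add: bdd_def indicator_def)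
 have Fb: "bdd haar F 1" unfolding F_def by (rule orbit_bdd[OF ib z])
 have "F (alpha g h) = F h" if g: "g \<in> GG" and h: "h \<in> solen" for g h
 proof -
  have "tr k (alpha g h) z = act g (tr k h z)" unfolding act_tr[OF tr_space[OF h z]] tr_tr alpha_eq[OF h] ..
  moreover have "act g (tr k h z) \<in> A \<longleftrightarrow> tr k h z \<in> A" using Ai[OF g] tr_space[OF h z] by blast
  ultimately show ?thesis by (simp add: F_def indicator_def)
 qed
 hence "\<forall>g\<in>GG. AE h in haar. F (alpha g h) = F h" by (intro ballI AE_I2) simp
 then obtain c where c: "AE h in haar. F h = c" using ergodic_U haar.bdd_square[OF Fb] unfolding g_ergodic_def by blast
 have "P (indicator A) z = (LINT h|haar. c)" unfolding P_def F_def[symmetric] by (rule integral_cong_AE) (use c bdd_measurable[OF Fb] in auto)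
 hence "P (indicator A) z = c" by (simp add: haar.prob_space[simplified])
 thus ?thesis using c unfolding F_def by simp
qed

text \<open>An invariant set has an almost constant indicator along each orbit, so after averaging
  both integrands become \<open>P (indicator A) z * P f z\<close>.\<close>

lemma set_integral_P:
 assumes f: "bdd N f B" and A: "A \<in> sets I"
 shows "(LINT z|N. indicator A z * f z) = (LINT z|N. indicator A z * P f z)"
proof -
 have AN: "A \<in> sets N" using A by (simp add: sets_I)
 have ib: "bdd N (indicator A :: _ => complex) 1" using borel_measurable_indicator[OF AN] by (simp add: bdd_def indicator_def)
 have 1: "P (\<lambda>z. indicator A z * f z) z = P (indicator A) z * P f z" if z: "z \<in> space N" for z
 proof -
  have "P (\<lambda>z. indicator A z * f z) z = (LINT h|haar. P (indicator A) z * f (tr k h z))" unfolding P_def[of "\<lambda>z. indicator A z * f z"]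
   using invariant_orbit[OF A z] bdd_measurable[OF orbit_bdd[OF bdd_mult[OF ib f] z]] bdd_measurable[OF orbit_bdd[OF f z]]
   by (intro integral_cong_AE) auto
  thus ?thesis by (simp add: P_def[of f])
 qed
 have 2: "P (\<lambda>z. indicator A z * P f z) z = P (indicator A) z * P f z" if z: "z \<in> space N" for z
 proof -
  have "P (\<lambda>z. indicator A z * P f z) z = (LINT h|haar. indicator A (tr k h z) * P f z)" unfolding P_def[of "\<lambda>z. indicator A z * P f z"]
   by (rule LINT_cong) (simp_all add: P_tr[OF f _ z])
  thus ?thesis by (simp add: P_def[of "indicator A"])
 qed
 have "(LINT z|N. indicator A z * f z) = (LINT z|N. P (\<lambda>z. indicator A z * f z) z)" by (rule integral_P[OF bdd_mult[OF ib f], symmetric])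
 also have "... = (LINT z|N. P (\<lambda>z. indicator A z * P f z) z)" by (rule LINT_cong) (simp_all only: 1 2)
 also have "... = (LINT z|N. indicator A z * P f z)" by (rule integral_P[OF bdd_mult[OF ib P_bdd[OF f]]])
 finally show ?thesis .
qed

lemma finite_I: "finite_measure_subalgebra N I" by unfold_locales (rule subalgebra_I)

text \<open>\<open>P f\<close> is measurable for the invariant sets and has the same integrals over
  them, which characterises the conditional expectation; real and imaginary parts are treated
  separately.\<close>

lemma cond_exp_bdd:
 assumes f: "bdd N f B"
 shows "AE z in N. complex_cond_exp N I f z = P f z"
proof -
 interpret S: finite_measure_subalgebra N I by (rule finite_I)
 have fi: "integrable N f" "integrable N (P f)" using bdd_integrable[OF f] bdd_integrable[OF P_bdd[OF f]] .
 have ii: "integrable N (\<lambda>z. indicator A z * h z)" if "A \<in> sets I" "integrable N h" for A and h :: "_ => complex"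
 proof -
  have e: "(\<lambda>z. indicator A z * h z) = (\<lambda>z. indicator A z *\<^sub>R h z)" by (simp add: fun_eq_iff indicator_def)
  have "A \<in> sets N" using that(1) unfolding sets_I by blast
  thus ?thesis unfolding e using that(2) by (rule integrable_mult_indicator)
 qed
 have si: "set_lebesgue_integral N A (\<lambda>z. Re (h z)) = Re (LINT z|N. indicator A z * h z)"
   "set_lebesgue_integral N A (\<lambda>z. Im (h z)) = Im (LINT z|N. indicator A z * h z)"
  if "A \<in> sets I" "integrable N h" for A and h :: "_ => complex"
 proof -
  have "(\<lambda>z. indicator A z *\<^sub>R Re (h z)) = (\<lambda>z. Re (indicator A z * h z))" by (simp add: fun_eq_iff indicator_def)
  thus "set_lebesgue_integral N A (\<lambda>z. Re (h z)) = Re (LINT z|N. indicator A z * h z)"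
   unfolding set_lebesgue_integral_def by (simp only: integral_Re[OF ii[OF that]])
  have "(\<lambda>z. indicator A z *\<^sub>R Im (h z)) = (\<lambda>z. Im (indicator A z * h z))" by (simp add: fun_eq_iff indicator_def)
  thus "set_lebesgue_integral N A (\<lambda>z. Im (h z)) = Im (LINT z|N. indicator A z * h z)"
   unfolding set_lebesgue_integral_def by (simp only: integral_Im[OF ii[OF that]])
 qed
 have "AE z in N. real_cond_exp N I (\<lambda>z. Re (f z)) z = Re (P f z)"
 proof (rule S.real_cond_exp_charact)
  show "set_lebesgue_integral N A (\<lambda>z. Re (f z)) = set_lebesgue_integral N A (\<lambda>z. Re (P f z))" if "A \<in> sets I" for A
   unfolding si(1)[OF that fi(1)] si(1)[OF that fi(2)] set_integral_P[OF f that] ..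
  show "(\<lambda>z. Re (P f z)) \<in> borel_measurable I" using P_measurable_I[OF f] by measurable
 qed (use fi in auto)
 moreover have "AE z in N. real_cond_exp N I (\<lambda>z. Im (f z)) z = Im (P f z)"
 proof (rule S.real_cond_exp_charact)
  show "set_lebesgue_integral N A (\<lambda>z. Im (f z)) = set_lebesgue_integral N A (\<lambda>z. Im (P f z))" if "A \<in> sets I" for A
   unfolding si(2)[OF that fi(1)] si(2)[OF that fi(2)] set_integral_P[OF f that] ..
  show "(\<lambda>z. Im (P f z)) \<in> borel_measurable I" using P_measurable_I[OF f] by measurable
 qed (use fi in auto)
 ultimately show ?thesis by eventually_elim (simp add: complex_cond_exp_def complex_eq_iff)
qed

lemma cond_exp_ess_bounded:
 assumes f: "f \<in> borel_measurable N" and f': "bdd N f' B" and eq: "AE z in N. f z = f' z"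
 shows "AE z in N. complex_cond_exp N I f z = P f' z"
proof -
 interpret S: finite_measure_subalgebra N I by (rule finite_I)
 have f'm: "f' \<in> borel_measurable N" by (rule bdd_measurable[OF f'])
 have "AE z in N. real_cond_exp N I (\<lambda>z. Re (f z)) z = real_cond_exp N I (\<lambda>z. Re (f' z)) z"
  by (rule S.real_cond_exp_cong) (use eq f f'm in auto)
 moreover have "AE z in N. real_cond_exp N I (\<lambda>z. Im (f z)) z = real_cond_exp N I (\<lambda>z. Im (f' z)) z"
  by (rule S.real_cond_exp_cong) (use eq f f'm in auto)
 ultimately show ?thesis using cond_exp_bdd[OF f'] by eventually_elim (simp add: complex_cond_exp_def)
qed

text \<open>The law of the pair of \<open>z\<close> and its translate by an independent Haar random
  \<open>h\<close>. This is the relatively independent square over the invariant sets.\<close>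

definition lift :: "(int list => nat => complex) measure" where
 "lift = distr (N \<Otimes>\<^sub>M haar) (cube_algebra haar (Suc k)) (\<lambda>p. join k (fst p) (tr k (snd p) (fst p)))"

lemma sets_lift: "sets lift = sets (cube_algebra haar (Suc k))" by (simp add: lift_def)

lemma join_measurable:
 assumes f: "f \<in> measurable M N" and g: "g \<in> measurable M N"
 shows "(\<lambda>x. join k (f x) (g x)) \<in> measurable M (cube_algebra haar (Suc k))" unfolding cube_algebra_def join_def
proof (rule measurable_restrict)
 fix w assume w: "w \<in> cube_vertices (Suc k)"
 show "(\<lambda>x. if hd w = - 1 then f x (tl w) else g x (tl w)) \<in> measurable M haar"
  using m_comp[OF f coord_measurable[OF cube_vertices_Suc[OF w]]]
   m_comp[OF g coord_measurable[OF cube_vertices_Suc[OF w]]] by (cases "hd w = - 1") simp_all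
qed

lemma pair_join_measurable: "(\<lambda>p. join k (fst p) (tr k (snd p) (fst p))) \<in> measurable (N \<Otimes>\<^sub>M haar) (cube_algebra haar (Suc k))"
 by (rule join_measurable[OF measurable_fst tr_pair_measurable])

lemma prob_pair_N: "prob_space (N \<Otimes>\<^sub>M haar)" by (rule prob_pair[OF prob_space_axioms haar_prob])

text \<open>The second marginal of the pair; it transports null sets, as the functions on the faces
  are only essentially bounded.\<close>

lemma distr_tr_pair: "distr (N \<Otimes>\<^sub>M haar) N (\<lambda>p. tr k (snd p) (fst p)) = N"
proof (rule measure_eqI)
 interpret Q: pair_prob_space N haar by (rule pair_prob_spaceI[OF prob_space_axioms haar_prob])
 let ?t = "\<lambda>p. tr k (snd p) (fst p)"
 show "sets (distr (N \<Otimes>\<^sub>M haar) N ?t) = sets N" by simp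
 fix A assume "A \<in> sets (distr (N \<Otimes>\<^sub>M haar) N ?t)"
 hence A: "A \<in> sets N" by simp
 have ib: "bdd N (indicator A :: _ => complex) 1" using borel_measurable_indicator[OF A] by (simp add: bdd_def indicator_def)
 have ind: "(LINT z|M. indicator B z) = complex_of_real (measure M B)" if "B \<in> sets M" "prob_space M" for M :: "'m measure" and B
 proof -
  interpret M: prob_space M by fact
  have "(\<lambda>b. indicator B b :: complex) = (\<lambda>b. of_real (indicator B b))" by (simp add: fun_eq_iff indicator_def)
  thus ?thesis using that(1) by (simp only: integral_complex_of_real) simp
 qed
 have tA: "?t -` A \<inter> space (N \<Otimes>\<^sub>M haar) \<in> sets (N \<Otimes>\<^sub>M haar)" by (rule measurable_sets[OF tr_pair_measurable A])
 have "complex_of_real (measure (N \<Otimes>\<^sub>M haar) (?t -` A \<inter> space (N \<Otimes>\<^sub>M haar)))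
  = (LINT p|(N \<Otimes>\<^sub>M haar). indicator (?t -` A \<inter> space (N \<Otimes>\<^sub>M haar)) p)" by (rule ind[OF tA prob_pair_N, symmetric])
 also have "... = (LINT p|(N \<Otimes>\<^sub>M haar). indicator A (?t p))" by (rule LINT_cong) (auto simp: indicator_def)
 also have "... = (LINT z|N. P (indicator A) z)" using pair_integral_bdd(1)[OF prob_space_axioms haar_prob pair_bdd[OF ib]] by (simp add: P_def)
 also have "... = complex_of_real (measure N A)" unfolding integral_P[OF ib] by (rule ind[OF A prob_space_axioms])
 finally have "measure (N \<Otimes>\<^sub>M haar) (?t -` A \<inter> space (N \<Otimes>\<^sub>M haar)) = measure N A" by (simp only: of_real_eq_iff)
 thus "emeasure (distr (N \<Otimes>\<^sub>M haar) N ?t) A = emeasure N A"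
  unfolding emeasure_distr[OF tr_pair_measurable A] by (simp add: Q.emeasure_eq_measure emeasure_eq_measure)
qed

lemma distr_fst_pair: "distr (N \<Otimes>\<^sub>M haar) N fst = N" by (rule prob_space.distr_pair_fst[OF haar_prob])

text \<open>Averaging over \<open>h\<close> turns the second factor into \<open>P f2\<close>. This
  is constant on orbits, so invariance of \<open>N\<close> permits replacing the first factor by
  \<open>P f1\<close> as well.\<close>

lemma cube_lift_integral:
 assumes f1: "ess_bounded N f1" and f2: "ess_bounded N f2"
 shows "(LINT z|lift. f1 (cube_face k (-1) z) * f2 (cube_face k 1 z)) = (LINT x|N. complex_cond_exp N I f1 x * complex_cond_exp N I f2 x)"
proof -
 let ?t = "\<lambda>p. tr k (snd p) (fst p)"
 let ?j = "\<lambda>p. join k (fst p) (?t p)"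
 obtain f1' B1 where f1': "bdd N f1' B1" "AE z in N. f1 z = f1' z" using ess_bounded_bdd[OF f1] .
 obtain f2' B2 where f2': "bdd N f2' B2" "AE z in N. f2 z = f2' z" using ess_bounded_bdd[OF f2] .
 have m: "f1 \<in> borel_measurable N" "f2 \<in> borel_measurable N" using f1 f2 by (simp_all add: ess_bounded_def)
 have face: "(\<lambda>z. cube_face k e z) \<in> measurable (cube_algebra haar (Suc k)) N" if "e \<in> {-1, 1}" for e
  unfolding measurable_cong_sets[OF refl sets_N] cube_algebra_def cube_face_def
  by (rule measurable_restrict) (rule measurable_component_singleton, rule cube_vertices_Cons[OF that])
 have fm: "(\<lambda>z. f1 (cube_face k (-1) z) * f2 (cube_face k 1 z)) \<in> borel_measurable (cube_algebra haar (Suc k))"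
  by (intro borel_measurable_times m_comp[OF face m(1)] m_comp[OF face m(2)]) simp_all
 have "(LINT z|lift. f1 (cube_face k (-1) z) * f2 (cube_face k 1 z))
  = (LINT p|(N \<Otimes>\<^sub>M haar). f1 (cube_face k (-1) (?j p)) * f2 (cube_face k 1 (?j p)))"
  unfolding lift_def by (rule integral_distr[OF pair_join_measurable fm])
 also have "... = (LINT p|(N \<Otimes>\<^sub>M haar). f1 (fst p) * f2 (?t p))"
 proof (rule LINT_cong[OF refl])
  fix p assume "p \<in> space (N \<Otimes>\<^sub>M haar)"
  hence "fst p \<in> space N" by (auto simp: space_pair_measure)
  thus "f1 (cube_face k (-1) (?j p)) * f2 (cube_face k 1 (?j p)) = f1 (fst p) * f2 (?t p)" by (simp add: cube_face_join[OF N_extensional tr_extensional])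
 qed
 also have "... = (LINT p|(N \<Otimes>\<^sub>M haar). f1' (fst p) * f2' (?t p))"
 proof (rule integral_cong_AE)
  show "(\<lambda>p. f1 (fst p) * f2 (?t p)) \<in> borel_measurable (N \<Otimes>\<^sub>M haar)"
   by (intro borel_measurable_times m_comp[OF measurable_fst m(1)] m_comp[OF tr_pair_measurable m(2)])
  show "(\<lambda>p. f1' (fst p) * f2' (?t p)) \<in> borel_measurable (N \<Otimes>\<^sub>M haar)"
   by (intro borel_measurable_times m_comp[OF measurable_fst bdd_measurable[OF f1'(1)]]
     m_comp[OF tr_pair_measurable bdd_measurable[OF f2'(1)]])
  have "AE z in distr (N \<Otimes>\<^sub>M haar) N fst. f1 z = f1' z" unfolding distr_fst_pair by (rule f1'(2))
  hence 1: "AE p in N \<Otimes>\<^sub>M haar. f1 (fst p) = f1' (fst p)" by (rule AE_distrD[OF measurable_fst])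
  have "AE z in distr (N \<Otimes>\<^sub>M haar) N ?t. f2 z = f2' z" unfolding distr_tr_pair by (rule f2'(2))
  hence 2: "AE p in N \<Otimes>\<^sub>M haar. f2 (?t p) = f2' (?t p)" by (rule AE_distrD[OF tr_pair_measurable])
  show "AE p in N \<Otimes>\<^sub>M haar. f1 (fst p) * f2 (?t p) = f1' (fst p) * f2' (?t p)" using 1 2 by eventually_elim simp
 qed
 also have "... = (LINT z|N. f1' z * P f2' z)" using pair_integral_bdd(1)[OF prob_space_axioms haar_prob
    bdd_mult[OF bdd_compose[OF f1'(1) measurable_fst] pair_bdd[OF f2'(1)]]] by (simp add: P_def)
 also have "... = (LINT z|N. P (\<lambda>z. f1' z * P f2' z) z)" by (rule integral_P[OF bdd_mult[OF f1'(1) P_bdd[OF f2'(1)]], symmetric])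
 also have "... = (LINT z|N. P f1' z * P f2' z)"
 proof (rule LINT_cong[OF refl])
  fix z assume z: "z \<in> space N"
  have "P (\<lambda>z. f1' z * P f2' z) z = (LINT h|haar. f1' (tr k h z) * P f2' z)" unfolding P_def[of "\<lambda>z. f1' z * P f2' z"]
   by (rule LINT_cong) (simp_all add: P_tr[OF f2'(1) _ z])
  thus "P (\<lambda>z. f1' z * P f2' z) z = P f1' z * P f2' z" by (simp add: P_def[of f1'])
 qed
 also have "... = (LINT z|N. complex_cond_exp N I f1 z * complex_cond_exp N I f2 z)"
 proof (rule integral_cong_AE)
  show "(\<lambda>z. P f1' z * P f2' z) \<in> borel_measurable N" by (rule bdd_measurable[OF bdd_mult[OF P_bdd[OF f1'(1)] P_bdd[OF f2'(1)]]])
  have c: "complex_cond_exp N I f \<in> borel_measurable N" for f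
  proof -
   have [measurable]: "real_cond_exp N I g \<in> borel_measurable N" for g by (rule borel_measurable_cond_exp2)
   have "complex_cond_exp N I f = (\<lambda>x. of_real (real_cond_exp N I (\<lambda>y. Re (f y)) x) + \<i> * of_real (real_cond_exp N I (\<lambda>y. Im (f y)) x))"
    by (simp add: complex_cond_exp_def complex_eq_iff fun_eq_iff)
   thus ?thesis by simp
  qed
  show "(\<lambda>z. complex_cond_exp N I f1 z * complex_cond_exp N I f2 z) \<in> borel_measurable N" by (intro borel_measurable_times c)
  show "AE z in N. P f1' z * P f2' z = complex_cond_exp N I f1 z * complex_cond_exp N I f2 z"
   using cond_exp_ess_bounded[OF m(1) f1'] cond_exp_ess_bounded[OF m(2) f2'] by eventually_elim simp
 qed
 finally show ?thesis .
qed

lemma is_cube_measure_lift: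
 assumes "is_cube_measure PG haar alpha k N"
 shows "is_cube_measure PG haar alpha (Suc k) lift"
proof -
 have "space lift = space (cube_algebra haar (Suc k))" by (rule sets_eq_imp_space_eq[OF sets_lift])
 thus ?thesis using assms sets_lift cube_lift_integral by auto
qed

text \<open>A diagonal translation by \<open>h\<close> commutes with the one by the random element,
  so it acts on the pair by translating its first member alone.\<close>

lemma cube_level_lift: "cube_level lift (Suc k)"
proof -
 interpret Q: prob_space "N \<Otimes>\<^sub>M haar" by (rule prob_pair_N)
 interpret L: prob_space lift unfolding lift_def by (rule Q.prob_space_distr[OF pair_join_measurable])
 show ?thesis
 proof unfold_locales
  show "sets lift = sets (cube_algebra haar (Suc k))" by (rule sets_lift)
  fix h assume h: "h \<in> solen"
  let ?C = "cube_algebra haar (Suc k)"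
  let ?j = "\<lambda>p. join k (fst p) (tr k (snd p) (fst p))"
  let ?s = "\<lambda>(z, h'). (tr k h z, h')"
  have tm: "tr (Suc k) h \<in> measurable ?C ?C" unfolding cube_algebra_def tr_def
   by (rule measurable_restrict) (rule measurable_solen_mult, use h in \<open>simp_all add: measurable_component_singleton\<close>)
  have "distr N N (tr k h) \<Otimes>\<^sub>M distr haar haar (\<lambda>x. x) = distr (N \<Otimes>\<^sub>M haar) (N \<Otimes>\<^sub>M haar) ?s"
  proof (rule pair_measure_distr[OF tr_measurable[OF h]])
   show "sigma_finite_measure (distr haar haar (\<lambda>x. x))" unfolding distr_id by (rule prob_space_imp_sigma_finite[OF haar_prob])
  qed simp
  hence s: "distr (N \<Otimes>\<^sub>M haar) (N \<Otimes>\<^sub>M haar) ?s = N \<Otimes>\<^sub>M haar" unfolding distr_id tr_distr[OF h] by (rule sym)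
  have sm: "?s \<in> measurable (N \<Otimes>\<^sub>M haar) (N \<Otimes>\<^sub>M haar)"
   unfolding split_beta' by (intro measurable_Pair m_comp[OF measurable_fst tr_measurable[OF h]] measurable_snd)
  have "distr lift lift (tr (Suc k) h) = distr lift ?C (tr (Suc k) h)" by (rule distr_cong) (simp_all add: sets_lift)
  also have "... = distr (N \<Otimes>\<^sub>M haar) ?C (tr (Suc k) h \<circ> ?j)" unfolding lift_def by (rule distr_distr[OF tm pair_join_measurable])
  also have "tr (Suc k) h \<circ> ?j = ?j \<circ> ?s"
   by (simp only: fun_eq_iff comp_def tr_join tr_tr split_beta fst_conv snd_conv mult.commute simp_thms)
  also have "distr (N \<Otimes>\<^sub>M haar) ?C (?j \<circ> ?s) = distr (distr (N \<Otimes>\<^sub>M haar) (N \<Otimes>\<^sub>M haar) ?s) ?C ?j"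
   by (rule distr_distr[OF pair_join_measurable sm, symmetric])
  also have "... = lift" unfolding s lift_def ..
  finally show "distr lift lift (tr (Suc k) h) = lift" .
 qed
qed

end

section \<open>The cube measure on squares and the type of the cocycle\<close>

definition cube0 :: "(int list => nat => complex) measure" where
 "cube0 = distr haar (cube_algebra haar 0) (\<lambda>x. \<lambda>w\<in>cube_vertices 0. x)"

interpretation C0: cube_level cube0 0
proof -
 let ?C = "cube_algebra haar 0"
 let ?d = "\<lambda>x. \<lambda>w\<in>cube_vertices 0. x"
 have dm: "?d \<in> measurable haar ?C" unfolding cube_algebra_def by (rule measurable_restrict) simp
 interpret L: prob_space cube0 unfolding cube0_def by (rule haar.prob_space_distr[OF dm])
 show "cube_level cube0 0"
 proof unfold_locales
  show sets: "sets cube0 = sets ?C" by (simp add: cube0_def)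
  fix h assume h: "h \<in> solen"
  have tm: "tr 0 h \<in> measurable ?C ?C" unfolding cube_algebra_def tr_def
   by (rule measurable_restrict) (rule measurable_solen_mult, use h in \<open>simp_all add: measurable_component_singleton\<close>)
  have "distr cube0 cube0 (tr 0 h) = distr cube0 ?C (tr 0 h)" by (rule distr_cong) (simp_all add: sets)
  also have "... = distr haar ?C (tr 0 h \<circ> ?d)" unfolding cube0_def by (rule distr_distr[OF tm dm])
  also have "tr 0 h \<circ> ?d = ?d \<circ> (\<lambda>u. h * u)" by (simp only: fun_eq_iff comp_def tr_def restrict_def simp_thms cong: if_cong) simp
  also have "distr haar ?C (?d \<circ> (\<lambda>u. h * u)) = distr (distr haar haar (\<lambda>u. h * u)) ?C ?d"
   by (rule distr_distr[OF dm translate_measurable[OF h], symmetric])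
  also have "... = cube0" unfolding distr_haar_translate[OF h] cube0_def ..
  finally show "distr cube0 cube0 (tr 0 h) = cube0" .
 qed
qed

text \<open>The numbering is shifted: \<open>C1\<close> is the level whose measure is
  \<open>C0.lift\<close>, so \<open>C1.lift\<close> is the measure on squares, and \<open>C2\<close>
  provides its coordinates.\<close>

interpretation C1: cube_level C0.lift "Suc 0" by (rule C0.cube_level_lift)
interpretation C2: cube_level C1.lift "Suc (Suc 0)" by (rule C1.cube_level_lift)

lemma is_cube_measure_2: "is_cube_measure PG haar alpha 2 C1.lift"
proof -
 have "is_cube_measure PG haar alpha 0 cube0" by (simp add: cube0_def)
 hence "is_cube_measure PG haar alpha (Suc (Suc 0)) C1.lift" by (rule C1.is_cube_measure_lift[OF C0.is_cube_measure_lift])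
 thus ?thesis by (simp only: numeral_2_eq_2)
qed

lemma cube_vertices_2: "cube_vertices 2 = {[-1, -1], [-1, 1], [1, -1], [1, 1]}"
proof (rule equalityI; rule subsetI)
 fix w assume "w \<in> cube_vertices 2"
 hence "length w = 2" and s: "set w \<subseteq> {-1, 1}" by (auto simp: cube_vertices_def)
 then obtain a b where "w = [a, b]" by (auto simp: length_Suc_conv numeral_2_eq_2)
 thus "w \<in> {[-1, -1], [-1, 1], [1, -1], [1, 1]}" using s by auto
qed (auto simp: cube_vertices_def)

lemma cube_derivative_2:
 "cube_derivative 2 \<rho> g x = \<rho> g (x [-1, -1]) * inverse (\<rho> g (x [-1, 1])) * inverse (\<rho> g (x [1, -1])) * \<rho> g (x [1, 1])"
 unfolding cube_derivative_def cube_vertices_2 by (simp add: power_int_minus mult.assoc)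

text \<open>By construction a random square consists of two points and their translates by a common
  element.\<close>

lemma cube_parallelogram:
 "AE x in C1.lift. x [-1, -1] * x [1, 1] = (x [-1, 1] * x [1, -1] :: nat => complex)" unfolding C1.lift_def
proof (subst AE_distr_iff[OF C1.pair_join_measurable])
 have V: "[a, b] \<in> cube_vertices (Suc (Suc 0))" if "a \<in> {-1, 1}" "b \<in> {-1, 1}" for a b :: int using that by (auto simp: cube_vertices_def)
 have c: "(\<lambda>x. x w i) \<in> borel_measurable (cube_algebra haar (Suc (Suc 0)))" if "w \<in> cube_vertices (Suc (Suc 0))" for w i
  unfolding cube_algebra_def by (rule m_comp[OF measurable_component_singleton[OF that] haar_coord])
 have "{x \<in> space (cube_algebra haar (Suc (Suc 0))). x [-1, -1] i * x [1, 1] i = x [-1, 1] i * x [1, -1] i} \<in> sets (cube_algebra haar (Suc (Suc 0)))" for i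
  by (rule measurable_equality_set) (intro borel_measurable_times c V insertI1 insertI2)+
 hence "{x \<in> space (cube_algebra haar (Suc (Suc 0))). \<forall>i. x [-1, -1] i * x [1, 1] i = x [-1, 1] i * x [1, -1] i} \<in> sets (cube_algebra haar (Suc (Suc 0)))"
  by (rule sets.sets_Collect_countable_All)
 thus "{x \<in> space (cube_algebra haar (Suc (Suc 0))). x [-1, -1] * x [1, 1] = x [-1, 1] * x [1, -1]} \<in> sets (cube_algebra haar (Suc (Suc 0)))"
  by (simp add: fun_eq_iff)
 have V1: "[a] \<in> cube_vertices (Suc 0)" if "a \<in> {-1, 1}" for a :: int using that by (auto simp: cube_vertices_def)
 show "AE p in C0.lift \<Otimes>\<^sub>M haar. join (Suc 0) (fst p) (tr (Suc 0) (snd p) (fst p)) [-1, -1] * join (Suc 0) (fst p) (tr (Suc 0) (snd p) (fst p)) [1, 1]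
  = join (Suc 0) (fst p) (tr (Suc 0) (snd p) (fst p)) [-1, 1] * join (Suc 0) (fst p) (tr (Suc 0) (snd p) (fst p)) [1, -1]"
  by (rule AE_I2) (simp add: join_def tr_def V V1 mult_ac del: times_fun_apply)
qed

text \<open>Almost every square is a parallelogram with sides \<open>v\<close> and \<open>b\<close>,
  and on those \<open>rho_quad\<close> exhibits the alternating product as a coboundary.\<close>

theorem type_rho: "type_less PG haar alpha rho 2" unfolding type_less_def
proof (intro conjI exI[of _ C1.lift])
 show "circle_family PG haar rho" unfolding circle_family_def by (intro ballI circle_valuedI rho_measurable) (simp_all add: rho_norm)
 show "is_cube_measure PG haar alpha 2 C1.lift" by (rule is_cube_measure_2)
 \<comment> \<open>\<open>psi\<close> with the sides expressed as quotients of corners. It is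
   inverted because in \<open>rho_quad\<close> the value at the moved point stands next to the
   corners in the numerator.\<close>
 define F where "F x = inverse (psi (uinv (x [-1, -1]) * x [-1, 1]) (uinv (x [-1, -1]) * x [1, -1]) (x [-1, -1]))" for x :: "int list => nat => complex"
 have V: "[a, b] \<in> cube_vertices (Suc (Suc 0))" if "a \<in> {-1, 1}" "b \<in> {-1, 1}" for a b :: int using that by (auto simp: cube_vertices_def)
 note V4 = V[of "-1" "-1"] V[of "-1" 1] V[of 1 "-1"] V[of 1 1]
 have sp: "x [a, b] \<in> solen" if "x \<in> space C1.lift" "a \<in> {-1, 1}" "b \<in> {-1, 1}" for x a b
  using measurable_space[OF C2.coord_measurable[OF V[OF that(2,3)]] that(1)] by simp
 have s3: "x [-1, -1] \<in> solen" "uinv (x [-1, -1]) * x [-1, 1] \<in> solen" "uinv (x [-1, -1]) * x [1, -1] \<in> solen"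
  if "x \<in> space C1.lift" for x using sp[OF that] by (simp_all add: solen_mult solen_uinv del: times_fun_apply)
 show "coboundary PG C1.lift (cube_action 2 alpha) (cube_derivative 2 rho)" unfolding coboundary_def
 proof (intro exI[of _ F] conjI ballI)
  have cm: "(\<lambda>x. x [a, b]) \<in> measurable C1.lift haar" if "a \<in> {-1, 1}" "b \<in> {-1, 1}" for a b
   by (rule C2.coord_measurable[OF V[OF that]])
  show "circle_valued C1.lift F"
  proof (rule circle_valuedI)
   show "F \<in> borel_measurable C1.lift" unfolding F_def[abs_def]
    by (intro borel_measurable_inverse psi_measurable measurable_solen_mult measurable_solen_uinv cm) simp_all
   show "cmod (F x) = 1" if "x \<in> space C1.lift" for x by (simp only: F_def norm_inverse psi_norm[OF s3(2,3,1)[OF that]] inverse_1)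
  qed
  fix g assume g: "g \<in> GG"
  show "AE x in C1.lift. cube_derivative 2 rho g x = mult_deriv (cube_action 2 alpha) g F x" using cube_parallelogram AE_space
  proof eventually_elim
   case (elim x)
   define u where "u = x [-1, -1]"
   define v where "v = uinv u * x [-1, 1]"
   define b where "b = uinv u * x [1, -1]"
   have us: "u \<in> solen" and vs: "v \<in> solen" and bs: "b \<in> solen" unfolding v_def b_def u_def by (rule s3[OF elim(2)])+
   have x2: "x [-1, 1] = v * u" unfolding v_def by (simp only: mult.commute[of _ u] solen_cancel[OF us])
   have x3: "x [1, -1] = b * u" unfolding b_def by (simp only: mult.commute[of _ u] solen_cancel[OF us])
   have "u * x [1, 1] = u * (v * (b * u))" using elim(1) unfolding x2 x3 u_def[symmetric] by (simp only: mult_ac)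
   hence "uinv u * (u * x [1, 1]) = uinv u * (u * (v * (b * u)))" by (simp only:)
   hence x4: "x [1, 1] = v * (b * u)" by (simp only: solen_cancel[OF us])
   have gu: "iota g * u \<in> solen" by (rule solen_mult[OF iota_solen[OF g] us])
   have act: "cube_action 2 alpha g x [a, c] = iota g * x [a, c]" if "a \<in> {-1, 1}" "c \<in> {-1, 1}" for a c
    using V[OF that] sp[OF elim(2) that] by (simp add: cube_action_def numeral_2_eq_2 alpha_eq del: times_fun_apply)
   have um: "uinv (iota g * u) * (iota g * (y * u)) = y" for y
   proof -
    have "uinv (iota g * u) * (iota g * (y * u)) = uinv (iota g * u) * ((iota g * u) * y)" by (simp only: mult_ac)
    also have "... = y" by (rule solen_cancel(1)[OF gu])
    finally show ?thesis .
   qed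
   have um1: "uinv u * (y * u) = y" for y using solen_cancel(1)[OF us, of y] by (simp only: mult.commute)
   have F1: "F x = inverse (psi v b u)" unfolding F_def x2 x3 u_def[symmetric] um1 ..
   have F2: "F (cube_action 2 alpha g x) = inverse (psi v b (iota g * u))"
   proof -
    have "cube_action 2 alpha g x [-1, -1] = iota g * u" "cube_action 2 alpha g x [-1, 1] = iota g * (v * u)"
     "cube_action 2 alpha g x [1, -1] = iota g * (b * u)"
     using act[of "-1" "-1"] act[of "-1" 1] act[of 1 "-1"] by (simp_all only: x2 x3 u_def[symmetric] insert_iff simp_thms)
    thus ?thesis unfolding F_def by (simp only: um)
   qed
   have nz: "psi v b u \<noteq> 0" "psi v b (iota g * u) \<noteq> 0" "rho g (v * u) \<noteq> 0" "rho g (b * u) \<noteq> 0"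
    using psi_norm[OF vs bs us] psi_norm[OF vs bs gu] rho_norm[OF g solen_mult[OF vs us]] rho_norm[OF g solen_mult[OF bs us]] by auto
   have "rho g u * rho g (v * (b * u)) * psi v b (iota g * u) = rho g (v * u) * rho g (b * u) * psi v b u" by (rule rho_quad[OF g vs bs us])
   hence "rho g u * inverse (rho g (v * u)) * inverse (rho g (b * u)) * rho g (v * (b * u)) = inverse (psi v b (iota g * u)) / inverse (psi v b u)"
    using nz by (simp add: field_simps)
   thus ?case unfolding cube_derivative_2 mult_deriv_def F1 F2 x2 x3 x4 u_def[symmetric] .
  qed
 qed
qed

section \<open>Phase polynomials of the skew product\<close>

lemma chars_pow_closed: "xi \<in> chars ==> (\<lambda>u. xi u ^ n) \<in> chars" by (induction n) (auto intro: chars.one chars_mult_closed)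

lemma PG_pow_apply:
 assumes g: "g \<in> GG" and p: "prime p"
 shows "(g [^]\<^bsub>PG\<^esub> n) p = (int n * g p) mod int p"
proof (induction n)
 case 0
 show ?case using p by (simp add: one_PG)
next
 case (Suc n)
 have "(g [^]\<^bsub>PG\<^esub> Suc n) p = ((int n * g p) mod int p + g p) mod int p" using p Suc by (simp add: mult_PG)
 also have "... = (int (Suc n) * g p) mod int p" by (simp add: mod_simps algebra_simps)
 finally show ?case .
qed

text \<open>The product of the primes in the support annihilates every residue.\<close>

lemma PG_torsion:
 assumes g: "g \<in> GG"
 shows "\<exists>n::nat. n > 0 \<and> g [^]\<^bsub>PG\<^esub> n = ID"
proof (intro exI conjI)
 let ?n = "\<Prod>p\<in>supp g. p"
 show "?n > 0" by (intro prod_pos) (auto dest: supp_prime prime_gt_0_nat)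
 show "g [^]\<^bsub>PG\<^esub> ?n = ID"
 proof (rule PG_eqI)
  fix p :: nat assume p: "prime p"
  have "int p dvd int ?n * g p"
  proof (cases "g p = 0")
   case False
   hence "p \<in> supp g" using p by (simp add: supp_def)
   hence "p dvd ?n" using finite_supp[OF g] by (intro dvd_prodI)
   thus ?thesis by (metis dvd_mult2 int_dvd_int_iff)
  qed simp
  thus "(g [^]\<^bsub>PG\<^esub> ?n) p = ID p" using p by (simp only: PG_pow_apply[OF g p]) (simp add: one_PG)
 qed (use g in simp_all)
qed

lemma TX_one:
 assumes x: "x \<in> space XM" shows "TX ID x = x"
proof -
 have u: "fst x \<in> solen" using x by (auto simp: space_XM)
 have "rho ID (fst x) = rho ID (fst x) * rho ID (fst x)" using rho_mult[OF PG.one_closed PG.one_closed u] by (simp add: iota_one)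
 moreover have "rho ID (fst x) \<noteq> 0" using rho_norm[OF PG.one_closed u] by auto
 ultimately have "rho ID (fst x) = 1" by simp
 thus ?thesis using TX_eq[OF x] by (simp add: iota_one)
qed

text \<open>Each further step contributes the same character of the base up to a constant, because a
  translation changes a character by a constant only.\<close>

lemma cocycle_iterate:
 fixes c :: complex
 assumes g: "g \<in> GG" and xi: "xi \<in> chars" and c: "cmod c = 1"
  and step: "AE x in XM. ph (TX g x) = ph x * (c * xi (fst x))"
 shows "\<exists>d. cmod d = 1 \<and> (AE x in XM. ph (TX (g [^]\<^bsub>PG\<^esub> n) x) = ph x * (d * xi (fst x) ^ n))"
proof (induction n)
 case 0
 have "AE x in XM. ph (TX (g [^]\<^bsub>PG\<^esub> (0::nat)) x) = ph x * (1 * xi (fst x) ^ 0)" by (rule AE_I2) (simp add: TX_one)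
 thus ?case by (intro exI[of _ 1]) simp
next
 case (Suc n)
 obtain d where d: "cmod d = 1" "AE x in XM. ph (TX (g [^]\<^bsub>PG\<^esub> n) x) = ph x * (d * xi (fst x) ^ n)" using Suc by (elim exE conjE)
 have "AE x in XM. ph (TX (g [^]\<^bsub>PG\<^esub> Suc n) x) = ph x * ((c * d * xi (iota g) ^ n) * xi (fst x) ^ Suc n)"
  using XA.AE_T[OF g d(2)] step AE_space
 proof eventually_elim
  case (elim x)
  have "TX (g [^]\<^bsub>PG\<^esub> Suc n) x = TX (g [^]\<^bsub>PG\<^esub> n) (TX g x)" using XA.T_mult[OF PG.nat_pow_closed[OF g] g elim(3)] by simp
  hence "ph (TX (g [^]\<^bsub>PG\<^esub> Suc n) x) = ph (TX g x) * (d * xi (iota g * fst x) ^ n)" using elim(1) by (simp add: TX_eq[OF elim(3)])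
  thus ?case unfolding elim(2) chars_mult[OF xi] by (simp add: power_mult_distrib mult_ac)
 qed
 moreover have "cmod (c * d * xi (iota g) ^ n) = 1" using c d(1) chars_norm[OF xi iota_solen[OF g]] by (simp add: norm_mult norm_power)
 ultimately show ?case by blast
qed

text \<open>Iterating up to the order \<open>n\<close> of \<open>g\<close> returns to the starting
  point, so \<open>xi ^ n\<close> is almost everywhere constant. A nontrivial character has integral
  0, so \<open>xi ^ n\<close> is trivial, and the dual has no torsion.\<close>

lemma derivative_constant:
 fixes c :: complex
 assumes g: "g \<in> GG" and xi: "xi \<in> chars" and c: "cmod c = 1"
  and ph: "circle_valued XM ph" and step: "AE x in XM. ph (TX g x) = ph x * (c * xi (fst x))"
  and u: "u \<in> solen"
 shows "xi u = 1"
proof -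
 obtain n :: nat where n: "n > 0" "g [^]\<^bsub>PG\<^esub> n = ID" using PG_torsion[OF g] by (elim exE conjE)
 obtain d where d: "cmod d = 1" "AE x in XM. ph (TX (g [^]\<^bsub>PG\<^esub> n) x) = ph x * (d * xi (fst x) ^ n)"
  using cocycle_iterate[OF g xi c step, of n] by (elim exE conjE)
 have x: "AE x in XM. d * xi (fst x) ^ n = 1" using d(2) AE_space
 proof eventually_elim
  case (elim x)
  have "ph x \<noteq> 0" using circle_valuedD(2)[OF ph elim(2)] by auto
  thus ?case using elim(1) TX_one[OF elim(2)] by (simp add: n(2))
 qed
 note pc = chars_pow_closed[OF xi, of n]
 have [measurable]: "(\<lambda>u. xi u ^ n) \<in> borel_measurable haar" by (rule chars_measurable[OF pc])
 have "{u \<in> space haar. d * xi u ^ n = 1} \<in> sets haar" by measurable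
 from AE_fst_iff[OF this] x have ae: "AE u in haar. d * xi u ^ n = 1" by blast
 have "xi v ^ n = 1" if v: "v \<in> solen" for v
 proof (rule ccontr)
  assume "xi v ^ n \<noteq> 1"
  hence "(LINT u|haar. xi u ^ n) = 0" by (rule chars_integral[OF pc v])
  hence 0: "(LINT u|haar. d * xi u ^ n) = 0" by simp
  have 1: "(LINT u|haar. d * xi u ^ n) = (LINT u|haar. 1)" by (rule integral_cong_AE) (use ae in auto)
  show False using 0 unfolding 1 by (simp add: haar.prob_space[simplified])
 qed
 thus ?thesis by (rule chars_torsion_free[OF xi n(1) _ u])
qed

lemma circle_valued_deriv:
 assumes "circle_valued XM ph" "g \<in> GG"
 shows "circle_valued XM (mult_deriv TX g ph)"
proof (rule circle_valuedI)
 note m = circle_valuedD[OF assms(1)]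
 show "mult_deriv TX g ph \<in> borel_measurable XM" unfolding mult_deriv_def
  by (rule borel_measurable_divide[OF m_comp[OF XA.T_measurable[OF assms(2)] m(1)] m(1)])
 show "cmod (mult_deriv TX g ph x) = 1" if "x \<in> space XM" for x
  by (simp add: mult_deriv_def norm_divide m(2)[OF that] m(2)[OF XA.T_space[OF assms(2) that]])
qed

text \<open>By induction a derivative of \<open>ph\<close> is a constant times a character, which
  \<open>derivative_constant\<close> shows to be trivial. So \<open>ph\<close> is an eigenfunction,
  and its quotient by the matching character is invariant, hence constant.\<close>

theorem phase_polynomial_character:
 assumes "phase_polynomial PG XM TX k ph"
 shows "\<exists>c. \<exists>xi\<in>chars. cmod c = 1 \<and> (AE x in XM. ph x = c * xi (fst x))" using assms
proof (induction k arbitrary: ph)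
 case 0
 hence "AE x in XM. ph x = 1" by (auto simp: phase_polynomial_def)
 thus ?case by (intro exI[of _ 1] bexI[OF _ chars.one]) simp
next
 case (Suc k)
 have cv: "circle_valued XM ph" using Suc.prems by (simp add: phase_polynomial_def)
 note m = circle_valuedD[OF cv]
 have "\<exists>c. cmod c = 1 \<and> (AE x in XM. ph (TX g x) = c * ph x)" if g: "g \<in> GG" for g
 proof -
  have pp: "phase_polynomial PG XM TX k (mult_deriv TX g ph)" unfolding phase_polynomial_def
  proof (intro conjI allI impI circle_valued_deriv[OF cv g])
   fix hs assume hs: "length hs = k \<and> set hs \<subseteq> GG"
   \<comment> \<open>\<open>foldr\<close> applies the last entry of the list first, so the innermost
     derivative is appended at the end.\<close>
   have "AE x in XM. foldr (mult_deriv TX) (hs @ [g]) ph x = 1"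
    using Suc.prems hs g unfolding phase_polynomial_def by (elim conjE allE[of _ "hs @ [g]"]) simp
   thus "AE x in XM. foldr (mult_deriv TX) hs (mult_deriv TX g ph) x = 1" by simp
  qed
  obtain c xi where c: "xi \<in> chars" "cmod c = 1" "AE x in XM. mult_deriv TX g ph x = c * xi (fst x)" using Suc.IH[OF pp] by (elim exE bexE conjE)
  have step: "AE x in XM. ph (TX g x) = ph x * (c * xi (fst x))" using c(3) AE_space
  proof eventually_elim
   case (elim x)
   have "ph x \<noteq> 0" using m(2)[OF elim(2)] by auto
   thus ?case using elim(1) by (simp add: mult_deriv_def field_simps)
  qed
  have "AE x in XM. ph (TX g x) = c * ph x" using step AE_space
  proof eventually_elim
   case (elim x)
   have "fst x \<in> solen" using elim(2) by (auto simp: space_XM)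
   thus ?case using elim(1) derivative_constant[OF g c(1,2) cv step] by simp
  qed
  thus ?thesis using c(2) by blast
 qed
 hence "\<forall>g\<in>GG. \<exists>c. cmod c = 1 \<and> (AE x in XM. ph (TX g x) = c * ph x)" by blast
 from bchoice[OF this] obtain c where c: "\<forall>g\<in>GG. cmod (c g) = 1 \<and> (AE x in XM. ph (TX g x) = c g * ph x)" by (elim exE)
 have pb: "bdd XM ph 1" using m by (simp add: bdd_def)
 have ps: "sqi XM ph" by (rule XM.bdd_square[OF pb])
 have nz: "\<not> (AE x in XM. ph x = 0)"
 proof
  assume "AE x in XM. ph x = 0"
  hence "AE x in XM. False" using AE_space by eventually_elim (use m(2) in force)
  thus False by simp
 qed
 have ev: "AE x in XM. ph (TX g x) = c g * ph x" if "g \<in> GG" for g using c that by blast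
 have "\<exists>xi\<in>chars. (\<forall>g\<in>GG. c g = xi (iota g)) \<and> (LINT x|XM. ph x * cnj (xi (fst x))) \<noteq> 0"
  by (rule eigenfunction[OF ps nz ev])
 then obtain xi where xi: "xi \<in> chars" and cx: "\<forall>g\<in>GG. c g = xi (iota g)" by (elim bexE conjE)
 define F where "F x = ph x * cnj (xi (fst x))" for x
 have xb: "bdd XM (\<lambda>x. xi (fst x)) 1" by (rule bdd_compose[OF _ XM_fst]) (simp add: bdd_def chars_measurable[OF xi] chars_norm[OF xi])
 have "bdd XM F (1 * 1)" unfolding F_def[abs_def] by (rule bdd_mult[OF pb bdd_cnj[OF xb]])
 hence Fs: "sqi XM F" by (rule XM.bdd_square)
 have "AE x in XM. F (TX g x) = F x" if g: "g \<in> GG" for g using ev[OF g] AE_space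
 proof eventually_elim
  case (elim x)
  have "xi (iota g) * cnj (xi (iota g)) = 1" using cnj_mult_unit[OF chars_norm[OF xi iota_solen[OF g]]] by (simp add: mult.commute)
  moreover have "fst (TX g x) = iota g * fst x" by (simp only: TX_eq[OF elim(2)] fst_conv)
  hence "F (TX g x) = (xi (iota g) * cnj (xi (iota g))) * F x"
   using bspec[OF cx g] unfolding F_def elim(1) by (simp only: chars_mult[OF xi] complex_cnj_mult mult_ac)
  ultimately show ?case by (simp only: mult_1)
 qed
 then obtain a where a: "AE x in XM. F x = a" using ergodic_X Fs unfolding g_ergodic_def by blast
 have e: "AE x in XM. ph x = a * xi (fst x) \<and> cmod a = 1" using a AE_space
 proof eventually_elim
  case (elim x)
  have "fst x \<in> solen" using elim(2) by (auto simp: space_XM)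
  hence n: "cmod (xi (fst x)) = 1" by (rule chars_norm[OF xi])
  have "a * xi (fst x) = ph x * (cnj (xi (fst x)) * xi (fst x))" using elim(1) by (simp add: F_def)
  hence 1: "ph x = a * xi (fst x)" by (simp only: cnj_mult_unit[OF n] mult_1_right)
  hence "cmod a = 1" using m(2)[OF elim(2)] n by (simp add: norm_mult)
  with 1 show ?case ..
 qed
 have "cmod a = 1"
 proof (rule ccontr)
  assume "cmod a \<noteq> 1"
  from e have "AE x in XM. False" by eventually_elim (simp add: \<open>cmod a \<noteq> 1\<close>)
  thus False by simp
 qed
 moreover have "AE x in XM. ph x = a * xi (fst x)" using e by eventually_elim simp
 ultimately show ?case using xi by blast
qed

section \<open>The fibre coordinate is orthogonal to the base\<close>

lemma snd_bdd: "bdd XM snd 1" by (auto simp: bdd_def space_XM)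

lemma snd_orthogonal:
 assumes r: "bdd haar r B"
 shows "(LINT x|XM. r (fst x) * snd x) = 0"
proof -
 have "(LINT x|XM. r (fst x) * snd x) = (LINT u|haar. r u * (LINT z|CM. z))" using fibre_integral[OF haar_prob r, of snd] snd_bdd unfolding XM_def by simp
 thus ?thesis using circle_integral_powi[of 1] by simp
qed

text \<open>\<open>snd\<close> has norm 1 and is orthogonal to every phase polynomial, so it stays
  at distance at least 1 from their span.\<close>

theorem not_abramov: "\<not> abramov_less PG XM TX k"
proof
 assume "abramov_less PG XM TX k"
 moreover have ss: "sqi XM snd" by (rule XM.bdd_square[OF snd_bdd])
 ultimately have "\<exists>S c. finite S \<and> (\<forall>ph\<in>S. phase_polynomial PG XM TX k ph) \<and> l2_norm XM (\<lambda>x. snd x - (\<Sum>ph\<in>S. c ph * ph x)) < 1"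
  unfolding abramov_less_def using zero_less_one by blast
 then obtain S c where S: "finite S" "\<forall>ph\<in>S. phase_polynomial PG XM TX k ph"
  and lt: "l2_norm XM (\<lambda>x. snd x - (\<Sum>ph\<in>S. c ph * ph x)) < 1" by (elim exE conjE)
 define D where "D x = snd x - (\<Sum>ph\<in>S. c ph * ph x)" for x
 have pb: "bdd XM ph 1" if "ph \<in> S" for ph using S(2) that circle_valuedD[of XM ph] by (simp add: phase_polynomial_def bdd_def)
 have sq: "sqi XM (\<lambda>x. c ph * ph x)" if "ph \<in> S" for ph by (rule sqi_cmult[OF XM.bdd_square[OF pb[OF that]]])
 have Ps: "sqi XM (\<lambda>x. \<Sum>ph\<in>S. c ph * ph x)" by (rule sqi_sum) (use sq in blast)
 have Ds: "sqi XM D" unfolding D_def by (rule sqi_diff[OF ss Ps])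
 have orth: "(LINT x|XM. snd x * cnj (c ph * ph x)) = 0" if p: "ph \<in> S" for ph
 proof -
  obtain a xi where a: "xi \<in> chars" "AE x in XM. ph x = a * xi (fst x)"
   using phase_polynomial_character[OF bspec[OF S(2) p]] by (elim exE bexE conjE)
  have xb: "bdd haar xi 1" by (simp add: bdd_def chars_measurable[OF a(1)] chars_norm[OF a(1)])
  have "bdd haar (\<lambda>u. cnj (c ph * a)) (cmod (c ph * a))" by (simp add: bdd_def norm_mult)
  from bdd_mult[OF this bdd_cnj[OF xb]] have rb: "bdd haar (\<lambda>u. cnj (c ph * a) * cnj (xi u)) (cmod (c ph * a) * 1)" .
  have m: "ph \<in> borel_measurable XM" "(\<lambda>x. cnj (c ph * a) * cnj (xi (fst x))) \<in> borel_measurable XM"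
   using bdd_measurable[OF pb[OF p]] m_comp[OF XM_fst bdd_measurable[OF rb]] .
  have "(LINT x|XM. snd x * cnj (c ph * ph x)) = (LINT x|XM. (cnj (c ph * a) * cnj (xi (fst x))) * snd x)"
  proof (rule integral_cong_AE)
   show "(\<lambda>x. snd x * cnj (c ph * ph x)) \<in> borel_measurable XM"
    using borel_measurable_times[OF XM_snd m_comp[OF square_integrableD(1)[OF sq[OF p]] measurable_cnj]] .
   show "(\<lambda>x. (cnj (c ph * a) * cnj (xi (fst x))) * snd x) \<in> borel_measurable XM" by (rule borel_measurable_times[OF m(2) XM_snd])
   show "AE x in XM. snd x * cnj (c ph * ph x) = (cnj (c ph * a) * cnj (xi (fst x))) * snd x" using a(2) by eventually_elim (simp add: mult_ac)
  qed
  also have "... = 0" by (rule snd_orthogonal[OF rb])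
  finally show ?thesis .
 qed
 have one: "snd x * cnj (snd x) = (1::complex)" if "x \<in> space XM" for x using that cnj_mult_unit[of "snd x"] by (auto simp: space_XM mult.commute)
 have "(LINT x|XM. snd x * cnj (\<Sum>ph\<in>S. c ph * ph x)) = (LINT x|XM. (\<Sum>ph\<in>S. snd x * cnj (c ph * ph x)))"
  by (simp only: cnj_sum sum_distrib_left)
 also have "... = (\<Sum>ph\<in>S. LINT x|XM. snd x * cnj (c ph * ph x))"
  by (rule Bochner_Integration.integral_sum) (rule integrable_mult_square[OF ss sqi_cnj[OF sq]])
 also have "... = 0" using orth by (intro sum.neutral) blast
 finally have z: "(LINT x|XM. snd x * cnj (\<Sum>ph\<in>S. c ph * ph x)) = 0" .
 have i: "integrable XM (\<lambda>x. snd x * cnj (snd x))" "integrable XM (\<lambda>x. snd x * cnj (\<Sum>ph\<in>S. c ph * ph x))"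
  by (rule integrable_mult_square[OF ss sqi_cnj[OF ss]], rule integrable_mult_square[OF ss sqi_cnj[OF Ps]])
 have "(LINT x|XM. snd x * cnj (D x)) = (LINT x|XM. snd x * cnj (snd x) - snd x * cnj (\<Sum>ph\<in>S. c ph * ph x))"
  unfolding D_def by (simp only: complex_cnj_diff right_diff_distrib)
 also have "... = (LINT x|XM. snd x * cnj (snd x)) - (LINT x|XM. snd x * cnj (\<Sum>ph\<in>S. c ph * ph x))"
  by (rule Bochner_Integration.integral_diff[OF i])
 also have "... = (LINT x|XM. snd x * cnj (snd x))" by (simp only: z diff_zero)
 also have "... = (LINT x|XM. 1)" by (rule LINT_cong) (simp_all only: one)
 also have "... = 1" by (simp add: XM.prob_space)
 finally have "1 = cmod (LINT x|XM. snd x * cnj (D x))" by simp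
 also have "... \<le> l2_norm XM snd * l2_norm XM D" by (rule Cauchy_Schwarz_l2[OF ss Ds])
 also have "l2_norm XM snd = 1"
 proof -
  have "(LINT x|XM. (cmod (snd x))\<^sup>2) = (LINT x|XM. 1)" by (rule LINT_cong) (auto simp: space_XM)
  thus ?thesis by (simp add: l2_norm_def XM.prob_space)
 qed
 finally show False using lt unfolding D_def by simp
qed

lemma foldr_deriv_cong_AE:
 assumes "AE x in XM. ph x = pz x" "set hs \<subseteq> GG"
 shows "AE x in XM. foldr (mult_deriv TX) hs ph x = foldr (mult_deriv TX) hs pz x" using assms(2)
proof (induction hs)
 case Nil
 show ?case using assms(1) by simp
next
 case (Cons h hs)
 have ih: "AE x in XM. foldr (mult_deriv TX) hs ph x = foldr (mult_deriv TX) hs pz x" using Cons by simp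
 have h: "h \<in> GG" using Cons.prems by simp
 show ?case using XA.AE_T[OF h ih] ih by eventually_elim (simp only: foldr.simps comp_apply mult_deriv_def[of TX h])
qed

lemma foldr_deriv_fst:
 assumes "set hs \<subseteq> GG" "x \<in> space XM"
 shows "foldr (mult_deriv TX) hs (\<lambda>x. r (fst x)) x = foldr (mult_deriv alpha) hs r (fst x)" using assms
proof (induction hs arbitrary: x)
 case Nil
 show ?case by simp
next
 case (Cons h hs)
 have h: "h \<in> GG" "set hs \<subseteq> GG" using Cons.prems by simp_all
 show ?case using Cons.IH[OF h(2) XA.T_space[OF h(1) Cons.prems(2)]] Cons.IH[OF h(2) Cons.prems(2)] by (simp add: mult_deriv_def fst_TX[OF Cons.prems(2)])
qed

text \<open>Divided by the transfer function \<open>F\<close>, the fibre coordinate has derivatives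
  \<open>q g\<close>, so it would be a phase polynomial of degree one higher and thus a multiple of
  a character of the base, against orthogonality.\<close>

theorem not_cohomologous:
 assumes q: "phase_polynomial_family PG haar alpha k q" and co: "cohomologous PG haar alpha rho q"
 shows False
proof -
 obtain F where F: "circle_valued haar F" "\<forall>g\<in>GG. AE u in haar. rho g u / q g u = mult_deriv alpha g F u"
  using co unfolding cohomologous_def coboundary_def by (elim exE conjE)
 note Fm = circle_valuedD[OF F(1)]
 define Ph where "Ph x = snd x / F (fst x)" for x
 have cv: "circle_valued XM Ph"
 proof (rule circle_valuedI)
  show "Ph \<in> borel_measurable XM" unfolding Ph_def[abs_def] by (rule borel_measurable_divide[OF XM_snd m_comp[OF XM_fst Fm(1)]])
  show "cmod (Ph x) = 1" if x: "x \<in> space XM" for x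
  proof -
   have "fst x \<in> solen" "cmod (snd x) = 1" using x by (auto simp: space_XM)
   thus ?thesis using Fm(2)[of "fst x"] by (simp add: Ph_def norm_divide)
  qed
 qed
 have der: "AE x in XM. mult_deriv TX g Ph x = q g (fst x)" if g: "g \<in> GG" for g
 proof -
  have qv: "circle_valued haar (q g)" using q g by (simp add: phase_polynomial_family_def phase_polynomial_def)
  from AE_fst[OF bspec[OF F(2) g]] AE_space show ?thesis
  proof eventually_elim
   case (elim x)
   have u: "fst x \<in> solen" "snd x \<noteq> 0" using elim(2) by (auto simp: space_XM)
   have gu: "iota g * fst x \<in> solen" by (rule solen_mult[OF iota_solen[OF g] u(1)])
   have nz: "F (fst x) \<noteq> 0" "F (iota g * fst x) \<noteq> 0" "q g (fst x) \<noteq> 0" "rho g (fst x) \<noteq> 0"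
    using Fm(2)[of "fst x"] Fm(2)[of "iota g * fst x"] circle_valuedD(2)[OF qv, of "fst x"] rho_norm[OF g u(1)] u(1) gu by auto
   have "rho g (fst x) / q g (fst x) = F (iota g * fst x) / F (fst x)" using elim(1) by (simp only: mult_deriv_def alpha_eq[OF u(1)])
   hence e: "rho g (fst x) * F (fst x) = F (iota g * fst x) * q g (fst x)" using nz by (simp add: frac_eq_eq)
   have "mult_deriv TX g Ph x = (rho g (fst x) * snd x / F (iota g * fst x)) / (snd x / F (fst x))"
    unfolding mult_deriv_def Ph_def TX_eq[OF elim(2)] fst_conv snd_conv ..
   also have "... = rho g (fst x) * F (fst x) / F (iota g * fst x)" using nz u(2) by simp
   also have "... = q g (fst x)" unfolding e using nz by simp
   finally show ?case .
  qed
 qed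
 have "phase_polynomial PG XM TX (Suc k) Ph" unfolding phase_polynomial_def
 proof (intro conjI allI impI cv)
  fix hs assume hs: "length hs = Suc k \<and> set hs \<subseteq> GG"
  hence "hs \<noteq> []" by auto
  then obtain hs' g where hs': "hs = hs' @ [g]" by (metis rev_exhaust)
  hence l: "length hs' = k" "set hs' \<subseteq> GG" and g: "g \<in> GG" using hs by auto
  have "AE u in haar. foldr (mult_deriv alpha) hs' (q g) u = 1" using q g l unfolding phase_polynomial_family_def phase_polynomial_def by blast
  from AE_fst[OF this] foldr_deriv_cong_AE[OF der[OF g] l(2)] AE_space
  show "AE x in XM. foldr (mult_deriv TX) hs Ph x = 1"
  proof eventually_elim
   case (elim x)
   have "foldr (mult_deriv TX) hs Ph x = foldr (mult_deriv TX) hs' (mult_deriv TX g Ph) x" by (simp add: hs')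
   also have "... = 1" using elim(1,2) foldr_deriv_fst[OF l(2) elim(3), of "q g"] by (simp only:)
   finally show ?case .
  qed
 qed
 from phase_polynomial_character[OF this]
 obtain c xi where xi: "xi \<in> chars" and c: "cmod c = 1" "AE x in XM. Ph x = c * xi (fst x)" by (elim exE bexE conjE)
 define r where "r u = cnj (xi u) / F u" for u
 have rb: "bdd haar r 1" unfolding bdd_def
 proof
  show "r \<in> borel_measurable haar" unfolding r_def[abs_def]
   by (rule borel_measurable_divide[OF m_comp[OF chars_measurable[OF xi] measurable_cnj] Fm(1)])
  show "\<forall>u\<in>space haar. cmod (r u) \<le> 1" using Fm(2) chars_norm[OF xi] by (simp add: r_def norm_divide)
 qed
 have "AE x in XM. r (fst x) * snd x = c" using c(2) AE_space
 proof eventually_elim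
  case (elim x)
  have "fst x \<in> solen" using elim(2) by (auto simp: space_XM)
  hence n: "cnj (xi (fst x)) * xi (fst x) = 1" by (intro cnj_mult_unit chars_norm[OF xi])
  have "r (fst x) * snd x = cnj (xi (fst x)) * Ph x" by (simp add: r_def Ph_def)
  also have "... = c * (cnj (xi (fst x)) * xi (fst x))" unfolding elim(1) by (simp only: mult_ac)
  finally show ?case by (simp only: n mult_1_right)
 qed
 hence "(LINT x|XM. r (fst x) * snd x) = (LINT x|XM. c)" using borel_measurable_times[OF m_comp[OF XM_fst bdd_measurable[OF rb]] XM_snd]
  by (intro integral_cong_AE) auto
 hence "c = 0" using snd_orthogonal[OF rb] by (simp add: XM.prob_space)
 thus False using c(1) by simp
qed

section \<open>The two systems\<close>

text \<open>Finite unions from a countable basis form the countable family: a measurable set is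
  enclosed in an open set by outer regularity, and that set is exhausted from inside by such
  unions.\<close>

lemma separable_mod_null_restrict:
 fixes S :: "'a :: {second_countable_topology, complete_space} set"
 assumes S: "S \<in> sets borel" and sets: "sets M = sets (restrict_space borel S)" and M: "prob_space M"
 shows "separable_mod_null M"
proof -
 interpret prob_space M by (rule M)
 obtain BB :: "'a set set" where B: "countable BB" "topological_basis BB" using ex_countable_basis by blast
 have sM: "A \<in> sets M \<longleftrightarrow> A \<in> sets borel \<and> A \<subseteq> S" for A
  unfolding sets by (subst sets_restrict_space_iff) (use S in auto)
 have spM: "space M = S" using sets_eq_imp_space_eq[OF sets] by (simp add: space_restrict_space)
 define N where "N = distr M borel (\<lambda>x. x)"
 have idm: "(\<lambda>x. x) \<in> measurable M borel" unfolding measurable_cong_sets[OF sets refl] by (rule measurable_restrict_space1) simp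
 interpret N: prob_space N unfolding N_def by (rule prob_space_distr[OF idm])
 have NM: "measure N A = measure M (A \<inter> S)" if "A \<in> sets borel" for A unfolding N_def measure_distr[OF idm that] by (simp add: spM)
 define CC where "CC = (\<lambda>FF. \<Union>FF \<inter> S) ` {FF. finite FF \<and> FF \<subseteq> BB}"
 have op: "open (\<Union>FF)" if "FF \<subseteq> BB" for FF using that topological_basis_open[OF B(2)] by blast
 have "countable CC" unfolding CC_def by (intro countable_image countable_Collect_finite_subset B(1))
 moreover have "CC \<subseteq> sets M" unfolding CC_def using op S by (auto simp: sM)
 moreover have "\<exists>C\<in>CC. measure M (sym_diff A C) < e" if A: "A \<in> sets M" and e: "e > 0" for A and e :: real
 proof -
  have Ab: "A \<in> sets borel" "A \<subseteq> S" using A by (auto simp: sM)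
  have "emeasure N A = (INF U\<in>{U. A \<subseteq> U \<and> open U}. emeasure N U)"
   by (rule outer_regular) (use Ab N.emeasure_finite in "auto simp: N_def")
  moreover have "emeasure N A < emeasure N A + ennreal (e / 2)"
   using e by (simp add: N.emeasure_eq_measure ennreal_plus[symmetric] ennreal_less_iff del: ennreal_plus)
  ultimately have "(INF U\<in>{U. A \<subseteq> U \<and> open U}. emeasure N U) < emeasure N A + ennreal (e / 2)" by simp
  then obtain U where U: "A \<subseteq> U" "open U" "emeasure N U < emeasure N A + ennreal (e / 2)" unfolding INF_less_iff by blast
  have Ub: "U \<in> sets borel" using U(2) by simp
  have "ennreal (measure N U) < ennreal (measure N A + e / 2)" using U(3) e by (simp add: N.emeasure_eq_measure)
  hence mU: "measure N U < measure N A + e / 2" by (simp add: ennreal_less_iff)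
  obtain BB' where B': "BB' \<subseteq> BB" "\<Union>BB' = U" using B(2) U(2) unfolding topological_basis_def by blast
  have cB': "countable BB'" using B(1) B'(1) by (rule countable_subset[rotated])
  \<comment> \<open>The empty set is added so that the family can be enumerated even if it is empty;
    it is removed again in \<open>FF\<close>, whose members must be basis sets.\<close>
  define V where "V n = \<Union>(from_nat_into (insert {} BB') ` {..n})" for n :: nat
  have ci: "countable (insert {} BB')" "insert {} BB' \<noteq> {}" using cB' by auto
  have opn: "open (from_nat_into (insert {} BB') i)" for i using from_nat_into[OF ci(2), of i] B'(1) topological_basis_open[OF B(2)] by auto
  have Vb: "V n \<in> sets borel" for n unfolding V_def using opn by (intro borel_open open_Union) blast
  have inc: "incseq V" unfolding V_def incseq_def by (intro allI impI Union_mono image_mono) simp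
  have "(\<Union>n. V n) = \<Union>(range (from_nat_into (insert {} BB')))" by (auto simp: V_def)
  also have "... = U" unfolding range_from_nat_into[OF ci(2,1)] using B'(2) by simp
  finally have UV: "(\<Union>n. V n) = U" .
  have "(\<lambda>n. measure N (V n)) ----> measure N (\<Union>n. V n)" by (rule N.finite_Lim_measure_incseq[OF _ inc]) (use Vb in "auto simp: N_def")
  hence "\<forall>\<^sub>F n in sequentially. measure N U - e / 2 < measure N (V n)" unfolding UV by (rule order_tendstoD) (use e in simp)
  then obtain n where n: "measure N U - e / 2 < measure N (V n)" unfolding eventually_sequentially by blast
  have VU: "V n \<subseteq> U" using UV by blast
  define FF where "FF = from_nat_into (insert {} BB') ` {..n} - {{}}"
  have F: "FF \<subseteq> BB" "finite FF" "\<Union>FF = V n"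
  proof -
   have "from_nat_into (insert {} BB') i \<in> insert {} BB'" for i by (rule from_nat_into[OF ci(2)])
   thus "FF \<subseteq> BB" using B'(1) unfolding FF_def by blast
   show "finite FF" by (simp add: FF_def)
   show "\<Union>FF = V n" unfolding FF_def V_def by blast
  qed
  let ?C = "V n \<inter> S"
  have C: "?C \<in> CC" unfolding CC_def using F by (intro image_eqI[of _ _ FF]) auto
  have m: "U \<inter> S \<in> sets M" "?C \<in> sets M" using Ub Vb S by (auto simp: sM)
  have "measure M (sym_diff A ?C) \<le> measure M ((U \<inter> S - A) \<union> (U \<inter> S - ?C))"
   by (rule finite_measure_mono) (use U(1) VU Ab m A in auto)
  also have "... \<le> measure M (U \<inter> S - A) + measure M (U \<inter> S - ?C)" by (rule measure_Un_le) (use m A in auto)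
  also have "measure M (U \<inter> S - A) = measure M (U \<inter> S) - measure M A" by (rule finite_measure_Diff[OF m(1) A]) (use U(1) Ab in blast)
  also have "measure M (U \<inter> S - ?C) = measure M (U \<inter> S) - measure M ?C" by (rule finite_measure_Diff[OF m]) (use VU in blast)
  also have "measure M (U \<inter> S) - measure M A + (measure M (U \<inter> S) - measure M ?C) < e"
  proof -
   have "A \<inter> S = A" using Ab(2) by blast
   thus ?thesis using mU n NM[OF Ub] NM[OF Ab(1)] NM[OF Vb] by simp
  qed
  finally show ?thesis using C by blast
 qed
 ultimately show ?thesis unfolding separable_mod_null_def by blast
qed

lemma group_actionI:
 assumes G: "group G" and ext: "\<And>g. g \<in> carrier G ==> ph g \<in> extensional E"
  and E: "\<And>g x. g \<in> carrier G ==> x \<in> E ==> ph g x \<in> E"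
  and mult: "\<And>g h x. g \<in> carrier G ==> h \<in> carrier G ==> x \<in> E ==> ph (g \<otimes>\<^bsub>G\<^esub> h) x = ph g (ph h x)"
  and one: "\<And>x. x \<in> E ==> ph \<one>\<^bsub>G\<^esub> x = x"
 shows "group_action G E ph"
proof -
 interpret group G by (rule G)
 have bij: "bij_betw (ph g) E E" if g: "g \<in> carrier G" for g
 proof (rule bij_betw_byWitness[where f'="ph (inv\<^bsub>G\<^esub> g)"])
  show "\<forall>x\<in>E. ph (inv\<^bsub>G\<^esub> g) (ph g x) = x" using mult[OF inv_closed[OF g] g] one g by simp
  show "\<forall>x\<in>E. ph g (ph (inv\<^bsub>G\<^esub> g) x) = x" using mult[OF g inv_closed[OF g]] one g by simp
 qed (use E g inv_closed in blast)+
 have Bij: "ph g \<in> Bij E" if "g \<in> carrier G" for g using bij[OF that] ext[OF that] by (simp add: Bij_def)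
 have "ph \<in> hom G (BijGroup E)"
 proof (rule homI)
  show "ph g \<in> carrier (BijGroup E)" if "g \<in> carrier G" for g using Bij[OF that] by (simp add: BijGroup_def)
  fix g h assume gh: "g \<in> carrier G" "h \<in> carrier G"
  have "ph (g \<otimes>\<^bsub>G\<^esub> h) = compose E (ph g) (ph h)"
  proof (rule extensionalityI)
   show "ph (g \<otimes>\<^bsub>G\<^esub> h) \<in> extensional E" using ext gh by simp
   show "compose E (ph g) (ph h) \<in> extensional E" by (rule compose_extensional)
   show "ph (g \<otimes>\<^bsub>G\<^esub> h) x = compose E (ph g) (ph h) x" if "x \<in> E" for x using mult[OF gh that] that by (simp add: compose_def)
  qed
  thus "ph (g \<otimes>\<^bsub>G\<^esub> h) = ph g \<otimes>\<^bsub>BijGroup E\<^esub> ph h" using Bij gh by (simp add: BijGroup_def)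
 qed
 thus ?thesis using G group_BijGroup by (simp add: group_action_def group_hom_def group_hom_axioms_def)
qed

lemma g_system_U: "g_system PG solen_top haar alpha" unfolding g_system_def
proof (intro conjI ballI)
 show "compact_space solen_top" "Hausdorff_space solen_top" by (rule compact_space_solen Hausdorff_solen)+
 show "space haar = topspace solen_top" "sets haar = sets (borel_of solen_top)" "prob_space haar"
  using haar_probability_solen by (auto simp: haar_probability_def)
 show "separable_mod_null haar" by (rule separable_mod_null_restrict[OF borel_closed[OF closed_solen] sets_haar haar_prob])
 show "group_action PG (space haar) alpha"
 proof (rule group_actionI[OF PG.group_axioms])
  show "alpha g \<in> extensional (space haar)" for g by (simp add: alpha_def)
  show "alpha g x \<in> space haar" if "g \<in> GG" "x \<in> space haar" for g x by (rule UA.T_space[OF that])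
  show "alpha (g \<cdot> h) x = alpha g (alpha h x)" if "g \<in> GG" "h \<in> GG" "x \<in> space haar" for g h x by (rule UA.T_mult[OF that])
  show "alpha ID x = x" if "x \<in> space haar" for x using that by (simp add: alpha_eq iota_one)
 qed
 show "alpha g \<in> measurable haar haar" "distr haar haar (alpha g) = haar" if "g \<in> GG" for g
  by (rule UA.T_measurable[OF that], rule UA.T_distr[OF that])
qed

lemma extension_topology_solen: "extension_topology solen_top = top_of_set XS"
 unfolding extension_topology_def solen_top_def circle_topology_def by (rule prod_topology_subtopology_eu)

lemma g_system_X: "g_system PG (extension_topology solen_top) XM TX" unfolding g_system_def
proof (intro conjI ballI)
 note top = extension_topology_solen
 have cl: "closed XS" by (rule compact_imp_closed[OF compact_XS])
 show "compact_space (extension_topology solen_top)" unfolding top using compact_XS by (simp add: compact_space_subtopology)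
 show "Hausdorff_space (extension_topology solen_top)" unfolding top by (simp add: Hausdorff_space_subtopology)
 show "space XM = topspace (extension_topology solen_top)" unfolding top by (simp add: space_XM)
 show "sets XM = sets (borel_of (extension_topology solen_top))" unfolding top sets_XM sets_borel_of[OF borel_closed[OF cl]] ..
 show "prob_space XM" by (rule XM.prob_space_axioms)
 show "separable_mod_null XM" by (rule separable_mod_null_restrict[OF borel_closed[OF cl] sets_XM XM.prob_space_axioms])
 show "group_action PG (space XM) TX"
 proof (rule group_actionI[OF PG.group_axioms])
  show "TX g \<in> extensional (space XM)" for g by (simp add: extension_action_def space_XM)
  show "TX g x \<in> space XM" if "g \<in> GG" "x \<in> space XM" for g x by (rule XA.T_space[OF that])
  show "TX (g \<cdot> h) x = TX g (TX h x)" if "g \<in> GG" "h \<in> GG" "x \<in> space XM" for g h x by (rule XA.T_mult[OF that])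
  show "TX ID x = x" if "x \<in> space XM" for x by (rule TX_one[OF that])
 qed
 show "TX g \<in> measurable XM XM" "distr XM XM (TX g) = XM" if "g \<in> GG" for g by (rule XA.T_measurable[OF that], rule XA.T_distr[OF that])
qed

lemma cocycle_rho: "cocycle PG haar alpha rho" unfolding cocycle_def circle_family_def
proof (intro conjI ballI)
 show "circle_valued haar (rho g)" if "g \<in> GG" for g by (rule circle_valuedI[OF rho_measurable[OF that]]) (simp add: rho_norm[OF that])
 show "AE x in haar. rho (g \<cdot> h) x = rho g x * rho h (alpha g x)" if "g \<in> GG" "h \<in> GG" for g h
  by (rule AE_I2) (simp add: rho_mult[OF that] alpha_eq)
qed

theorem theorem1p21:
  shows "\<exists>(U :: (nat \<Rightarrow> complex) monoid) T \<mu> \<alpha> \<rho>.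
    solenoid U T \<and> haar_probability U T \<mu> \<and>
    g_system prime_sum_group T \<mu> \<alpha> \<and>
    g_ergodic prime_sum_group \<mu> \<alpha> \<and>
    order_less prime_sum_group \<mu> \<alpha> 2 \<and>
    cocycle prime_sum_group \<mu> \<alpha> \<rho> \<and>
    type_less prime_sum_group \<mu> \<alpha> \<rho> 2 \<and>
    \<not> (\<exists>k q. phase_polynomial_family prime_sum_group \<mu> \<alpha> k q \<and>
             cohomologous prime_sum_group \<mu> \<alpha> \<rho> q) \<and>
    g_system prime_sum_group (extension_topology T) (extension_measure \<mu>)
      (extension_action \<mu> \<alpha> \<rho>) \<and>
    g_ergodic prime_sum_group (extension_measure \<mu>) (extension_action \<mu> \<alpha> \<rho>) \<and>
    order_less prime_sum_group (extension_measure \<mu>) (extension_action \<mu> \<alpha> \<rho>) 3 \<and>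
    \<not> (\<exists>k. abramov_less prime_sum_group (extension_measure \<mu>) (extension_action \<mu> \<alpha> \<rho>) k)"
proof (intro exI conjI)
 show "\<not> (\<exists>k q. phase_polynomial_family PG haar alpha k q \<and> cohomologous PG haar alpha rho q)" using not_cohomologous by blast
 show "\<not> (\<exists>k. abramov_less PG XM TX k)" using not_abramov by blast
qed (rule solenoid_solen haar_probability_solen g_system_U ergodic_U order_2_U cocycle_rho type_rho
  g_system_X ergodic_X order_3_X)+

end
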